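(* Let $n\ge 2$ be an even integer, $\lambda$ a positive even integer, $c>0$, $m=1+\frac{\lambda}{2}$, and let $h:\mathbb{R}^n\to\mathbb{R}$ be the shifted surface spline $$h(x)=(-1)^m(|x|^2+c^2)^{\lambda/2}\log\big((|x|^2+c^2)^{1/2}\big).$$ Let $l(\lambda,n)$, $\alpha_n$, $\gamma_n$, $\rho$, $\Delta_0$, the space $\mathcal{C}_{h,m}$, its semi-norm $\|\cdot\|_h$, and the notion of $h$ spline interpolant be as defined in the context. Given a positive number $b_0$, put $$\rho'=\frac{\rho}{c},\quad C=\max\left\{2\rho'\sqrt{n}\,e^{2n\gamma_n},\ \frac{2}{3b_0}\right\},\quad \delta_0=\frac{1}{3C\gamma_n(m+1)},\quad \omega=\left(\frac{2}{3}\right)^{\frac{1}{3C\gamma_n}},\quad d_0=\frac{\delta_0}{2},\quad \omega'=\sqrt{\omega},$$ so that $d_0>0$ and $0<\omega'<1$. Then the following is true: if $f\in\mathcal{C}_{h,m}$ and $s$ is the $h$ spline that interpolates $f$ on a subset $X$ of $\mathbb{R}^n$, then $$|f(x)-s(x)|\le \sqrt{l(\lambda,n)}\cdot\left(\frac{\pi}{2}\right)^{1/4}\cdot\sqrt{n\,\alpha_n}\cdot c^{\lambda/2}\cdot\sqrt{\Delta_0}\cdot(\omega')^{1/d}\cdot\|f\|_h$$ holds for all $x$ in a cube $E\subseteq\Omega$, where $\Omega\subseteq\mathbb{R}^n$ is a set which can be expressed as the union of rotations and translations of a fixed cube of side $b_0$, provided that (a) $E$ has side $b\ge b_0$; (b)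 $0<d\le d_0$; and (c) every subcube of $E$ of side $2d$ contains a point of $X$.
   Context: Notation. $|x|$ is the Euclidean norm; $P_{m-1}$ is the space of polynomials on $\mathbb{R}^n$ of degree $\le m-1$; $\alpha_n$ is the volume of the unit ball in $\mathbb{R}^n$; $\lceil t\rceil$ is the smallest integer $\ge t$. The numbers $\gamma_n$ are defined by $\gamma_1=2$ and $\gamma_n=2n(1+\gamma_{n-1})$ for $n>1$. Function space. $\mathcal{D}$ is the space of complex-valued, compactly supported, infinitely differentiable functions on $\mathbb{R}^n$, with Fourier transform $\hat\phi(\xi)=\int e^{-i\langle x,\xi\rangle}\phi(x)\,dx$, and $\mathcal{D}_m=\{\phi\in\mathcal{D}:\int x^\alpha\phi(x)\,dx=0 \text{ for all } |\alpha|<m\}$. The function $h$ is conditionally positive definite of order $m$. $\mathcal{C}_{h,m}$ is the class of continuous functions $f$ on $\mathbb{R}^n$ for which there is a constant $c(f)$ with $$\left|\int f(x)\phi(x)\,dx\right|\le c(f)\left\{\iint h(x-y)\phi(x)\overline{\phi(y)}\,dx\,dy\right\}^{1/2}\quad\text{for all }\phi\in\mathcal{D}_m,$$ and $\|f\|_h$ denotes the smallest such constant $c(f)$. Interpolant. For a finite set $X=\{x_1,\dots,x_N\}\subset\mathbb{R}^n$, the $h$ spline interpolating $f$ on $X$ is the function $s(x)=p(x)+\sum_{j=1}^N c_jh(x-x_j)$ with $p\in P_{m-1}$ and coefficients $c_j$ such that $\sum_{j=1}^N c_jq(x_j)=0$ for all $q\in P_{m-1}$ and $s(x_i)=f(x_i)$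 for $i=1,\dots,N$. (It is uniquely determined when $X$ is a determining set for $P_{m-1}$, i.e. when the only $p\in P_{m-1}$ vanishing on $X$ is $0$.) The constant $l(\lambda,n)$. It is the positive constant, depending on $\lambda$ and $n$, in the formula for the (generalized) Fourier transform of $h$ (away from the origin): $$\hat h(\theta)=l(\lambda,n)\,|\theta|^{-\lambda-n}\,\tilde{\mathcal K}_{\frac{n+\lambda}{2}}(c|\theta|),\qquad \tilde{\mathcal K}_\nu(t)=t^\nu\mathcal{K}_\nu(t),$$ where $\mathcal{K}_\nu$ is the modified Bessel function of the second kind. The constants $\rho$ and $\Delta_0$. (a) If $n-\lambda>3$, let $s_0=\lceil\frac{n-\lambda-3}{2}\rceil$; then $\rho=1+\frac{s_0}{2m+3}$ and $\Delta_0=\dfrac{(2m+2+s_0)(2m+1+s_0)\cdots(2m+3)}{\rho^{2m+2}}$. (b) If $n-\lambda\le 1$, let $s_0=-\lceil\frac{n-\lambda-3}{2}\rceil$; then $\rho=1$ and $\Delta_0=\dfrac{1}{(2m+2)(2m+1)\cdots(2m-s_0+3)}$. (c) If $1<n-\lambda\le 3$, then $\rho=1$ and $\Delta_0=1$. *)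

theory Defs
  imports "HOL-Analysis.Analysis"
begin

section \<open>Multi-indices and polynomials on \<open>\<real>\<^sup>n\<close>\<close>

definition monomial_fun :: "('n::finite \<Rightarrow> nat) \<Rightarrow> real^'n \<Rightarrow> real" where
  "monomial_fun \<alpha> x = (\<Prod>i\<in>UNIV. (x $ i) ^ \<alpha> i)"

text \<open>Everything is complex-valued, as the test functions are; real-valued data are the special
  case of functions with values in \<open>\<real>\<close>.\<close>

definition poly_space :: "nat \<Rightarrow> (real^'n::finite \<Rightarrow> complex) set" where
  "poly_space k = {p. \<exists>a :: ('n \<Rightarrow> nat) \<Rightarrow> complex.
     p = (\<lambda>x. \<Sum>\<alpha> | sum \<alpha> UNIV \<le> k. a \<alpha> * of_real (monomial_fun \<alpha> x))}"

section \<open>Test functions and Fourier transforms\<close>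

fun cont_diff :: "nat \<Rightarrow> ('a::euclidean_space \<Rightarrow> 'b::real_normed_vector) \<Rightarrow> bool" where
  "cont_diff 0 f \<longleftrightarrow> continuous_on UNIV f"
| "cont_diff (Suc k) f \<longleftrightarrow> (\<forall>x. f differentiable (at x)) \<and>
     (\<forall>v. cont_diff k (\<lambda>x. frechet_derivative f (at x) v))"

definition supp :: "('a::euclidean_space \<Rightarrow> complex) \<Rightarrow> 'a set" where
  "supp \<phi> = closure {x. \<phi> x \<noteq> 0}"

definition test_functions :: "('a::euclidean_space \<Rightarrow> complex) set" where
  "test_functions = {\<phi>. (\<forall>k. cont_diff k \<phi>) \<and> compact (supp \<phi>)}"

definition test_functions_ord :: "nat \<Rightarrow> (real^'n::finite \<Rightarrow> complex) set" where
  "test_functions_ord m = {\<phi> \<in> test_functions.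
     \<forall>\<alpha>. sum \<alpha> UNIV < m \<longrightarrow> (LINT x|lborel. of_real (monomial_fun \<alpha> x) * \<phi> x) = 0}"

definition fourier :: "('a::euclidean_space \<Rightarrow> complex) \<Rightarrow> 'a \<Rightarrow> complex" where
  "fourier \<phi> \<xi> = (LINT x|lborel. exp (- \<i> * of_real (x \<bullet> \<xi>)) * \<phi> x)"

text \<open>For \<open>u\<close> of polynomial growth, \<open>g\<close> represents the distributional Fourier transform of \<open>u\<close> on
  the complement of the origin.\<close>

definition fourier_off_origin ::
    "('a::euclidean_space \<Rightarrow> complex) \<Rightarrow> ('a \<Rightarrow> complex) \<Rightarrow> bool" where
  "fourier_off_origin u g \<longleftrightarrow> (\<forall>\<psi>\<in>test_functions. 0 \<notin> supp \<psi> \<longrightarrow>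
     (LINT x|lborel. u x * fourier \<psi> x) = (LINT \<theta>|lborel. g \<theta> * \<psi> \<theta>))"

section \<open>The semi-norm defined by \<open>h\<close>\<close>

text \<open>For the real, even, conditionally positive definite \<open>h\<close> considered here the double integral is
  a nonnegative real number; \<open>Re\<close> only adjusts its type.\<close>

definition h_form :: "(real^'n::finite \<Rightarrow> real) \<Rightarrow> (real^'n \<Rightarrow> complex) \<Rightarrow> real" where
  "h_form h \<phi> = Re (LINT x|lborel. LINT y|lborel. of_real (h (x - y)) * \<phi> x * cnj (\<phi> y))"

definition h_bound ::
    "(real^'n::finite \<Rightarrow> real) \<Rightarrow> nat \<Rightarrow> (real^'n \<Rightarrow> complex) \<Rightarrow> real \<Rightarrow> bool" where
  "h_bound h m f K \<longleftrightarrow> 0 \<le> K \<and> (\<forall>\<phi>\<in>test_functions_ord m.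
     cmod (LINT x|lborel. f x * \<phi> x) \<le> K * sqrt (h_form h \<phi>))"

definition native_space :: "(real^'n::finite \<Rightarrow> real) \<Rightarrow> nat \<Rightarrow> (real^'n \<Rightarrow> complex) set" where
  "native_space h m = {f. continuous_on UNIV f \<and> (\<exists>K. h_bound h m f K)}"

text \<open>The set of admissible constants is closed, so on \<open>native_space\<close> the infimum is a minimum.\<close>

definition h_seminorm :: "(real^'n::finite \<Rightarrow> real) \<Rightarrow> nat \<Rightarrow> (real^'n \<Rightarrow> complex) \<Rightarrow> real" where
  "h_seminorm h m f = Inf {K. h_bound h m f K}"

section \<open>Interpolation by \<open>h\<close> splines\<close>

definition h_spline_interpolant ::
    "(real^'n::finite \<Rightarrow> real) \<Rightarrow> nat \<Rightarrow> (real^'n) set \<Rightarrow>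
     (real^'n \<Rightarrow> complex) \<Rightarrow> (real^'n \<Rightarrow> complex) \<Rightarrow> bool" where
  "h_spline_interpolant h m X f s \<longleftrightarrow> finite X \<and>
     (\<exists>p\<in>poly_space (m - 1). \<exists>a :: real^'n \<Rightarrow> complex.
        (\<forall>q\<in>poly_space (m - 1). (\<Sum>y\<in>X. a y * q y) = 0) \<and>
        (\<forall>x. s x = p x + (\<Sum>y\<in>X. a y * of_real (h (x - y)))) \<and>
        (\<forall>y\<in>X. s y = f y))"

section \<open>Cubes\<close>

text \<open>The closed cube of side \<open>b\<close> obtained from \<open>[0,b]\<^sup>n\<close> by the rotation \<open>R\<close> and the translation
  by \<open>v\<close>. Two cubes with the same \<open>R\<close> have parallel sides.\<close>

definition cube :: "real^'n^'n::finite \<Rightarrow> real^'n \<Rightarrow> real \<Rightarrow> (real^'n) set" where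
  "cube R v b = (\<lambda>x. v + R *v x) ` cbox 0 (\<chi> i. b)"

definition union_of_cubes :: "real \<Rightarrow> (real^'n::finite) set \<Rightarrow> bool" where
  "union_of_cubes b \<Omega> \<longleftrightarrow>
     (\<exists>M. (\<forall>(R, v)\<in>M. rotation_matrix R) \<and> \<Omega> = (\<Union>(R, v)\<in>M. cube R v b))"

section \<open>Shifted surface splines and the associated constants\<close>

definition shifted_spline :: "nat \<Rightarrow> nat \<Rightarrow> real \<Rightarrow> real^'n::finite \<Rightarrow> real" where
  "shifted_spline m lam c x =
     (- 1) ^ m * ((norm x)\<^sup>2 + c\<^sup>2) powr (real lam / 2) * ln (((norm x)\<^sup>2 + c\<^sup>2) powr (1 / 2))"

text \<open>The modified Bessel function of the second kind, for \<open>t > 0\<close>.\<close>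

definition bessel_K :: "real \<Rightarrow> real \<Rightarrow> real" where
  "bessel_K \<nu> t = (LBINT u:{0..}. exp (- t * cosh u) * cosh (\<nu> * u))"

definition bessel_K_tilde :: "real \<Rightarrow> real \<Rightarrow> real" where
  "bessel_K_tilde \<nu> t = t powr \<nu> * bessel_K \<nu> t"

text \<open>The type argument carries the dimension. The constant does not depend on the shift \<open>c\<close>: its
  value is \<open>(2 * pi) powr (n / 2) * 2 ^ (lam div 2) * fact (lam div 2)\<close> for even \<open>lam > 0\<close>.\<close>

definition l_const :: "'n::finite itself \<Rightarrow> nat \<Rightarrow> real" where
  "l_const TYPE('n) lam = (THE l. l > 0 \<and> (\<forall>c>0.
     fourier_off_origin
       (\<lambda>x :: real^'n. of_real (shifted_spline (1 + lam div 2) lam c x))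
       (\<lambda>\<theta> :: real^'n. of_real (l * norm \<theta> powr (- real lam - real CARD('n)) *
          bessel_K_tilde ((real CARD('n) + real lam) / 2) (c * norm \<theta>)))))"

text \<open>The sequence starts at index 1; the value at 0 is a dummy.\<close>

fun gamma_seq :: "nat \<Rightarrow> nat" where
  "gamma_seq 0 = 0"
| "gamma_seq (Suc 0) = 2"
| "gamma_seq (Suc (Suc k)) = 2 * Suc (Suc k) * (1 + gamma_seq (Suc k))"

definition rho_const :: "nat \<Rightarrow> nat \<Rightarrow> nat \<Rightarrow> real" where
  "rho_const n lam m =
     (if int n - int lam > 3
      then 1 + of_int \<lceil>(real n - real lam - 3) / 2\<rceil> / (2 * real m + 3)
      else 1)"

definition Delta0_const :: "nat \<Rightarrow> nat \<Rightarrow> nat \<Rightarrow> real" where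
  "Delta0_const n lam m =
     (if int n - int lam > 3 then
        let s0 = \<lceil>(real n - real lam - 3) / 2\<rceil>
        in (\<Prod>k = 2 * int m + 3..2 * int m + 2 + s0. of_int k) / rho_const n lam m ^ (2 * m + 2)
      else if int n - int lam \<le> 1 then
        let s0 = - \<lceil>(real n - real lam - 3) / 2\<rceil>
        in 1 / (\<Prod>k = 2 * int m - s0 + 3..2 * int m + 2. of_int k)
      else 1)"

end

theory Submission
  imports Defs "HOL-Probability.Probability" "HOL-Complex_Analysis.Complex_Analysis"
begin

text \<open>Write \<open>lam = 2 * L\<close>, so that \<open>m = Suc L\<close> and \<open>h\<close> is \<open>(- 1) ^ Suc L * s ^ L * ln s / 2\<close> with
  \<open>s = (norm x)\<^sup>2 + c\<^sup>2\<close>. The proof estimates \<open>f x - s x\<close> at one point \<open>x\<close> of the cube by a linear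
  functional that annihilates all polynomials of degree below a number \<open>k\<close> proportional to \<open>1 / d\<close>.

  \<^item> \<^emph>\<open>The kernel is a Gaussian mixture.\<close> The integral of \<open>exp (- s * t) / t ^ Suc L\<close> over \<open>t \<ge> e\<close> is
  \<open>(- 1) ^ Suc L / fact L * s ^ L * ln s\<close> plus a polynomial of degree at most \<open>L\<close> in \<open>s\<close> plus \<open>O(e)\<close>
  (\<open>gamma_tail_expansion\<close>). A family of coefficients that annihilates the polynomials of degree at most
  \<open>L\<close> does not see the polynomial part, so on such families the quadratic form of \<open>h\<close> is an
  integral over \<open>t\<close> of quadratic forms of Gaussians, and hence nonnegative. If the family annihilates
  all polynomials of degree below \<open>k\<close>, Taylor expansion on the Fourier side makes these forms small, and
  integration over \<open>t\<close> gives \<open>form_upper_bound\<close>.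

  \<^item> \<^emph>\<open>Interpolation is a projection.\<close> The inequality that defines the native space extends from test
  functions to point functionals by mollification (\<open>native_point_functional_bound\<close>). Since the
  spline is, up to polynomials, the orthogonal projection of \<open>f\<close>, the same inequality holds for \<open>f - s\<close>
  (\<open>native_interpolation_error\<close>). For a functional that is the evaluation at \<open>x\<close> minus a combination of
  evaluations at data points, where \<open>f - s\<close> vanishes, this bounds \<open>f x - s x\<close>.

  \<^item> \<^emph>\<open>The functional comes from a norming inequality.\<close> Suppose that a polynomial \<open>p\<close> of degree below
  \<open>k\<close> is bounded by \<open>B\<close> on points that are dense in a ball of radius \<open>r\<close> at a scale comparable with
  \<open>r / k\<close>. Then \<open>p\<close> is bounded by \<open>B\<close> times an exponential in \<open>k\<close> near the ball (\<open>norming_set_ball\<close>).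
  To see this, maximise \<open>\<bar>p x\<bar> / (1 + (norm x)\<^sup>2) ^ (2 * k)\<close>: on each line this weighted polynomial is a
  trigonometric polynomial in a suitable angle, and a trigonometric polynomial of degree \<open>K\<close> leaves
  its maximum no faster than a cosine of frequency \<open>K\<close> (\<open>trig_poly_near_max\<close>). The extension argument
  of Hahn and Banach turns the inequality into weights of controlled total mass that reproduce
  polynomials of degree below \<open>k\<close> (\<open>weights_from_norming_set\<close>).

  \<^item> \<^emph>\<open>The constants.\<close> The constant \<open>l_const\<close> is evaluated by computing the Fourier transform of \<open>h\<close>
  off the origin: there the polynomial part of the mixture has no transform, and the mixture
  of the transformed Gaussians is a Bessel function (\<open>l_const_eq\<close>). With \<open>t = 6 * C * gam * d\<close>, the order
  \<open>k = \<lceil>1 / t\<rceil>\<close> and a subcube of side \<open>2 * d * gam * k\<close>, every exponential factor of the estimate is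
  absorbed by the factor \<open>exp (2 * n * gam)\<close> in \<open>C\<close>; what remains of the squared error is
  \<open>(2 / 3) ^ (2 * k)\<close>, which is at most \<open>omega powr (1 / d)\<close>.\<close>

section \<open>Growth and oscillation of polynomials in one variable\<close>

lemma zeros_of_alternating:
  fixes D :: "real \<Rightarrow> real" and a :: "nat \<Rightarrow> real"
  assumes cont: "continuous_on UNIV D"
    and "\<And>i. i < r \<Longrightarrow> a i < a (Suc i)"
    and "\<And>i. i < r \<Longrightarrow> D (a i) * D (a (Suc i)) < 0"
  shows "a 0 \<le> a r \<and> (\<exists>S. finite S \<and> card S = r \<and> S \<subseteq> {a 0<..<a r} \<and> (\<forall>x\<in>S. D x = 0))"
  using assms(2,3)
proof (induction r)
  case 0
  then show ?case by (auto intro!: exI[of _ "{}"])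
next
  case (Suc r)
  have IH: "a 0 \<le> a r \<and> (\<exists>S. finite S \<and> card S = r \<and> S \<subseteq> {a 0<..<a r} \<and> (\<forall>x\<in>S. D x = 0))"
    by (rule Suc.IH) (use Suc.prems in auto)
  then obtain S where S: "finite S" "card S = r" "S \<subseteq> {a 0<..<a r}" "\<forall>x\<in>S. D x = 0"
    by blast
  have lt: "a r < a (Suc r)" and ng: "D (a r) * D (a (Suc r)) < 0" using Suc.prems by auto
  have c: "continuous_on {a r..a (Suc r)} D" using cont continuous_on_subset by blast
  obtain z where z: "a r \<le> z" "z \<le> a (Suc r)" "D z = 0"
  proof (cases "D (a r) < 0")
    case True
    hence "D (a (Suc r)) > 0" using ng by (auto simp: mult_less_0_iff)
    thus ?thesis using IVT'[of D "a r" 0 "a (Suc r)"] True lt c that by force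
  next
    case False
    hence "D (a r) > 0" "D (a (Suc r)) < 0" using ng by (auto simp: mult_less_0_iff)
    thus ?thesis using IVT2'[of D "a (Suc r)" 0 "a r"] lt c that by force
  qed
  have zn: "z \<noteq> a r" "z \<noteq> a (Suc r)" using ng z by auto
  have "z \<notin> S" using S(3) z(1) by auto
  moreover have "insert z S \<subseteq> {a 0<..<a (Suc r)}"
  proof -
    have "S \<subseteq> {a 0<..<a (Suc r)}" using S(3) lt by fastforce
    thus ?thesis using z zn IH by auto
  qed
  ultimately show ?case using S z lt IH
    by (intro conjI exI[of _ "insert z S"]) auto
qed

lemma cis_inj_on_period: "inj_on cis {a<..<a + 2 * pi}"
proof (rule inj_onI)
  fix x y assume x: "x \<in> {a<..<a + 2 * pi}" and y: "y \<in> {a<..<a + 2 * pi}" and "cis x = cis y"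
  hence "sin x = sin y \<and> cos x = cos y" by (simp add: complex_eq_iff)
  then obtain n :: int where n: "x = y + 2 * pi * n" by (auto simp: sin_cos_eq_iff)
  have "\<bar>2 * pi * n\<bar> < 2 * pi" using x y n by auto
  hence "\<bar>real_of_int n\<bar> < 1" by (simp add: abs_mult)
  hence "n = 0" by linarith
  thus "x = y" using n by simp
qed

text \<open>A comparison argument of M. Riesz. If \<open>T\<close> were smaller than \<open>T t0 * cos (K * t)\<close> at
  \<open>t0 + t\<close>, then the difference \<open>D\<close> of a slightly shifted cosine of amplitude \<open>T t0\<close> and a
  slightly shrunken \<open>T\<close> would have alternating signs at \<open>2 * K + 3\<close> points of a closed period,
  hence \<open>2 * K + 2\<close> zeros inside it. But \<open>D\<close> is a trigonometric polynomial of degree \<open>K\<close> and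
  has at most \<open>2 * K\<close> zeros in a period. The polynomial \<open>P\<close> expresses that \<open>T\<close> is one as
  well.\<close>

lemma trig_poly_near_max:
  fixes T :: "real \<Rightarrow> real" and P :: "complex poly"
  assumes P: "\<And>t. poly P (cis t) = cis (real K * t) * of_real (T t)"
    and deg: "degree P \<le> 2 * K" and K: "K > 0" and cont: "continuous_on UNIV T"
    and max: "\<And>t. \<bar>T t\<bar> \<le> T t0" and t: "0 \<le> t" "real K * t \<le> pi"
  shows "T t0 * cos (real K * t) \<le> T (t0 + t)"
proof (rule ccontr)
  assume neg: "\<not> ?thesis"
  define M where "M = T t0"
  have M0: "M \<ge> 0" using max[of t0] by (simp add: M_def)
  have Mle: "\<bar>T s\<bar> \<le> M" for s using max by (simp add: M_def)
  have M: "M > 0"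
  proof (rule ccontr)
    assume "\<not> M > 0"
    hence "M = 0" using M0 by simp
    thus False using neg Mle[of "t0 + t"] by (simp add: M_def)
  qed
  have tpos: "t > 0" using neg t by (cases "t = 0") auto
  have tlt: "real K * t < pi"
  proof (rule ccontr)
    assume "\<not> real K * t < pi"
    hence "real K * t = pi" using t by simp
    thus False using neg Mle[of "t0 + t"] by (simp add: M_def)
  qed
  define f where "f u = M * cos (real K * (t + u)) - T (t0 + t)" for u
  have "f 0 > 0" using neg by (simp add: f_def M_def)
  moreover have "isCont f 0" unfolding f_def by (intro continuous_intros)
  ultimately have "eventually (\<lambda>u. f u > 0) (at 0)"
    by (simp add: isCont_def order_tendstoD(1))
  then obtain d where d: "d > 0" "\<And>u. u \<noteq> 0 \<Longrightarrow> dist u 0 < d \<Longrightarrow> f u > 0"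
    by (auto simp: eventually_at)
  define \<eta> where "\<eta> = min (d / 2) ((pi / K - t) / 2)"
  have pK: "pi / K - t > 0" using tlt K by (simp add: field_simps)
  have \<eta>pos: "\<eta> > 0" and \<eta>d: "\<eta> < d" using d(1) pK by (auto simp: \<eta>_def)
  have "\<eta> \<le> (pi / K - t) / 2" unfolding \<eta>_def by (rule min.cobounded2)
  hence \<eta>: "\<eta> > 0" "f \<eta> > 0" "t + \<eta> < pi / K"
    using \<eta>pos \<eta>d d(2)[of \<eta>] pK by auto
  have K\<eta>: "0 < real K * \<eta>" "real K * \<eta> < pi"
  proof -
    show "0 < real K * \<eta>" using K \<eta> by simp
    have "\<eta> < pi / K" using \<eta> tpos by linarith
    thus "real K * \<eta> < pi" using K by (simp add: field_simps)
  qed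
  have cl: "cos (real K * \<eta>) < 1"
    using cos_monotone_0_pi[of 0 "real K * \<eta>"] K\<eta> by simp
  \<comment> \<open>shrinking \<open>T\<close> by \<open>1 - e\<close> must not destroy the strict inequalities for \<open>D\<close> at \<open>t0\<close> and at
    \<open>t0 + t\<close>\<close>
  define e where "e = min (1/2) (min ((1 - cos (real K * \<eta>)) / 2) (f \<eta> / (2 * M)))"
  have e: "0 < e" "e < 1" using cl \<eta> M by (auto simp: e_def)
  have e2: "e < 1 - cos (real K * \<eta>)" using cl by (auto simp: e_def min_def)
  have e3: "e * M < f \<eta>"
  proof -
    have "e \<le> f \<eta> / (2 * M)" by (simp add: e_def)
    hence "e * M \<le> f \<eta> / 2" using M by (simp add: field_simps)
    thus ?thesis using \<eta> by simp
  qed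
  define D where "D s = M * cos (real K * (s - t0 + \<eta>)) - (1 - e) * T s" for s
  have Dc: "continuous_on UNIV D" unfolding D_def by (intro continuous_intros cont)
  \<comment> \<open>from \<open>i = 3\<close> on, and at \<open>i = 0\<close>, these are extrema of the shifted cosine\<close>
  define a where "a i = (if i = 0 then t0 - \<eta> else if i = 1 then t0 else if i = 2 then t0 + t
     else t0 - \<eta> + real (i - 2) * pi / K)" for i :: nat
  have sgn: "(-1) ^ i * D (a i) > 0" for i
  proof -
    have small: "\<bar>(1 - e) * T s\<bar> < M" for s
    proof -
      have "\<bar>(1 - e) * T s\<bar> \<le> (1 - e) * M" using e Mle[of s] by (simp add: abs_mult)
      also have "\<dots> < M" using e M by simp
      finally show ?thesis .
    qed
    consider "i = 0" | "i = 1" | "i = 2" | "i \<ge> 3" by linarith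
    thus ?thesis
    proof cases
      case 1
      thus ?thesis using small[of "t0 - \<eta>"] by (simp add: a_def D_def)
    next
      case 2
      have "M * cos (real K * \<eta>) < M * (1 - e)" using M e2 by simp
      thus ?thesis using 2 by (simp add: a_def D_def M_def[symmetric] algebra_simps)
    next
      case 3
      have "M * cos (real K * (t + \<eta>)) - (1 - e) * T (t0 + t) = f \<eta> + e * T (t0 + t)"
        by (simp add: f_def algebra_simps)
      moreover have "e * T (t0 + t) \<ge> - (e * M)"
      proof -
        have "T (t0 + t) \<ge> - M" using Mle[of "t0 + t"] by linarith
        thus ?thesis using e mult_left_mono[of "- M" "T (t0 + t)" e] by simp
      qed
      ultimately show ?thesis using 3 e3 by (simp add: a_def D_def)
    next
      case 4
      have "real K * (a i - t0 + \<eta>) = real (i - 2) * pi" using 4 K by (simp add: a_def)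
      hence "cos (real K * (a i - t0 + \<eta>)) = (-1) ^ (i - 2)" by simp
      moreover have "(-1::real) ^ (i - 2) = (-1) ^ i" using 4
        by (simp add: minus_one_power_iff)
      ultimately have "(-1) ^ i * D (a i) = M * ((-1) ^ i * (-1) ^ i) - (-1) ^ i * ((1 - e) * T (a i))"
        by (simp add: D_def algebra_simps)
      also have "(-1::real) ^ i * (-1) ^ i = 1" by (simp flip: power_mult_distrib)
      finally have "(-1) ^ i * D (a i) = M - (-1) ^ i * ((1 - e) * T (a i))" by simp
      moreover have "\<bar>(-1) ^ i * ((1 - e) * T (a i))\<bar> < M" using small[of "a i"]
        by (simp add: abs_mult power_abs)
      ultimately show ?thesis by linarith
    qed
  qed
  have mono: "a i < a (Suc i)" for i
  proof -
    consider "i = 0" | "i = 1" | "i = 2" | "i \<ge> 3" by linarith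
    thus ?thesis
    proof cases
      case 3 thus ?thesis using \<eta> by (simp add: a_def)
    next
      case 4
      have "real (i - 2) * pi / K < real (Suc i - 2) * pi / K"
        using 4 K by (intro divide_strict_right_mono mult_strict_right_mono) auto
      thus ?thesis using 4 by (simp add: a_def)
    qed (use \<eta> tpos in \<open>auto simp: a_def\<close>)
  qed
  have alt: "D (a i) * D (a (Suc i)) < 0" for i
  proof -
    have "((-1) ^ i * D (a i)) * ((-1) ^ Suc i * D (a (Suc i))) > 0"
      using sgn[of i] sgn[of "Suc i"] mult_pos_pos by blast
    also have "((-1) ^ i * D (a i)) * ((-1) ^ Suc i * D (a (Suc i))) =
       - (((-1) ^ i * (-1) ^ i) * (D (a i) * D (a (Suc i))))" by simp
    also have "(-1::real) ^ i * (-1) ^ i = 1" by (simp flip: power_mult_distrib)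
    finally show ?thesis by simp
  qed
  obtain S where S: "finite S" "card S = 2 * K + 2" "S \<subseteq> {a 0<..<a (2 * K + 2)}" "\<forall>x\<in>S. D x = 0"
    using zeros_of_alternating[of D "2 * K + 2" a] Dc mono alt by blast
  have aK: "a (2 * K + 2) = a 0 + 2 * pi" using K by (simp add: a_def)
  \<comment> \<open>a polynomial in \<open>cis s\<close> that represents \<open>D\<close> in the way in which \<open>P\<close> represents \<open>T\<close>\<close>
  define PD where "PD = smult (of_real (M / 2)) (monom (cis (real K * (\<eta> - t0))) (2 * K) +
      [:cis (- (real K * (\<eta> - t0))):]) - smult (of_real (1 - e)) P"
  have PD: "poly PD (cis s) = cis (real K * s) * of_real (D s)" for s
  proof -
    have c: "complex_of_real (cos x) = (cis x + cis (- x)) / 2" for x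
      by (simp add: complex_eq_iff)
    define x where "x = real K * (s - t0 + \<eta>)"
    define z where "z = real K * s"
    have x: "real K * (\<eta> - t0) = x - z" by (simp add: x_def z_def algebra_simps)
    have "cis s ^ (2 * K) = cis (real (2 * K) * s)" by (rule Complex.DeMoivre)
    hence 0: "cis s ^ (2 * K) = cis (2 * z)" by (simp add: z_def mult.assoc)
    have 1: "cis (x - z) * cis (2 * z) = cis z * cis x" and 2: "cis (- (x - z)) = cis z * cis (- x)"
      by (simp_all add: cis_mult)
    have "poly PD (cis s) = of_real (M / 2) * (cis (x - z) * cis (2 * z) + cis (- (x - z)))
        - of_real (1 - e) * (cis z * of_real (T s))"
      unfolding PD_def x by (simp add: poly_monom 0 P z_def)
    also have "\<dots> = cis z * (of_real M * of_real (cos x) - of_real (1 - e) * of_real (T s))"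
      unfolding 1 2 c by (simp add: algebra_simps)
    finally show ?thesis unfolding D_def x_def z_def by simp
  qed
  have "degree PD \<le> 2 * K" unfolding PD_def
    by (intro degree_diff_le order.trans[OF degree_smult_le] degree_add_le degree_monom_le deg) auto
  moreover have "PD \<noteq> 0"
  proof
    assume "PD = 0"
    hence "D (a 0) = 0" using PD[of "a 0"] by simp
    thus False using sgn[of 0] by simp
  qed
  moreover have "cis ` S \<subseteq> {x. poly PD x = 0}" using S(4) PD by auto
  moreover have "card (cis ` S) = 2 * K + 2"
    using S aK cis_inj_on_period[of "a 0"] by (metis card_image inj_on_subset)
  ultimately show False
    using card_poly_roots_bound[of PD] card_mono[OF poly_roots_finite, of PD "cis ` S"] by simp
qed

lemma poly_sum_upto:
  fixes p :: "'a::comm_semiring_1 poly"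
  assumes "degree p \<le> k"
  shows "poly p x = (\<Sum>i\<le>k. coeff p i * x ^ i)"
  unfolding poly_altdef
  by (rule sum.mono_neutral_left) (use assms in \<open>auto simp: coeff_eq_0\<close>)

text \<open>With \<open>s = b / 2 * (w + 1 / w)\<close>, the function \<open>w ^ k * g s\<close> is a polynomial in \<open>w\<close>, and
  the unit circle corresponds to the interval from \<open>- b\<close> to \<open>b\<close>. By the maximum principle the
  bound \<open>M\<close> holds in the whole disc; each real \<open>t\<close> outside the interval is reached from a \<open>w\<close>
  with \<open>1 / \<bar>w\<bar> \<le> 2 * \<bar>t\<bar> / b\<close>.\<close>

lemma poly_growth_outside_interval:
  fixes g :: "real poly"
  assumes deg: "degree g \<le> k" and b: "b > 0"
    and M: "\<And>s. \<bar>s\<bar> \<le> b \<Longrightarrow> \<bar>poly g s\<bar> \<le> M" and t: "\<bar>t\<bar> \<ge> b"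
  shows "\<bar>poly g t\<bar> \<le> M * (2 * \<bar>t\<bar> / b) ^ k"
proof -
  \<comment> \<open>\<open>w ^ k * g (b / 2 * (w + 1 / w))\<close>, written so that it is defined at \<open>0\<close>\<close>
  define q where "q w = (\<Sum>i\<le>k. of_real (coeff g i * (b / 2) ^ i) * ((1 + w\<^sup>2) ^ i * w ^ (k - i)))"
    for w :: complex
  have hol: "q holomorphic_on A" for A unfolding q_def by (intro holomorphic_intros)
  have q: "q w = w ^ k * of_real (poly g x)" if "w \<noteq> 0" "b / 2 * (w + 1 / w) = of_real x"
    for w :: complex and x :: real
  proof -
    have "of_real (coeff g i * (b / 2) ^ i) * ((1 + w\<^sup>2) ^ i * w ^ (k - i)) =
        w ^ k * (of_real (coeff g i) * of_real x ^ i)" if "i \<in> {..k}" for i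
    proof -
      have w1: "1 + w\<^sup>2 = w * (w + 1 / w)" using \<open>w \<noteq> 0\<close> by (simp add: field_simps power2_eq_square)
      hence "of_real (b / 2) ^ i * (1 + w\<^sup>2) ^ i = w ^ i * (of_real (b / 2) * (w + 1 / w)) ^ i"
        by (simp only: w1 power_mult_distrib ac_simps)
      also have "of_real (b / 2) * (w + 1 / w) = of_real x" using \<open>b / 2 * (w + 1 / w) = of_real x\<close> by simp
      finally have "of_real (b / 2) ^ i * (1 + w\<^sup>2) ^ i = w ^ i * of_real x ^ i" .
      moreover have "w ^ i * w ^ (k - i) = w ^ k" using that by (simp flip: power_add)
      ultimately show ?thesis by (simp add: algebra_simps)
    qed
    hence "q w = (\<Sum>i\<le>k. w ^ k * (of_real (coeff g i) * of_real x ^ i))"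
      unfolding q_def by (intro sum.cong) auto
    thus ?thesis using deg by (simp add: poly_sum_upto[of g k] sum_distrib_left)
  qed
  have bd: "cmod (q w) \<le> M" if "cmod w \<le> 1" for w
  proof (rule maximum_modulus_frontier[of q "cball 0 1"])
    fix z :: complex assume "z \<in> frontier (cball 0 1)"
    hence z: "cmod z = 1" by (simp add: dist_norm)
    hence "z \<noteq> 0" by auto
    obtain \<theta> where \<theta>: "z = cis \<theta>" using z by (metis complex_norm_eq_1_exp cis_conv_exp)
    have "1 / z = cis (- \<theta>)" unfolding \<theta> by (simp add: divide_inverse)
    hence "z + 1 / z = of_real (2 * cos \<theta>)" unfolding \<theta> by (simp add: complex_eq_iff)
    hence "q z = z ^ k * of_real (poly g (b * cos \<theta>))" using \<open>z \<noteq> 0\<close> by (intro q) auto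
    moreover have "\<bar>poly g (b * cos \<theta>)\<bar> \<le> M"
      using b by (intro M) (simp add: abs_mult mult_left_le)
    ultimately show "cmod (q z) \<le> M" using z by (simp add: norm_mult norm_power)
  qed (use that in \<open>auto intro!: hol holomorphic_on_imp_continuous_on\<close>)
  define \<tau> where "\<tau> = \<bar>t\<bar>"
  define r where "r = sqrt (\<tau>\<^sup>2 - b\<^sup>2)"
  have \<tau>: "\<tau> \<ge> b" "\<tau> > 0" using t b by (auto simp: \<tau>_def)
  have r2: "r\<^sup>2 = \<tau>\<^sup>2 - b\<^sup>2" using \<tau> b by (simp add: r_def power_mono)
  have r0: "0 \<le> r" using \<tau> b by (simp add: r_def power_mono)
  have "r\<^sup>2 \<le> \<tau>\<^sup>2" using r2 by simp
  hence r\<tau>: "r \<le> \<tau>" using \<tau> r0 power2_le_imp_le by fastforce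
  have prod: "(\<tau> - r) * (\<tau> + r) = b\<^sup>2" using r2 by (simp add: algebra_simps power2_eq_square)
  have tr: "\<tau> + r > 0" using \<tau> r0 by linarith
  \<comment> \<open>the root of \<open>b / 2 * (w + 1 / w) = \<tau>\<close> in the unit interval\<close>
  define w0 where "w0 = b / (\<tau> + r)"
  have w0: "w0 > 0" "w0 \<le> 1" using \<tau> tr r0 b by (auto simp: w0_def field_simps)
  have iw0: "1 / w0 = (\<tau> + r) / b" by (simp add: w0_def)
  also have "\<dots> \<le> 2 * \<tau> / b" using r\<tau> b by (intro divide_right_mono) auto
  finally have iw: "1 / w0 \<le> 2 * \<tau> / b" .
  have w0alt: "w0 = (\<tau> - r) / b" using prod b tr by (simp add: w0_def field_simps power2_eq_square)
  have sumw: "b / 2 * (w0 + 1 / w0) = \<tau>" 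
  proof -
    have "w0 + 1 / w0 = (\<tau> - r) / b + (\<tau> + r) / b" by (subst iw0) (simp only: w0alt)
    also have "\<dots> = 2 * \<tau> / b" by (simp add: add_divide_distrib[symmetric])
    finally show ?thesis using b by simp
  qed
  define w :: complex where "w = of_real (sgn t * w0)"
  have st: "sgn t \<noteq> 0" "sgn t * sgn t = 1" "t = sgn t * \<tau>" "\<bar>sgn t\<bar> = 1"
    using \<tau> by (auto simp: \<tau>_def sgn_if)
  have isg: "1 / sgn t = sgn t" using st(1,2) by (simp add: field_simps)
  have "b / 2 * (sgn t * w0 + 1 / (sgn t * w0)) = sgn t * (b / 2 * (w0 + 1 / w0))"
  proof -
    have "1 / (sgn t * w0) = sgn t * (1 / w0)" using isg by (metis divide_divide_eq_left times_divide_eq_right mult.right_neutral)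
    thus ?thesis by (simp add: algebra_simps)
  qed
  hence "b / 2 * (sgn t * w0 + 1 / (sgn t * w0)) = sgn t * \<tau>" by (simp only: sumw)
  hence "b / 2 * (sgn t * w0 + 1 / (sgn t * w0)) = t" using st(3) by simp
  hence "of_real (b / 2 * (sgn t * w0 + 1 / (sgn t * w0))) = complex_of_real t" by simp
  hence "q w = w ^ k * of_real (poly g t)" using w0 st by (intro q) (auto simp: w_def)
  hence "cmod (q w) = w0 ^ k * \<bar>poly g t\<bar>" using w0 st
    by (simp add: norm_mult norm_power w_def abs_mult)
  moreover have "cmod w \<le> 1" using w0 st by (simp add: w_def norm_mult abs_mult)
  ultimately have "w0 ^ k * \<bar>poly g t\<bar> \<le> M" using bd[of w] by simp
  hence "\<bar>poly g t\<bar> \<le> M * (1 / w0) ^ k" using w0 by (simp add: field_simps power_one_over)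
  also have "\<dots> \<le> M * (2 * \<tau> / b) ^ k"
    using iw w0 M[of 0] b by (intro mult_left_mono power_mono) auto
  finally show ?thesis by (simp add: \<tau>_def)
qed

section \<open>Norming sets for polynomials in several variables\<close>

lemma arctan_diff_le: "y \<le> x \<Longrightarrow> arctan x - arctan y \<le> x - y"
proof -
  assume "y \<le> x"
  hence "y - arctan y \<le> x - arctan x"
    by (rule DERIV_nonneg_imp_nondecreasing)
       (auto intro!: exI derivative_eq_intros simp: field_simps add_pos_nonneg)
  thus ?thesis by simp
qed

text \<open>The substitution \<open>s = sqrt A * tan (\<theta> / 2)\<close> turns the weighted polynomial into a
  trigonometric polynomial of degree \<open>2 * k\<close> in \<open>\<theta>\<close>, to which \<open>trig_poly_near_max\<close> applies.
  Since \<open>A \<ge> 1\<close>, an increment of \<open>s\<close> changes \<open>\<theta>\<close> by at most twice as much, which is the source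
  of the frequency \<open>4 * k\<close>.\<close>

lemma weighted_poly_near_max_right:
  fixes g :: "real poly"
  assumes A: "A \<ge> 1" and deg: "degree g \<le> k" and k: "k \<ge> 1"
    and max: "\<And>s. \<bar>poly g s\<bar> / (A + s\<^sup>2) ^ (2 * k) \<le> poly g s0 / (A + s0\<^sup>2) ^ (2 * k)"
    and s: "s0 \<le> s" "4 * real k * (s - s0) \<le> pi"
  shows "poly g s0 / (A + s0\<^sup>2) ^ (2 * k) * cos (4 * real k * (s - s0)) \<le> poly g s / (A + s\<^sup>2) ^ (2 * k)"
proof -
  define F where "F s = poly g s / (A + s\<^sup>2) ^ (2 * k)" for s
  \<comment> \<open>the weighted polynomial as a function of the angle; it vanishes at \<open>\<theta> = \<pi>\<close>, which
    corresponds to \<open>s = \<infinity>\<close>\<close>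
  define T where "T \<theta> = (\<Sum>i\<le>k. coeff g i * sqrt A ^ i * sin (\<theta> / 2) ^ i * cos (\<theta> / 2) ^ (4 * k - i)) / A ^ (2 * k)"
    for \<theta> :: real
  have sA: "sqrt A > 0" "sqrt A ^ 2 = A" using A by auto
  have TF: "T \<theta> = F (sqrt A * tan (\<theta> / 2))" if "cos (\<theta> / 2) \<noteq> 0" for \<theta>
  proof -
    let ?c = "cos (\<theta> / 2)" and ?s = "sin (\<theta> / 2)"
    have "A + (sqrt A * tan (\<theta> / 2))\<^sup>2 = A * (1 + (tan (\<theta> / 2))\<^sup>2)"
      using sA by (simp add: power_mult_distrib algebra_simps)
    also have "1 + (tan (\<theta> / 2))\<^sup>2 = inverse ?c ^ 2" using that tan_sec[of "\<theta> / 2"] by simp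
    also have "A * inverse ?c ^ 2 = A / ?c\<^sup>2" by (simp add: field_simps)
    finally have "(A + (sqrt A * tan (\<theta> / 2))\<^sup>2) ^ (2 * k) = A ^ (2 * k) / (?c\<^sup>2) ^ (2 * k)"
      by (simp only: power_divide)
    moreover have "(?c\<^sup>2) ^ (2 * k) = ?c ^ (4 * k)" by (simp flip: power_mult)
    ultimately have 1: "(A + (sqrt A * tan (\<theta> / 2))\<^sup>2) ^ (2 * k) = A ^ (2 * k) / ?c ^ (4 * k)" by simp
    have 2: "poly g (sqrt A * tan (\<theta> / 2)) * ?c ^ (4 * k) =
       (\<Sum>i\<le>k. coeff g i * sqrt A ^ i * ?s ^ i * ?c ^ (4 * k - i))"
      unfolding poly_sum_upto[OF deg] sum_distrib_right
    proof (rule sum.cong)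
      fix i assume "i \<in> {..k}"
      hence "?c ^ (4 * k) = ?c ^ i * ?c ^ (4 * k - i)" by (simp flip: power_add)
      thus "coeff g i * (sqrt A * tan (\<theta> / 2)) ^ i * ?c ^ (4 * k) =
         coeff g i * sqrt A ^ i * ?s ^ i * ?c ^ (4 * k - i)"
        using that by (simp add: tan_def power_mult_distrib power_divide)
    qed simp
    show ?thesis unfolding F_def T_def 1 2[symmetric] by simp
  qed
  have T0: "T \<theta> = 0" if "cos (\<theta> / 2) = 0" for \<theta>
    unfolding T_def using that k by (auto intro!: sum.neutral)
  \<comment> \<open>obtained by writing \<open>sin (\<theta> / 2)\<close> and \<open>cos (\<theta> / 2)\<close> as multiples of \<open>cis \<theta> - 1\<close> and
    \<open>cis \<theta> + 1\<close>\<close>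
  define P where "P = (\<Sum>i\<le>k. smult (of_real (coeff g i * sqrt A ^ i / (A ^ (2 * k) * 2 ^ (4 * k))) / \<i> ^ i)
     ([:-1, 1:] ^ i * [:1, 1:] ^ (4 * k - i)))"
  have P: "poly P (cis \<theta>) = cis (real (2 * k) * \<theta>) * of_real (T \<theta>)" for \<theta>
  proof -
    let ?c = "cos (\<theta> / 2)" and ?s = "sin (\<theta> / 2)"
    have m: "- 1 + cis \<theta> = 2 * cis (\<theta> / 2) * (\<i> * of_real ?s)"
    proof -
      have "cos \<theta> = 1 - 2 * ?s ^ 2" "sin \<theta> = 2 * ?s * ?c"
        using cos_double_sin[of "\<theta> / 2"] sin_double[of "\<theta> / 2"] by auto
      thus ?thesis by (simp add: complex_eq_iff power2_eq_square)
    qed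
    have p: "1 + cis \<theta> = 2 * cis (\<theta> / 2) * of_real ?c"
    proof -
      have "cos \<theta> = 2 * ?c ^ 2 - 1" "sin \<theta> = 2 * ?s * ?c"
        using cos_double_cos[of "\<theta> / 2"] sin_double[of "\<theta> / 2"] by auto
      thus ?thesis by (simp add: complex_eq_iff power2_eq_square)
    qed
    have "poly P (cis \<theta>) = (\<Sum>i\<le>k. of_real (coeff g i * sqrt A ^ i / (A ^ (2 * k) * 2 ^ (4 * k))) / \<i> ^ i *
       ((2 * cis (\<theta> / 2) * (\<i> * of_real ?s)) ^ i * (2 * cis (\<theta> / 2) * of_real ?c) ^ (4 * k - i)))"
      unfolding P_def m[symmetric] p[symmetric] by (simp add: poly_sum)
    also have "\<dots> = (\<Sum>i\<le>k. cis (real (2 * k) * \<theta>) *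
       of_real (coeff g i * sqrt A ^ i * ?s ^ i * ?c ^ (4 * k - i) / A ^ (2 * k)))"
    proof (rule sum.cong)
      fix i assume i: "i \<in> {..k}"
      have "(2 * cis (\<theta> / 2) * (\<i> * of_real ?s)) ^ i * (2 * cis (\<theta> / 2) * of_real ?c) ^ (4 * k - i)
        = ((2 * cis (\<theta> / 2)) ^ i * (2 * cis (\<theta> / 2)) ^ (4 * k - i)) * (\<i> ^ i * of_real (?s ^ i * ?c ^ (4 * k - i)))"
        by (simp add: power_mult_distrib)
      also have "(2 * cis (\<theta> / 2)) ^ i * (2 * cis (\<theta> / 2)) ^ (4 * k - i) = (2 * cis (\<theta> / 2)) ^ (4 * k)"
        using i by (subst power_add[symmetric]) simp
      also have "\<dots> = 2 ^ (4 * k) * cis (real (2 * k) * \<theta>)"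
        by (simp add: power_mult_distrib Complex.DeMoivre mult_ac)
      finally have eq: "(2 * cis (\<theta> / 2) * (\<i> * of_real ?s)) ^ i * (2 * cis (\<theta> / 2) * of_real ?c) ^ (4 * k - i)
        = 2 ^ (4 * k) * cis (real (2 * k) * \<theta>) * (\<i> ^ i * of_real (?s ^ i * ?c ^ (4 * k - i)))" .
      show "of_real (coeff g i * sqrt A ^ i / (A ^ (2 * k) * 2 ^ (4 * k))) / \<i> ^ i *
       ((2 * cis (\<theta> / 2) * (\<i> * of_real ?s)) ^ i * (2 * cis (\<theta> / 2) * of_real ?c) ^ (4 * k - i)) =
        cis (real (2 * k) * \<theta>) * of_real (coeff g i * sqrt A ^ i * ?s ^ i * ?c ^ (4 * k - i) / A ^ (2 * k))"
        unfolding eq by simp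
    qed simp
    also have "\<dots> = cis (real (2 * k) * \<theta>) * of_real (T \<theta>)"
      by (simp add: T_def sum_divide_distrib sum_distrib_left)
    finally show ?thesis .
  qed
  have degP: "degree P \<le> 2 * (2 * k)" unfolding P_def
  proof (rule degree_sum_le)
    fix i assume i: "i \<in> {..k}"
    have "degree ([:-1, 1:] ^ i * [:1, 1:] ^ (4 * k - i) :: complex poly) \<le> 1 * i + 1 * (4 * k - i)"
      by (intro order.trans[OF degree_mult_le] add_mono order.trans[OF degree_power_le]) auto
    thus "degree (smult (of_real (coeff g i * sqrt A ^ i / (A ^ (2 * k) * 2 ^ (4 * k))) / \<i> ^ i)
     ([:-1, 1:] ^ i * [:1, 1:] ^ (4 * k - i)) :: complex poly) \<le> 2 * (2 * k)"
      using i by (intro order.trans[OF degree_smult_le]) auto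
  qed simp
  define \<theta>0 where "\<theta>0 = 2 * arctan (s0 / sqrt A)"
  define \<theta>1 where "\<theta>1 = 2 * arctan (s / sqrt A)"
  have F0: "T \<theta>0 = F s0" and F1: "T \<theta>1 = F s"
    using sA by (auto simp: TF \<theta>0_def \<theta>1_def tan_arctan)
  have Fs0: "F s0 \<ge> 0"
  proof -
    have "0 \<le> \<bar>poly g s0\<bar> / (A + s0\<^sup>2) ^ (2 * k)" using A by simp
    from order.trans[OF this max[of s0]] show ?thesis by (simp add: F_def)
  qed
  have Tmax: "\<bar>T \<theta>\<bar> \<le> T \<theta>0" for \<theta>
  proof (cases "cos (\<theta> / 2) = 0")
    case False
    have "\<bar>F x\<bar> = \<bar>poly g x\<bar> / (A + x\<^sup>2) ^ (2 * k)" for x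
      using A by (simp add: F_def abs_divide power_abs)
    thus ?thesis using max False F0 by (simp add: TF F_def)
  qed (simp add: T0 F0 Fs0)
  have diff: "0 \<le> \<theta>1 - \<theta>0" "\<theta>1 - \<theta>0 \<le> 2 * (s - s0)"
  proof -
    have "s0 / sqrt A \<le> s / sqrt A" using sA s by (simp add: divide_right_mono)
    thus "0 \<le> \<theta>1 - \<theta>0" by (simp add: \<theta>0_def \<theta>1_def arctan_le_iff)
    have "\<theta>1 - \<theta>0 \<le> 2 * (s / sqrt A - s0 / sqrt A)" unfolding \<theta>0_def \<theta>1_def
      using arctan_diff_le[OF \<open>s0 / sqrt A \<le> s / sqrt A\<close>] by simp
    also have "s / sqrt A - s0 / sqrt A = (s - s0) / sqrt A" by (simp add: diff_divide_distrib)
    also have "\<dots> \<le> (s - s0) / 1" using A s by (intro divide_left_mono) auto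
    finally show "\<theta>1 - \<theta>0 \<le> 2 * (s - s0)" by simp
  qed
  have Kb: "real (2 * k) * (\<theta>1 - \<theta>0) \<le> 4 * real k * (s - s0)"
    using mult_left_mono[OF diff(2), of "real (2 * k)"] by (simp add: algebra_simps)
  have "T \<theta>0 * cos (real (2 * k) * (\<theta>1 - \<theta>0)) \<le> T (\<theta>0 + (\<theta>1 - \<theta>0))"
  proof (rule trig_poly_near_max[OF P degP])
    show "continuous_on UNIV T" unfolding T_def by (intro continuous_intros) (use A in auto)
  qed (use k Tmax diff order.trans[OF Kb s(2)] in simp_all)
  moreover have "cos (4 * real k * (s - s0)) \<le> cos (real (2 * k) * (\<theta>1 - \<theta>0))"
    using Kb diff s by (intro cos_monotone_0_pi_le) auto
  ultimately have "F s0 * cos (4 * real k * (s - s0)) \<le> F s"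
    using F0 F1 Fs0 mult_left_mono by fastforce
  thus ?thesis by (simp add: F_def)
qed

lemma cos_sqrt_2_ge: "cos (sqrt 2) \<ge> 1 / 8"
proof -
  have "cos (sqrt 2) = 2 * cos (sqrt 2 / 2) ^ 2 - 1" using cos_double_cos[of "sqrt 2 / 2"] by simp
  moreover have "cos (sqrt 2 / 2) \<ge> 3 / 4"
    using cos_double_sin[of "sqrt 2 / 4"] sin_x_le_x[of "sqrt 2 / 4"] sin_ge_zero[of "sqrt 2 / 4"]
      power_mono[of "sin (sqrt 2 / 4)" "sqrt 2 / 4" 2] pi_gt3 sqrt2_less_2
    by (simp add: power_divide)
  hence "cos (sqrt 2 / 2) ^ 2 \<ge> (3 / 4) ^ 2" by (intro power_mono) auto
  ultimately show ?thesis by (simp add: power_divide)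
qed

text \<open>Apart from continuity, this is all that the norming inequality needs to know about
  polynomials in several variables.\<close>

definition poly_on_lines :: "nat \<Rightarrow> ('a::real_vector \<Rightarrow> real) \<Rightarrow> bool" where
  "poly_on_lines k p \<longleftrightarrow> (\<forall>a u. \<exists>g :: real poly. degree g \<le> k \<and> (\<forall>s. p (a + s *\<^sub>R u) = poly g s))"

text \<open>The weight \<open>(1 + (norm x)\<^sup>2) ^ (2 * k)\<close> grows faster than the polynomial can, so the
  maximum \<open>M\<close> of the weighted polynomial over the ball of radius \<open>3 / 2\<close> is global. Along the
  line from a maximum point to a nearby point of \<open>Y\<close> the weighted polynomial loses at most the
  factor \<open>cos (sqrt 2)\<close>, whence \<open>M \<le> 8 * B\<close>.\<close>

lemma norming_set_unit:
  fixes p :: "'a::euclidean_space \<Rightarrow> real"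
  assumes k: "k \<ge> 1" and p: "poly_on_lines k p" and cont: "continuous_on UNIV p"
    and dense: "\<And>x. norm x \<le> 3 / 2 \<Longrightarrow> \<exists>y\<in>Y. dist x y \<le> \<eta>" and \<eta>: "4 * real k * \<eta> \<le> sqrt 2"
    and B: "\<And>y. y \<in> Y \<Longrightarrow> \<bar>p y\<bar> \<le> B"
  shows "\<bar>p x\<bar> \<le> 8 * (1 + (norm x)\<^sup>2) ^ (2 * k) * B"
proof -
  define w where "w x = (1 + (norm x)\<^sup>2) ^ (2 * k)" for x :: 'a
  have w: "w x > 0" for x unfolding w_def by (intro zero_less_power add_pos_nonneg) auto
  define F where "F x = \<bar>p x\<bar> / w x" for x
  have "\<exists>x\<in>cball 0 (3/2). \<forall>y\<in>cball 0 (3/2). F y \<le> F x"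
  proof (rule continuous_attains_sup)
    show "continuous_on (cball 0 (3/2)) F" unfolding F_def
    proof (intro continuous_intros)
      show "continuous_on (cball 0 (3/2)) p" using cont continuous_on_subset by blast
      show "continuous_on (cball 0 (3/2)) w" unfolding w_def by (intro continuous_intros)
      show "\<forall>x\<in>cball 0 (3/2). w x \<noteq> 0" using w by (metis less_irrefl)
    qed
  qed auto
  then obtain x0 where x0: "norm x0 \<le> 3/2" "\<And>y. norm y \<le> 3/2 \<Longrightarrow> F y \<le> F x0" by auto
  define M where "M = F x0"
  have M0: "M \<ge> 0" using w[of x0] by (simp add: M_def F_def)
  have inb: "\<bar>p y\<bar> \<le> M * w y" if "norm y \<le> 3/2" for y
    using x0(2)[OF that] w[of y] by (simp add: F_def M_def field_simps)
  \<comment> \<open>Outside the ball the bound on the segment of radius \<open>3 / 5\<close> through the origin is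
    extrapolated. The radii are chosen so that the factor \<open>(34 / 25)\<^sup>2 * (10 / 3 * t)\<close> that
    arises is at most \<open>(1 + t\<^sup>2)\<^sup>2\<close> for \<open>t \<ge> 3 / 2\<close>.\<close>
  have glob: "\<bar>p y\<bar> \<le> M * w y" for y
  proof (cases "norm y \<le> 3/2")
    case False
    define t where "t = norm y"
    have t: "t > 3/2" using False by (simp add: t_def)
    define u where "u = y /\<^sub>R t"
    have u: "norm u = 1" "t *\<^sub>R u = y" using t by (simp_all add: u_def t_def[symmetric])
    obtain g :: "real poly" where g: "degree g \<le> k" "\<And>s. p (0 + s *\<^sub>R u) = poly g s"
      using p unfolding poly_on_lines_def by blast
    have "\<bar>poly g t\<bar> \<le> (M * (34 / 25) ^ (2 * k)) * (2 * \<bar>t\<bar> / (3/5)) ^ k"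
    proof (rule poly_growth_outside_interval[OF g(1)])
      fix s :: real assume s: "\<bar>s\<bar> \<le> 3/5"
      have "\<bar>poly g s\<bar> = \<bar>p (s *\<^sub>R u)\<bar>" using g(2)[of s] by simp
      also have "\<dots> \<le> M * w (s *\<^sub>R u)" using s u by (intro inb) simp
      also have "\<dots> \<le> M * (34/25) ^ (2 * k)"
      proof -
        have "s\<^sup>2 \<le> (3/5)\<^sup>2" using s by (metis abs_ge_zero power2_abs power_mono)
        hence "1 + (norm (s *\<^sub>R u))\<^sup>2 \<le> 34/25" using u by (simp add: power_divide)
        thus ?thesis unfolding w_def using M0 by (intro mult_left_mono power_mono) auto
      qed
      finally show "\<bar>poly g s\<bar> \<le> M * (34/25) ^ (2 * k)" .
    qed (use t in auto)
    also have "2 * \<bar>t\<bar> / (3/5) = 10 / 3 * t" using t by simp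
    also have "M * (34 / 25) ^ (2 * k) * (10 / 3 * t) ^ k = M * ((34 / 25)\<^sup>2 * (10 / 3 * t)) ^ k"
      by (simp only: power_mult power_mult_distrib mult.assoc)
    also have "\<dots> \<le> M * ((1 + t\<^sup>2)\<^sup>2) ^ k"
    proof (intro mult_left_mono power_mono)
      have "0 \<le> (t - 3/2) * (t - 2/3)" using t by simp
      hence 1: "1 + t\<^sup>2 \<ge> 13/6 * t" by (simp add: algebra_simps power2_eq_square)
      have 2: "1 + t\<^sup>2 \<ge> 13/4" using t power_mono[of "3/2" t 2] by (simp add: power_divide)
      have "(13/6 * t) * (13/4) \<le> (1 + t\<^sup>2) * (1 + t\<^sup>2)" using 1 2 t by (intro mult_mono) auto
      thus "(34 / 25)\<^sup>2 * (10 / 3 * t) \<le> (1 + t\<^sup>2)\<^sup>2" using t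
        by (simp add: power2_eq_square[of "1 + t\<^sup>2"] power_divide)
    qed (use M0 t in auto)
    also have "\<dots> = M * w y" by (simp add: w_def t_def power_mult)
    finally show ?thesis using g(2)[of t] u by simp
  qed (rule inb)
  obtain y where y: "y \<in> Y" "dist x0 y \<le> \<eta>" using dense x0(1) by blast
  define \<sigma> :: real where "\<sigma> = (if p x0 \<ge> 0 then 1 else - 1)"
  have "M / 8 \<le> B / w y"
  proof -
    define d where "d = dist x0 y"
    obtain u where u: "norm u = 1" "y = x0 + d *\<^sub>R u"
    proof (cases "y = x0")
      case True
      obtain u :: 'a where "u \<in> Basis" using SOME_Basis by blast
      thus ?thesis using that[of u] True by (simp add: d_def)
    next
      case False
      have "d \<noteq> 0" using False by (simp add: d_def)
      show ?thesis
        by (rule that[of "(y - x0) /\<^sub>R d"])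
           (use \<open>d \<noteq> 0\<close> False in \<open>auto simp: d_def dist_norm norm_minus_commute\<close>)
    qed
    \<comment> \<open>The line is parametrised from its point closest to the origin, so that \<open>1 + (norm x)\<^sup>2\<close>
      becomes \<open>A + s\<^sup>2\<close>.\<close>
    define b where "b = x0 \<bullet> u"
    define A where "A = 1 + (norm x0)\<^sup>2 - b\<^sup>2"
    have "\<bar>b\<bar> \<le> norm x0" unfolding b_def using Cauchy_Schwarz_ineq2[of x0 u] u by simp
    hence "b\<^sup>2 \<le> (norm x0)\<^sup>2" by (metis abs_ge_zero power2_abs power_mono)
    hence A: "A \<ge> 1" by (simp add: A_def)
    obtain g :: "real poly" where g: "degree g \<le> k" "\<And>s. p ((x0 - b *\<^sub>R u) + s *\<^sub>R u) = poly g s"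
      using p unfolding poly_on_lines_def by blast
    have ws: "w ((x0 - b *\<^sub>R u) + s *\<^sub>R u) = (A + s\<^sup>2) ^ (2 * k)" for s
    proof -
      have uu: "u \<bullet> u = 1" using u by (simp add: norm_eq_1)
      have e: "(x0 - b *\<^sub>R u) + s *\<^sub>R u = x0 + (s - b) *\<^sub>R u" by (simp add: algebra_simps)
      have "(norm (x0 + (s - b) *\<^sub>R u))\<^sup>2 = (norm x0)\<^sup>2 + 2 * (s - b) * b + (s - b)\<^sup>2"
        unfolding power2_norm_eq_inner
        by (simp add: inner_add_left inner_add_right uu b_def inner_commute power2_eq_square algebra_simps)
      hence "1 + (norm ((x0 - b *\<^sub>R u) + s *\<^sub>R u))\<^sup>2 = A + s\<^sup>2"
        unfolding e by (simp add: A_def power2_eq_square algebra_simps)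
      thus ?thesis by (simp add: w_def)
    qed
    let ?g = "smult \<sigma> g"
    have pb: "poly ?g b / (A + b\<^sup>2) ^ (2 * k) = M"
      using g(2)[of b] ws[of b] by (simp add: M_def F_def \<sigma>_def)
    have "poly ?g b / (A + b\<^sup>2) ^ (2 * k) * cos (4 * real k * (b + d - b)) \<le>
        poly ?g (b + d) / (A + (b + d)\<^sup>2) ^ (2 * k)"
    proof (rule weighted_poly_near_max_right[OF A _ k])
      show "degree ?g \<le> k" using g(1) degree_smult_le order.trans by blast
      show "b \<le> b + d" by (simp add: d_def)
      have "4 * real k * d \<le> 4 * real k * \<eta>" using y(2) by (intro mult_left_mono) (auto simp: d_def)
      thus "4 * real k * (b + d - b) \<le> pi" using \<eta> pi_gt3 sqrt2_less_2 by simp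
      fix s
      have "\<bar>poly ?g s\<bar> = \<bar>p ((x0 - b *\<^sub>R u) + s *\<^sub>R u)\<bar>" using g(2)[of s] by (simp add: \<sigma>_def)
      also have "\<dots> \<le> M * (A + s\<^sup>2) ^ (2 * k)" using glob ws by metis
      finally show "\<bar>poly ?g s\<bar> / (A + s\<^sup>2) ^ (2 * k) \<le> poly ?g b / (A + b\<^sup>2) ^ (2 * k)"
        unfolding pb using A by (simp add: divide_le_eq add_pos_nonneg)
    qed
    moreover have "cos (4 * real k * d) \<ge> 1 / 8"
    proof -
      have "4 * real k * d \<le> 4 * real k * \<eta>" using y(2) by (intro mult_left_mono) (auto simp: d_def)
      hence "cos (sqrt 2) \<le> cos (4 * real k * d)" using \<eta> pi_gt3 sqrt2_less_2
        by (intro cos_monotone_0_pi_le) (auto simp: d_def)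
      thus ?thesis using cos_sqrt_2_ge by linarith
    qed
    moreover have "poly ?g (b + d) / (A + (b + d)\<^sup>2) ^ (2 * k) \<le> B / w y"
    proof -
      have e: "(x0 - b *\<^sub>R u) + (b + d) *\<^sub>R u = y" using u by (simp add: algebra_simps)
      have "poly ?g (b + d) \<le> \<bar>p y\<bar>" using g(2)[of "b + d"] abs_ge_self[of "p y"] abs_ge_minus_self[of "p y"]
        by (simp add: e \<sigma>_def)
      also have "\<dots> \<le> B" by (rule B[OF y(1)])
      finally show ?thesis using ws[of "b + d"] w[of y] by (simp add: e divide_right_mono)
    qed
    ultimately have "M * cos (4 * real k * d) \<le> B / w y" "cos (4 * real k * d) \<ge> 1 / 8"
      unfolding pb by simp_all
    with mult_left_mono[OF this(2) M0] show ?thesis by linarith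
  qed
  moreover have "B / w y \<le> B"
  proof -
    have "B \<ge> 0" using B[OF y(1)] by linarith
    moreover have "w y \<ge> 1" unfolding w_def by (intro one_le_power) simp
    ultimately show ?thesis using w[of y] by (simp add: divide_le_eq mult_right_mono mult_le_cancel_left1)
  qed
  ultimately have "M \<le> 8 * B" by linarith
  hence "M * w x \<le> 8 * B * w x" using w[of x] by (intro mult_right_mono) auto
  thus ?thesis using glob[of x] by (simp add: w_def mult.commute mult.left_commute)
qed

lemma norming_set_ball:
  fixes p :: "'a::euclidean_space \<Rightarrow> real"
  assumes k: "k \<ge> 1" and p: "poly_on_lines k p" and cont: "continuous_on UNIV p" and r: "r > 0"
    and dense: "\<And>x. dist z x \<le> r \<Longrightarrow> \<exists>y\<in>Y. dist x y \<le> \<eta>" and \<eta>: "6 * real k * \<eta> \<le> sqrt 2 * r"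
    and B: "\<And>y. y \<in> Y \<Longrightarrow> \<bar>p y\<bar> \<le> B"
  shows "\<bar>p x\<bar> \<le> 8 * (1 + (3 * dist z x / (2 * r))\<^sup>2) ^ (2 * k) * B"
proof -
  \<comment> \<open>scaling by \<open>e\<close> maps the ball of radius \<open>3 / 2\<close> to the ball of radius \<open>r\<close>\<close>
  define e where "e = 2 * r / 3"
  have e: "e > 0" using r by (simp add: e_def)
  have "\<bar>p (z + e *\<^sub>R ((x - z) /\<^sub>R e))\<bar> \<le> 8 * (1 + (norm ((x - z) /\<^sub>R e))\<^sup>2) ^ (2 * k) * B"
  proof (rule norming_set_unit[where p="\<lambda>v. p (z + e *\<^sub>R v)" and Y="{v. z + e *\<^sub>R v \<in> Y}" and \<eta>="\<eta> / e"])
    show "poly_on_lines k (\<lambda>v. p (z + e *\<^sub>R v))" unfolding poly_on_lines_def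
    proof (intro allI)
      fix a u
      obtain g :: "real poly" where "degree g \<le> k" "\<And>s. p ((z + e *\<^sub>R a) + s *\<^sub>R (e *\<^sub>R u)) = poly g s"
        using p unfolding poly_on_lines_def by blast
      thus "\<exists>g :: real poly. degree g \<le> k \<and> (\<forall>s. p (z + e *\<^sub>R (a + s *\<^sub>R u)) = poly g s)"
        by (intro exI[of _ g]) (auto simp: algebra_simps)
    qed
    show "continuous_on UNIV (\<lambda>v. p (z + e *\<^sub>R v))"
      by (rule continuous_on_compose2[OF cont]) (auto intro!: continuous_intros)
    fix v :: 'a assume v: "norm v \<le> 3/2"
    have "dist z (z + e *\<^sub>R v) \<le> r"
      using v r by (simp add: dist_norm e_def)
    then obtain y where y: "y \<in> Y" "dist (z + e *\<^sub>R v) y \<le> \<eta>" using dense by blast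
    have yy: "y = z + e *\<^sub>R ((y - z) /\<^sub>R e)" using e by simp
    have "dist (z + e *\<^sub>R v) (z + e *\<^sub>R ((y - z) /\<^sub>R e)) = e * dist v ((y - z) /\<^sub>R e)"
    proof -
      have "dist (z + e *\<^sub>R v) (z + e *\<^sub>R ((y - z) /\<^sub>R e)) = norm (e *\<^sub>R (v - (y - z) /\<^sub>R e))"
        unfolding dist_norm by (simp only: scaleR_right_diff_distrib add_diff_cancel_left)
      thus ?thesis using e by (simp only: norm_scaleR dist_norm)
    qed
    hence "dist v ((y - z) /\<^sub>R e) \<le> \<eta> / e" using y(2) yy e by (simp add: field_simps)
    thus "\<exists>y\<in>{v. z + e *\<^sub>R v \<in> Y}. dist v y \<le> \<eta> / e" using y(1) yy by (intro bexI[of _ "(y - z) /\<^sub>R e"]) auto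
  next
    show "4 * real k * (\<eta> / e) \<le> sqrt 2" using \<eta> r by (simp add: e_def field_simps)
  qed (use k B in auto)
  moreover have "norm ((x - z) /\<^sub>R e) = 3 * dist z x / (2 * r)"
  proof -
    have "norm ((x - z) /\<^sub>R e) = norm (x - z) / e" using e by (simp add: divide_inverse)
    thus ?thesis by (simp add: e_def dist_norm norm_minus_commute mult.commute)
  qed
  ultimately show ?thesis using e by simp
qed

section \<open>Reproducing weights by extension of functionals\<close>

text \<open>One step of the Hahn-Banach argument. The functional \<open>\<psi>\<close> is extended, with the same
  bound \<open>\<Lambda>\<close>, to functions on \<open>insert w Z\<close> whose value \<open>d\<close> at \<open>w\<close> is arbitrary, and \<open>s\<close> is the
  value of the extension at the function that is \<open>1\<close> at \<open>w\<close> and \<open>0\<close> on \<open>Z\<close>. The choices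
  \<open>d = B\<close> and \<open>d = - B\<close> give the conclusion.\<close>

lemma one_dim_extension:
  fixes \<psi> :: "('a \<Rightarrow> real) \<Rightarrow> real"
  assumes add: "\<And>f g s t. f \<in> W \<Longrightarrow> g \<in> W \<Longrightarrow> (\<lambda>x. s * f x + t * g x) \<in> W"
    and zero: "(\<lambda>x. 0) \<in> W"
    and lin: "\<And>f g s t. f \<in> W \<Longrightarrow> g \<in> W \<Longrightarrow> \<psi> (\<lambda>x. s * f x + t * g x) = s * \<psi> f + t * \<psi> g"
    and bd: "\<And>p B. p \<in> W \<Longrightarrow> (\<And>y. y \<in> insert w Z \<Longrightarrow> \<bar>p y\<bar> \<le> B) \<Longrightarrow> \<psi> p \<le> \<Lambda> * B"
    and L: "\<Lambda> \<ge> 0"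
  shows "\<exists>s. \<forall>p\<in>W. \<forall>B\<ge>0. (\<forall>y\<in>Z. \<bar>p y\<bar> \<le> B) \<longrightarrow> \<psi> p - s * p w \<le> (\<Lambda> - \<bar>s\<bar>) * B"
proof -
  \<comment> \<open>the lower bounds imposed on \<open>s\<close> by the functions with \<open>d < p w\<close>; those with \<open>d > p w\<close>
    impose upper bounds\<close>
  define Lo where "Lo = {(\<psi> p - \<Lambda> * B) / (p w - d) | p B d. p \<in> W \<and> (\<forall>y\<in>Z. \<bar>p y\<bar> \<le> B) \<and> \<bar>d\<bar> \<le> B \<and> d < p w}"
  have key: "(\<psi> p - \<Lambda> * B) / (p w - d) \<le> (\<Lambda> * B' - \<psi> p') / (d' - p' w)"
    if p: "p \<in> W" "\<forall>y\<in>Z. \<bar>p y\<bar> \<le> B" "\<bar>d\<bar> \<le> B" "d < p w"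
      and p': "p' \<in> W" "\<forall>y\<in>Z. \<bar>p' y\<bar> \<le> B'" "\<bar>d'\<bar> \<le> B'" "p' w < d'" for p B d p' B' d'
  proof -
    define a where "a = p w - d"
    define b where "b = d' - p' w"
    have ab: "a > 0" "b > 0" using p p' by (auto simp: a_def b_def)
    have "\<psi> (\<lambda>x. b * p x + a * p' x) \<le> \<Lambda> * (b * B + a * B')"
    proof (rule bd)
      show "(\<lambda>x. b * p x + a * p' x) \<in> W" using add p p' by blast
      fix y assume "y \<in> insert w Z"
      hence "y = w \<or> y \<in> Z" by blast
      thus "\<bar>b * p y + a * p' y\<bar> \<le> b * B + a * B'"
      proof
        assume "y = w"
        hence "b * p y + a * p' y = b * d + a * d'" by (simp add: a_def b_def algebra_simps)
        also have "\<bar>\<dots>\<bar> \<le> b * \<bar>d\<bar> + a * \<bar>d'\<bar>" using ab abs_triangle_ineq[of "b * d" "a * d'"] by (simp add: abs_mult)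
        also have "\<dots> \<le> b * B + a * B'" using ab p p' by (intro add_mono mult_left_mono) auto
        finally show ?thesis .
      next
        assume y: "y \<in> Z"
        have "\<bar>b * p y + a * p' y\<bar> \<le> b * \<bar>p y\<bar> + a * \<bar>p' y\<bar>"
          using ab abs_triangle_ineq[of "b * p y" "a * p' y"] by (simp add: abs_mult)
        also have "\<dots> \<le> b * B + a * B'" using ab p p' y by (intro add_mono mult_left_mono) auto
        finally show ?thesis .
      qed
    qed
    hence "b * \<psi> p + a * \<psi> p' \<le> \<Lambda> * (b * B + a * B')" using lin p p' by simp
    hence "(\<psi> p - \<Lambda> * B) * b \<le> (\<Lambda> * B' - \<psi> p') * a" by (simp add: algebra_simps)
    thus ?thesis using ab by (simp add: a_def[symmetric] b_def[symmetric] divide_le_eq pos_le_divide_eq)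
  qed
  have ub: "x \<le> (\<Lambda> * B' - \<psi> p') / (d' - p' w)" if "x \<in> Lo"
     "p' \<in> W" "\<forall>y\<in>Z. \<bar>p' y\<bar> \<le> B'" "\<bar>d'\<bar> \<le> B'" "p' w < d'" for x p' B' d'
    using that key unfolding Lo_def by blast
  have "(\<psi> (\<lambda>x. 0) - \<Lambda> * 1) / (0 - (-1)) \<in> Lo" unfolding Lo_def
    by (rule CollectI, intro exI[of _ "\<lambda>x. 0"] exI[of _ 1] exI[of _ "-1"]) (use zero in auto)
  hence ne: "Lo \<noteq> {}" by blast
  have bdd: "bdd_above Lo"
    by (rule bdd_aboveI[of _ "(\<Lambda> * 1 - \<psi> (\<lambda>x. 0)) / (1 - 0)"], rule ub[of _ "\<lambda>x. 0" 1 1]) (use zero in auto)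
  define s where "s = Sup Lo"
  show ?thesis
  proof (intro exI[of _ s] ballI allI impI)
    fix p B assume p: "p \<in> W" and B: "B \<ge> 0" and pB: "\<forall>y\<in>Z. \<bar>p y\<bar> \<le> B"
    have main: "\<psi> p + s * (d - p w) \<le> \<Lambda> * B" if d: "\<bar>d\<bar> \<le> B" for d
    proof -
      consider "d = p w" | "d < p w" | "d > p w" by linarith
      thus ?thesis
      proof cases
        case 1
        thus ?thesis using bd[OF p, of B] pB d by auto
      next
        case 2
        have "(\<psi> p - \<Lambda> * B) / (p w - d) \<in> Lo" using p pB d 2 unfolding Lo_def by blast
        hence "(\<psi> p - \<Lambda> * B) / (p w - d) \<le> s" unfolding s_def by (rule cSup_upper[OF _ bdd])
        thus ?thesis using 2 by (simp add: divide_le_eq algebra_simps)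
      next
        case 3
        have "s \<le> (\<Lambda> * B - \<psi> p) / (d - p w)" unfolding s_def
          by (rule cSup_least[OF ne]) (rule ub, use p pB d 3 in auto)
        thus ?thesis using 3 by (simp add: pos_le_divide_eq algebra_simps)
      qed
    qed
    show "\<psi> p - s * p w \<le> (\<Lambda> - \<bar>s\<bar>) * B"
      using main[of B] main[of "-B"] B by (cases "s \<ge> 0") (simp_all add: algebra_simps)
  qed
qed

text \<open>The points of \<open>Y\<close> are removed one by one. The point \<open>w\<close> receives a weight \<open>s\<close>, and the
  remaining functional is bounded by \<open>\<Lambda> - \<bar>s\<bar>\<close> times the maximum over the remaining points.
  When no point is left, every \<open>B \<ge> 0\<close> is admissible, and \<open>B = 0\<close> shows that the remaining
  functional is zero.\<close>

lemma weights_from_norming_set: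
  fixes W :: "('a \<Rightarrow> real) set"
  assumes fin: "finite Y"
    and add: "\<And>f g s t. f \<in> W \<Longrightarrow> g \<in> W \<Longrightarrow> (\<lambda>x. s * f x + t * g x) \<in> W"
    and zero: "(\<lambda>x. 0) \<in> W" and L: "\<Lambda> \<ge> 0"
    and bd: "\<And>p B. p \<in> W \<Longrightarrow> (\<And>y. y \<in> Y \<Longrightarrow> \<bar>p y\<bar> \<le> B) \<Longrightarrow> \<bar>p x\<bar> \<le> \<Lambda> * B"
  obtains \<sigma> where "(\<Sum>y\<in>Y. \<bar>\<sigma> y\<bar>) \<le> \<Lambda>" "\<And>p. p \<in> W \<Longrightarrow> p x = (\<Sum>y\<in>Y. \<sigma> y * p y)"
proof (cases "Y = {}")
  case True
  have "p x = 0" if "p \<in> W" for p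
    using bd[OF that, of 0] True by simp
  thus ?thesis using that[of "\<lambda>_. 0"] True L by simp
next
  case Yne: False
  have "\<exists>\<sigma>. \<forall>p\<in>W. \<forall>B\<ge>0. (\<forall>y\<in>Y - Z. \<bar>p y\<bar> \<le> B) \<longrightarrow>
      p x - (\<Sum>z\<in>Z. \<sigma> z * p z) \<le> (\<Lambda> - (\<Sum>z\<in>Z. \<bar>\<sigma> z\<bar>)) * B" if "Z \<subseteq> Y" for Z
    using finite_subset[OF that fin] that
  proof (induction Z rule: finite_induct)
    case empty
    show ?case
    proof (intro exI ballI allI impI)
      fix p B assume "p \<in> W" "\<forall>y\<in>Y - {}. \<bar>p y\<bar> \<le> B"
      hence "\<bar>p x\<bar> \<le> \<Lambda> * B" by (intro bd) auto
      thus "p x - (\<Sum>z\<in>{}. undefined z * p z) \<le> (\<Lambda> - (\<Sum>z\<in>{}. \<bar>undefined z\<bar>)) * B" by simp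
    qed
  next
    case (insert w Z)
    then obtain \<sigma> where \<sigma>: "\<And>p B. p \<in> W \<Longrightarrow> B \<ge> 0 \<Longrightarrow> (\<And>y. y \<in> Y - Z \<Longrightarrow> \<bar>p y\<bar> \<le> B) \<Longrightarrow>
      p x - (\<Sum>z\<in>Z. \<sigma> z * p z) \<le> (\<Lambda> - (\<Sum>z\<in>Z. \<bar>\<sigma> z\<bar>)) * B" by blast
    define \<psi> where "\<psi> p = p x - (\<Sum>z\<in>Z. \<sigma> z * p z)" for p
    define \<Lambda>' where "\<Lambda>' = \<Lambda> - (\<Sum>z\<in>Z. \<bar>\<sigma> z\<bar>)"
    have w: "w \<in> Y - Z" using insert by auto
    have L': "\<Lambda>' \<ge> 0" using \<sigma>[OF zero, of 1] by (simp add: \<Lambda>'_def)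
    have eq: "insert w (Y - insert w Z) = Y - Z" using w by auto
    have "\<exists>s. \<forall>p\<in>W. \<forall>B\<ge>0. (\<forall>y\<in>Y - insert w Z. \<bar>p y\<bar> \<le> B) \<longrightarrow> \<psi> p - s * p w \<le> (\<Lambda>' - \<bar>s\<bar>) * B"
    proof (rule one_dim_extension[OF add zero _ _ L'])
      fix f g :: "'a \<Rightarrow> real" and s t :: real
      show "\<psi> (\<lambda>x. s * f x + t * g x) = s * \<psi> f + t * \<psi> g"
        by (simp add: \<psi>_def algebra_simps sum.distrib sum_distrib_left)
    next
      fix p B assume p: "p \<in> W" and b: "\<And>y. y \<in> insert w (Y - insert w Z) \<Longrightarrow> \<bar>p y\<bar> \<le> B"
      have "B \<ge> 0" using b[of w] by simp
      thus "\<psi> p \<le> \<Lambda>' * B" unfolding \<psi>_def \<Lambda>'_def using b unfolding eq by (intro \<sigma> p) auto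
    qed
    then obtain s where s: "\<And>p B. p \<in> W \<Longrightarrow> B \<ge> 0 \<Longrightarrow> \<forall>y\<in>Y - insert w Z. \<bar>p y\<bar> \<le> B \<Longrightarrow>
        \<psi> p - s * p w \<le> (\<Lambda>' - \<bar>s\<bar>) * B" by blast
    have e: "(\<Sum>z\<in>Z. (\<sigma>(w := s)) z * p z) = (\<Sum>z\<in>Z. \<sigma> z * p z)"
      "(\<Sum>z\<in>Z. \<bar>(\<sigma>(w := s)) z\<bar>) = (\<Sum>z\<in>Z. \<bar>\<sigma> z\<bar>)" for p
      using insert by (auto intro!: sum.cong)
    show ?case
    proof (intro exI[of _ "\<sigma>(w := s)"] ballI allI impI)
      fix p B assume "p \<in> W" "B \<ge> (0::real)" "\<forall>y\<in>Y - insert w Z. \<bar>p y\<bar> \<le> B"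
      from s[OF this] have "p x - (\<Sum>z\<in>Z. \<sigma> z * p z) - s * p w \<le> (\<Lambda> - (\<Sum>z\<in>Z. \<bar>\<sigma> z\<bar>) - \<bar>s\<bar>) * B"
        by (simp add: \<psi>_def \<Lambda>'_def)
      moreover have "(\<Sum>z\<in>insert w Z. (\<sigma>(w := s)) z * p z) = s * p w + (\<Sum>z\<in>Z. \<sigma> z * p z)"
        "(\<Sum>z\<in>insert w Z. \<bar>(\<sigma>(w := s)) z\<bar>) = \<bar>s\<bar> + (\<Sum>z\<in>Z. \<bar>\<sigma> z\<bar>)"
        using insert(1,2) e by (simp_all del: fun_upd_apply, simp_all)
      ultimately show "p x - (\<Sum>z\<in>insert w Z. (\<sigma>(w := s)) z * p z)
          \<le> (\<Lambda> - (\<Sum>z\<in>insert w Z. \<bar>(\<sigma>(w := s)) z\<bar>)) * B" by (simp only: algebra_simps)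
    qed
  qed
  from this[of Y] obtain \<sigma> where \<sigma>: "\<And>p B. p \<in> W \<Longrightarrow> B \<ge> 0 \<Longrightarrow> 
      p x - (\<Sum>z\<in>Y. \<sigma> z * p z) \<le> (\<Lambda> - (\<Sum>z\<in>Y. \<bar>\<sigma> z\<bar>)) * B" by auto
  show ?thesis
  proof (rule that[of \<sigma>])
    show "(\<Sum>y\<in>Y. \<bar>\<sigma> y\<bar>) \<le> \<Lambda>" using \<sigma>[OF zero, of 1] by simp
    fix p assume p: "p \<in> W"
    have m: "(\<lambda>x. (-1) * p x + 0 * p x) \<in> W" by (rule add[OF p p])
    show "p x = (\<Sum>y\<in>Y. \<sigma> y * p y)"
      using \<sigma>[OF p, of 0] \<sigma>[OF m, of 0] by (simp add: sum_negf)
  qed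
qed

section \<open>Polynomials in coordinates and annihilating coefficients\<close>

definition real_polys :: "nat \<Rightarrow> (real^'n::finite \<Rightarrow> real) set" where
  "real_polys k = {p. \<exists>a. p = (\<lambda>x. \<Sum>\<alpha> | sum \<alpha> UNIV \<le> k. a \<alpha> * monomial_fun \<alpha> x)}"

lemma finite_multi_indices: "finite {\<alpha> :: 'n::finite \<Rightarrow> nat. sum \<alpha> UNIV \<le> k}"
proof (rule finite_subset)
  show "{\<alpha> :: 'n \<Rightarrow> nat. sum \<alpha> UNIV \<le> k} \<subseteq> PiE UNIV (\<lambda>_. {..k})"
  proof
    fix \<alpha> :: "'n \<Rightarrow> nat" assume "\<alpha> \<in> {\<alpha>. sum \<alpha> UNIV \<le> k}"
    moreover have "\<alpha> i \<le> sum \<alpha> UNIV" for i by (rule member_le_sum) auto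
    ultimately have "\<alpha> i \<le> k" for i by (metis mem_Collect_eq order.trans)
    thus "\<alpha> \<in> PiE UNIV (\<lambda>_. {..k})" by (simp add: PiE_def extensional_def)
  qed
  show "finite (PiE (UNIV :: 'n set) (\<lambda>_. {..k}))" by (intro finite_PiE) auto
qed

lemma real_polys_lincomb:
  assumes "f \<in> real_polys k" "g \<in> real_polys k"
  shows "(\<lambda>x. s * f x + t * g x) \<in> real_polys k"
proof -
  obtain a b where "f = (\<lambda>x. \<Sum>\<alpha> | sum \<alpha> UNIV \<le> k. a \<alpha> * monomial_fun \<alpha> x)"
    "g = (\<lambda>x. \<Sum>\<alpha> | sum \<alpha> UNIV \<le> k. b \<alpha> * monomial_fun \<alpha> x)"
    using assms unfolding real_polys_def by blast
  hence "(\<lambda>x. s * f x + t * g x) = (\<lambda>x. \<Sum>\<alpha> | sum \<alpha> UNIV \<le> k. (s * a \<alpha> + t * b \<alpha>) * monomial_fun \<alpha> x)"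
    by (simp add: fun_eq_iff sum_distrib_left sum.distrib algebra_simps)
  thus ?thesis unfolding real_polys_def by (intro CollectI exI)
qed

lemma real_polys_zero: "(\<lambda>x. 0) \<in> real_polys k"
  unfolding real_polys_def by (intro CollectI exI[of _ "\<lambda>_. 0"]) simp

lemma real_polys_scale: "f \<in> real_polys k \<Longrightarrow> (\<lambda>x. s * f x) \<in> real_polys k"
  using real_polys_lincomb[of f k f s 0] by simp

lemma real_polys_add: "f \<in> real_polys k \<Longrightarrow> g \<in> real_polys k \<Longrightarrow> (\<lambda>x. f x + g x) \<in> real_polys k"
  using real_polys_lincomb[of f k g 1 1] by simp

lemma real_polys_sum: "(\<And>i. i \<in> A \<Longrightarrow> f i \<in> real_polys k) \<Longrightarrow> (\<lambda>x. \<Sum>i\<in>A. f i x) \<in> real_polys k"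
  by (induction A rule: infinite_finite_induct) (auto intro: real_polys_zero real_polys_add)

lemma monomial_in_real_polys:
  assumes "sum \<alpha> UNIV \<le> k" shows "monomial_fun \<alpha> \<in> real_polys k"
proof -
  have "monomial_fun \<alpha> x = (\<Sum>\<beta> | sum \<beta> UNIV \<le> k. (if \<beta> = \<alpha> then 1 else 0) * monomial_fun \<beta> x)" for x
    using assms by (simp add: finite_multi_indices if_distrib[of "\<lambda>c. c * _"] sum.delta cong: if_cong)
  hence "monomial_fun \<alpha> = (\<lambda>x. \<Sum>\<beta> | sum \<beta> UNIV \<le> k. (if \<beta> = \<alpha> then 1 else 0) * monomial_fun \<beta> x)"
    by blast
  thus ?thesis unfolding real_polys_def by (intro CollectI exI)
qed

lemma real_polys_mult:
  assumes "f \<in> real_polys k" "g \<in> real_polys l"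
  shows "(\<lambda>x. f x * g x) \<in> real_polys (k + l)"
proof -
  obtain a b where fg: "f = (\<lambda>x. \<Sum>\<alpha> | sum \<alpha> UNIV \<le> k. a \<alpha> * monomial_fun \<alpha> x)"
    "g = (\<lambda>x. \<Sum>\<alpha> | sum \<alpha> UNIV \<le> l. b \<alpha> * monomial_fun \<alpha> x)"
    using assms unfolding real_polys_def by blast
  have "(\<lambda>x. \<Sum>\<alpha> | sum \<alpha> UNIV \<le> k. \<Sum>\<beta> | sum \<beta> UNIV \<le> l.
      (a \<alpha> * b \<beta>) * monomial_fun (\<lambda>i. \<alpha> i + \<beta> i) x) \<in> real_polys (k + l)"
    by (intro real_polys_sum real_polys_scale monomial_in_real_polys) (auto simp: sum.distrib)
  also have "(\<lambda>x. \<Sum>\<alpha> | sum \<alpha> UNIV \<le> k. \<Sum>\<beta> | sum \<beta> UNIV \<le> l.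
      (a \<alpha> * b \<beta>) * monomial_fun (\<lambda>i. \<alpha> i + \<beta> i) x) = (\<lambda>x. f x * g x)"
    by (simp add: fun_eq_iff fg sum_product monomial_fun_def power_add prod.distrib mult_ac)
  finally show ?thesis .
qed

lemma real_polys_const: "(\<lambda>x. c) \<in> real_polys k"
  using real_polys_scale[OF monomial_in_real_polys[of "\<lambda>_. 0" k], of c]
  by (simp add: monomial_fun_def)

lemma real_polys_nth: "(\<lambda>x. x $ i) \<in> real_polys 1"
proof -
  have "monomial_fun (\<lambda>j. of_bool (j = i)) = (\<lambda>x. x $ i)"
    unfolding monomial_fun_def fun_eq_iff of_bool_def
    by (auto simp: if_distrib[of "\<lambda>n. _ ^ n"] prod.delta cong: if_cong)
  thus ?thesis using monomial_in_real_polys[of "\<lambda>j. of_bool (j = i)" 1] by simp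
qed

lemma real_polys_power: "f \<in> real_polys k \<Longrightarrow> (\<lambda>x. f x ^ j) \<in> real_polys (k * j)"
  by (induction j) (auto intro: real_polys_const real_polys_mult)

lemma real_polys_prod:
  "(\<And>i. i \<in> A \<Longrightarrow> f i \<in> real_polys (k i)) \<Longrightarrow> (\<lambda>x. \<Prod>i\<in>A. f i x) \<in> real_polys (sum k A)"
  by (induction A rule: infinite_finite_induct) (auto intro: real_polys_const real_polys_mult)

lemma real_polys_inner: "(\<lambda>x. x \<bullet> u) \<in> real_polys 1"
proof -
  have "(\<lambda>x. \<Sum>i\<in>UNIV. u $ i * x $ i) \<in> real_polys 1"
    by (intro real_polys_sum real_polys_scale real_polys_nth)
  thus ?thesis by (simp add: inner_vec_def mult.commute)
qed

lemma real_polys_norm_square: "(\<lambda>x. (norm x)\<^sup>2) \<in> real_polys 2"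
proof -
  have "(\<lambda>x. \<Sum>i\<in>UNIV. x $ i * x $ i) \<in> real_polys (1 + 1)"
    by (intro real_polys_sum real_polys_mult real_polys_nth)
  thus ?thesis unfolding power2_norm_eq_inner by (simp add: inner_vec_def numeral_2_eq_2)
qed

lemma real_polys_monomial_translate: "(\<lambda>y. monomial_fun \<alpha> (u + y)) \<in> real_polys (sum \<alpha> UNIV)"
proof -
  have "(\<lambda>y. (u + y) $ i) \<in> real_polys 1" for i
    using real_polys_add[OF real_polys_const real_polys_nth] by simp
  hence "(\<lambda>y. (u + y) $ i ^ \<alpha> i) \<in> real_polys (\<alpha> i)" for i
    using real_polys_power[of _ 1] by fastforce
  from real_polys_prod[OF this] show ?thesis by (simp add: monomial_fun_def)
qed

lemma poly_on_lines_real_polys: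
  assumes "p \<in> real_polys k" shows "poly_on_lines k p"
  unfolding poly_on_lines_def
proof (intro allI)
  fix v u :: "real^'a"
  obtain c where c: "p = (\<lambda>x. \<Sum>\<alpha> | sum \<alpha> UNIV \<le> k. c \<alpha> * monomial_fun \<alpha> x)"
    using assms unfolding real_polys_def by blast
  define g where "g = (\<Sum>\<alpha> | sum \<alpha> UNIV \<le> k. smult (c \<alpha>) (\<Prod>i\<in>UNIV. [:v $ i, u $ i:] ^ \<alpha> i))"
  have "degree g \<le> k" unfolding g_def
  proof (rule degree_sum_le)
    fix \<alpha> :: "'a \<Rightarrow> nat" assume \<alpha>: "\<alpha> \<in> {\<alpha>. sum \<alpha> UNIV \<le> k}"
    have "degree (\<Prod>i\<in>UNIV. [:v $ i, u $ i:] ^ \<alpha> i) \<le> sum (degree \<circ> (\<lambda>i. [:v $ i, u $ i:] ^ \<alpha> i)) UNIV"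
      by (rule degree_prod_sum_le) simp
    also have "\<dots> \<le> sum \<alpha> UNIV"
    proof (rule sum_mono)
      fix i
      have "degree ([:v $ i, u $ i:] ^ \<alpha> i) \<le> degree [:v $ i, u $ i:] * \<alpha> i" by (rule degree_power_le)
      also have "\<dots> \<le> 1 * \<alpha> i" by (intro mult_right_mono) auto
      finally show "(degree \<circ> (\<lambda>i. [:v $ i, u $ i:] ^ \<alpha> i)) i \<le> \<alpha> i" by simp
    qed
    finally show "degree (smult (c \<alpha>) (\<Prod>i\<in>UNIV. [:v $ i, u $ i:] ^ \<alpha> i)) \<le> k"
      using \<alpha> degree_smult_le[of "c \<alpha>" "\<Prod>i\<in>UNIV. [:v $ i, u $ i:] ^ \<alpha> i"] by simp
  qed (rule finite_multi_indices)
  moreover have "p (v + s *\<^sub>R u) = poly g s" for s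
    unfolding c g_def by (simp add: poly_sum poly_prod monomial_fun_def mult.commute)
  ultimately show "\<exists>g :: real poly. degree g \<le> k \<and> (\<forall>s. p (v + s *\<^sub>R u) = poly g s)" by blast
qed

lemma continuous_on_monomial: "continuous_on A (monomial_fun \<alpha>)"
  unfolding monomial_fun_def by (intro continuous_intros)

lemma continuous_on_real_polys: "p \<in> real_polys k \<Longrightarrow> continuous_on A p"
  unfolding real_polys_def monomial_fun_def by (auto intro!: continuous_intros)

definition annihilates :: "nat \<Rightarrow> (real^'n::finite) set \<Rightarrow> (real^'n \<Rightarrow> complex) \<Rightarrow> bool" where
  "annihilates m V \<tau> \<longleftrightarrow> (\<forall>\<alpha>. sum \<alpha> UNIV < m \<longrightarrow> (\<Sum>v\<in>V. \<tau> v * of_real (monomial_fun \<alpha> v)) = 0)"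

lemma annihilates_real_polys:
  assumes "annihilates m V \<tau>" "p \<in> real_polys k" "k < m"
  shows "(\<Sum>v\<in>V. \<tau> v * of_real (p v)) = 0"
proof -
  obtain c where c: "p = (\<lambda>x. \<Sum>\<alpha> | sum \<alpha> UNIV \<le> k. c \<alpha> * monomial_fun \<alpha> x)"
    using assms unfolding real_polys_def by blast
  have "(\<Sum>v\<in>V. \<tau> v * of_real (p v)) =
     (\<Sum>v\<in>V. \<Sum>\<alpha> | sum \<alpha> UNIV \<le> k. of_real (c \<alpha>) * (\<tau> v * of_real (monomial_fun \<alpha> v)))"
    by (simp add: c sum_distrib_left algebra_simps)
  also have "\<dots> = (\<Sum>\<alpha> | sum \<alpha> UNIV \<le> k. of_real (c \<alpha>) * (\<Sum>v\<in>V. \<tau> v * of_real (monomial_fun \<alpha> v)))"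
    by (subst sum.swap) (simp add: sum_distrib_left)
  also have "\<dots> = 0" using assms unfolding annihilates_def by (intro sum.neutral) auto
  finally show ?thesis .
qed

lemma annihilates_mono: "annihilates m V \<tau> \<Longrightarrow> l \<le> m \<Longrightarrow> annihilates l V \<tau>"
  unfolding annihilates_def by simp

text \<open>The polynomial part of a spline is invisible to annihilating coefficients; this connects
  the real polynomials used for the weights with the complex space \<open>poly_space\<close>.\<close>

lemma annihilates_poly_space:
  assumes "annihilates m V \<tau>" "p \<in> poly_space (m - 1)" "m > 0"
  shows "(\<Sum>v\<in>V. \<tau> v * p v) = 0"
proof -
  obtain c where c: "p = (\<lambda>x. \<Sum>\<alpha> | sum \<alpha> UNIV \<le> m - 1. c \<alpha> * of_real (monomial_fun \<alpha> x))"
    using assms unfolding poly_space_def by blast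
  have "(\<Sum>v\<in>V. \<tau> v * p v) =
     (\<Sum>v\<in>V. \<Sum>\<alpha> | sum \<alpha> UNIV \<le> m - 1. c \<alpha> * (\<tau> v * of_real (monomial_fun \<alpha> v)))"
    by (simp add: c sum_distrib_left algebra_simps)
  also have "\<dots> = (\<Sum>\<alpha> | sum \<alpha> UNIV \<le> m - 1. c \<alpha> * (\<Sum>v\<in>V. \<tau> v * of_real (monomial_fun \<alpha> v)))"
    by (subst sum.swap) (simp add: sum_distrib_left)
  also have "\<dots> = 0" using assms unfolding annihilates_def by (intro sum.neutral) auto
  finally show ?thesis .
qed

lemma monomial_in_poly_space:
  assumes "sum \<alpha> UNIV \<le> k" shows "(\<lambda>x. of_real (monomial_fun \<alpha> x)) \<in> poly_space k"
proof -
  have "complex_of_real (monomial_fun \<alpha> x) =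
      (\<Sum>\<beta> | sum \<beta> UNIV \<le> k. (if \<beta> = \<alpha> then 1 else 0) * of_real (monomial_fun \<beta> x))" for x
    using assms by (simp add: finite_multi_indices if_distrib[of "\<lambda>c. c * _"] sum.delta cong: if_cong)
  hence "(\<lambda>x. complex_of_real (monomial_fun \<alpha> x)) =
      (\<lambda>x. \<Sum>\<beta> | sum \<beta> UNIV \<le> k. (if \<beta> = \<alpha> then 1 else 0) * of_real (monomial_fun \<beta> x))"
    by blast
  thus ?thesis unfolding poly_space_def by (intro CollectI exI)
qed

section \<open>Quadratic forms of Gaussian kernels\<close>

lemma power_over_fact_le_exp: "y \<ge> 0 \<Longrightarrow> y ^ k / fact k \<le> exp (y :: real)"
  using sum_le_suminf[OF summable_exp_generic[of y], of "{k}"]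
  by (simp add: exp_def divide_inverse mult.commute)

text \<open>Fubini's theorem for products of functions of one variable, transported from functions
  on the set of basis vectors to coordinates.\<close>

lemma lborel_prod_vec:
  fixes f :: "'n::finite \<Rightarrow> real \<Rightarrow> complex"
  assumes int: "\<And>i. integrable lborel (f i)"
  shows "integrable lborel (\<lambda>x :: real^'n. \<Prod>i\<in>UNIV. f i (x $ i))"
    and "(LINT x|lborel. (\<Prod>i\<in>UNIV. f i ((x :: real^'n) $ i))) = (\<Prod>i\<in>UNIV. LINT x|lborel. f i x)"
proof -
  interpret product_sigma_finite "\<lambda>_ :: real^'n. lborel :: real measure" ..
  define ix :: "real^'n \<Rightarrow> 'n" where "ix b = (THE i. b = axis i 1)" for b
  have ix: "ix (axis i 1) = i" for i
    unfolding ix_def by (rule the_equality) (auto simp: axis_eq_axis)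
  have Basis: "(Basis :: (real^'n) set) = range (\<lambda>i. axis i 1)"
    by (auto simp: Basis_vec_def)
  have inj: "inj (\<lambda>i :: 'n. axis i 1 :: real^'n)" by (rule injI) (simp add: axis_eq_axis)
  define F where "F b = f (ix b)" for b :: "real^'n"
  define T where "T w = (\<Sum>b\<in>Basis. w b *\<^sub>R b)" for w :: "real^'n \<Rightarrow> real"
  have Tn: "T w $ i = w (axis i 1)" for w i
  proof -
    have "T w = (\<Sum>j\<in>UNIV. w (axis j 1) *\<^sub>R axis j 1)" unfolding T_def Basis
      by (subst sum.reindex[OF inj]) simp
    hence "T w $ i = (\<Sum>j\<in>UNIV. if j = i then w (axis i 1) else 0)"
      by (simp add: axis_def if_distrib cong: if_cong)
    thus ?thesis by simp
  qed
  have gT: "(\<Prod>i\<in>UNIV. f i (T w $ i)) = (\<Prod>b\<in>Basis. F b (w b))" for w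
    unfolding Basis by (subst prod.reindex[OF inj]) (simp add: F_def ix Tn)
  define PM where "PM = Pi\<^sub>M (Basis :: (real^'n) set) (\<lambda>b. lborel :: real measure)"
  have lb: "lborel = distr (Pi\<^sub>M (Basis :: (real^'n) set) (\<lambda>b. lborel)) borel T"
    unfolding T_def by (rule lborel_eq)
  have Tm: "T \<in> measurable (Pi\<^sub>M (Basis :: (real^'n) set) (\<lambda>b. lborel)) borel"
    unfolding T_def by measurable
  have fm[measurable]: "f i \<in> borel_measurable borel" for i using int[of i] by auto
  have gm: "(\<lambda>x :: real^'n. \<Prod>i\<in>UNIV. f i (x $ i)) \<in> borel_measurable borel" by measurable
  have i1: "integrable (Pi\<^sub>M (Basis :: (real^'n) set) (\<lambda>b. lborel)) (\<lambda>w. \<Prod>b\<in>Basis. F b (w b))"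
    by (rule product_integrable_prod) (auto simp: F_def int)
  show "integrable lborel (\<lambda>x :: real^'n. \<Prod>i\<in>UNIV. f i (x $ i))"
    by (subst lb, subst integrable_distr_eq[OF Tm gm]) (simp add: gT i1)
  have "(LINT x|lborel. (\<Prod>i\<in>UNIV. f i ((x :: real^'n) $ i))) =
      integral\<^sup>L PM (\<lambda>w. \<Prod>b\<in>Basis. F b (w b))"
    by (subst lb, subst integral_distr[OF Tm gm]) (simp add: gT PM_def)
  also have "\<dots> = (\<Prod>b\<in>Basis. LINT x|lborel. F b x)"
    unfolding PM_def by (rule product_integral_prod) (auto simp: F_def int)
  also have "\<dots> = (\<Prod>i\<in>UNIV. LINT x|lborel. f i x)"
    unfolding Basis by (subst prod.reindex[OF inj]) (simp add: F_def ix)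
  finally show "(LINT x|lborel. (\<Prod>i\<in>UNIV. f i ((x :: real^'n) $ i))) = (\<Prod>i\<in>UNIV. LINT x|lborel. f i x)" .
qed

lemma gaussian_fourier_real:
  fixes a u :: real
  assumes a: "a > 0"
  shows "integrable lborel (\<lambda>x. of_real (exp (- a * x\<^sup>2)) * iexp (u * x))"
    and "(LINT x|lborel. of_real (exp (- a * x\<^sup>2)) * iexp (u * x)) =
      complex_of_real (sqrt (pi / a) * exp (- u\<^sup>2 / (4 * a)))"
proof -
  define c where "c = sqrt (2 * a)"
  have c: "c > 0" "c\<^sup>2 = 2 * a" using a by (auto simp: c_def)
  define t where "t = u / c"
  have nd: "std_normal_density (c * x) = exp (- a * x\<^sup>2) / sqrt (2 * pi)" for x
    using c by (simp add: std_normal_density_def power_mult_distrib)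
  have i1: "integrable lborel (\<lambda>x. std_normal_density x *\<^sub>R iexp (t * x))"
  proof (rule Bochner_Integration.integrable_bound)
    show "integrable lborel std_normal_density" by simp
    show "AE x in lborel. norm (std_normal_density x *\<^sub>R iexp (t * x)) \<le> norm (std_normal_density x)"
      by simp
  qed auto
  have v1: "(LINT x|lborel. std_normal_density x *\<^sub>R iexp (t * x)) = complex_of_real (exp (- t\<^sup>2 / 2))"
  proof -
    have "(LINT x|lborel. std_normal_density x *\<^sub>R iexp (t * x)) = char std_normal_distribution t"
      unfolding char_def by (subst integral_density) auto
    thus ?thesis by (simp add: char_std_normal_distribution)
  qed
  have e: "std_normal_density (0 + c * x) *\<^sub>R iexp (t * (0 + c * x)) =
     of_real (1 / sqrt (2 * pi)) * (of_real (exp (- a * x\<^sup>2)) * iexp (u * x))" for x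
    using c by (simp add: nd[simplified] t_def scaleR_conv_of_real)
  have i2: "integrable lborel (\<lambda>x. of_real (1 / sqrt (2 * pi)) * (of_real (exp (- a * x\<^sup>2)) * iexp (u * x)))"
    unfolding e[symmetric] using c i1 by (intro lborel_integrable_real_affine) auto
  have e2: "of_real (sqrt (2 * pi)) * (of_real (1 / sqrt (2 * pi)) * z) = z" for z :: complex by simp
  have "integrable lborel (\<lambda>x. of_real (sqrt (2 * pi)) *
      (of_real (1 / sqrt (2 * pi)) * (of_real (exp (- a * x\<^sup>2)) * iexp (u * x))))"
    by (intro integrable_mult_right i2)
  thus "integrable lborel (\<lambda>x. of_real (exp (- a * x\<^sup>2)) * iexp (u * x))"
    unfolding e2 .
  have "complex_of_real (exp (- t\<^sup>2 / 2)) = \<bar>c\<bar> *\<^sub>R (LINT x|lborel. std_normal_density (0 + c * x) *\<^sub>R iexp (t * (0 + c * x)))"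
    unfolding v1[symmetric] using c by (intro lborel_integral_real_affine) auto
  also have "\<dots> = of_real (c / sqrt (2 * pi)) * (LINT x|lborel. of_real (exp (- a * x\<^sup>2)) * iexp (u * x))"
    unfolding e using c by (simp add: scaleR_conv_of_real)
  finally have "(LINT x|lborel. of_real (exp (- a * x\<^sup>2)) * iexp (u * x)) =
     of_real (sqrt (2 * pi) / c) * complex_of_real (exp (- t\<^sup>2 / 2))"
    using c by (simp add: field_simps)
  also have "sqrt (2 * pi) / c = sqrt (pi / a)" by (simp add: c_def real_sqrt_divide real_sqrt_mult)
  also have "- t\<^sup>2 / 2 = - u\<^sup>2 / (4 * a)" using c by (simp add: t_def power_divide)
  finally show "(LINT x|lborel. of_real (exp (- a * x\<^sup>2)) * iexp (u * x)) =
      complex_of_real (sqrt (pi / a) * exp (- u\<^sup>2 / (4 * a)))" by simp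
qed

lemma norm_sq_vec: "(norm (x :: real^'n::finite))\<^sup>2 = (\<Sum>i\<in>UNIV. (x $ i)\<^sup>2)"
  unfolding power2_norm_eq_inner by (simp add: inner_vec_def power2_eq_square)

lemma gaussian_fourier:
  fixes u :: "real^'n::finite"
  assumes a: "a > 0"
  shows "integrable lborel (\<lambda>x :: real^'n. of_real (exp (- a * (norm x)\<^sup>2)) * iexp (u \<bullet> x))"
    and "(LINT x|lborel. of_real (exp (- a * (norm (x :: real^'n))\<^sup>2)) * iexp (u \<bullet> x)) =
      complex_of_real (sqrt (pi / a) ^ CARD('n) * exp (- (norm u)\<^sup>2 / (4 * a)))"
proof -
  have eq: "of_real (exp (- a * (norm x)\<^sup>2)) * iexp (u \<bullet> x) =
     (\<Prod>i\<in>UNIV. of_real (exp (- a * (x $ i)\<^sup>2)) * iexp (u $ i * x $ i))" for x :: "real^'n"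
  proof -
    have "(norm x)\<^sup>2 = (\<Sum>i\<in>UNIV. (x $ i)\<^sup>2)" by (rule norm_sq_vec)
    hence "exp (- a * (norm x)\<^sup>2) = (\<Prod>i\<in>UNIV. exp (- a * (x $ i)\<^sup>2))"
      by (simp add: sum_distrib_left exp_sum[symmetric] sum_negf)
    moreover have "iexp (u \<bullet> x) = (\<Prod>i\<in>UNIV. iexp (u $ i * x $ i))"
      by (simp add: inner_vec_def sum_distrib_left exp_sum[symmetric])
    ultimately show ?thesis by (simp add: prod.distrib)
  qed
  show "integrable lborel (\<lambda>x :: real^'n. of_real (exp (- a * (norm x)\<^sup>2)) * iexp (u \<bullet> x))"
    unfolding eq by (rule lborel_prod_vec) (rule gaussian_fourier_real[OF a])
  have "(LINT x|lborel. of_real (exp (- a * (norm (x :: real^'n))\<^sup>2)) * iexp (u \<bullet> x)) =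
    (\<Prod>i\<in>UNIV. complex_of_real (sqrt (pi / a) * exp (- (u $ i)\<^sup>2 / (4 * a))))"
    unfolding eq by (subst lborel_prod_vec(2)) (simp_all only: gaussian_fourier_real[OF a])
  also have "\<dots> = of_real (sqrt (pi / a) ^ CARD('n) * (\<Prod>i\<in>UNIV. exp (- (u $ i)\<^sup>2 / (4 * a))))"
    by (simp add: prod.distrib)
  also have "(\<Prod>i\<in>UNIV. exp (- (u $ i)\<^sup>2 / (4 * a))) = exp (- (norm u)\<^sup>2 / (4 * a))"
    unfolding power2_norm_eq_inner
    by (simp add: inner_vec_def power2_eq_square exp_sum[symmetric] sum_divide_distrib[symmetric] sum_negf)
  finally show "(LINT x|lborel. of_real (exp (- a * (norm (x :: real^'n))\<^sup>2)) * iexp (u \<bullet> x)) =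
      complex_of_real (sqrt (pi / a) ^ CARD('n) * exp (- (norm u)\<^sup>2 / (4 * a)))" .
qed

lemma gaussian_integral:
  assumes a: "a > 0"
  shows "integrable lborel (\<lambda>x :: real^'n::finite. exp (- a * (norm x)\<^sup>2))"
    and "(LINT x|lborel. exp (- a * (norm (x :: real^'n))\<^sup>2)) = sqrt (pi / a) ^ CARD('n)"
proof -
  have "integrable lborel (\<lambda>x :: real^'n. complex_of_real (exp (- a * (norm x)\<^sup>2)))"
    using gaussian_fourier(1)[OF a, of "0 :: real^'n"] by simp
  thus "integrable lborel (\<lambda>x :: real^'n. exp (- a * (norm x)\<^sup>2))"
    using integrable_Re by fastforce
  have "complex_of_real (LINT x|lborel. exp (- a * (norm (x :: real^'n))\<^sup>2)) = of_real (sqrt (pi / a) ^ CARD('n))"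
    using gaussian_fourier(2)[OF a, of "0 :: real^'n"] by simp
  thus "(LINT x|lborel. exp (- a * (norm (x :: real^'n))\<^sup>2)) = sqrt (pi / a) ^ CARD('n)"
    using of_real_eq_iff by blast
qed

definition gauss_form :: "real \<Rightarrow> (real^'n::finite) set \<Rightarrow> (real^'n \<Rightarrow> complex) \<Rightarrow> complex" where
  "gauss_form t V \<tau> = (\<Sum>u\<in>V. \<Sum>v\<in>V. \<tau> u * cnj (\<tau> v) * of_real (exp (- t * (norm (u - v))\<^sup>2)))"

text \<open>A Gaussian is the Fourier transform of a Gaussian, so the form is the integral of a
  squared exponential sum against a Gaussian weight. This yields positivity and reduces upper
  bounds to bounds for exponential sums.\<close>

lemma gauss_form_spectral:
  fixes V :: "(real^'n::finite) set"
  assumes t: "t > 0"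
  shows "integrable lborel (\<lambda>\<xi>. exp (- (norm \<xi>)\<^sup>2 / (4 * t)) * (cmod (\<Sum>u\<in>V. \<tau> u * iexp (u \<bullet> \<xi>)))\<^sup>2)"
    and "gauss_form t V \<tau> = of_real ((LINT \<xi>|lborel. exp (- (norm \<xi>)\<^sup>2 / (4 * t)) *
       (cmod (\<Sum>u\<in>V. \<tau> u * iexp (u \<bullet> \<xi>)))\<^sup>2) / sqrt (4 * pi * t) ^ CARD('n))"
proof -
  define a where "a = 1 / (4 * t)"
  have a: "a > 0" using t by (simp add: a_def)
  define G where "G \<xi> = exp (- a * (norm \<xi>)\<^sup>2) * (cmod (\<Sum>u\<in>V. \<tau> u * iexp (u \<bullet> \<xi>)))\<^sup>2" for \<xi>
  have Geq: "complex_of_real (G \<xi>) =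
     (\<Sum>u\<in>V. \<Sum>v\<in>V. \<tau> u * cnj (\<tau> v) * (of_real (exp (- a * (norm \<xi>)\<^sup>2)) * iexp ((u - v) \<bullet> \<xi>)))" for \<xi>
  proof -
    have "complex_of_real ((cmod (\<Sum>u\<in>V. \<tau> u * iexp (u \<bullet> \<xi>)))\<^sup>2) =
       (\<Sum>u\<in>V. \<tau> u * iexp (u \<bullet> \<xi>)) * cnj (\<Sum>u\<in>V. \<tau> u * iexp (u \<bullet> \<xi>))"
      using complex_norm_square by blast
    also have "\<dots> = (\<Sum>u\<in>V. \<Sum>v\<in>V. \<tau> u * cnj (\<tau> v) * iexp ((u - v) \<bullet> \<xi>))"
    proof -
      have "iexp (u \<bullet> \<xi>) * cnj (iexp (v \<bullet> \<xi>)) = iexp ((u - v) \<bullet> \<xi>)" for u v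
        by (simp add: exp_cnj exp_add[symmetric] inner_diff_left algebra_simps)
      hence "\<tau> u * iexp (u \<bullet> \<xi>) * (cnj (\<tau> v) * cnj (iexp (v \<bullet> \<xi>))) =
          \<tau> u * cnj (\<tau> v) * iexp ((u - v) \<bullet> \<xi>)" for u v
        by (metis mult.assoc mult.left_commute)
      thus ?thesis by (simp only: cnj_sum complex_cnj_mult sum_product)
    qed
    finally show ?thesis unfolding G_def of_real_mult by (simp add: sum_distrib_left mult_ac)
  qed
  have ig: "integrable lborel (\<lambda>\<xi>. complex_of_real (G \<xi>))"
    unfolding Geq by (intro Bochner_Integration.integrable_sum integrable_mult_right gaussian_fourier(1)[OF a]) 
  hence iG: "integrable lborel G" using integrable_Re by fastforce
  thus "integrable lborel (\<lambda>\<xi>. exp (- (norm \<xi>)\<^sup>2 / (4 * t)) * (cmod (\<Sum>u\<in>V. \<tau> u * iexp (u \<bullet> \<xi>)))\<^sup>2)"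
    by (simp add: G_def[abs_def] a_def)
  have pa: "pi / a = 4 * pi * t" by (simp add: a_def)
  have "complex_of_real (LINT \<xi>|lborel. G \<xi>) = (LINT \<xi>|lborel. complex_of_real (G \<xi>))" by simp
  also have "\<dots> = (\<Sum>u\<in>V. \<Sum>v\<in>V. \<tau> u * cnj (\<tau> v) *
      complex_of_real (sqrt (pi / a) ^ CARD('n) * exp (- (norm (u - v))\<^sup>2 / (4 * a))))"
    unfolding Geq
    by (subst Bochner_Integration.integral_sum, intro Bochner_Integration.integrable_sum integrable_mult_right gaussian_fourier(1)[OF a],
        intro sum.cong refl, subst Bochner_Integration.integral_sum, intro integrable_mult_right gaussian_fourier(1)[OF a],
        intro sum.cong refl, subst Bochner_Integration.integral_mult_right_zero, subst gaussian_fourier(2)[OF a], rule refl)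
  also have "\<dots> = of_real (sqrt (4 * pi * t) ^ CARD('n)) * gauss_form t V \<tau>"
    unfolding pa using t by (simp add: gauss_form_def sum_distrib_left a_def mult_ac)
  finally have "complex_of_real (LINT \<xi>|lborel. G \<xi>) = of_real (sqrt (4 * pi * t) ^ CARD('n)) * gauss_form t V \<tau>" .
  moreover have "sqrt (4 * pi * t) ^ CARD('n) \<noteq> 0" using t by simp
  ultimately have "gauss_form t V \<tau> = of_real ((LINT \<xi>|lborel. G \<xi>) / sqrt (4 * pi * t) ^ CARD('n))"
    by (simp add: field_simps)
  thus "gauss_form t V \<tau> = of_real ((LINT \<xi>|lborel. exp (- (norm \<xi>)\<^sup>2 / (4 * t)) *
       (cmod (\<Sum>u\<in>V. \<tau> u * iexp (u \<bullet> \<xi>)))\<^sup>2) / sqrt (4 * pi * t) ^ CARD('n))"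
    by (simp add: G_def a_def)
qed

lemma gauss_form_nonneg:
  assumes "t > 0" shows "gauss_form t V \<tau> = of_real (Re (gauss_form t V \<tau>))" "0 \<le> Re (gauss_form t V \<tau>)"
  unfolding gauss_form_spectral(2)[OF assms]
  using assms by (auto intro!: divide_nonneg_nonneg integral_nonneg_AE)

text \<open>The Taylor polynomial of \<open>iexp ((v - x) \<bullet> \<xi>)\<close> of degree \<open>k - 1\<close> is a polynomial in \<open>v\<close>
  and is annihilated, so only the remainder contributes.\<close>

lemma exp_sum_bound:
  fixes V :: "(real^'n::finite) set"
  assumes ann: "annihilates k V \<tau>" and k: "k \<ge> 1"
  shows "cmod (\<Sum>v\<in>V. \<tau> v * iexp (v \<bullet> \<xi>)) \<le> (\<Sum>v\<in>V. cmod (\<tau> v) * norm (v - x) ^ k) * norm \<xi> ^ k / fact k"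
proof -
  define R where "R v = iexp ((v - x) \<bullet> \<xi>) - (\<Sum>j\<le>k - 1. (\<i> * of_real ((v - x) \<bullet> \<xi>)) ^ j / fact j)" for v
  have R: "cmod (R v) \<le> norm (v - x) ^ k * norm \<xi> ^ k / fact k" for v
  proof -
    have "cmod (R v) \<le> \<bar>(v - x) \<bullet> \<xi>\<bar> ^ Suc (k - 1) / fact (Suc (k - 1))"
      unfolding R_def by (rule iexp_approx1)
    also have "Suc (k - 1) = k" using k by simp
    also have "\<bar>(v - x) \<bullet> \<xi>\<bar> ^ k \<le> (norm (v - x) * norm \<xi>) ^ k"
      by (intro power_mono Cauchy_Schwarz_ineq2) auto
    finally show ?thesis by (simp add: power_mult_distrib divide_right_mono)
  qed
  have zero: "(\<Sum>v\<in>V. \<tau> v * (\<Sum>j\<le>k - 1. (\<i> * of_real ((v - x) \<bullet> \<xi>)) ^ j / fact j)) = 0"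
  proof -
    have "(\<Sum>v\<in>V. \<tau> v * (\<Sum>j\<le>k - 1. (\<i> * of_real ((v - x) \<bullet> \<xi>)) ^ j / fact j)) =
      (\<Sum>j\<le>k - 1. \<i> ^ j / fact j * (\<Sum>v\<in>V. \<tau> v * of_real (((v - x) \<bullet> \<xi>) ^ j)))"
      by (simp add: sum_distrib_left power_mult_distrib mult_ac, subst sum.swap, rule refl)
    also have "\<dots> = 0"
    proof (intro sum.neutral ballI)
      fix j assume j: "j \<in> {..k - 1}"
      have "(\<lambda>v. v \<bullet> \<xi> + (- (x \<bullet> \<xi>))) \<in> real_polys 1"
        by (intro real_polys_add real_polys_inner real_polys_const)
      hence "(\<lambda>v. ((v - x) \<bullet> \<xi>) ^ j) \<in> real_polys (1 * j)"
        by (intro real_polys_power) (simp add: inner_diff_left)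
      hence "(\<Sum>v\<in>V. \<tau> v * of_real (((v - x) \<bullet> \<xi>) ^ j)) = 0"
        by (rule annihilates_real_polys[OF ann]) (use j k in auto)
      thus "\<i> ^ j / fact j * (\<Sum>v\<in>V. \<tau> v * of_real (((v - x) \<bullet> \<xi>) ^ j)) = 0" by simp
    qed
    finally show ?thesis .
  qed
  have "(\<Sum>v\<in>V. \<tau> v * iexp (v \<bullet> \<xi>)) = iexp (x \<bullet> \<xi>) * (\<Sum>v\<in>V. \<tau> v * iexp ((v - x) \<bullet> \<xi>))"
  proof -
    have "\<tau> v * iexp (v \<bullet> \<xi>) = iexp (x \<bullet> \<xi>) * (\<tau> v * iexp ((v - x) \<bullet> \<xi>))" for v
      by (simp add: exp_add[symmetric] inner_diff_left algebra_simps)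
    thus ?thesis by (simp only: sum_distrib_left)
  qed
  also have "(\<Sum>v\<in>V. \<tau> v * iexp ((v - x) \<bullet> \<xi>)) = (\<Sum>v\<in>V. \<tau> v * R v)"
    unfolding R_def right_diff_distrib sum_subtractf zero by simp
  finally have "cmod (\<Sum>v\<in>V. \<tau> v * iexp (v \<bullet> \<xi>)) = cmod (\<Sum>v\<in>V. \<tau> v * R v)"
    by (simp add: norm_mult)
  also have "\<dots> \<le> (\<Sum>v\<in>V. cmod (\<tau> v) * (norm (v - x) ^ k * norm \<xi> ^ k / fact k))"
    by (intro order.trans[OF norm_sum] sum_mono) (simp only: norm_mult R mult_left_mono norm_ge_zero)
  also have "\<dots> = (\<Sum>v\<in>V. cmod (\<tau> v) * norm (v - x) ^ k) * norm \<xi> ^ k / fact k"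
    by (simp add: sum_distrib_right sum_divide_distrib mult.assoc)
  finally show ?thesis .
qed

lemma gauss_form_bound:
  fixes V :: "(real^'n::finite) set"
  assumes ann: "annihilates k V \<tau>" and k: "k \<ge> 1" and t: "t > 0"
    and W: "(\<Sum>v\<in>V. cmod (\<tau> v) * norm (v - x) ^ k) \<le> W"
  shows "Re (gauss_form t V \<tau>) \<le> W\<^sup>2 / fact k * (8 * t) ^ k * sqrt 2 ^ CARD('n)"
proof -
  \<comment> \<open>half of the exponent \<open>1 / (4 * t)\<close> pays for the factor \<open>norm \<xi> ^ (2 * k)\<close>, the other half
    remains for the integral\<close>
  define a where "a = 1 / (8 * t)"
  have a: "a > 0" using t by (simp add: a_def)
  have W0: "W \<ge> 0" using W by (rule order.trans[rotated]) (intro sum_nonneg, simp)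
  have pw: "norm \<xi> ^ (2 * k) \<le> fact k * (8 * t) ^ k * exp (a * (norm \<xi>)\<^sup>2)" for \<xi> :: "real^'n"
  proof -
    have "(a * (norm \<xi>)\<^sup>2) ^ k / fact k \<le> exp (a * (norm \<xi>)\<^sup>2)"
      using a by (intro power_over_fact_le_exp) auto
    hence "(a * (norm \<xi>)\<^sup>2) ^ k \<le> fact k * exp (a * (norm \<xi>)\<^sup>2)" by (simp add: field_simps)
    hence "(8 * t) ^ k * (a * (norm \<xi>)\<^sup>2) ^ k \<le> (8 * t) ^ k * (fact k * exp (a * (norm \<xi>)\<^sup>2))"
      using t by (intro mult_left_mono) auto
    moreover have "(8 * t) * (a * (norm \<xi>)\<^sup>2) = (norm \<xi>)\<^sup>2" using t by (simp add: a_def)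
    hence "(8 * t) ^ k * (a * (norm \<xi>)\<^sup>2) ^ k = norm \<xi> ^ (2 * k)"
      by (simp only: power_mult power_mult_distrib[symmetric])
    ultimately show ?thesis by (simp only: mult_ac)
  qed
  have "(LINT \<xi>|lborel. exp (- (norm \<xi>)\<^sup>2 / (4 * t)) * (cmod (\<Sum>u\<in>V. \<tau> u * iexp (u \<bullet> \<xi>)))\<^sup>2)
      \<le> (LINT \<xi>|lborel. W\<^sup>2 / fact k * (8 * t) ^ k * exp (- a * (norm (\<xi> :: real^'n))\<^sup>2))"
  proof (rule integral_mono)
    show "integrable lborel (\<lambda>\<xi>. exp (- (norm \<xi>)\<^sup>2 / (4 * t)) * (cmod (\<Sum>u\<in>V. \<tau> u * iexp (u \<bullet> \<xi>)))\<^sup>2)"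
      by (rule gauss_form_spectral(1)[OF t])
    show "integrable lborel (\<lambda>\<xi> :: real^'n. W\<^sup>2 / fact k * (8 * t) ^ k * exp (- a * (norm \<xi>)\<^sup>2))"
      by (intro integrable_mult_right gaussian_integral(1)[OF a])
    fix \<xi> :: "real^'n"
    have "cmod (\<Sum>u\<in>V. \<tau> u * iexp (u \<bullet> \<xi>)) \<le> W * norm \<xi> ^ k / fact k"
      by (rule order.trans[OF exp_sum_bound[OF ann k, of _ x]])
         (intro divide_right_mono mult_right_mono W, auto)
    hence "(cmod (\<Sum>u\<in>V. \<tau> u * iexp (u \<bullet> \<xi>)))\<^sup>2 \<le> (W * norm \<xi> ^ k / fact k)\<^sup>2"
      by (intro power_mono) auto
    also have "\<dots> = W\<^sup>2 / (fact k)\<^sup>2 * norm \<xi> ^ (2 * k)"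
      unfolding power_divide power_mult_distrib power_mult[symmetric] mult.commute[of k 2] by simp
    also have "\<dots> \<le> W\<^sup>2 / (fact k)\<^sup>2 * (fact k * (8 * t) ^ k * exp (a * (norm \<xi>)\<^sup>2))"
      using pw by (intro mult_left_mono) auto
    also have "\<dots> = W\<^sup>2 / fact k * (8 * t) ^ k * exp (a * (norm \<xi>)\<^sup>2)"
      by (simp add: power2_eq_square)
    finally have "exp (- (norm \<xi>)\<^sup>2 / (4 * t)) * (cmod (\<Sum>u\<in>V. \<tau> u * iexp (u \<bullet> \<xi>)))\<^sup>2 \<le>
       exp (- (norm \<xi>)\<^sup>2 / (4 * t)) * (W\<^sup>2 / fact k * (8 * t) ^ k * exp (a * (norm \<xi>)\<^sup>2))"
      by (intro mult_left_mono) auto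
    also have "\<dots> = W\<^sup>2 / fact k * (8 * t) ^ k * (exp (- (norm \<xi>)\<^sup>2 / (4 * t)) * exp (a * (norm \<xi>)\<^sup>2))"
      by (simp only: mult_ac)
    also have "exp (- (norm \<xi>)\<^sup>2 / (4 * t)) * exp (a * (norm \<xi>)\<^sup>2) = exp (- a * (norm \<xi>)\<^sup>2)"
      unfolding exp_add[symmetric] using t by (intro arg_cong[where f=exp]) (simp add: a_def field_simps)
    finally show "exp (- (norm \<xi>)\<^sup>2 / (4 * t)) * (cmod (\<Sum>u\<in>V. \<tau> u * iexp (u \<bullet> \<xi>)))\<^sup>2 \<le>
      W\<^sup>2 / fact k * (8 * t) ^ k * exp (- a * (norm \<xi>)\<^sup>2)" .
  qed
  also have "\<dots> = W\<^sup>2 / fact k * (8 * t) ^ k * sqrt (pi / a) ^ CARD('n)"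
    by (subst Bochner_Integration.integral_mult_right_zero, subst gaussian_integral(2)[OF a]) (rule refl)
  finally have "Re (gauss_form t V \<tau>) \<le> W\<^sup>2 / fact k * (8 * t) ^ k * sqrt (pi / a) ^ CARD('n) / sqrt (4 * pi * t) ^ CARD('n)"
    unfolding gauss_form_spectral(2)[OF t] Re_complex_of_real by (intro divide_right_mono) (use t in auto)
  also have "\<dots> = W\<^sup>2 / fact k * (8 * t) ^ k * (sqrt (pi / a) / sqrt (4 * pi * t)) ^ CARD('n)"
    by (simp add: power_divide)
  also have "sqrt (pi / a) / sqrt (4 * pi * t) = sqrt 2"
    unfolding real_sqrt_divide[symmetric] using t by (simp add: a_def)
  finally show ?thesis .
qed

section \<open>The shifted surface spline as a mixture of Gaussians\<close>

lemma power_exp_integral: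
  assumes l: "l > (0::real)"
  shows "set_integrable lborel {0..} (\<lambda>t. t ^ k * exp (- l * t))"
    and "(LINT t:{0..}|lborel. t ^ k * exp (- l * t)) = fact k / l ^ Suc k" (is ?thesis2)
proof -
  interpret prob_space "density lborel (erlang_density k l)" by (rule prob_space_erlang_density[OF l])
  have nn: "(\<integral>\<^sup>+ x. ennreal (erlang_density k l x) \<partial>lborel) = 1"
    using emeasure_space_1 by (simp add: emeasure_density)
  have e: "erlang_density k l = (\<lambda>t. l ^ Suc k / fact k * (indicator {0..} t *\<^sub>R (t ^ k * exp (- l * t))))"
    by (auto simp: erlang_density_def fun_eq_iff)
  have i: "integrable lborel (erlang_density k l)"
    using nn l by (intro integrableI_nonneg) (auto simp: erlang_density_nonneg)
  have v: "integral\<^sup>L lborel (erlang_density k l) = 1"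
    using nn l by (subst integral_eq_nn_integral) (auto simp: erlang_density_nonneg)
  have ne: "l ^ Suc k / fact k \<noteq> 0" using l by simp
  show "set_integrable lborel {0..} (\<lambda>t. t ^ k * exp (- l * t))"
    using i ne unfolding e set_integrable_def by (subst (asm) integrable_mult_left_iff) simp
  have "l ^ Suc k / fact k * (LINT t:{0..}|lborel. t ^ k * exp (- l * t)) = 1"
    using v unfolding e set_lebesgue_integral_def by (subst (asm) Bochner_Integration.integral_mult_right_zero)
  thus ?thesis2
  proof -
    define I where "I = (LINT t:{0..}|lborel. t ^ k * exp (- l * t))"
    assume "l ^ Suc k / fact k * (LINT t:{0..}|lborel. t ^ k * exp (- l * t)) = 1"
    hence a: "l ^ Suc k / fact k * I = 1" by (simp only: I_def)
    have "I = fact k / l ^ Suc k * (l ^ Suc k / fact k * I)" using l by simp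
    thus ?thesis2 unfolding a by (simp add: I_def)
  qed
qed

lemma set_integrable_exp_over_power:
  assumes "e > 0" "s > (0::real)"
  shows "set_integrable lborel {e..} (\<lambda>t. exp (- s * t) / t ^ k)"
proof (rule set_integrable_bound)
  have "set_integrable lborel {0..} (\<lambda>t. exp (- s * t))"
    using power_exp_integral(1)[OF assms(2), of 0] by simp
  hence "set_integrable lborel {e..} (\<lambda>t. exp (- s * t))"
    by (rule set_integrable_subset) (use assms in auto)
  thus "set_integrable lborel {e..} (\<lambda>t. 1 / e ^ k * exp (- s * t))" by simp
  show "set_borel_measurable lborel {e..} (\<lambda>t. exp (- s * t) / t ^ k)"
    unfolding set_borel_measurable_def by measurable
  show "AE t in lborel. t \<in> {e..} \<longrightarrow> norm (exp (- s * t) / t ^ k) \<le> norm (1 / e ^ k * exp (- s * t))"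
  proof (rule AE_I2, rule impI)
    fix t assume "t \<in> {e..}"
    hence t: "t \<ge> e" "t > 0" using assms by auto
    hence "exp (- s * t) / t ^ k \<le> exp (- s * t) / e ^ k"
      using assms by (intro divide_left_mono power_mono) auto
    thus "norm (exp (- s * t) / t ^ k) \<le> norm (1 / e ^ k * exp (- s * t))" using t assms by simp
  qed
qed

text \<open>For \<open>s = 1\<close> this is the upper incomplete Gamma function of order \<open>- L\<close> at \<open>e\<close>.\<close>

definition gamma_tail :: "nat \<Rightarrow> real \<Rightarrow> real \<Rightarrow> real" where
  "gamma_tail L e s = (LINT t:{e..}|lborel. exp (- s * t) / t ^ Suc L)"

lemma gamma_tail_scale:
  assumes "e > 0" "s > 0"
  shows "gamma_tail L e s = s ^ L * gamma_tail L (s * e) 1"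
proof -
  have "gamma_tail L (s * e) 1 = \<bar>s\<bar> *\<^sub>R (LINT t|lborel. indicator {s * e..} (0 + s * t) *\<^sub>R (exp (- 1 * (0 + s * t)) / (0 + s * t) ^ Suc L))"
    unfolding gamma_tail_def set_lebesgue_integral_def
    by (rule lborel_integral_real_affine) (use assms in auto)
  also have "(\<lambda>t. indicator {s * e..} (0 + s * t) *\<^sub>R (exp (- 1 * (0 + s * t)) / (0 + s * t) ^ Suc L)) =
     (\<lambda>t. 1 / s ^ Suc L * (indicator {e..} t *\<^sub>R (exp (- s * t) / t ^ Suc L)))"
    using assms by (auto simp: fun_eq_iff indicator_def power_mult_distrib)
  also have "\<bar>s\<bar> *\<^sub>R (LINT t|lborel. 1 / s ^ Suc L * (indicator {e..} t *\<^sub>R (exp (- s * t) / t ^ Suc L))) =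
     1 / s ^ L * gamma_tail L e s"
    unfolding gamma_tail_def set_lebesgue_integral_def
    by (subst Bochner_Integration.integral_mult_right_zero) (use assms in simp)
  finally show ?thesis using assms by simp
qed

lemma exp_minus_taylor_bound:
  assumes u: "u > (0::real)"
  shows "\<bar>exp (- u) - (\<Sum>j\<le>L. (- u) ^ j / fact j)\<bar> \<le> u ^ Suc L"
proof -
  have "\<exists>t>0. t < u \<and> exp (- u) = (\<Sum>m<Suc L. (-1) ^ m * exp (- 0) / fact m * u ^ m) + (-1) ^ Suc L * exp (- t) / fact (Suc L) * u ^ Suc L"
    by (rule Maclaurin[where diff="\<lambda>m x. (-1) ^ m * exp (- x)"])
       (use u in \<open>auto intro!: derivative_eq_intros\<close>)
  then obtain t where t: "t > 0" "exp (- u) = (\<Sum>m<Suc L. (-1) ^ m * exp (- 0) / fact m * u ^ m) + (-1) ^ Suc L * exp (- t) / fact (Suc L) * u ^ Suc L"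
    by blast
  have "(\<Sum>m<Suc L. (-1) ^ m * exp (- 0) / fact m * u ^ m) = (\<Sum>j\<le>L. (- u) ^ j / fact j)"
    unfolding lessThan_Suc_atMost by (intro sum.cong refl) (subst power_minus, simp)
  hence "\<bar>exp (- u) - (\<Sum>j\<le>L. (- u) ^ j / fact j)\<bar> = exp (- t) / fact (Suc L) * u ^ Suc L"
    using t u by (simp add: abs_mult)
  also have "\<dots> \<le> 1 * u ^ Suc L"
  proof (rule mult_right_mono)
    have "exp (- t) / fact (Suc L) \<le> exp (- t) / 1"
      by (intro divide_left_mono) (auto simp: fact_ge_1 simp del: fact_Suc)
    also have "\<dots> \<le> 1" using t by simp
    finally show "exp (- t) / fact (Suc L) \<le> 1" .
  qed (use u in auto)
  finally show ?thesis by simp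
qed

text \<open>The primitive of the singular part \<open>(\<Sum>j\<le>L. (- x) ^ j / fact j) / x ^ Suc L\<close> of
  \<open>exp (- x) / x ^ Suc L\<close>; the term \<open>j = L\<close> produces the logarithm.\<close>

definition tail_primitive :: "nat \<Rightarrow> real \<Rightarrow> real" where
  "tail_primitive L x = (- 1) ^ L / fact L * ln x - (\<Sum>j<L. (- 1) ^ j / (fact j * real (L - j)) / x ^ (L - j))"

lemma tail_primitive_deriv:
  assumes x: "x > 0"
  shows "(tail_primitive L has_real_derivative (\<Sum>j\<le>L. (- x) ^ j / fact j) / x ^ Suc L) (at x)"
proof -
  have d: "((\<lambda>x. (- 1) ^ j / (fact j * real (L - j)) / x ^ (L - j)) has_real_derivative
      - ((- x) ^ j / fact j / x ^ Suc L)) (at x)" if j: "j < L" for j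
  proof -
    define i where "i = L - j"
    have i: "i > 0" "L = i + j" using j by (auto simp: i_def)
    have "((\<lambda>x. (- 1) ^ j / (fact j * real i) / x ^ i) has_real_derivative
      (0 * x ^ i - (- 1) ^ j / (fact j * real i) * (real i * x ^ (i - Suc 0))) / (x ^ i * x ^ i)) (at x)"
      using x by (auto intro!: derivative_eq_intros)
    moreover have "(0 * x ^ i - (- 1) ^ j / (fact j * real i) * (real i * x ^ (i - Suc 0))) / (x ^ i * x ^ i) =
       - ((- x) ^ j / fact j / x ^ Suc L)"
    proof -
      have "x ^ i = x * x ^ (i - Suc 0)" using i by (metis Suc_pred One_nat_def power_Suc)
      moreover have "x ^ Suc L = x * x ^ i * x ^ j" using i by (simp add: power_add)
      moreover have "(- x) ^ j = (- 1) ^ j * x ^ j" by (rule power_minus)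
      ultimately show ?thesis using x i by (simp add: field_simps)
    qed
    ultimately show ?thesis unfolding i_def by simp
  qed
  have "(tail_primitive L has_real_derivative (- 1) ^ L / fact L * (1 / x) - (\<Sum>j<L. - ((- x) ^ j / fact j / x ^ Suc L))) (at x)"
    unfolding tail_primitive_def[abs_def]
    by (intro DERIV_diff DERIV_sum d DERIV_cmult) (use x in \<open>auto intro!: derivative_eq_intros\<close>)
  moreover have "(- 1) ^ L / fact L * (1 / x) = (- x) ^ L / fact L / x ^ Suc L"
    using x by (simp add: power_minus[of x])
  moreover have "{..L} = insert L {..<L}" by auto
  ultimately show ?thesis
    by (simp add: sum_negf sum_divide_distrib add_divide_distrib)
qed

text \<open>Adding the primitive cancels the singularity at \<open>0\<close>: the derivative of the sum is a
  Taylor remainder of \<open>exp (- x)\<close> divided by \<open>x ^ Suc L\<close>, which is bounded by \<open>1\<close>.\<close>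

lemma gamma_tail_increment:
  assumes x: "0 < x" "x \<le> y"
  shows "\<bar>(gamma_tail L x 1 + tail_primitive L x) - (gamma_tail L y 1 + tail_primitive L y)\<bar> \<le> y - x"
proof -
  define f where "f t = exp (- 1 * t) / t ^ Suc L" for t :: real
  define g where "g t = (\<Sum>j\<le>L. (- t) ^ j / fact j) / t ^ Suc L" for t :: real
  have ix: "set_integrable lborel {x..} f" unfolding f_def using x by (intro set_integrable_exp_over_power) auto
  have iy: "set_integrable lborel {y..} f" unfolding f_def using x by (intro set_integrable_exp_over_power) auto
  have ixy: "set_integrable lborel {x..<y} f" by (rule set_integrable_subset[OF ix]) auto
  have ixy': "set_integrable lborel {x..y} f" by (rule set_integrable_subset[OF ix]) auto
  have dis: "{x..<y} \<inter> {y..} = {}" by auto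
  have "{x..} = {x..<y} \<union> {y..}" using x by auto
  hence "gamma_tail L x 1 = (LINT t:{x..<y}|lborel. f t) + gamma_tail L y 1"
    unfolding gamma_tail_def f_def[symmetric]
    using set_integral_Un[OF dis ixy iy] by simp
  moreover have "(LINT t:{x..<y}|lborel. f t) = (LINT t:{x..y}|lborel. f t)"
    unfolding set_lebesgue_integral_def
  proof (rule integral_cong_AE)
    have fm: "f \<in> borel_measurable borel" unfolding f_def by measurable
    show "(\<lambda>t. indicat_real {x..<y} t *\<^sub>R f t) \<in> borel_measurable lborel" "(\<lambda>t. indicat_real {x..y} t *\<^sub>R f t) \<in> borel_measurable lborel"
      using fm by measurable
    show "AE t in lborel. indicat_real {x..<y} t *\<^sub>R f t = indicat_real {x..y} t *\<^sub>R f t"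
      using AE_lborel_singleton[of y] by eventually_elim (auto simp: indicator_def)
  qed
  moreover have gc: "continuous_on {x..y} g" unfolding g_def using x by (intro continuous_intros) auto
  have gi: "set_integrable lborel {x..y} g"
    by (rule borel_integrable_atLeastAtMost'[OF gc])
  have "(LINT t:{x..y}|lborel. g t) = tail_primitive L y - tail_primitive L x"
    unfolding set_lebesgue_integral_def
  proof (rule integral_FTC_Icc[OF x(2) _ gc])
    fix t assume "x \<le> t" "t \<le> y"
    hence "t > 0" using x by linarith
    from tail_primitive_deriv[OF this] have "(tail_primitive L has_real_derivative g t) (at t within {x..y})"
      unfolding g_def by (rule has_field_derivative_at_within)
    thus "(tail_primitive L has_vector_derivative g t) (at t within {x..y})"
      by (rule has_real_derivative_iff_has_vector_derivative[THEN iffD1])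
  qed
  ultimately have "(gamma_tail L x 1 + tail_primitive L x) - (gamma_tail L y 1 + tail_primitive L y) =
      (LINT t:{x..y}|lborel. f t) - (LINT t:{x..y}|lborel. g t)" by simp
  also have "\<dots> = (LINT t:{x..y}|lborel. f t - g t)" using ixy' gi by simp
  also have "\<bar>\<dots>\<bar> \<le> (LINT t:{x..y}|lborel. 1)"
  proof -
    have "norm (LINT t:{x..y}|lborel. f t - g t) \<le> (LINT t:{x..y}|lborel. norm (f t - g t))"
      by (rule set_integral_norm_bound) (use ixy' gi in auto)
    also have "\<dots> \<le> (LINT t:{x..y}|lborel. 1)"
    proof (rule set_integral_mono)
      show "set_integrable lborel {x..y} (\<lambda>t. norm (f t - g t))"
        by (rule set_integrable_norm) (use ixy' gi in auto)
      show "set_integrable lborel {x..y} (\<lambda>t. 1 :: real)"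
        by (intro borel_integrable_atLeastAtMost' continuous_intros)
      fix t assume "t \<in> {x..y}"
      hence t: "t > 0" using x by auto
      have "f t - g t = (exp (- t) - (\<Sum>j\<le>L. (- t) ^ j / fact j)) / t ^ Suc L"
        by (simp add: f_def g_def diff_divide_distrib)
      hence "\<bar>f t - g t\<bar> = \<bar>exp (- t) - (\<Sum>j\<le>L. (- t) ^ j / fact j)\<bar> / t ^ Suc L"
        using t by (simp add: abs_divide abs_mult)
      also have "\<dots> \<le> t ^ Suc L / t ^ Suc L"
        using exp_minus_taylor_bound[OF t, of L] t by (intro divide_right_mono) auto
      finally show "norm (f t - g t) \<le> 1" using t by simp
    qed
    finally show ?thesis by simp
  qed
  also have "(LINT t:{x..y}|lborel. 1) = y - x" using x by (simp add: set_lebesgue_integral_def)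
  finally show ?thesis .
qed

text \<open>By scaling, the claim concerns \<open>s ^ L * gamma_tail L (s * e) 1\<close>. There the singular
  terms of \<open>tail_primitive\<close> become monomials in \<open>s\<close> and the logarithm, and the Lipschitz
  function of \<open>gamma_tail_increment\<close> is constant up to \<open>O(e)\<close>.\<close>

lemma gamma_tail_expansion:
  assumes e: "e > 0"
  obtains \<kappa> where "\<And>s. s > 0 \<Longrightarrow>
    \<bar>gamma_tail L e s - (\<Sum>j\<le>L. \<kappa> j * s ^ j) + (- 1) ^ L / fact L * s ^ L * ln s\<bar> \<le> e * s ^ L * (s + 1)"
proof -
  define J where "J x = gamma_tail L x 1 + tail_primitive L x" for x
  define \<kappa> where "\<kappa> j = (if j < L then (- 1) ^ j / (fact j * real (L - j)) / e ^ (L - j)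
     else J e - (- 1) ^ L / fact L * ln e)" for j
  show thesis
  proof (rule that[of \<kappa>])
    fix s :: real assume s: "s > 0"
    have Jd: "\<bar>J (s * e) - J e\<bar> \<le> e * (s + 1)"
    proof (cases "s \<ge> 1")
      case True
      hence "e \<le> s * e" using e by simp
      from gamma_tail_increment[OF e this, of L] show ?thesis using e s unfolding J_def by (simp add: algebra_simps)
    next
      case False
      hence "s * e \<le> e" using e by simp
      from gamma_tail_increment[OF _ this, of L] mult_pos_pos[OF s e] have "\<bar>J (s * e) - J e\<bar> \<le> e - s * e" unfolding J_def by simp
      also have "\<dots> \<le> e + s * e" using mult_pos_pos[OF s e] by simp
      finally show ?thesis by (simp add: algebra_simps)
    qed
    have sp: "s ^ L * tail_primitive L (s * e) = (- 1) ^ L / fact L * s ^ L * (ln s + ln e)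
        - (\<Sum>j<L. (- 1) ^ j / (fact j * real (L - j)) / e ^ (L - j) * s ^ j)"
    proof -
      have "s ^ L * ((- 1) ^ j / (fact j * real (L - j)) / (s * e) ^ (L - j)) =
          (- 1) ^ j / (fact j * real (L - j)) / e ^ (L - j) * s ^ j" if "j < L" for j
      proof -
        have "s ^ L = s ^ (L - j) * s ^ j" using that by (simp flip: power_add)
        thus ?thesis using s by (simp add: power_mult_distrib mult_ac)
      qed
      hence "s ^ L * (\<Sum>j<L. (- 1) ^ j / (fact j * real (L - j)) / (s * e) ^ (L - j)) =
         (\<Sum>j<L. (- 1) ^ j / (fact j * real (L - j)) / e ^ (L - j) * s ^ j)"
        unfolding sum_distrib_left by (intro sum.cong) auto
      thus ?thesis unfolding tail_primitive_def right_diff_distrib using s e by (simp add: ln_mult mult_ac)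
    qed
    have k: "(\<Sum>j\<le>L. \<kappa> j * s ^ j) = (J e - (- 1) ^ L / fact L * ln e) * s ^ L +
       (\<Sum>j<L. (- 1) ^ j / (fact j * real (L - j)) / e ^ (L - j) * s ^ j)"
    proof -
      have "{..L} = insert L {..<L}" by auto
      thus ?thesis by (simp add: \<kappa>_def)
    qed
    have "gamma_tail L e s = s ^ L * J (s * e) - s ^ L * tail_primitive L (s * e)"
      using gamma_tail_scale[OF e s, of L] by (simp add: J_def algebra_simps)
    moreover have "G = X * j1 - (A * X * (p + q) - S) \<Longrightarrow>
        G - ((j0 - A * q) * X + S) + A * X * p = X * (j1 - j0)" for G X j1 j0 A p q S :: real
      by (simp add: algebra_simps)
    ultimately have "gamma_tail L e s - (\<Sum>j\<le>L. \<kappa> j * s ^ j) + (- 1) ^ L / fact L * s ^ L * ln s =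
       s ^ L * (J (s * e) - J e)"
      unfolding sp k by blast
    also have "\<bar>\<dots>\<bar> \<le> s ^ L * (e * (s + 1))" using Jd s by (simp add: abs_mult)
    finally show "\<bar>gamma_tail L e s - (\<Sum>j\<le>L. \<kappa> j * s ^ j) + (- 1) ^ L / fact L * s ^ L * ln s\<bar> \<le> e * s ^ L * (s + 1)"
      by (simp add: mult_ac)
  qed
qed

lemma shifted_spline_eq:
  assumes c: "c > 0"
  shows "shifted_spline (Suc L) (2 * L) c x = (- 1) ^ Suc L * ((norm x)\<^sup>2 + c\<^sup>2) ^ L * (ln ((norm x)\<^sup>2 + c\<^sup>2) / 2)"
proof -
  have s: "(norm x)\<^sup>2 + c\<^sup>2 > 0" using c by (simp add: add_nonneg_pos)
  have "((norm x)\<^sup>2 + c\<^sup>2) powr (real (2 * L) / 2) = ((norm x)\<^sup>2 + c\<^sup>2) ^ L" using s by (simp add: powr_realpow)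
  moreover have "ln (((norm x)\<^sup>2 + c\<^sup>2) powr (1 / 2)) = ln ((norm x)\<^sup>2 + c\<^sup>2) / 2" using s by (simp add: ln_powr)
  ultimately show ?thesis unfolding shifted_spline_def by simp
qed

text \<open>Here \<open>gamma_tail L e ((norm x)\<^sup>2 + c\<^sup>2)\<close> is an integral of Gaussians
  \<open>exp (- t * (norm x)\<^sup>2)\<close> with a positive weight in \<open>t\<close>. The expansion of \<open>gamma_tail\<close> thus
  displays the spline as a Gaussian mixture up to a polynomial and \<open>O(e)\<close>.\<close>

lemma shifted_spline_gaussian_mixture:
  assumes e: "e > 0" and c: "c > 0"
  obtains \<kappa> where "\<And>x :: real^'n::finite.
    \<bar>shifted_spline (Suc L) (2 * L) c x - fact L / 2 * (gamma_tail L e ((norm x)\<^sup>2 + c\<^sup>2) - (\<Sum>j\<le>L. \<kappa> j * ((norm x)\<^sup>2 + c\<^sup>2) ^ j))\<bar>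
     \<le> e * (fact L / 2 * (((norm x)\<^sup>2 + c\<^sup>2) ^ L * ((norm x)\<^sup>2 + c\<^sup>2 + 1)))"
proof -
  obtain \<kappa> where \<kappa>: "\<And>s. s > 0 \<Longrightarrow>
    \<bar>gamma_tail L e s - (\<Sum>j\<le>L. \<kappa> j * s ^ j) + (- 1) ^ L / fact L * s ^ L * ln s\<bar> \<le> e * s ^ L * (s + 1)"
    using gamma_tail_expansion[OF e] by blast
  show thesis
  proof (rule that[of \<kappa>])
    fix x :: "real^'n"
    define s where "s = (norm x)\<^sup>2 + c\<^sup>2"
    have s: "s > 0" using c by (simp add: s_def add_nonneg_pos)
    have "shifted_spline (Suc L) (2 * L) c x = (- 1) ^ Suc L * s ^ L * (ln s / 2)"
      unfolding s_def by (rule shifted_spline_eq[OF c])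
    moreover have "H = - P * X * (l / 2) \<Longrightarrow> F \<noteq> 0 \<Longrightarrow> H - F / 2 * (G - S) = - (F / 2 * (G - S + P / F * X * l))"
      for H P X l F G S :: real by (simp add: field_simps)
    ultimately have eq: "shifted_spline (Suc L) (2 * L) c x - fact L / 2 * (gamma_tail L e s - (\<Sum>j\<le>L. \<kappa> j * s ^ j))
       = - (fact L / 2 * (gamma_tail L e s - (\<Sum>j\<le>L. \<kappa> j * s ^ j) + (- 1) ^ L / fact L * s ^ L * ln s))"
      by simp
    have "\<bar>- (a * G)\<bar> \<le> a * B" if "\<bar>G\<bar> \<le> B" "a \<ge> 0" for a G B :: real
      using mult_left_mono[OF that] that by (simp add: abs_mult)
    from this[OF \<kappa>[OF s], of "fact L / 2"]
    have "\<bar>shifted_spline (Suc L) (2 * L) c x - fact L / 2 * (gamma_tail L e s - (\<Sum>j\<le>L. \<kappa> j * s ^ j))\<bar>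
       \<le> fact L / 2 * (e * s ^ L * (s + 1))" unfolding eq by simp
    also have "\<dots> = e * (fact L / 2 * (s ^ L * (s + 1)))" by (simp only: mult_ac)
    finally show "\<bar>shifted_spline (Suc L) (2 * L) c x - fact L / 2 * (gamma_tail L e ((norm x)\<^sup>2 + c\<^sup>2) - (\<Sum>j\<le>L. \<kappa> j * ((norm x)\<^sup>2 + c\<^sup>2) ^ j))\<bar>
     \<le> e * (fact L / 2 * (((norm x)\<^sup>2 + c\<^sup>2) ^ L * ((norm x)\<^sup>2 + c\<^sup>2 + 1)))"
      unfolding s_def .
  qed
qed

section \<open>The quadratic form of the shifted surface spline\<close>

definition kernel_form :: "(real^'n::finite \<Rightarrow> real) \<Rightarrow> (real^'n) set \<Rightarrow> (real^'n \<Rightarrow> complex) \<Rightarrow> (real^'n \<Rightarrow> complex) \<Rightarrow> complex" where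
  "kernel_form h V \<sigma> \<tau> = (\<Sum>u\<in>V. \<Sum>v\<in>V. \<sigma> u * cnj (\<tau> v) * of_real (h (u - v)))"

text \<open>In the expansion of the kernel every term has total degree at most \<open>2 * L\<close> in \<open>u\<close> and
  \<open>v\<close>, hence degree at most \<open>L\<close> in one of them, and the sum over that variable vanishes.\<close>

lemma annihilates_even_power_kernel:
  fixes V :: "(real^'n::finite) set"
  assumes ann: "annihilates (Suc L) V \<tau>" and j: "j \<le> L"
  shows "(\<Sum>u\<in>V. \<Sum>v\<in>V. \<tau> u * cnj (\<tau> v) * of_real (((norm (u - v))\<^sup>2 + c) ^ j)) = 0"
proof -
  define A where "A x = (norm x)\<^sup>2 + c" for x :: "real^'n"
  have A: "A \<in> real_polys 2" unfolding A_def[abs_def] by (intro real_polys_add real_polys_norm_square real_polys_const)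
  have N: "(\<lambda>x. (norm x)\<^sup>2) \<in> real_polys 2" by (rule real_polys_norm_square)
  define g where "g a b u v = A u ^ a * ((u \<bullet> v) ^ b * ((norm v)\<^sup>2) ^ (j - a - b))" for a b u v
  have expand: "((norm (u - v))\<^sup>2 + c) ^ j =
     (\<Sum>a\<le>j. \<Sum>b\<le>j - a. (real (j choose a) * (real ((j - a) choose b) * (- 2) ^ b)) * g a b u v)" for u v
  proof -
    have "(norm (u - v))\<^sup>2 + c = A u + ((- 2) * (u \<bullet> v) + (norm v)\<^sup>2)"
      by (simp add: A_def power2_norm_eq_inner inner_diff inner_commute algebra_simps)
    hence "((norm (u - v))\<^sup>2 + c) ^ j =
       (\<Sum>a\<le>j. real (j choose a) * A u ^ a * ((- 2) * (u \<bullet> v) + (norm v)\<^sup>2) ^ (j - a))"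
      by (simp only: binomial_ring)
    also have "\<dots> = (\<Sum>a\<le>j. real (j choose a) * A u ^ a *
        (\<Sum>b\<le>j - a. real ((j - a) choose b) * ((- 2) * (u \<bullet> v)) ^ b * ((norm v)\<^sup>2) ^ (j - a - b)))"
      by (simp only: binomial_ring)
    finally show ?thesis by (simp only: sum_distrib_left power_mult_distrib g_def mult_ac)
  qed
  have zero: "(\<Sum>u\<in>V. \<Sum>v\<in>V. \<tau> u * cnj (\<tau> v) * of_real (g a b u v)) = 0" if "a \<le> j" "b \<le> j - a" for a b
  proof (cases "2 * a + b \<le> L")
    case True
    have "(\<Sum>u\<in>V. \<tau> u * of_real (g a b u v)) = 0" for v
    proof (rule annihilates_real_polys[OF ann])
      have "(\<lambda>u. A u ^ a * (u \<bullet> v) ^ b) \<in> real_polys (2 * a + 1 * b)"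
        by (intro real_polys_mult real_polys_power A real_polys_inner)
      from real_polys_scale[OF this, of "((norm v)\<^sup>2) ^ (j - a - b)"]
      show "(\<lambda>u. g a b u v) \<in> real_polys (2 * a + b)" by (simp add: g_def mult_ac)
    qed (use True in simp)
    moreover have "(\<Sum>u\<in>V. \<Sum>v\<in>V. \<tau> u * cnj (\<tau> v) * of_real (g a b u v)) =
       (\<Sum>v\<in>V. cnj (\<tau> v) * (\<Sum>u\<in>V. \<tau> u * of_real (g a b u v)))"
      by (subst sum.swap) (simp add: sum_distrib_left mult_ac)
    ultimately show ?thesis by simp
  next
    case False
    hence k: "b + 2 * (j - a - b) \<le> L" using that j by linarith
    have "(\<Sum>v\<in>V. \<tau> v * of_real (g a b u v)) = 0" for u
    proof (rule annihilates_real_polys[OF ann])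
      have "(\<lambda>v. (v \<bullet> u) ^ b * ((norm v)\<^sup>2) ^ (j - a - b)) \<in> real_polys (1 * b + 2 * (j - a - b))"
        by (intro real_polys_mult real_polys_power N real_polys_inner)
      from real_polys_scale[OF this, of "A u ^ a"]
      show "(\<lambda>v. g a b u v) \<in> real_polys (b + 2 * (j - a - b))"
        by (simp add: g_def mult_ac inner_commute)
    qed (use k in simp)
    hence "cnj (\<Sum>v\<in>V. \<tau> v * of_real (g a b u v)) = 0" for u by simp
    hence "(\<Sum>v\<in>V. cnj (\<tau> v) * of_real (g a b u v)) = 0" for u by simp
    moreover have "(\<Sum>u\<in>V. \<Sum>v\<in>V. \<tau> u * cnj (\<tau> v) * of_real (g a b u v)) =
       (\<Sum>u\<in>V. \<tau> u * (\<Sum>v\<in>V. cnj (\<tau> v) * of_real (g a b u v)))"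
      by (simp add: sum_distrib_left mult_ac)
    ultimately show ?thesis by simp
  qed
  have "(\<Sum>u\<in>V. \<Sum>v\<in>V. \<tau> u * cnj (\<tau> v) * of_real (((norm (u - v))\<^sup>2 + c) ^ j)) =
    (\<Sum>u\<in>V. \<Sum>v\<in>V. \<Sum>a\<le>j. \<Sum>b\<le>j - a.
      of_real (real (j choose a) * (real ((j - a) choose b) * (- 2) ^ b)) * (\<tau> u * cnj (\<tau> v) * of_real (g a b u v)))"
    unfolding expand of_real_sum of_real_mult sum_distrib_left by (simp only: mult_ac)
  also have "\<dots> = (\<Sum>u\<in>V. \<Sum>a\<le>j. \<Sum>b\<le>j - a. \<Sum>v\<in>V.
      of_real (real (j choose a) * (real ((j - a) choose b) * (- 2) ^ b)) * (\<tau> u * cnj (\<tau> v) * of_real (g a b u v)))"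
    by (intro sum.cong refl, subst sum.swap, intro sum.cong refl, rule sum.swap)
  also have "\<dots> = (\<Sum>a\<le>j. \<Sum>b\<le>j - a. \<Sum>u\<in>V. \<Sum>v\<in>V.
      of_real (real (j choose a) * (real ((j - a) choose b) * (- 2) ^ b)) * (\<tau> u * cnj (\<tau> v) * of_real (g a b u v)))"
    by (subst sum.swap, intro sum.cong refl, rule sum.swap)
  also have "\<dots> = 0"
    unfolding sum_distrib_left[symmetric] using zero by (intro sum.neutral ballI) auto
  finally show ?thesis .
qed

lemma limit_of_linear_bound:
  fixes x B C :: real
  assumes "\<And>e. e > 0 \<Longrightarrow> x \<le> B + e * C" "C \<ge> 0"
  shows "x \<le> B"
proof (rule field_le_epsilon)
  fix d :: real assume d: "d > 0"
  have "x \<le> B + d / (C + 1) * C" by (rule assms(1)) (use d assms(2) in simp)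
  also have "d / (C + 1) * C \<le> d" using d assms(2) by (simp add: field_simps)
  finally show "x \<le> B + d" by simp
qed

text \<open>All statements about the quadratic form are limits as \<open>e\<close> tends to \<open>0\<close> of statements
  about the mixture truncated to \<open>t \<ge> e\<close>.\<close>

locale spline_form =
  fixes L :: nat and c :: real and V :: "(real^'n::finite) set" and \<tau> :: "real^'n \<Rightarrow> complex"
  assumes c: "c > 0" and fin: "finite V" and ann: "annihilates (Suc L) V \<tau>"
begin

definition truncated_mixture :: "real \<Rightarrow> real" where
  "truncated_mixture e = (LINT t:{e..}|lborel. exp (- c\<^sup>2 * t) / t ^ Suc L * Re (gauss_form t V \<tau>))"

definition truncation_error :: real where
  "truncation_error = (\<Sum>u\<in>V. \<Sum>v\<in>V. cmod (\<tau> u) * cmod (\<tau> v) *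
     (fact L / 2 * (((norm (u - v))\<^sup>2 + c\<^sup>2) ^ L * ((norm (u - v))\<^sup>2 + c\<^sup>2 + 1))))"

lemma truncation_error_nonneg: "truncation_error \<ge> 0"
  unfolding truncation_error_def by (intro sum_nonneg mult_nonneg_nonneg) auto

lemma truncated_mixture_eq:
  assumes e: "e > 0"
  shows "set_integrable lborel {e..} (\<lambda>t. exp (- c\<^sup>2 * t) / t ^ Suc L * Re (gauss_form t V \<tau>))"
   and "(\<Sum>u\<in>V. \<Sum>v\<in>V. \<tau> u * cnj (\<tau> v) * of_real (gamma_tail L e ((norm (u - v))\<^sup>2 + c\<^sup>2))) = of_real (truncated_mixture e)"
proof -
  let ?f = "\<lambda>(u :: real^'n) v t. exp (- ((norm (u - v))\<^sup>2 + c\<^sup>2) * t) / t ^ Suc L"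
  have pos: "(norm (u - v))\<^sup>2 + c\<^sup>2 > 0" for u v :: "real^'n" using c by (simp add: add_nonneg_pos)
  have i1: "set_integrable lborel {e..} (?f u v)" for u v
    by (rule set_integrable_exp_over_power[OF e pos])
  have i2: "integrable lborel (\<lambda>t. complex_of_real (indicator {e..} t *\<^sub>R ?f u v t))" for u v
    using i1[of u v] unfolding set_integrable_def by (rule integrable_of_real)
  have eq: "complex_of_real (indicator {e..} t *\<^sub>R (exp (- c\<^sup>2 * t) / t ^ Suc L * Re (gauss_form t V \<tau>))) =
     (\<Sum>u\<in>V. \<Sum>v\<in>V. \<tau> u * cnj (\<tau> v) * complex_of_real (indicator {e..} t *\<^sub>R ?f u v t))" for t
  proof (cases "t \<ge> e")
    case True
    hence t: "t > 0" using e by linarith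
    have "complex_of_real (exp (- c\<^sup>2 * t) / t ^ Suc L * Re (gauss_form t V \<tau>)) =
      of_real (exp (- c\<^sup>2 * t) / t ^ Suc L) * gauss_form t V \<tau>"
      unfolding of_real_mult gauss_form_nonneg(1)[OF t, symmetric] by (rule refl)
    also have "\<dots> = (\<Sum>u\<in>V. \<Sum>v\<in>V. \<tau> u * cnj (\<tau> v) * complex_of_real (?f u v t))"
    proof -
      have "exp (- ((norm (u - v))\<^sup>2 + c\<^sup>2) * t) = exp (- c\<^sup>2 * t) * exp (- t * (norm (u - v))\<^sup>2)" for u v :: "real^'n"
        by (simp add: exp_add[symmetric] algebra_simps)
      thus ?thesis unfolding gauss_form_def sum_distrib_left
        by (intro sum.cong refl) (simp only: of_real_mult of_real_divide times_divide_eq_left times_divide_eq_right mult_ac)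
    qed
    finally show ?thesis using True by simp
  qed simp
  have "integrable lborel (\<lambda>t. complex_of_real (indicator {e..} t *\<^sub>R (exp (- c\<^sup>2 * t) / t ^ Suc L * Re (gauss_form t V \<tau>))))"
    unfolding eq by (intro Bochner_Integration.integrable_sum integrable_mult_right i2)
  from integrable_Re[OF this]
  show "set_integrable lborel {e..} (\<lambda>t. exp (- c\<^sup>2 * t) / t ^ Suc L * Re (gauss_form t V \<tau>))"
    unfolding set_integrable_def Re_complex_of_real .
  have "of_real (truncated_mixture e) = (LINT t|lborel. complex_of_real (indicator {e..} t *\<^sub>R (exp (- c\<^sup>2 * t) / t ^ Suc L * Re (gauss_form t V \<tau>))))"
    unfolding truncated_mixture_def set_lebesgue_integral_def by (rule integral_complex_of_real[symmetric])
  also have "\<dots> = (\<Sum>u\<in>V. \<Sum>v\<in>V. \<tau> u * cnj (\<tau> v) * (LINT t|lborel. complex_of_real (indicator {e..} t *\<^sub>R ?f u v t)))"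
    unfolding eq
    by (subst Bochner_Integration.integral_sum, intro Bochner_Integration.integrable_sum integrable_mult_right i2,
        intro sum.cong refl, subst Bochner_Integration.integral_sum, intro integrable_mult_right i2,
        intro sum.cong refl, rule Bochner_Integration.integral_mult_right_zero)
  also have "\<dots> = (\<Sum>u\<in>V. \<Sum>v\<in>V. \<tau> u * cnj (\<tau> v) * of_real (gamma_tail L e ((norm (u - v))\<^sup>2 + c\<^sup>2)))"
    unfolding gamma_tail_def set_lebesgue_integral_def integral_complex_of_real by (rule refl)
  finally show "(\<Sum>u\<in>V. \<Sum>v\<in>V. \<tau> u * cnj (\<tau> v) * of_real (gamma_tail L e ((norm (u - v))\<^sup>2 + c\<^sup>2))) = of_real (truncated_mixture e)"
    by simp
qed

lemma truncated_mixture_nonneg: assumes e: "e > 0" shows "truncated_mixture e \<ge> 0"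
  unfolding truncated_mixture_def set_lebesgue_integral_def
proof (intro integral_nonneg_AE AE_I2)
  fix t
  show "0 \<le> indicator {e..} t *\<^sub>R (exp (- c\<^sup>2 * t) / t ^ Suc L * Re (gauss_form t V \<tau>))"
  proof (cases "t \<ge> e")
    case True
    hence t: "t > 0" using e by linarith
    have "0 \<le> exp (- c\<^sup>2 * t) / t ^ Suc L * Re (gauss_form t V \<tau>)"
      by (rule mult_nonneg_nonneg[OF _ gauss_form_nonneg(2)[OF t]]) (use t in simp)
    thus ?thesis using True by simp
  qed simp
qed

lemma form_approx:
  assumes e: "e > 0"
  shows "cmod (kernel_form (shifted_spline (Suc L) (2 * L) c) V \<tau> \<tau> - of_real (fact L / 2 * truncated_mixture e)) \<le> e * truncation_error"
proof -
  obtain \<kappa> where \<kappa>: "\<And>x :: real^'n.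
    \<bar>shifted_spline (Suc L) (2 * L) c x - fact L / 2 * (gamma_tail L e ((norm x)\<^sup>2 + c\<^sup>2) - (\<Sum>j\<le>L. \<kappa> j * ((norm x)\<^sup>2 + c\<^sup>2) ^ j))\<bar>
     \<le> e * (fact L / 2 * (((norm x)\<^sup>2 + c\<^sup>2) ^ L * ((norm x)\<^sup>2 + c\<^sup>2 + 1)))"
    using shifted_spline_gaussian_mixture[OF e c] by blast
  define H where "H x = fact L / 2 * (gamma_tail L e ((norm x)\<^sup>2 + c\<^sup>2) - (\<Sum>j\<le>L. \<kappa> j * ((norm x)\<^sup>2 + c\<^sup>2) ^ j))" for x :: "real^'n"
  have pz: "(\<Sum>u\<in>V. \<Sum>v\<in>V. \<tau> u * cnj (\<tau> v) * of_real (\<Sum>j\<le>L. \<kappa> j * ((norm (u - v))\<^sup>2 + c\<^sup>2) ^ j)) = 0"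
  proof -
    have "(\<Sum>u\<in>V. \<Sum>v\<in>V. \<tau> u * cnj (\<tau> v) * of_real (\<Sum>j\<le>L. \<kappa> j * ((norm (u - v))\<^sup>2 + c\<^sup>2) ^ j)) =
      (\<Sum>u\<in>V. \<Sum>v\<in>V. \<Sum>j\<le>L. of_real (\<kappa> j) * (\<tau> u * cnj (\<tau> v) * of_real (((norm (u - v))\<^sup>2 + c\<^sup>2) ^ j)))"
      unfolding of_real_sum of_real_mult sum_distrib_left by (simp only: mult_ac)
    also have "\<dots> = (\<Sum>j\<le>L. \<Sum>u\<in>V. \<Sum>v\<in>V. of_real (\<kappa> j) * (\<tau> u * cnj (\<tau> v) * of_real (((norm (u - v))\<^sup>2 + c\<^sup>2) ^ j)))"
      by (subst (2) sum.swap, intro sum.cong refl, rule sum.swap)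
    also have "\<dots> = 0" unfolding sum_distrib_left[symmetric]
      using annihilates_even_power_kernel[OF ann, of _ "c\<^sup>2"] by (intro sum.neutral ballI) auto
    finally show ?thesis .
  qed
  define G where "G u v = gamma_tail L e ((norm (u - v))\<^sup>2 + c\<^sup>2)" for u v :: "real^'n"
  define P where "P u v = (\<Sum>j\<le>L. \<kappa> j * ((norm (u - v))\<^sup>2 + c\<^sup>2) ^ j)" for u v :: "real^'n"
  have "kernel_form H V \<tau> \<tau> = (\<Sum>u\<in>V. \<Sum>v\<in>V. of_real (fact L / 2) * (\<tau> u * cnj (\<tau> v) * of_real (G u v)))
       - (\<Sum>u\<in>V. \<Sum>v\<in>V. of_real (fact L / 2) * (\<tau> u * cnj (\<tau> v) * of_real (P u v)))"
    unfolding kernel_form_def H_def G_def[symmetric] P_def[symmetric] sum_subtractf[symmetric]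
    by (intro sum.cong refl) (simp add: algebra_simps)
  also have "\<dots> = of_real (fact L / 2) * of_real (truncated_mixture e)"
    unfolding sum_distrib_left[symmetric] G_def P_def truncated_mixture_eq(2)[OF e] pz by simp
  finally have "kernel_form H V \<tau> \<tau> = of_real (fact L / 2) * of_real (truncated_mixture e)" .
  hence "kernel_form (shifted_spline (Suc L) (2 * L) c) V \<tau> \<tau> - of_real (fact L / 2 * truncated_mixture e) =
     (\<Sum>u\<in>V. \<Sum>v\<in>V. \<tau> u * cnj (\<tau> v) * of_real (shifted_spline (Suc L) (2 * L) c (u - v) - H (u - v)))"
    unfolding kernel_form_def by (simp add: sum_subtractf algebra_simps)
  also have "cmod \<dots> \<le> (\<Sum>u\<in>V. \<Sum>v\<in>V. cmod (\<tau> u) * cmod (\<tau> v) * (e *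
     (fact L / 2 * (((norm (u - v))\<^sup>2 + c\<^sup>2) ^ L * ((norm (u - v))\<^sup>2 + c\<^sup>2 + 1)))))"
  proof (intro order.trans[OF norm_sum] sum_mono)
    fix u v
    show "cmod (\<tau> u * cnj (\<tau> v) * of_real (shifted_spline (Suc L) (2 * L) c (u - v) - H (u - v)))
       \<le> cmod (\<tau> u) * cmod (\<tau> v) * (e *
       (fact L / 2 * (((norm (u - v))\<^sup>2 + c\<^sup>2) ^ L * ((norm (u - v))\<^sup>2 + c\<^sup>2 + 1))))"
      unfolding norm_mult norm_of_real complex_mod_cnj H_def
      by (intro mult_left_mono \<kappa> mult_nonneg_nonneg norm_ge_zero)
  qed
  also have "\<dots> = e * truncation_error" unfolding truncation_error_def sum_distrib_left by (simp only: mult_ac)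
  finally show ?thesis .
qed

lemma form_nonneg:
  "kernel_form (shifted_spline (Suc L) (2 * L) c) V \<tau> \<tau> = of_real (Re (kernel_form (shifted_spline (Suc L) (2 * L) c) V \<tau> \<tau>))"
  "Re (kernel_form (shifted_spline (Suc L) (2 * L) c) V \<tau> \<tau>) \<ge> 0"
proof -
  let ?Q = "kernel_form (shifted_spline (Suc L) (2 * L) c) V \<tau> \<tau>"
  have "\<bar>Im ?Q\<bar> \<le> 0"
  proof (rule limit_of_linear_bound[OF _ truncation_error_nonneg])
    fix e :: real assume e: "e > 0"
    show "\<bar>Im ?Q\<bar> \<le> 0 + e * truncation_error"
      using order.trans[OF abs_Im_le_cmod form_approx[OF e]] by simp
  qed
  thus "?Q = of_real (Re ?Q)" by (simp add: complex_eq_iff)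
  have "- Re ?Q \<le> 0"
  proof (rule limit_of_linear_bound[OF _ truncation_error_nonneg])
    fix e :: real assume e: "e > 0"
    have "\<bar>Re ?Q - fact L / 2 * truncated_mixture e\<bar> \<le> e * truncation_error"
      using order.trans[OF abs_Re_le_cmod form_approx[OF e]] by simp
    moreover have "fact L / 2 * truncated_mixture e \<ge> 0" using truncated_mixture_nonneg[OF e] by simp
    ultimately show "- Re ?Q \<le> 0 + e * truncation_error" by linarith
  qed
  thus "Re ?Q \<ge> 0" by simp
qed

text \<open>The bound for the Gaussian form at \<open>t\<close> is a multiple of \<open>t ^ k\<close>. The integral over \<open>t\<close>
  of the weight times this power is the Gamma integral that produces \<open>fact (k - Suc L)\<close>.\<close>

lemma form_upper_bound:
  assumes annk: "annihilates k V \<tau>" and k: "k \<ge> Suc L"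
    and W: "(\<Sum>v\<in>V. cmod (\<tau> v) * norm (v - x) ^ k) \<le> W"
  shows "Re (kernel_form (shifted_spline (Suc L) (2 * L) c) V \<tau> \<tau>) \<le>
    fact L / 2 * (W\<^sup>2 / fact k * 8 ^ k * sqrt 2 ^ CARD('n) * (fact (k - Suc L) / (c\<^sup>2) ^ (k - L)))"
proof (rule limit_of_linear_bound[OF _ truncation_error_nonneg])
  fix e :: real assume e: "e > 0"
  define B where "B = W\<^sup>2 / fact k * 8 ^ k * sqrt 2 ^ CARD('n)"
  have B0: "B \<ge> 0" by (simp add: B_def)
  have c2: "c\<^sup>2 > 0" using c by simp
  have i0: "set_integrable lborel {0..} (\<lambda>t. B * (t ^ (k - Suc L) * exp (- c\<^sup>2 * t)))"
    using power_exp_integral(1)[OF c2] by simp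
  have ie: "set_integrable lborel {e..} (\<lambda>t. B * (t ^ (k - Suc L) * exp (- c\<^sup>2 * t)))"
    by (rule set_integrable_subset[OF i0]) (use e in auto)
  have "truncated_mixture e \<le> (LINT t:{e..}|lborel. B * (t ^ (k - Suc L) * exp (- c\<^sup>2 * t)))"
    unfolding truncated_mixture_def
  proof (rule set_integral_mono[OF truncated_mixture_eq(1)[OF e] ie])
    fix t assume "t \<in> {e..}"
    hence t: "t > 0" using e by simp
    have "Re (gauss_form t V \<tau>) \<le> W\<^sup>2 / fact k * (8 * t) ^ k * sqrt 2 ^ CARD('n)"
      by (rule gauss_form_bound[OF annk _ t W]) (use k in simp)
    also have "\<dots> = B * t ^ k" by (simp add: B_def power_mult_distrib)
    finally have "exp (- c\<^sup>2 * t) / t ^ Suc L * Re (gauss_form t V \<tau>) \<le> exp (- c\<^sup>2 * t) / t ^ Suc L * (B * t ^ k)"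
      using t by (intro mult_left_mono) auto
    also have "t ^ k = t ^ (k - Suc L) * t ^ Suc L" using k by (subst power_add[symmetric]) simp
    also have "exp (- c\<^sup>2 * t) / t ^ Suc L * (B * (t ^ (k - Suc L) * t ^ Suc L)) = B * (t ^ (k - Suc L) * exp (- c\<^sup>2 * t))"
      using t by simp
    finally show "exp (- c\<^sup>2 * t) / t ^ Suc L * Re (gauss_form t V \<tau>) \<le> B * (t ^ (k - Suc L) * exp (- c\<^sup>2 * t))" .
  qed
  also have "\<dots> \<le> (LINT t:{0..}|lborel. B * (t ^ (k - Suc L) * exp (- c\<^sup>2 * t)))"
    unfolding set_lebesgue_integral_def
    by (rule Bochner_Integration.integral_mono[OF ie[unfolded set_integrable_def] i0[unfolded set_integrable_def]])
       (use e B0 in \<open>auto simp: indicator_def\<close>)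
  also have "\<dots> = B * (fact (k - Suc L) / (c\<^sup>2) ^ Suc (k - Suc L))"
    using power_exp_integral(2)[OF c2, of "k - Suc L"] by simp
  also have "Suc (k - Suc L) = k - L" using k by simp
  finally have m: "fact L / 2 * truncated_mixture e \<le> fact L / 2 * (B * (fact (k - Suc L) / (c\<^sup>2) ^ (k - L)))"
    by (intro mult_left_mono) auto
  have "\<bar>Re (kernel_form (shifted_spline (Suc L) (2 * L) c) V \<tau> \<tau>) - fact L / 2 * truncated_mixture e\<bar> \<le> e * truncation_error"
    using order.trans[OF abs_Re_le_cmod form_approx[OF e]] by simp
  thus "Re (kernel_form (shifted_spline (Suc L) (2 * L) c) V \<tau> \<tau>) \<le>
    fact L / 2 * (W\<^sup>2 / fact k * 8 ^ k * sqrt 2 ^ CARD('n) * (fact (k - Suc L) / (c\<^sup>2) ^ (k - L))) + e * truncation_error"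
    using m unfolding B_def by linarith
qed

end

section \<open>Interpolation error by projection\<close>

text \<open>The spline corresponds to a coefficient family \<open>b\<close> on \<open>X\<close>: pairing any annihilating \<open>\<sigma>\<close>
  with \<open>s\<close> gives the form of \<open>\<sigma>\<close> and \<open>b\<close>. The component \<open>\<mu>\<close> of \<open>\<tau>\<close> orthogonal to \<open>b\<close> has a
  form at most that of \<open>\<tau>\<close>, and pairing it with \<open>f\<close> equals pairing \<open>\<tau>\<close> with \<open>f - s\<close>, because
  \<open>f\<close> and \<open>s\<close> agree on \<open>X\<close>.\<close>

lemma native_interpolation_error:
  fixes h :: "real^'n::finite \<Rightarrow> real" and f s :: "real^'n \<Rightarrow> complex"
  assumes fin: "finite V" and XV: "X \<subseteq> V" and m: "m > 0"
    and even: "\<And>x. h (- x) = h x"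
    and real: "\<And>\<sigma>. annihilates m V \<sigma> \<Longrightarrow> kernel_form h V \<sigma> \<sigma> = of_real (Re (kernel_form h V \<sigma> \<sigma>))"
    and nonneg: "\<And>\<sigma>. annihilates m V \<sigma> \<Longrightarrow> Re (kernel_form h V \<sigma> \<sigma>) \<ge> 0"
    and K: "K \<ge> 0"
    and fb: "\<And>\<sigma>. annihilates m V \<sigma> \<Longrightarrow> cmod (\<Sum>v\<in>V. \<sigma> v * f v) \<le> K * sqrt (Re (kernel_form h V \<sigma> \<sigma>))"
    and p: "p \<in> poly_space (m - 1)"
    and a: "\<And>q. q \<in> poly_space (m - 1) \<Longrightarrow> (\<Sum>y\<in>X. a y * q y) = 0"
    and s: "\<And>x. s x = p x + (\<Sum>y\<in>X. a y * of_real (h (x - y)))"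
    and interp: "\<And>y. y \<in> X \<Longrightarrow> s y = f y"
    and tau: "annihilates m V \<tau>"
  shows "cmod (\<Sum>v\<in>V. \<tau> v * (f v - s v)) \<le> K * sqrt (Re (kernel_form h V \<tau> \<tau>))"
proof -
  let ?Q = "kernel_form h V"
  define b where "b v = (if v \<in> X then cnj (a v) else 0)" for v
  have sumX: "(\<Sum>v\<in>V. (if v \<in> X then g v else 0)) = (\<Sum>v\<in>X. g v)" for g :: "real^'n \<Rightarrow> complex"
    using sum.inter_restrict[OF fin, of g X] XV by (simp add: Int_absorb1)
  have bann: "annihilates m V b" unfolding annihilates_def
  proof (intro allI impI)
    fix \<alpha> :: "'n \<Rightarrow> nat" assume "sum \<alpha> UNIV < m"
    hence "(\<Sum>y\<in>X. a y * of_real (monomial_fun \<alpha> y)) = 0"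
      by (intro a monomial_in_poly_space) simp
    hence "cnj (\<Sum>y\<in>X. a y * of_real (monomial_fun \<alpha> y)) = 0" by simp
    moreover have "(\<Sum>v\<in>V. b v * of_real (monomial_fun \<alpha> v)) = (\<Sum>v\<in>V. if v \<in> X then cnj (a v) * of_real (monomial_fun \<alpha> v) else 0)"
      by (intro sum.cong) (auto simp: b_def)
    ultimately show "(\<Sum>v\<in>V. b v * of_real (monomial_fun \<alpha> v)) = 0" by (simp add: sumX)
  qed
  have spl: "(\<Sum>v\<in>V. \<sigma> v * s v) = ?Q \<sigma> b" if "annihilates m V \<sigma>" for \<sigma>
  proof -
    have s': "s v = p v + (\<Sum>y\<in>V. cnj (b y) * of_real (h (v - y)))" for v
    proof -
      have "(\<Sum>y\<in>V. cnj (b y) * of_real (h (v - y))) = (\<Sum>y\<in>V. if y \<in> X then a y * of_real (h (v - y)) else 0)"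
        by (intro sum.cong) (auto simp: b_def)
      thus ?thesis by (simp add: s sumX)
    qed
    have "(\<Sum>v\<in>V. \<sigma> v * s v) = (\<Sum>v\<in>V. \<sigma> v * p v) + ?Q \<sigma> b"
      unfolding s' kernel_form_def by (simp add: algebra_simps sum.distrib sum_distrib_left)
    thus ?thesis using annihilates_poly_space[OF that p m] by simp
  qed
  have bf: "(\<Sum>v\<in>V. b v * f v) = ?Q b b"
    unfolding spl[OF bann, symmetric] by (intro sum.cong) (auto simp: b_def interp)
  have comb: "annihilates m V (\<lambda>v. \<tau> v - \<beta> * b v)" for \<beta>
    using tau bann unfolding annihilates_def
    by (auto simp: left_diff_distrib sum_subtractf mult.assoc sum_distrib_left[symmetric])
  have herm: "?Q b \<tau> = cnj (?Q \<tau> b)"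
  proof -
    have "h (u - v) = h (v - u)" for u v using even[of "v - u"] by simp
    thus ?thesis unfolding kernel_form_def by (subst sum.swap) (simp add: mult_ac)
  qed
  define q where "q = Re (?Q b b)"
  define w where "w = ?Q \<tau> b"
  define t where "t = Re (?Q \<tau> \<tau>)"
  have qq: "?Q b b = of_real q" unfolding q_def by (rule real[OF bann])
  have q0: "q \<ge> 0" unfolding q_def by (rule nonneg[OF bann])
  have exp: "?Q (\<lambda>v. \<tau> v - \<beta> * b v) (\<lambda>v. \<tau> v - \<beta> * b v) =
      ?Q \<tau> \<tau> - cnj \<beta> * w - \<beta> * cnj w + \<beta> * cnj \<beta> * of_real q" for \<beta>
    unfolding w_def herm[symmetric] qq[symmetric] unfolding kernel_form_def
    by (simp add: algebra_simps sum_subtractf sum.distrib sum_distrib_left)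
  have expR: "Re (?Q (\<lambda>v. \<tau> v - (of_real r * w) * b v) (\<lambda>v. \<tau> v - (of_real r * w) * b v)) =
      t - 2 * r * (cmod w)\<^sup>2 + r\<^sup>2 * (cmod w)\<^sup>2 * q" for r
  proof -
    have ww: "w * cnj w = of_real ((cmod w)\<^sup>2)" by (rule complex_norm_square[symmetric])
    have "?Q (\<lambda>v. \<tau> v - (of_real r * w) * b v) (\<lambda>v. \<tau> v - (of_real r * w) * b v) =
      ?Q \<tau> \<tau> - of_real (2 * r) * (w * cnj w) + of_real (r\<^sup>2 * q) * (w * cnj w)"
      unfolding exp by (simp add: power2_eq_square algebra_simps)
    hence "?Q (\<lambda>v. \<tau> v - (of_real r * w) * b v) (\<lambda>v. \<tau> v - (of_real r * w) * b v) =
      ?Q \<tau> \<tau> - of_real (2 * r * (cmod w)\<^sup>2) + of_real (r\<^sup>2 * (cmod w)\<^sup>2 * q)"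
      unfolding ww by (simp only: of_real_mult mult_ac)
    thus ?thesis by (simp add: t_def)
  qed
  \<comment> \<open>\<open>r = 1 / q\<close> gives the orthogonal component; if \<open>q = 0\<close>, nonnegativity of the form forces
    \<open>w = 0\<close>\<close>
  have "\<exists>r. of_real (r * q) * w = w \<and> t - 2 * r * (cmod w)\<^sup>2 + r\<^sup>2 * (cmod w)\<^sup>2 * q \<le> t"
  proof (cases "q = 0")
    case True
    have "w = 0"
    proof (rule ccontr)
      assume w: "w \<noteq> 0"
      define r where "r = (t + 1) / (2 * (cmod w)\<^sup>2)"
      have "Re (?Q (\<lambda>v. \<tau> v - (of_real r * w) * b v) (\<lambda>v. \<tau> v - (of_real r * w) * b v)) = -1"
        unfolding expR using w True by (simp add: r_def field_simps)
      thus False using nonneg[OF comb, of "of_real r * w"] by simp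
    qed
    thus ?thesis by auto
  next
    case False
    hence "q > 0" using q0 by simp
    thus ?thesis by (intro exI[of _ "1 / q"]) (simp add: power2_eq_square)
  qed
  then obtain r where r: "of_real (r * q) * w = w" "t - 2 * r * (cmod w)\<^sup>2 + r\<^sup>2 * (cmod w)\<^sup>2 * q \<le> t"
    by auto
  let ?\<mu> = "\<lambda>v. \<tau> v - (of_real r * w) * b v"
  have "(\<Sum>v\<in>V. ?\<mu> v * f v) = (\<Sum>v\<in>V. \<tau> v * f v) - of_real r * w * of_real q"
    unfolding qq[symmetric] bf[symmetric] by (simp add: algebra_simps sum_subtractf sum_distrib_left)
  also have "of_real r * w * of_real q = (\<Sum>v\<in>V. \<tau> v * s v)"
    unfolding spl[OF tau] using r(1) by (simp add: w_def mult_ac)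
  finally have "(\<Sum>v\<in>V. \<tau> v * (f v - s v)) = (\<Sum>v\<in>V. ?\<mu> v * f v)"
    by (simp add: right_diff_distrib sum_subtractf)
  hence "cmod (\<Sum>v\<in>V. \<tau> v * (f v - s v)) \<le> K * sqrt (Re (?Q ?\<mu> ?\<mu>))"
    using fb[OF comb] by simp
  also have "\<dots> \<le> K * sqrt (Re (?Q \<tau> \<tau>))"
    using K r(2) unfolding expR t_def by (intro mult_left_mono) auto
  finally show ?thesis .
qed

section \<open>Smooth bumps\<close>

text \<open>Smoothness of a concrete function is proved by placing it in a class that is closed
  under directional derivatives.\<close>

lemma cont_diff_of_closed_class:
  fixes S :: "('a::euclidean_space \<Rightarrow> 'b::real_normed_vector) set"
  assumes "\<And>f. f \<in> S \<Longrightarrow> \<exists>f'. (\<forall>x. (f has_derivative f' x) (at x)) \<and> (\<forall>v. (\<lambda>x. f' x v) \<in> S)"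
  shows "f \<in> S \<Longrightarrow> cont_diff k f"
proof (induction k arbitrary: f)
  case 0
  then obtain f' where "\<forall>x. (f has_derivative f' x) (at x)" using assms by blast
  thus ?case by (auto intro!: continuous_at_imp_continuous_on has_derivative_continuous)
next
  case (Suc k)
  then obtain f' where f': "\<And>x. (f has_derivative f' x) (at x)" "\<And>v. (\<lambda>x. f' x v) \<in> S"
    using assms by blast
  have "frechet_derivative f (at x) = f' x" for x
    using frechet_derivative_at[OF f'(1)] by simp
  thus ?case using f' Suc.IH by (auto simp: differentiable_def)
qed

lemma cont_diff_lincomb:
  fixes f g :: "'a::euclidean_space \<Rightarrow> complex"
  shows "cont_diff k f \<Longrightarrow> cont_diff k g \<Longrightarrow> cont_diff k (\<lambda>x. a * f x + b * g x)"
proof (induction k arbitrary: f g)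
  case 0
  thus ?case by (auto intro!: continuous_intros)
next
  case (Suc k)
  have df: "(f has_derivative frechet_derivative f (at x)) (at x)"
    and dg: "(g has_derivative frechet_derivative g (at x)) (at x)" for x
    using Suc.prems by (auto simp: frechet_derivative_works)
  have d: "((\<lambda>x. a * f x + b * g x) has_derivative
      (\<lambda>v. a * frechet_derivative f (at x) v + b * frechet_derivative g (at x) v)) (at x)" for x
    by (intro has_derivative_add has_derivative_mult_right df dg)
  have "frechet_derivative (\<lambda>x. a * f x + b * g x) (at x) =
      (\<lambda>v. a * frechet_derivative f (at x) v + b * frechet_derivative g (at x) v)" for x
    using frechet_derivative_at[OF d] by simp
  thus ?case using d Suc by (auto simp: differentiable_def)
qed

lemma compact_supp_iff_bounded: "compact (supp \<phi>) \<longleftrightarrow> bounded {x. \<phi> x \<noteq> 0}"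
  unfolding supp_def by (simp add: compact_closure)

lemma test_functions_lincomb:
  assumes "f \<in> test_functions" "g \<in> test_functions"
  shows "(\<lambda>x. a * f x + b * g x) \<in> test_functions"
proof -
  have "bounded {x. f x \<noteq> 0}" "bounded {x. g x \<noteq> 0}"
    using assms by (auto simp: test_functions_def compact_supp_iff_bounded)
  hence "bounded ({x. f x \<noteq> 0} \<union> {x. g x \<noteq> 0})" by simp
  hence "bounded {x. a * f x + b * g x \<noteq> 0}" by (rule bounded_subset) auto
  thus ?thesis using assms by (auto simp: test_functions_def compact_supp_iff_bounded cont_diff_lincomb)
qed

lemma test_functions_zero: "(\<lambda>x. 0) \<in> test_functions"
proof -
  have "cont_diff k (\<lambda>x :: 'a. 0 :: complex)" for k
    by (rule cont_diff_of_closed_class[of "{\<lambda>x. 0}"]) (auto intro!: exI[of _ "\<lambda>_ _. 0"])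
  thus ?thesis by (simp add: test_functions_def compact_supp_iff_bounded)
qed

lemma test_functions_sum:
  "(\<And>i. i \<in> A \<Longrightarrow> f i \<in> test_functions) \<Longrightarrow> (\<lambda>x. \<Sum>i\<in>A. a i * f i x) \<in> test_functions"
proof (induction A rule: infinite_finite_induct)
  case (insert i A)
  have "(\<lambda>x. a i * f i x + 1 * (\<Sum>i\<in>A. a i * f i x)) \<in> test_functions"
    using insert by (intro test_functions_lincomb) auto
  thus ?case using insert by simp
qed (auto simp: test_functions_zero)

text \<open>The family of these functions is closed under differentiation up to linear combinations,
  which makes \<open>flat_exp 0\<close> smooth.\<close>

definition flat_exp :: "nat \<Rightarrow> real \<Rightarrow> real" where
  "flat_exp j t = (if t > 0 then exp (- 1 / t) / t ^ j else 0)"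

lemma flat_exp_bound: "\<bar>flat_exp j t\<bar> \<le> fact (Suc j) * \<bar>t\<bar>"
proof (cases "t > 0")
  case True
  have "(1 / t) ^ Suc j / fact (Suc j) \<le> exp (1 / t)"
    by (rule power_over_fact_le_exp) (use True in simp)
  hence "1 / t ^ Suc j \<le> exp (1 / t) * fact (Suc j)"
    unfolding power_one_over by (subst (asm) pos_divide_le_eq) (auto simp del: fact_Suc)
  hence "exp (- 1 / t) * (1 / t ^ Suc j) \<le> exp (- 1 / t) * (exp (1 / t) * fact (Suc j))"
    by (intro mult_left_mono) auto
  also have "\<dots> = fact (Suc j)" by (simp add: mult.assoc[symmetric] exp_add[symmetric] del: fact_Suc)
  finally have "exp (- 1 / t) * (1 / t ^ Suc j) * t \<le> fact (Suc j) * t"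
    using True by (intro mult_right_mono) auto
  thus ?thesis using True by (simp add: flat_exp_def del: fact_Suc)
qed (simp add: flat_exp_def mult_nonneg_nonpos del: fact_Suc)

lemma flat_exp_deriv:
  "(flat_exp j has_real_derivative flat_exp (j + 2) t - real j * flat_exp (j + 1) t) (at t)"
proof -
  consider "t > 0" | "t < 0" | "t = 0" by linarith
  thus ?thesis
  proof cases
    case 1
    have "((\<lambda>t. exp (- 1 / t) / t ^ j) has_real_derivative
       (exp (- 1 / t) * (1 / t\<^sup>2) * t ^ j - exp (- 1 / t) * (real j * t ^ (j - 1))) / (t ^ j * t ^ j)) (at t)"
      using 1 by (auto intro!: derivative_eq_intros simp: power2_eq_square)
    moreover have "(exp (- 1 / t) * (1 / t\<^sup>2) * t ^ j - exp (- 1 / t) * (real j * t ^ (j - 1))) / (t ^ j * t ^ j)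
      = flat_exp (j + 2) t - real j * flat_exp (j + 1) t"
      using 1 by (cases j) (auto simp: flat_exp_def field_simps power2_eq_square)
    ultimately have "((\<lambda>t. exp (- 1 / t) / t ^ j) has_real_derivative flat_exp (j + 2) t - real j * flat_exp (j + 1) t) (at t)"
      by simp
    thus ?thesis
      by (rule DERIV_cong_ev[THEN iffD1, OF refl _ refl, rotated])
         (use eventually_nhds_in_open[of "{0<..}" t] 1 in \<open>auto simp: flat_exp_def elim!: eventually_mono\<close>)
  next
    case 2
    have "((\<lambda>t. 0 :: real) has_real_derivative 0) (at t)" by simp
    moreover have "flat_exp (j + 2) t - real j * flat_exp (j + 1) t = 0" using 2 by (simp add: flat_exp_def)
    ultimately have "((\<lambda>t. 0 :: real) has_real_derivative flat_exp (j + 2) t - real j * flat_exp (j + 1) t) (at t)"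
      by simp
    thus ?thesis
      by (rule DERIV_cong_ev[THEN iffD1, OF refl _ refl, rotated])
         (use eventually_nhds_in_open[of "{..<0}" t] 2 in \<open>auto simp: flat_exp_def elim!: eventually_mono\<close>)
  next
    case 3
    have "(\<lambda>h. (flat_exp j (0 + h) - flat_exp j 0) / h) \<midarrow>0\<rightarrow> 0"
    proof (rule Lim_null_comparison)
      show "\<forall>\<^sub>F h in at 0. norm ((flat_exp j (0 + h) - flat_exp j 0) / h) \<le> fact (Suc (Suc j)) * \<bar>h\<bar>"
      proof (rule always_eventually, rule allI)
        fix h
        have "(flat_exp j (0 + h) - flat_exp j 0) / h = flat_exp (Suc j) h"
          by (simp add: flat_exp_def)
        thus "norm ((flat_exp j (0 + h) - flat_exp j 0) / h) \<le> fact (Suc (Suc j)) * \<bar>h\<bar>"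
          using flat_exp_bound[of "Suc j" h] by (simp del: fact_Suc)
      qed
      show "(\<lambda>h. fact (Suc (Suc j)) * \<bar>h\<bar>) \<midarrow>0\<rightarrow> (0 :: real)" by (intro tendsto_eq_intros) auto
    qed
    moreover have "flat_exp (j + 2) t - real j * flat_exp (j + 1) t = 0" using 3 by (simp add: flat_exp_def)
    ultimately show ?thesis using 3 by (simp add: DERIV_def)
  qed
qed

lemma real_polynomial_function_derivative:
  assumes "real_polynomial_function p"
  shows "\<exists>p'. (\<forall>x. (p has_derivative p' x) (at x)) \<and> (\<forall>v. real_polynomial_function (\<lambda>x. p' x v))"
  using assms
proof (induction rule: real_polynomial_function.induct)
  case (linear f)
  thus ?case by (intro exI[of _ "\<lambda>_. f"]) (auto intro: bounded_linear_imp_has_derivative real_polynomial_function.intros(2))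
next
  case (const c)
  thus ?case by (intro exI[of _ "\<lambda>_ _. 0"]) (auto intro: real_polynomial_function.intros(2))
next
  case (add f g)
  then obtain f' g' where "\<And>x. (f has_derivative f' x) (at x)" "\<And>v. real_polynomial_function (\<lambda>x. f' x v)"
    "\<And>x. (g has_derivative g' x) (at x)" "\<And>v. real_polynomial_function (\<lambda>x. g' x v)" by blast
  thus ?case
    by (intro exI[of _ "\<lambda>x v. f' x v + g' x v"]) (auto intro: has_derivative_add real_polynomial_function.intros(3))
next
  case (mult f g)
  then obtain f' g' where d: "\<And>x. (f has_derivative f' x) (at x)" "\<And>x. (g has_derivative g' x) (at x)"
    and p: "\<And>v. real_polynomial_function (\<lambda>x. f' x v)" "\<And>v. real_polynomial_function (\<lambda>x. g' x v)" by blast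
  have "real_polynomial_function (\<lambda>x. f x * g' x v + f' x v * g x)" for v
    by (intro real_polynomial_function.intros(3,4) p mult.hyps)
  thus ?case using has_derivative_mult[OF d]
    by (intro exI[of _ "\<lambda>x v. f x * g' x v + f' x v * g x"]) auto
qed

definition bump :: "'a::euclidean_space \<Rightarrow> real \<Rightarrow> 'a \<Rightarrow> real" where
  "bump y e x = flat_exp 0 (e\<^sup>2 - (norm (x - y))\<^sup>2)"

text \<open>A class closed under directional derivatives that contains \<open>bump y e\<close>.\<close>

inductive_set bump_span :: "'a::euclidean_space \<Rightarrow> real \<Rightarrow> ('a \<Rightarrow> real) set" for y e where
  base: "real_polynomial_function p \<Longrightarrow> (\<lambda>x. p x * flat_exp j (e\<^sup>2 - (norm (x - y))\<^sup>2)) \<in> bump_span y e"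
| add: "f \<in> bump_span y e \<Longrightarrow> g \<in> bump_span y e \<Longrightarrow> (\<lambda>x. f x + g x) \<in> bump_span y e"

lemma bump_span_derivative:
  assumes "f \<in> bump_span y e"
  shows "\<exists>f'. (\<forall>x. (f has_derivative f' x) (at x)) \<and> (\<forall>v. (\<lambda>x. f' x v) \<in> bump_span y e)"
  using assms
proof (induction rule: bump_span.induct)
  case (base p j)
  then obtain p' where p': "\<And>x. (p has_derivative p' x) (at x)" "\<And>v. real_polynomial_function (\<lambda>x. p' x v)"
    using real_polynomial_function_derivative by blast
  define r where "r x = e\<^sup>2 - (norm (x - y))\<^sup>2" for x
  have r': "(r has_derivative (\<lambda>v. - 2 * ((x - y) \<bullet> v))) (at x)" for x
    unfolding r_def[abs_def] power2_norm_eq_inner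
    by (auto intro!: derivative_eq_intros simp: inner_commute)
  have g': "((\<lambda>x. flat_exp j (r x)) has_derivative
     (\<lambda>v. (- 2 * ((x - y) \<bullet> v)) * (flat_exp (j + 2) (r x) - real j * flat_exp (j + 1) (r x)))) (at x)" for x
    using DERIV_compose_FDERIV[OF flat_exp_deriv r'] .
  have d: "((\<lambda>x. p x * flat_exp j (r x)) has_derivative
     (\<lambda>v. p x * ((- 2 * ((x - y) \<bullet> v)) * (flat_exp (j + 2) (r x) - real j * flat_exp (j + 1) (r x))) + p' x v * flat_exp j (r x))) (at x)" for x
    by (rule has_derivative_mult[OF p'(1) g'])
  have lin: "real_polynomial_function (\<lambda>x. k * ((x - y) \<bullet> v))" for v k
    unfolding inner_diff_left right_diff_distrib
    by (intro real_polynomial_function_diff real_polynomial_function.intros(4) real_polynomial_function.intros(2)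
        real_polynomial_function.intros(1) bounded_linear_inner_left)
  show ?case
  proof (intro exI conjI allI)
    fix x v
    show "((\<lambda>x. p x * flat_exp j (e\<^sup>2 - (norm (x - y))\<^sup>2)) has_derivative
     (\<lambda>v. p x * ((- 2 * ((x - y) \<bullet> v)) * (flat_exp (j + 2) (r x) - real j * flat_exp (j + 1) (r x))) + p' x v * flat_exp j (r x))) (at x)"
      using d unfolding r_def .
    have "(\<lambda>x. ((p x * ((- 2) * ((x - y) \<bullet> v))) * flat_exp (j + 2) (r x) +
        (p x * (2 * real j * ((x - y) \<bullet> v))) * flat_exp (j + 1) (r x)) + p' x v * flat_exp j (r x)) \<in> bump_span y e"
      unfolding r_def
      by (intro bump_span.add bump_span.base real_polynomial_function.intros(4) lin base p')
    thus "(\<lambda>x. p x * ((- 2 * ((x - y) \<bullet> v)) * (flat_exp (j + 2) (r x) - real j * flat_exp (j + 1) (r x))) + p' x v * flat_exp j (r x)) \<in> bump_span y e"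
      by (simp add: algebra_simps)
  qed
next
  case (add f g)
  then obtain f' g' where "\<And>x. (f has_derivative f' x) (at x)" "\<And>v. (\<lambda>x. f' x v) \<in> bump_span y e"
    "\<And>x. (g has_derivative g' x) (at x)" "\<And>v. (\<lambda>x. g' x v) \<in> bump_span y e" by blast
  thus ?case
    by (intro exI[of _ "\<lambda>x v. f' x v + g' x v"]) (auto intro: has_derivative_add bump_span.add)
qed

lemma bump_nonneg: "bump y e x \<ge> 0" by (simp add: bump_def flat_exp_def)

lemma bump_pos_iff: "e > 0 \<Longrightarrow> bump y e x > 0 \<longleftrightarrow> dist x y < e"
  by (auto simp: bump_def flat_exp_def dist_norm power_strict_mono intro: power2_less_imp_less)

lemma bump_eq_0_iff: "e > 0 \<Longrightarrow> bump y e x = 0 \<longleftrightarrow> dist x y \<ge> e"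
  using bump_pos_iff[of e y x] bump_nonneg[of y e x] by linarith

lemma continuous_on_bump: "continuous_on A (bump y e)"
proof -
  have "continuous_on UNIV (flat_exp 0)"
    using DERIV_isCont[OF flat_exp_deriv] by (intro continuous_at_imp_continuous_on) auto
  thus ?thesis unfolding bump_def
    by (rule continuous_on_compose2) (auto intro!: continuous_intros)
qed

lemma bump_test_function:
  assumes "e > 0" shows "(\<lambda>x. complex_of_real (bump y e x)) \<in> test_functions"
proof -
  have "cont_diff k (\<lambda>x. complex_of_real (bump y e x))" for k
  proof (rule cont_diff_of_closed_class[of "(\<lambda>f x. complex_of_real (f x)) ` bump_span y e"])
    fix F assume "F \<in> (\<lambda>f x. complex_of_real (f x)) ` bump_span y e"
    then obtain f where f: "f \<in> bump_span y e" "F = (\<lambda>x. of_real (f x))" by blast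
    then obtain f' where "\<And>x. (f has_derivative f' x) (at x)" "\<And>v. (\<lambda>x. f' x v) \<in> bump_span y e"
      using bump_span_derivative by blast
    thus "\<exists>F'. (\<forall>x. (F has_derivative F' x) (at x)) \<and> (\<forall>v. (\<lambda>x. F' x v) \<in> (\<lambda>f x. complex_of_real (f x)) ` bump_span y e)"
      unfolding f by (intro exI[of _ "\<lambda>x v. of_real (f' x v)"]) (auto intro!: has_derivative_of_real)
  next
    have "(\<lambda>x. 1 * flat_exp 0 (e\<^sup>2 - (norm (x - y))\<^sup>2)) \<in> bump_span y e"
      by (intro bump_span.base real_polynomial_function.intros(2))
    hence "bump y e \<in> bump_span y e" by (simp add: bump_def[abs_def])
    thus "(\<lambda>x. complex_of_real (bump y e x)) \<in> (\<lambda>f x. complex_of_real (f x)) ` bump_span y e" by blast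
  qed
  moreover have "bounded {x. complex_of_real (bump y e x) \<noteq> 0}"
    by (rule bounded_subset[OF bounded_ball[of y e]]) (use assms in \<open>auto simp: bump_eq_0_iff dist_commute\<close>)
  ultimately show ?thesis by (simp add: test_functions_def compact_supp_iff_bounded)
qed

section \<open>From test functions to point functionals\<close>

lemma test_function_continuous: "\<phi> \<in> test_functions \<Longrightarrow> continuous_on UNIV \<phi>"
proof -
  assume "\<phi> \<in> test_functions"
  hence "cont_diff 0 \<phi>" by (simp only: test_functions_def mem_Collect_eq)
  thus ?thesis by simp
qed

lemma test_function_mult_integrable:
  fixes F :: "'a::euclidean_space \<Rightarrow> complex"
  assumes \<phi>: "\<phi> \<in> test_functions" and F: "continuous_on UNIV F"
  shows "integrable lborel (\<lambda>x. F x * \<phi> x)"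
proof -
  have c: "compact (supp \<phi>)" using \<phi> by (simp add: test_functions_def)
  have "integrable lborel (\<lambda>x. indicator (supp \<phi>) x *\<^sub>R (F x * \<phi> x))"
    by (rule borel_integrable_compact[OF c])
       (intro continuous_intros continuous_on_subset[OF F] continuous_on_subset[OF test_function_continuous[OF \<phi>]], auto)
  moreover have "indicator (supp \<phi>) x *\<^sub>R (F x * \<phi> x) = F x * \<phi> x" for x
    using closure_subset[of "{x. \<phi> x \<noteq> 0}"] by (auto simp: supp_def indicator_def)
  ultimately show ?thesis by simp
qed

lemma test_function_integrable: "\<phi> \<in> test_functions \<Longrightarrow> integrable lborel \<phi>"
  using test_function_mult_integrable[of \<phi> "\<lambda>_. 1"] by simp

lemma bump_integrable: "e > 0 \<Longrightarrow> integrable lborel (bump y e)"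
  using integrable_Re[OF test_function_integrable[OF bump_test_function]] by simp

lemma integral_positive:
  fixes f :: "'a::euclidean_space \<Rightarrow> real"
  assumes i: "integrable lborel f" and nn: "\<And>x. f x \<ge> 0" and e: "e > 0" and pos: "\<And>x. dist y x < e \<Longrightarrow> f x > 0"
  shows "integral\<^sup>L lborel f > 0"
proof -
  have "integral\<^sup>L lborel f \<noteq> 0"
  proof
    assume "integral\<^sup>L lborel f = 0"
    hence "AE x in lborel. f x = 0" using integral_nonneg_eq_0_iff_AE[OF i] nn by fastforce
    hence "AE x in lborel. x \<notin> ball y e" by eventually_elim (use pos in fastforce)
    hence "emeasure lborel (ball y e) = 0" by (subst (asm) AE_iff_measurable[of "ball y e"]) auto
    moreover have "\<not> negligible (ball y e)" using e by (intro open_not_negligible) auto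
    ultimately show False by (simp add: negligible_iff_null_sets null_sets_completionI null_sets_def)
  qed
  moreover have "integral\<^sup>L lborel f \<ge> 0" using nn by (intro integral_nonneg_AE AE_I2)
  ultimately show ?thesis by simp
qed

lemma bump_integral_pos:
  assumes e: "e > 0" shows "integral\<^sup>L lborel (bump y e) > 0"
  by (rule integral_positive[OF bump_integrable[OF e] bump_nonneg e, of y])
     (use e in \<open>simp add: bump_pos_iff dist_commute\<close>)

lemma bump_translate: "bump y e x = bump 0 e (x - y)" by (simp add: bump_def)

definition mollifier :: "real \<Rightarrow> 'a::euclidean_space \<Rightarrow> real" where
  "mollifier e x = bump 0 e x / integral\<^sup>L lborel (bump (0 :: 'a) e)"

lemma mollifier_nonneg: "e > 0 \<Longrightarrow> mollifier e x \<ge> 0"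
  unfolding mollifier_def using bump_nonneg bump_integral_pos by (intro divide_nonneg_pos)

lemma mollifier_eq_0: "e > 0 \<Longrightarrow> dist x u \<ge> e \<Longrightarrow> mollifier e (x - u) = 0"
  using bump_eq_0_iff[of e u x] by (simp add: mollifier_def bump_translate[symmetric])

lemma mollifier_alt:
  fixes x :: "'a::euclidean_space"
  shows "mollifier e (x - u) = bump u e x / integral\<^sup>L lborel (bump (0 :: 'a) e)"
  by (simp add: mollifier_def bump_translate[of u])

lemma mollifier_integrable: "e > 0 \<Longrightarrow> integrable lborel (\<lambda>x. mollifier e (x - u))"
  unfolding mollifier_alt by (intro integrable_divide bump_integrable) auto

lemma lborel_integral_translate:
  fixes f :: "'a::euclidean_space \<Rightarrow> 'b::{banach,second_countable_topology}"
  assumes "f \<in> borel_measurable borel"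
  shows "integral\<^sup>L lborel (\<lambda>x. f (t + x)) = integral\<^sup>L lborel f"
proof -
  have "integral\<^sup>L lborel f = integral\<^sup>L (distr lborel borel ((+) t)) f"
    by (simp add: lborel_distr_plus)
  also have "\<dots> = integral\<^sup>L lborel (\<lambda>x. f (t + x))"
    by (rule integral_distr) (use assms in auto)
  finally show ?thesis by simp
qed

lemma mollifier_integral:
  assumes e: "e > 0" shows "(LINT x|lborel. mollifier e (x - u :: 'a::euclidean_space)) = 1"
proof -
  have m: "bump 0 e \<in> borel_measurable (borel :: 'a measure)"
    by (intro borel_measurable_continuous_onI continuous_on_bump)
  have mb: "mollifier e \<in> borel_measurable (borel :: 'a measure)"
    unfolding mollifier_def[abs_def] using m by measurable
  have "(LINT x|lborel. mollifier e (x - u)) = (LINT x|lborel. mollifier e (- u + x))" by simp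
  also have "\<dots> = integral\<^sup>L lborel (mollifier e :: 'a \<Rightarrow> real)"
    by (rule lborel_integral_translate[OF mb])
  also have "\<dots> = 1" using bump_integral_pos[OF e, of "0 :: 'a"] by (simp add: mollifier_def[abs_def])
  finally show ?thesis .
qed

lemma mollifier_test_function:
  assumes e: "e > 0" shows "(\<lambda>x. complex_of_real (mollifier e (x - u))) \<in> test_functions"
  using test_functions_lincomb[OF bump_test_function[OF e, of u] test_functions_zero, of "1 / of_real (integral\<^sup>L lborel (bump 0 e))" 0]
  by (simp add: mollifier_alt)

text \<open>In one application \<open>G\<close> is the inner integral of a double integral, whence measurability
  instead of continuity.\<close>

lemma mollifier_average:
  fixes G :: "'a::euclidean_space \<Rightarrow> complex"
  assumes e: "e > 0" and G: "G \<in> borel_measurable borel"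
    and close: "\<And>x. dist x u \<le> e \<Longrightarrow> cmod (G x - a) \<le> k" and k: "k \<ge> 0"
  shows "integrable lborel (\<lambda>x. of_real (mollifier e (x - u)) * G x)"
    and "cmod ((LINT x|lborel. of_real (mollifier e (x - u)) * G x) - a) \<le> k"
proof -
  have mm: "(\<lambda>x. mollifier e (x - u)) \<in> borel_measurable borel"
    using mollifier_integrable[OF e, of u] by (simp add: borel_measurable_integrable)
  have i0: "integrable lborel (\<lambda>x. mollifier e (x - u))" by (rule mollifier_integrable[OF e])
  have b: "cmod (of_real (mollifier e (x - u)) * (G x - a)) \<le> mollifier e (x - u) * k" for x
  proof (cases "dist x u \<le> e")
    case True
    thus ?thesis using close[OF True] mollifier_nonneg[OF e, of "x - u"]
      by (simp add: norm_mult mult_left_mono)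
  next
    case False
    thus ?thesis using mollifier_eq_0[OF e, of x u] by simp
  qed
  have i1: "integrable lborel (\<lambda>x. of_real (mollifier e (x - u)) * (G x - a))"
  proof (rule Bochner_Integration.integrable_bound)
    show "integrable lborel (\<lambda>x. mollifier e (x - u) * k)" using i0 by simp
    show "(\<lambda>x. of_real (mollifier e (x - u)) * (G x - a)) \<in> borel_measurable lborel" using mm G by measurable
    show "AE x in lborel. norm (complex_of_real (mollifier e (x - u)) * (G x - a)) \<le> norm (mollifier e (x - u) * k)"
      by (intro AE_I2 order.trans[OF b]) simp
  qed
  have i2: "integrable lborel (\<lambda>x. complex_of_real (mollifier e (x - u)) * a)"
    using i0 by (intro integrable_mult_left integrable_of_real) auto
  have i3: "integrable lborel (\<lambda>x. of_real (mollifier e (x - u)) * (G x - a) + of_real (mollifier e (x - u)) * a)"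
    by (rule Bochner_Integration.integrable_add[OF i1 i2])
  thus "integrable lborel (\<lambda>x. of_real (mollifier e (x - u)) * G x)" by (simp add: algebra_simps)
  have "(LINT x|lborel. of_real (mollifier e (x - u)) * G x) =
      (LINT x|lborel. of_real (mollifier e (x - u)) * (G x - a) + of_real (mollifier e (x - u)) * a)"
    by (simp add: algebra_simps)
  also have "\<dots> = (LINT x|lborel. of_real (mollifier e (x - u)) * (G x - a)) + a"
    using i1 i2 mollifier_integral[OF e, of u]
    by (subst Bochner_Integration.integral_add) (simp_all add: mult.commute[of _ a])
  finally have "(LINT x|lborel. of_real (mollifier e (x - u)) * G x) - a = (LINT x|lborel. of_real (mollifier e (x - u)) * (G x - a))"
    by simp
  also have "cmod \<dots> \<le> (LINT x|lborel. cmod (of_real (mollifier e (x - u)) * (G x - a)))"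
    by (rule integral_norm_bound)
  also have "\<dots> \<le> (LINT x|lborel. mollifier e (x - u) * k)"
    by (rule Bochner_Integration.integral_mono) (use i1 i0 b in auto)
  also have "\<dots> = k" using mollifier_integral[OF e, of u] by simp
  finally show "cmod ((LINT x|lborel. of_real (mollifier e (x - u)) * G x) - a) \<le> k" .
qed

text \<open>The approximation of the point functional with coefficients \<open>\<sigma>\<close> by a test function.\<close>

definition smear :: "real \<Rightarrow> (real^'n::finite) set \<Rightarrow> (real^'n \<Rightarrow> complex) \<Rightarrow> real^'n \<Rightarrow> complex" where
  "smear e V \<sigma> x = (\<Sum>v\<in>V. \<sigma> v * of_real (mollifier e (x - v)))"

lemma smear_test_function:
  assumes e: "e > 0" shows "smear e V \<sigma> \<in> test_functions"
  unfolding smear_def[abs_def] by (intro test_functions_sum mollifier_test_function e)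

lemma smear_integral:
  assumes e: "e > 0" and F: "continuous_on UNIV F"
  shows "(LINT x|lborel. F x * smear e V \<sigma> x) = (\<Sum>v\<in>V. \<sigma> v * (LINT x|lborel. of_real (mollifier e (x - v)) * F x))"
proof -
  have i: "integrable lborel (\<lambda>x. of_real (mollifier e (x - v)) * F x)" for v
    using test_function_mult_integrable[OF mollifier_test_function[OF e] F] by (simp add: mult.commute)
  have eq: "F x * smear e V \<sigma> x = (\<Sum>v\<in>V. \<sigma> v * (of_real (mollifier e (x - v)) * F x))" for x
    unfolding smear_def sum_distrib_left by (simp only: mult_ac)
  show ?thesis unfolding eq
    by (subst Bochner_Integration.integral_sum, intro integrable_mult_right i, intro sum.cong refl, rule Bochner_Integration.integral_mult_right_zero)
qed

text \<open>Moments of a translate are polynomials in the translation, so that smearing preserves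
  the annihilation of polynomials.\<close>

lemma smear_ord:
  assumes e: "e > 0" and ann: "annihilates m V \<sigma>"
  shows "smear e V \<sigma> \<in> test_functions_ord m"
  unfolding test_functions_ord_def
proof (intro CollectI conjI allI impI smear_test_function[OF e])
  fix \<alpha> :: "'a \<Rightarrow> nat" assume \<alpha>: "sum \<alpha> UNIV < m"
  have mc: "continuous_on UNIV (\<lambda>x. complex_of_real (monomial_fun \<alpha> x))"
    by (intro continuous_intros continuous_on_monomial)
  have mb: "monomial_fun \<alpha> \<in> borel_measurable borel"
    by (intro borel_measurable_continuous_onI continuous_on_monomial)
  have tr: "continuous_on UNIV (\<lambda>x :: real^'a. monomial_fun \<alpha> (x + v))" for v
    by (rule continuous_on_compose2[OF continuous_on_monomial[of UNIV]]) (auto intro!: continuous_intros)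
  have mm: "mollifier e \<in> borel_measurable (borel :: (real^'a) measure)"
    using mollifier_integrable[OF e, of "0 :: real^'a"] by (simp add: borel_measurable_integrable)
  have i: "integrable lborel (\<lambda>x. of_real (mollifier e x) * complex_of_real (monomial_fun \<alpha> (x + v)))" for v
    using test_function_mult_integrable[OF mollifier_test_function[OF e, of 0], of "\<lambda>x. complex_of_real (monomial_fun \<alpha> (x + v))"] tr[of v]
    by (simp add: mult.commute continuous_intros)
  have "(LINT x|lborel. of_real (monomial_fun \<alpha> x) * smear e V \<sigma> x) =
     (\<Sum>v\<in>V. \<sigma> v * (LINT x|lborel. of_real (mollifier e (x - v)) * of_real (monomial_fun \<alpha> x)))"
    by (rule smear_integral[OF e mc])
  also have "\<dots> = (\<Sum>v\<in>V. \<sigma> v * (LINT x|lborel. of_real (mollifier e x) * of_real (monomial_fun \<alpha> (x + v))))"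
  proof (intro sum.cong refl arg_cong[where f="\<lambda>x. _ * x"])
    fix v
    have "(LINT x|lborel. of_real (mollifier e (v + x - v)) * complex_of_real (monomial_fun \<alpha> (v + x))) =
      (LINT x|lborel. of_real (mollifier e (x - v)) * of_real (monomial_fun \<alpha> x))"
      by (rule lborel_integral_translate) (use mm mb in measurable)
    thus "(LINT x|lborel. of_real (mollifier e (x - v)) * complex_of_real (monomial_fun \<alpha> x)) =
      (LINT x|lborel. of_real (mollifier e x) * of_real (monomial_fun \<alpha> (x + v)))"
      by (simp add: add.commute)
  qed
  also have "\<dots> = (LINT x|lborel. (\<Sum>v\<in>V. \<sigma> v * (of_real (mollifier e x) * of_real (monomial_fun \<alpha> (x + v)))))"
    by (subst Bochner_Integration.integral_sum, intro integrable_mult_right i, intro sum.cong refl, rule Bochner_Integration.integral_mult_right_zero[symmetric])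
  also have "(\<lambda>x. \<Sum>v\<in>V. \<sigma> v * (of_real (mollifier e x) * of_real (monomial_fun \<alpha> (x + v)))) = (\<lambda>x. 0)"
  proof
    fix x :: "real^'a"
    have "(\<Sum>v\<in>V. \<sigma> v * of_real (monomial_fun \<alpha> (x + v))) = 0"
      by (rule annihilates_real_polys[OF ann real_polys_monomial_translate \<alpha>])
    hence "of_real (mollifier e x) * (\<Sum>v\<in>V. \<sigma> v * of_real (monomial_fun \<alpha> (x + v))) = 0" by simp
    thus "(\<Sum>v\<in>V. \<sigma> v * (of_real (mollifier e x) * of_real (monomial_fun \<alpha> (x + v)))) = 0"
      unfolding sum_distrib_left by (simp only: mult_ac)
  qed
  finally show "(LINT x|lborel. of_real (monomial_fun \<alpha> x) * smear e V \<sigma> x) = 0" by simp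
qed

lemma smear_form:
  fixes h :: "real^'n::finite \<Rightarrow> real"
  assumes e: "e > 0" and h: "continuous_on UNIV h" and k: "k \<ge> 0"
    and close: "\<And>u v x y. u \<in> V \<Longrightarrow> v \<in> V \<Longrightarrow> dist x u \<le> e \<Longrightarrow> dist y v \<le> e \<Longrightarrow> \<bar>h (x - y) - h (u - v)\<bar> \<le> k"
  shows "\<bar>h_form h (smear e V \<sigma>) - Re (kernel_form h V \<sigma> \<sigma>)\<bar> \<le> k * (\<Sum>v\<in>V. cmod (\<sigma> v))\<^sup>2"
proof -
  define H where "H v x = (LINT y|lborel. of_real (mollifier e (y - v)) * complex_of_real (h (x - y)))" for v x :: "real^'n"
  have hb: "h \<in> borel_measurable borel" using h by (rule borel_measurable_continuous_onI)
  have mm: "mollifier e \<in> borel_measurable (borel :: (real^'n) measure)"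
    using mollifier_integrable[OF e, of "0 :: real^'n"] by (simp add: borel_measurable_integrable)
  have hx: "continuous_on UNIV (\<lambda>y. complex_of_real (h (x - y)))" for x
    by (intro continuous_intros continuous_on_compose2[OF h]) auto
  have Hm: "H v \<in> borel_measurable borel" for v
    unfolding H_def[abs_def] using hb mm by measurable
  have H1: "cmod (H v x - of_real (h (u - v))) \<le> k" if "u \<in> V" "v \<in> V" "dist x u \<le> e" for u v x
    unfolding H_def
    by (rule mollifier_average(2)[OF e])
       (use hx close[OF that] k in \<open>auto intro: borel_measurable_continuous_onI simp flip: of_real_diff\<close>)
  have H2: "integrable lborel (\<lambda>x. of_real (mollifier e (x - u)) * H v x)"
    "cmod ((LINT x|lborel. of_real (mollifier e (x - u)) * H v x) - of_real (h (u - v))) \<le> k"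
    if "u \<in> V" "v \<in> V" for u v
    using mollifier_average[OF e Hm[of v], of u "of_real (h (u - v))" k] H1 that k by auto
  have inner: "(LINT y|lborel. of_real (h (x - y)) * smear e V \<sigma> x * cnj (smear e V \<sigma> y)) =
     (\<Sum>u\<in>V. \<Sum>v\<in>V. \<sigma> u * cnj (\<sigma> v) * (of_real (mollifier e (x - u)) * H v x))" for x
  proof -
    have cs: "cnj (smear e V \<sigma> y) = smear e V (\<lambda>v. cnj (\<sigma> v)) y" for y
      by (simp add: smear_def)
    have "(LINT y|lborel. of_real (h (x - y)) * smear e V \<sigma> x * cnj (smear e V \<sigma> y)) =
       (LINT y|lborel. smear e V \<sigma> x * (of_real (h (x - y)) * smear e V (\<lambda>v. cnj (\<sigma> v)) y))"
      unfolding cs by (simp only: mult_ac)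
    also have "\<dots> = smear e V \<sigma> x * (\<Sum>v\<in>V. cnj (\<sigma> v) * H v x)"
      unfolding H_def smear_integral[OF e hx, symmetric] by (rule Bochner_Integration.integral_mult_right_zero)
    finally show ?thesis unfolding smear_def sum_product by (simp only: mult_ac)
  qed
  have "(LINT x|lborel. LINT y|lborel. of_real (h (x - y)) * smear e V \<sigma> x * cnj (smear e V \<sigma> y)) =
     (\<Sum>u\<in>V. \<Sum>v\<in>V. \<sigma> u * cnj (\<sigma> v) * (LINT x|lborel. of_real (mollifier e (x - u)) * H v x))"
    unfolding inner
    by (subst Bochner_Integration.integral_sum, intro Bochner_Integration.integrable_sum integrable_mult_right H2(1),
        assumption, assumption,
        intro sum.cong refl, subst Bochner_Integration.integral_sum, intro integrable_mult_right H2(1), assumption, assumption,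
        intro sum.cong refl, rule Bochner_Integration.integral_mult_right_zero)
  hence "(LINT x|lborel. LINT y|lborel. of_real (h (x - y)) * smear e V \<sigma> x * cnj (smear e V \<sigma> y)) - kernel_form h V \<sigma> \<sigma> =
     (\<Sum>u\<in>V. \<Sum>v\<in>V. \<sigma> u * cnj (\<sigma> v) * ((LINT x|lborel. of_real (mollifier e (x - u)) * H v x) - of_real (h (u - v))))"
    by (simp add: kernel_form_def sum_subtractf right_diff_distrib)
  also have "cmod \<dots> \<le> (\<Sum>u\<in>V. \<Sum>v\<in>V. cmod (\<sigma> u) * cmod (\<sigma> v) * k)"
    using H2(2) by (intro order.trans[OF norm_sum] sum_mono) (simp add: norm_mult mult_left_mono)
  also have "\<dots> = k * (\<Sum>v\<in>V. cmod (\<sigma> v))\<^sup>2"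
    by (simp add: power2_eq_square sum_product sum_distrib_left mult_ac)
  finally have "cmod ((LINT x|lborel. LINT y|lborel. of_real (h (x - y)) * smear e V \<sigma> x * cnj (smear e V \<sigma> y)) - kernel_form h V \<sigma> \<sigma>)
     \<le> k * (\<Sum>v\<in>V. cmod (\<sigma> v))\<^sup>2" .
  from order.trans[OF abs_Re_le_cmod this] show ?thesis unfolding h_form_def by simp
qed

text \<open>Both sides of the defining inequality of the native space, taken at a smeared point
  functional, converge as the width of the mollifier tends to \<open>0\<close>, by continuity of \<open>f\<close> and
  \<open>h\<close>.\<close>

lemma native_point_functional_bound:
  fixes h :: "real^'n::finite \<Rightarrow> real"
  assumes f: "continuous_on UNIV f" and hb: "h_bound h m f K" and h: "continuous_on UNIV h"
    and fin: "finite V" and ann: "annihilates m V \<sigma>"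
  shows "cmod (\<Sum>v\<in>V. \<sigma> v * f v) \<le> K * sqrt (Re (kernel_form h V \<sigma> \<sigma>))"
proof -
  define S where "S = (\<Sum>v\<in>V. cmod (\<sigma> v))"
  have S: "S \<ge> 0" unfolding S_def by (intro sum_nonneg) auto
  have K: "K \<ge> 0" using hb by (simp add: h_bound_def)
  have main: "cmod (\<Sum>v\<in>V. \<sigma> v * f v) \<le> k * S + K * sqrt (Re (kernel_form h V \<sigma> \<sigma>) + k * S\<^sup>2)" if k: "k > 0" for k
  proof -
    have e1: "eventually (\<lambda>e. \<forall>v\<in>V. \<forall>x. dist x v \<le> e \<longrightarrow> cmod (f x - f v) \<le> k) (at_right 0)"
    proof (rule eventually_ball_finite[OF fin], rule ballI)
      fix v
      obtain d where d: "d > 0" "\<And>x. dist x v < d \<Longrightarrow> dist (f x) (f v) < k"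
        using f k unfolding continuous_on_iff by fastforce
      show "eventually (\<lambda>e. \<forall>x. dist x v \<le> e \<longrightarrow> cmod (f x - f v) \<le> k) (at_right 0)"
        unfolding eventually_at_right_field
      proof (intro exI[of _ d] conjI allI impI)
        fix e x assume "0 < e" "e < d" "dist x v \<le> e"
        hence "dist (f x) (f v) < k" by (intro d) simp
        thus "cmod (f x - f v) \<le> k" by (simp add: dist_norm)
      qed (use d in auto)
    qed
    have e2: "eventually (\<lambda>e. \<forall>u\<in>V. \<forall>v\<in>V. \<forall>x y. dist x u \<le> e \<longrightarrow> dist y v \<le> e \<longrightarrow> \<bar>h (x - y) - h (u - v)\<bar> \<le> k) (at_right 0)"
    proof (intro eventually_ball_finite[OF fin] ballI)
      fix u v
      obtain d where d: "d > 0" "\<And>x. dist x (u - v) < d \<Longrightarrow> dist (h x) (h (u - v)) < k"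
        using h k unfolding continuous_on_iff by fastforce
      show "eventually (\<lambda>e. \<forall>x y. dist x u \<le> e \<longrightarrow> dist y v \<le> e \<longrightarrow> \<bar>h (x - y) - h (u - v)\<bar> \<le> k) (at_right 0)"
        unfolding eventually_at_right_field
      proof (intro exI[of _ "d / 2"] conjI allI impI)
        fix e x y assume a: "0 < e" "e < d / 2" "dist x u \<le> e" "dist y v \<le> e"
        have "dist (x - y) (u - v) \<le> dist x u + dist y v"
          using norm_triangle_ineq4[of "x - u" "y - v"] by (simp add: dist_norm algebra_simps)
        hence "dist (h (x - y)) (h (u - v)) < k" using a by (intro d) simp
        thus "\<bar>h (x - y) - h (u - v)\<bar> \<le> k" by (simp add: dist_real_def)
      qed (use d in auto)
    qed
    have e3: "eventually (\<lambda>e :: real. e > 0) (at_right 0)" by (rule eventually_at_right_less)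
    obtain e where e: "e > 0" "\<And>v x. v \<in> V \<Longrightarrow> dist x v \<le> e \<Longrightarrow> cmod (f x - f v) \<le> k"
      "\<And>u v x y. u \<in> V \<Longrightarrow> v \<in> V \<Longrightarrow> dist x u \<le> e \<Longrightarrow> dist y v \<le> e \<Longrightarrow> \<bar>h (x - y) - h (u - v)\<bar> \<le> k"
      using eventually_happens[OF eventually_conj[OF e1 eventually_conj[OF e2 e3]]] by auto
    have "cmod (LINT x|lborel. f x * smear e V \<sigma> x) \<le> K * sqrt (h_form h (smear e V \<sigma>))"
      using hb smear_ord[OF e(1) ann] unfolding h_bound_def by blast
    also have "\<dots> \<le> K * sqrt (Re (kernel_form h V \<sigma> \<sigma>) + k * S\<^sup>2)"
      using smear_form[OF e(1) h _ e(3), of V \<sigma>] k K unfolding S_def[symmetric]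
      by (intro mult_left_mono) auto
    finally have 1: "cmod (LINT x|lborel. f x * smear e V \<sigma> x) \<le> K * sqrt (Re (kernel_form h V \<sigma> \<sigma>) + k * S\<^sup>2)" .
    have fb: "f \<in> borel_measurable borel" using f by (rule borel_measurable_continuous_onI)
    have "cmod ((\<Sum>v\<in>V. \<sigma> v * f v) - (LINT x|lborel. f x * smear e V \<sigma> x)) =
       cmod (\<Sum>v\<in>V. \<sigma> v * (f v - (LINT x|lborel. of_real (mollifier e (x - v)) * f x)))"
      unfolding smear_integral[OF e(1) f] by (simp add: sum_subtractf right_diff_distrib)
    also have "\<dots> \<le> (\<Sum>v\<in>V. cmod (\<sigma> v) * k)"
    proof (intro order.trans[OF norm_sum] sum_mono)
      fix v assume "v \<in> V"
      hence "cmod ((LINT x|lborel. of_real (mollifier e (x - v)) * f x) - f v) \<le> k"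
        using k by (intro mollifier_average(2)[OF e(1) fb] e(2)) auto
      thus "cmod (\<sigma> v * (f v - (LINT x|lborel. of_real (mollifier e (x - v)) * f x))) \<le> cmod (\<sigma> v) * k"
        unfolding norm_mult by (intro mult_left_mono) (auto simp: norm_minus_commute)
    qed
    also have "\<dots> = k * S" by (simp add: S_def sum_distrib_left mult.commute)
    finally have "cmod ((\<Sum>v\<in>V. \<sigma> v * f v) - (LINT x|lborel. f x * smear e V \<sigma> x)) \<le> k * S" .
    thus ?thesis using 1 norm_triangle_sub[of "\<Sum>v\<in>V. \<sigma> v * f v" "LINT x|lborel. f x * smear e V \<sigma> x"] by linarith
  qed
  have lim: "((\<lambda>k. k * S + K * sqrt (Re (kernel_form h V \<sigma> \<sigma>) + k * S\<^sup>2)) \<longlongrightarrow>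
      0 * S + K * sqrt (Re (kernel_form h V \<sigma> \<sigma>) + 0 * S\<^sup>2)) (at_right 0)"
    by (intro tendsto_intros)
  have "cmod (\<Sum>v\<in>V. \<sigma> v * f v) \<le> 0 * S + K * sqrt (Re (kernel_form h V \<sigma> \<sigma>) + 0 * S\<^sup>2)"
    by (rule tendsto_lowerbound[OF lim])
       (use main in \<open>auto simp: eventually_at_right_field intro!: exI[of _ 1]\<close>)
  thus ?thesis by simp
qed

section \<open>Fourier transforms of test functions\<close>

lemma fubini_dominated:
  fixes f :: "'a::euclidean_space \<Rightarrow> 'b::euclidean_space \<Rightarrow> complex" and a :: "'a \<Rightarrow> real" and b :: "'b \<Rightarrow> real"
  assumes f: "(\<lambda>(x, y). f x y) \<in> borel_measurable (lborel \<Otimes>\<^sub>M lborel)"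
    and bd: "\<And>x y. cmod (f x y) \<le> a x * b y"
    and a: "integrable lborel a" and b: "integrable lborel b"
    and nn: "\<And>x. 0 \<le> a x" "\<And>y. 0 \<le> b y"
  shows "(LINT x|lborel. LINT y|lborel. f x y) = (LINT y|lborel. LINT x|lborel. f x y)"
    and "integrable lborel (\<lambda>x. LINT y|lborel. f x y)"
    and "integrable lborel (\<lambda>y. LINT x|lborel. f x y)"
    and "integrable lborel (\<lambda>y. f x y)"
proof -
  have am[measurable]: "a \<in> borel_measurable borel" and bm[measurable]: "b \<in> borel_measurable borel"
    using a b by auto
  have ab: "integrable (lborel \<Otimes>\<^sub>M lborel) (\<lambda>(x, y). a x * b y)"
  proof (rule lborel_pair.Fubini_integrable)
    show "(\<lambda>(x, y). a x * b y) \<in> borel_measurable (lborel \<Otimes>\<^sub>M lborel)" by measurable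
    have "(\<lambda>x. LINT y|lborel. norm (case (x, y) of (x, y) \<Rightarrow> a x * b y)) = (\<lambda>x. a x * integral\<^sup>L lborel b)"
      using nn by (simp add: abs_mult)
    thus "integrable lborel (\<lambda>x. LINT y|lborel. norm (case (x, y) of (x, y) \<Rightarrow> a x * b y))"
      using a by simp
    show "AE x in lborel. integrable lborel (\<lambda>y. case (x, y) of (x, y) \<Rightarrow> a x * b y)" using b by simp
  qed
  have i: "integrable (lborel \<Otimes>\<^sub>M lborel) (\<lambda>(x, y). f x y)"
    by (rule Bochner_Integration.integrable_bound[OF ab f]) (use bd nn in \<open>auto simp: abs_mult\<close>)
  show "(LINT x|lborel. LINT y|lborel. f x y) = (LINT y|lborel. LINT x|lborel. f x y)"
    using lborel_pair.Fubini_integral[OF i] by simp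
  show "integrable lborel (\<lambda>x. LINT y|lborel. f x y)" using lborel_pair.integrable_fst[OF i] by simp
  show "integrable lborel (\<lambda>y. LINT x|lborel. f x y)" using lborel_pair.integrable_snd[OF i] by simp
  have "(\<lambda>y. f x y) \<in> borel_measurable lborel" using measurable_Pair2[OF f, of x] by simp
  thus "integrable lborel (\<lambda>y. f x y)"
  proof (rule Bochner_Integration.integrable_bound[rotated])
    show "integrable lborel (\<lambda>y. a x * b y)" by (intro integrable_mult_right b)
    show "AE y in lborel. norm (f x y) \<le> norm (a x * b y)"
      using bd nn by (intro AE_I2) (simp add: abs_mult)
  qed
qed

text \<open>Difference quotients of \<open>g\<close> have integral \<open>0\<close> by translation invariance and converge
  dominatedly.\<close>

lemma integral_directional_derivative_eq_0:
  fixes g :: "'a::euclidean_space \<Rightarrow> complex"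
  assumes d: "\<And>x. (g has_derivative g' x) (at x)" and c: "continuous_on UNIV (\<lambda>x. g' x v)"
    and bs: "bounded {x. g x \<noteq> 0}"
  shows "(LINT x|lborel. g' x v) = 0"
proof -
  obtain R where R: "R > 0" "\<And>x. g x \<noteq> 0 \<Longrightarrow> norm x \<le> R"
    using bs by (auto simp: bounded_pos)
  have gc: "continuous_on A g" for A
    using d by (auto intro!: continuous_at_imp_continuous_on has_derivative_continuous)
  have gz: "g' x v = 0" if x: "norm x > R" for x
  proof -
    have "eventually (\<lambda>y. y \<in> - cball 0 R) (nhds x)"
      using x by (intro eventually_nhds_in_open) auto
    hence "eventually (\<lambda>y. g y = 0) (nhds x)" by eventually_elim (use R in force)
    hence "(g has_derivative (\<lambda>_. 0)) (at x)"
      by (intro has_derivative_transform_eventually[OF has_derivative_const[of 0]])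
         (use R(2)[of x] x in \<open>auto simp: eventually_at_filter elim!: eventually_mono\<close>)
    hence "g' x = (\<lambda>_. 0)" using d has_derivative_unique by blast
    thus ?thesis by simp
  qed
  obtain B where B: "B \<ge> 0" "\<And>x. cmod (g' x v) \<le> B"
  proof -
    have "compact ((\<lambda>x. g' x v) ` cball 0 R)"
      by (intro compact_continuous_image continuous_on_subset[OF c]) auto
    hence "bounded ((\<lambda>x. g' x v) ` cball 0 R)" by (rule compact_imp_bounded)
    then obtain B where B: "B > 0" "\<And>x. norm x \<le> R \<Longrightarrow> cmod (g' x v) \<le> B"
      unfolding bounded_pos by auto
    have "cmod (g' x v) \<le> B" for x
      using B gz[of x] by (cases "norm x \<le> R") auto
    thus thesis using that[of B] B by simp
  qed
  define D where "D k x = of_nat (Suc k) * (g (x + (1 / real (Suc k)) *\<^sub>R v) - g x)" for k x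
  have gi: "integrable lborel g"
  proof -
    have "integrable lborel (\<lambda>x. indicator (cball 0 R) x *\<^sub>R g x)"
      by (intro borel_integrable_compact gc) auto
    moreover have "indicator (cball 0 R) x *\<^sub>R g x = g x" for x
      using R(2)[of x] by (auto simp: indicator_def)
    ultimately show ?thesis by simp
  qed
  have gb: "g \<in> borel_measurable borel" by (rule borel_measurable_continuous_onI[OF gc])
  have git: "integrable lborel (\<lambda>x. g (x + w))" for w
  proof -
    have "integrable (distr lborel borel ((+) w)) g" using gi by (simp add: lborel_distr_plus)
    hence "integrable lborel (\<lambda>x. g (w + x))" using gb by (subst (asm) integrable_distr_eq) auto
    thus ?thesis by (simp add: add.commute)
  qed
  have I0: "(LINT x|lborel. D k x) = 0" for k
  proof -
    have "(LINT x|lborel. g ((1 / real (Suc k)) *\<^sub>R v + x)) = integral\<^sup>L lborel g"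
      by (rule lborel_integral_translate[OF gb])
    thus ?thesis unfolding D_def using git[of "(1 / real (Suc k)) *\<^sub>R v"] gi
      by (simp add: add.commute)
  qed
  have "(\<lambda>k. LINT x|lborel. D k x) \<longlonglongrightarrow> (LINT x|lborel. g' x v)"
  proof (rule integral_dominated_convergence[where w="\<lambda>x. B * indicator (cball 0 (R + norm v)) x"])
    show "(\<lambda>x. g' x v) \<in> borel_measurable lborel" using borel_measurable_continuous_onI[OF c] by simp
    show "D k \<in> borel_measurable lborel" for k unfolding D_def[abs_def] using gb by measurable
    show "integrable lborel (\<lambda>x. B * indicator (cball 0 (R + norm v)) x)"
      by (intro integrable_mult_right) (auto intro!: integrable_real_indicator emeasure_bounded_finite)
    show "AE x in lborel. (\<lambda>k. D k x) \<longlonglongrightarrow> g' x v"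
    proof (rule AE_I2)
      fix x
      have dl: "((\<lambda>s. g (x + s *\<^sub>R v)) has_derivative (\<lambda>s. g' (x + 0 *\<^sub>R v) (s *\<^sub>R v))) (at 0)"
        by (rule has_derivative_compose[OF _ d]) (auto intro!: derivative_eq_intros)
      hence "((\<lambda>s. g (x + s *\<^sub>R v)) has_vector_derivative g' x v) (at 0)"
        unfolding has_vector_derivative_def
        using linear_scale[OF has_derivative_linear[OF d[of x]]] by simp
      hence "((\<lambda>s. (g (x + s *\<^sub>R v) - g x) /\<^sub>R s) \<longlongrightarrow> g' x v) (at 0)"
      proof -
        assume "((\<lambda>s. g (x + s *\<^sub>R v)) has_vector_derivative g' x v) (at 0)"
        hence t: "(\<lambda>s. norm (g (x + s *\<^sub>R v) - g x - s *\<^sub>R g' x v) / \<bar>s\<bar>) \<midarrow>0\<rightarrow> 0"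
          by (simp add: has_vector_derivative_def has_derivative_at)
        have "norm ((g (x + s *\<^sub>R v) - g x) /\<^sub>R s - g' x v) = norm (g (x + s *\<^sub>R v) - g x - s *\<^sub>R g' x v) / \<bar>s\<bar>"
          if "s \<noteq> 0" for s
        proof -
          have "(g (x + s *\<^sub>R v) - g x) /\<^sub>R s - g' x v = (g (x + s *\<^sub>R v) - g x - s *\<^sub>R g' x v) /\<^sub>R s"
            using that by (simp add: scaleR_right_diff_distrib)
          thus ?thesis by (simp only: norm_scaleR) (simp add: divide_inverse mult.commute)
        qed
        note eq = this
        have "eventually (\<lambda>s. norm (g (x + s *\<^sub>R v) - g x - s *\<^sub>R g' x v) / \<bar>s\<bar> =
            norm ((g (x + s *\<^sub>R v) - g x) /\<^sub>R s - g' x v)) (at 0)"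
          unfolding eventually_at_filter by (intro always_eventually allI impI) (rule eq[symmetric])
        from Lim_transform_eventually[OF t this]
        have "(\<lambda>s. norm ((g (x + s *\<^sub>R v) - g x) /\<^sub>R s - g' x v)) \<midarrow>0\<rightarrow> 0" .
        thus ?thesis by (rule LIM_zero_cancel[OF tendsto_norm_zero_cancel])
      qed
      moreover have "filterlim (\<lambda>k. 1 / real (Suc k)) (at 0) sequentially"
        unfolding filterlim_at using LIMSEQ_inverse_real_of_nat by (simp add: inverse_eq_divide)
      ultimately have "(\<lambda>k. (g (x + (1 / real (Suc k)) *\<^sub>R v) - g x) /\<^sub>R (1 / real (Suc k))) \<longlonglongrightarrow> g' x v"
        by (rule filterlim_compose)
      thus "(\<lambda>k. D k x) \<longlonglongrightarrow> g' x v" by (simp add: D_def scaleR_conv_of_real)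
    qed
    show "AE x in lborel. norm (D k x) \<le> B * indicator (cball 0 (R + norm v)) x" for k
    proof (rule AE_I2)
      fix x
      define s where "s = 1 / real (Suc k)"
      have s: "0 < s" "s \<le> 1" by (auto simp: s_def)
      show "norm (D k x) \<le> B * indicator (cball 0 (R + norm v)) x"
      proof (cases "norm x \<le> R + norm v")
        case True
        have "\<exists>\<xi>\<in>{0<..<s}. norm (g (x + s *\<^sub>R v) - g (x + 0 *\<^sub>R v)) \<le> norm (g' (x + \<xi> *\<^sub>R v) ((s - 0) *\<^sub>R v))"
        proof (rule mvt_general[OF s(1)])
          show "continuous_on {0..s} (\<lambda>s. g (x + s *\<^sub>R v))"
            by (rule continuous_on_compose2[OF gc[of UNIV]]) (auto intro!: continuous_intros)
          fix r show "((\<lambda>s. g (x + s *\<^sub>R v)) has_derivative (\<lambda>s. g' (x + r *\<^sub>R v) (s *\<^sub>R v))) (at r)"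
            by (rule has_derivative_compose[OF _ d]) (auto intro!: derivative_eq_intros)
        qed
        then obtain \<xi> where "norm (g (x + s *\<^sub>R v) - g x) \<le> norm (g' (x + \<xi> *\<^sub>R v) (s *\<^sub>R v))" by auto
        also have "g' (x + \<xi> *\<^sub>R v) (s *\<^sub>R v) = s *\<^sub>R g' (x + \<xi> *\<^sub>R v) v"
          by (rule linear_scale[OF has_derivative_linear[OF d]])
        also have "norm (s *\<^sub>R g' (x + \<xi> *\<^sub>R v) v) \<le> s * B" using B s by simp
        finally have "real (Suc k) * norm (g (x + s *\<^sub>R v) - g x) \<le> real (Suc k) * (s * B)"
          by (intro mult_left_mono) auto
        also have "\<dots> = B" by (simp add: s_def)
        finally show ?thesis using True unfolding D_def s_def[symmetric] norm_mult norm_of_nat by simp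
      next
        case False
        have "norm (s *\<^sub>R v) \<le> norm v" using s by (simp add: mult_left_le_one_le)
        hence "norm (x + s *\<^sub>R v) > R" using False norm_triangle_ineq4[of "x + s *\<^sub>R v" "s *\<^sub>R v"] by simp
        moreover have "norm x > R" using False norm_ge_zero[of v] by linarith
        ultimately have "g (x + s *\<^sub>R v) = 0" "g x = 0" using R(2) by (meson not_less)+
        thus ?thesis using False unfolding D_def s_def[symmetric] by simp
      qed
    qed
  qed
  hence "(\<lambda>k. 0) \<longlonglongrightarrow> (LINT x|lborel. g' x v)" unfolding I0 .
  thus ?thesis using LIMSEQ_unique tendsto_const by metis
qed

lemma test_function_derivative:
  assumes "\<phi> \<in> test_functions"
  obtains \<phi>' where "\<And>x. (\<phi> has_derivative \<phi>' x) (at x)" "\<And>v. (\<lambda>x. \<phi>' x v) \<in> test_functions"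
proof (rule that)
  have cd: "cont_diff (Suc k) \<phi>" for k using assms by (simp only: test_functions_def mem_Collect_eq)
  show d: "(\<phi> has_derivative frechet_derivative \<phi> (at x)) (at x)" for x
    using cd[of 0] by (simp add: frechet_derivative_works)
  fix v
  have "cont_diff k (\<lambda>x. frechet_derivative \<phi> (at x) v)" for k using cd[of k] by simp
  moreover have "bounded {x. frechet_derivative \<phi> (at x) v \<noteq> 0}"
  proof (rule bounded_subset)
    show "bounded (supp \<phi>)" using assms by (auto simp: test_functions_def intro: compact_imp_bounded)
    show "{x. frechet_derivative \<phi> (at x) v \<noteq> 0} \<subseteq> supp \<phi>"
    proof (rule ccontr)
      assume "\<not> ?thesis"
      then obtain x where x: "frechet_derivative \<phi> (at x) v \<noteq> 0" "x \<notin> supp \<phi>" by blast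
      have "eventually (\<lambda>y. y \<in> - supp \<phi>) (nhds x)"
        using x by (intro eventually_nhds_in_open) (auto simp: supp_def)
      hence "eventually (\<lambda>y. \<phi> y = 0) (nhds x)"
        by eventually_elim (use closure_subset[of "{x. \<phi> x \<noteq> 0}"] in \<open>auto simp: supp_def\<close>)
      moreover have "\<phi> x = 0" using eventually_nhds_x_imp_x[OF calculation] .
      ultimately have "(\<phi> has_derivative (\<lambda>_. 0)) (at x)"
        by (intro has_derivative_transform_eventually[OF has_derivative_const[of 0]])
           (auto simp: eventually_at_filter elim!: eventually_mono)
      hence "frechet_derivative \<phi> (at x) = (\<lambda>_. 0)" using d has_derivative_unique by blast
      thus False using x by simp
    qed
  qed
  ultimately show "(\<lambda>x. frechet_derivative \<phi> (at x) v) \<in> test_functions"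
    by (simp add: test_functions_def compact_supp_iff_bounded)
qed

lemma fourier_integrand_integrable:
  assumes "\<phi> \<in> test_functions"
  shows "integrable lborel (\<lambda>x. exp (- \<i> * of_real (x \<bullet> \<xi>)) * \<phi> x)"
  by (intro test_function_mult_integrable assms continuous_intros)

lemma fourier_lincomb:
  assumes "\<phi> \<in> test_functions" "\<zeta> \<in> test_functions"
  shows "fourier (\<lambda>x. a * \<phi> x + b * \<zeta> x) \<xi> = a * fourier \<phi> \<xi> + b * fourier \<zeta> \<xi>"
proof -
  have "exp (- \<i> * of_real (x \<bullet> \<xi>)) * (a * \<phi> x + b * \<zeta> x) =
     a * (exp (- \<i> * of_real (x \<bullet> \<xi>)) * \<phi> x) + b * (exp (- \<i> * of_real (x \<bullet> \<xi>)) * \<zeta> x)" for x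
    by (simp add: algebra_simps)
  hence "fourier (\<lambda>x. a * \<phi> x + b * \<zeta> x) \<xi> =
     (LINT x|lborel. a * (exp (- \<i> * of_real (x \<bullet> \<xi>)) * \<phi> x) + b * (exp (- \<i> * of_real (x \<bullet> \<xi>)) * \<zeta> x))"
    unfolding fourier_def by presburger
  also have "\<dots> = a * fourier \<phi> \<xi> + b * fourier \<zeta> \<xi>" unfolding fourier_def
    by (subst Bochner_Integration.integral_add; (intro integrable_mult_right fourier_integrand_integrable assms)?)
       (simp only: Bochner_Integration.integral_mult_right_zero)
  finally show ?thesis .
qed

lemma fourier_derivative:
  assumes \<phi>: "\<phi> \<in> test_functions" and d: "\<And>x. (\<phi> has_derivative \<phi>' x) (at x)" and t: "(\<lambda>x. \<phi>' x v) \<in> test_functions"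
  shows "fourier (\<lambda>x. \<phi>' x v) \<xi> = \<i> * of_real (v \<bullet> \<xi>) * fourier \<phi> \<xi>"
proof -
  define E where "E x = exp (- \<i> * complex_of_real (x \<bullet> \<xi>))" for x :: 'a
  define g' where "g' x w = E x * \<phi>' x w + (- \<i> * of_real (w \<bullet> \<xi>) * E x) * \<phi> x" for x w
  have E': "(E has_derivative (\<lambda>w. - \<i> * of_real (w \<bullet> \<xi>) * E x)) (at x)" for x
  proof -
    have "((\<lambda>x. - \<i> * complex_of_real (x \<bullet> \<xi>)) has_derivative (\<lambda>w. - \<i> * complex_of_real (w \<bullet> \<xi>))) (at x)"
      by (intro has_derivative_mult_right has_derivative_of_real has_derivative_inner_left has_derivative_ident)
    from has_derivative_compose[OF this DERIV_exp[unfolded has_field_derivative_def]]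
    show ?thesis unfolding E_def by (simp add: mult.commute)
  qed
  have Ec: "continuous_on UNIV E" unfolding E_def by (intro continuous_intros)
  have "(LINT x|lborel. g' x v) = 0"
  proof (rule integral_directional_derivative_eq_0)
    show "((\<lambda>x. E x * \<phi> x) has_derivative g' x) (at x)" for x
      unfolding g'_def by (rule has_derivative_mult[OF E' d])
    show "continuous_on UNIV (\<lambda>x. g' x v)" unfolding g'_def
      by (intro continuous_intros Ec test_function_continuous \<phi> t)
    have "bounded {x. \<phi> x \<noteq> 0}" using \<phi> by (simp add: test_functions_def compact_supp_iff_bounded)
    thus "bounded {x. E x * \<phi> x \<noteq> 0}" by (rule bounded_subset) auto
  qed
  also have "(\<lambda>x. g' x v) = (\<lambda>x. E x * \<phi>' x v + (- \<i> * of_real (v \<bullet> \<xi>)) * (E x * \<phi> x))"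
    by (simp add: g'_def fun_eq_iff)
  also have "(LINT x|lborel. E x * \<phi>' x v + (- \<i> * of_real (v \<bullet> \<xi>)) * (E x * \<phi> x)) =
      fourier (\<lambda>x. \<phi>' x v) \<xi> + (- \<i> * of_real (v \<bullet> \<xi>)) * fourier \<phi> \<xi>"
    unfolding fourier_def E_def
    by (subst Bochner_Integration.integral_add; (intro integrable_mult_right fourier_integrand_integrable \<phi> t)?)
       (simp only: Bochner_Integration.integral_mult_right_zero)
  finally show ?thesis by (simp add: algebra_simps)
qed

text \<open>Polynomials have this property, since differentiation of a test function multiplies its
  transform by a coordinate. Together with the trivial bound by the \<open>L\<^sup>1\<close> norm this gives the
  decay of the transform.\<close>

definition fourier_multiplier :: "('a::euclidean_space \<Rightarrow> real) \<Rightarrow> bool" where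
  "fourier_multiplier q \<longleftrightarrow> (\<forall>\<phi>\<in>test_functions. \<exists>\<zeta>\<in>test_functions. \<forall>\<xi>. of_real (q \<xi>) * fourier \<phi> \<xi> = fourier \<zeta> \<xi>)"

lemma fourier_multiplier_const: "fourier_multiplier (\<lambda>_. c)"
  unfolding fourier_multiplier_def
proof
  fix \<phi> :: "'a \<Rightarrow> complex" assume \<phi>: "\<phi> \<in> test_functions"
  show "\<exists>\<zeta>\<in>test_functions. \<forall>\<xi>. complex_of_real c * fourier \<phi> \<xi> = fourier \<zeta> \<xi>"
    by (rule bexI[OF _ test_functions_lincomb[OF \<phi> \<phi>, of "of_real c" 0]])
       (simp only: fourier_lincomb[OF \<phi> \<phi>], simp)
qed

lemma fourier_multiplier_inner: "fourier_multiplier (\<lambda>\<xi>. v \<bullet> \<xi>)"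
  unfolding fourier_multiplier_def
proof
  fix \<phi> :: "'a \<Rightarrow> complex" assume \<phi>: "\<phi> \<in> test_functions"
  obtain \<phi>' where d: "\<And>x. (\<phi> has_derivative \<phi>' x) (at x)" "\<And>v. (\<lambda>x. \<phi>' x v) \<in> test_functions"
    using test_function_derivative[OF \<phi>] by blast
  have "of_real (v \<bullet> \<xi>) * fourier \<phi> \<xi> = fourier (\<lambda>x. - \<i> * \<phi>' x v + 0 * \<phi> x) \<xi>" for \<xi>
    unfolding fourier_lincomb[OF d(2) \<phi>] fourier_derivative[OF \<phi> d] by (simp add: mult.assoc[symmetric])
  thus "\<exists>\<zeta>\<in>test_functions. \<forall>\<xi>. complex_of_real (v \<bullet> \<xi>) * fourier \<phi> \<xi> = fourier \<zeta> \<xi>"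
    using test_functions_lincomb[OF d(2) \<phi>, of "- \<i>" _ 0] by blast
qed

lemma fourier_multiplier_add:
  assumes "fourier_multiplier p" "fourier_multiplier q" shows "fourier_multiplier (\<lambda>\<xi>. p \<xi> + q \<xi>)"
  unfolding fourier_multiplier_def
proof
  fix \<phi> :: "'a \<Rightarrow> complex" assume \<phi>: "\<phi> \<in> test_functions"
  obtain \<zeta>1 \<zeta>2 where c: "\<zeta>1 \<in> test_functions" "\<And>\<xi>. of_real (p \<xi>) * fourier \<phi> \<xi> = fourier \<zeta>1 \<xi>"
    "\<zeta>2 \<in> test_functions" "\<And>\<xi>. of_real (q \<xi>) * fourier \<phi> \<xi> = fourier \<zeta>2 \<xi>"
    using assms \<phi> unfolding fourier_multiplier_def by blast
  show "\<exists>\<zeta>\<in>test_functions. \<forall>\<xi>. complex_of_real (p \<xi> + q \<xi>) * fourier \<phi> \<xi> = fourier \<zeta> \<xi>"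
    by (rule bexI[OF _ test_functions_lincomb[OF c(1,3), of 1 1]])
       (simp only: fourier_lincomb[OF c(1,3)] c(2,4)[symmetric], simp add: algebra_simps)
qed

lemma fourier_multiplier_mult:
  assumes "fourier_multiplier p" "fourier_multiplier q" shows "fourier_multiplier (\<lambda>\<xi>. p \<xi> * q \<xi>)"
  unfolding fourier_multiplier_def
proof
  fix \<phi> :: "'a \<Rightarrow> complex" assume \<phi>: "\<phi> \<in> test_functions"
  obtain \<zeta>1 where c1: "\<zeta>1 \<in> test_functions" "\<And>\<xi>. of_real (q \<xi>) * fourier \<phi> \<xi> = fourier \<zeta>1 \<xi>"
    using assms(2) \<phi> unfolding fourier_multiplier_def by blast
  obtain \<zeta>2 where c2: "\<zeta>2 \<in> test_functions" "\<And>\<xi>. of_real (p \<xi>) * fourier \<zeta>1 \<xi> = fourier \<zeta>2 \<xi>"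
    using assms(1) c1(1) unfolding fourier_multiplier_def by blast
  show "\<exists>\<zeta>\<in>test_functions. \<forall>\<xi>. complex_of_real (p \<xi> * q \<xi>) * fourier \<phi> \<xi> = fourier \<zeta> \<xi>"
    by (rule bexI[OF _ c2(1)]) (simp add: c2(2)[symmetric] c1(2)[symmetric] mult.assoc)
qed

lemma fourier_multiplier_prod:
  "(\<And>i. i \<in> A \<Longrightarrow> fourier_multiplier (q i)) \<Longrightarrow> fourier_multiplier (\<lambda>\<xi>. \<Prod>i\<in>A. q i \<xi>)"
  by (induction A rule: infinite_finite_induct) (auto intro: fourier_multiplier_const fourier_multiplier_mult)

lemma fourier_multiplier_sum:
  "(\<And>i. i \<in> A \<Longrightarrow> fourier_multiplier (q i)) \<Longrightarrow> fourier_multiplier (\<lambda>\<xi>. \<Sum>i\<in>A. q i \<xi>)"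
  by (induction A rule: infinite_finite_induct) (auto intro: fourier_multiplier_const fourier_multiplier_add)

lemma fourier_multiplier_power: "fourier_multiplier q \<Longrightarrow> fourier_multiplier (\<lambda>\<xi>. q \<xi> ^ j)"
  by (induction j) (auto intro: fourier_multiplier_const fourier_multiplier_mult)

lemma fourier_multiplier_nth: "fourier_multiplier (\<lambda>\<xi> :: real^'n::finite. \<xi> $ i)"
  using fourier_multiplier_inner[of "axis i 1 :: real^'n"] by (simp add: inner_axis' )

lemma fourier_measurable: 
  assumes "\<phi> \<in> test_functions" shows "fourier \<phi> \<in> borel_measurable borel"
proof -
  have [measurable]: "\<phi> \<in> borel_measurable borel"
    using test_function_continuous[OF assms] by (rule borel_measurable_continuous_onI)
  show ?thesis unfolding fourier_def[abs_def] by measurable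
qed

text \<open>Multiplication by \<open>\<Prod>i\<in>UNIV. 1 + (\<xi> $ i)\<^sup>2\<close> leaves the integrand bounded, and the
  reciprocal of this product is integrable.\<close>

lemma fourier_moment_integrable:
  fixes \<phi> :: "real^'n::finite \<Rightarrow> complex"
  assumes \<phi>: "\<phi> \<in> test_functions"
  shows "integrable lborel (\<lambda>\<xi>. of_real ((norm \<xi>) ^ (2 * j)) * fourier \<phi> \<xi>)"
proof -
  define P where "P \<xi> = (\<Prod>i\<in>UNIV. 1 + (\<xi> $ i)\<^sup>2)" for \<xi> :: "real^'n"
  have P0: "P \<xi> > 0" for \<xi> unfolding P_def by (intro prod_pos) (auto intro: add_pos_nonneg)
  have "fourier_multiplier (\<lambda>\<xi> :: real^'n. ((\<Sum>i\<in>UNIV. (\<xi> $ i)\<^sup>2) ^ j) * (\<Prod>i\<in>UNIV. 1 + (\<xi> $ i)\<^sup>2))"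
    by (intro fourier_multiplier_mult fourier_multiplier_power fourier_multiplier_sum fourier_multiplier_prod
        fourier_multiplier_add fourier_multiplier_const fourier_multiplier_nth)
  then obtain \<zeta> where \<zeta>: "\<zeta> \<in> test_functions"
    "\<And>\<xi>. of_real (((norm \<xi>)\<^sup>2) ^ j * P \<xi>) * fourier \<phi> \<xi> = fourier \<zeta> \<xi>"
    using \<phi> unfolding fourier_multiplier_def norm_sq_vec[symmetric] P_def[symmetric] by blast
  define C where "C = (LINT x|lborel. cmod (\<zeta> x))"
  have C: "cmod (fourier \<zeta> \<xi>) \<le> C" for \<xi>
  proof -
    have "cmod (fourier \<zeta> \<xi>) \<le> (LINT x|lborel. cmod (exp (- \<i> * of_real (x \<bullet> \<xi>)) * \<zeta> x))"
      unfolding fourier_def by (rule integral_norm_bound)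
    thus ?thesis by (simp add: norm_mult C_def)
  qed
  have i: "integrable lborel (\<lambda>\<xi> :: real^'n. C * (1 / P \<xi>))"
  proof -
    have "set_integrable lborel (einterval (- \<infinity>) \<infinity>) (\<lambda>x :: real. inverse (1 + x\<^sup>2))"
      by (rule integrable_inverse_1_plus_square)
    hence "integrable lborel (\<lambda>x :: real. complex_of_real (inverse (1 + x\<^sup>2)))"
      by (intro integrable_of_real) (simp add: set_integrable_def einterval_def)
    from lborel_prod_vec(1)[OF this]
    have "integrable lborel (\<lambda>\<xi> :: real^'n. \<Prod>i\<in>UNIV. complex_of_real (inverse (1 + (\<xi> $ i)\<^sup>2)))" .
    also have "(\<lambda>\<xi> :: real^'n. \<Prod>i\<in>UNIV. complex_of_real (inverse (1 + (\<xi> $ i)\<^sup>2))) = (\<lambda>\<xi>. of_real (1 / P \<xi>))"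
      unfolding inverse_eq_divide of_real_prod[symmetric] prod_dividef P_def by simp
    finally have "integrable lborel (\<lambda>\<xi> :: real^'n. complex_of_real (1 / P \<xi>))" .
    from integrable_Re[OF this] show ?thesis by (intro integrable_mult_right) simp
  qed
  show ?thesis
  proof (rule Bochner_Integration.integrable_bound[OF i])
    show "(\<lambda>\<xi>. of_real ((norm \<xi>) ^ (2 * j)) * fourier \<phi> \<xi>) \<in> borel_measurable lborel"
      using fourier_measurable[OF \<phi>] by measurable
    show "AE \<xi> in lborel. norm (of_real ((norm \<xi>) ^ (2 * j)) * fourier \<phi> \<xi>) \<le> norm (C * (1 / P \<xi>))"
    proof (rule AE_I2)
      fix \<xi> :: "real^'n"
      have "cmod (of_real ((norm \<xi>) ^ (2 * j)) * fourier \<phi> \<xi>) * P \<xi> = cmod (fourier \<zeta> \<xi>)"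
        unfolding \<zeta>(2)[symmetric] norm_mult norm_of_real using P0[of \<xi>] by (simp add: power_mult abs_mult)
      hence "cmod (of_real ((norm \<xi>) ^ (2 * j)) * fourier \<phi> \<xi>) * P \<xi> \<le> C" using C by simp
      hence "cmod (of_real ((norm \<xi>) ^ (2 * j)) * fourier \<phi> \<xi>) \<le> C / P \<xi>"
        using P0[of \<xi>] by (simp only: pos_le_divide_eq)
      thus "norm (of_real ((norm \<xi>) ^ (2 * j)) * fourier \<phi> \<xi>) \<le> norm (C * (1 / P \<xi>))"
        unfolding real_norm_def times_divide_eq_right mult_1_right using abs_ge_self[of "C / P \<xi>"] by linarith
    qed
  qed
qed

section \<open>The Bessel function as a heat integral\<close>

text \<open>The weight of the Gaussian mixture times the Fourier transform at radius \<open>r\<close> of the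
  Gaussian with parameter \<open>t\<close>, in dimension \<open>\<mu>\<close>.\<close>

definition heat_integrand :: "nat \<Rightarrow> real \<Rightarrow> real \<Rightarrow> real \<Rightarrow> real \<Rightarrow> real" where
  "heat_integrand L \<mu> c r t = exp (- c\<^sup>2 * t - r\<^sup>2 / (4 * t)) / t ^ Suc L * sqrt (pi / t) powr \<mu>"

lemma lborel_set_integral_eq_integral:
  fixes f :: "real \<Rightarrow> real"
  assumes "f \<in> borel_measurable borel" "S \<in> sets borel" "f absolutely_integrable_on S"
  shows "set_integrable lborel S f" "(LINT x:S|lborel. f x) = integral S f"
proof -
  have m: "(\<lambda>x. indicator S x *\<^sub>R f x) \<in> borel_measurable lborel" using assms by measurable
  show "set_integrable lborel S f"
    using assms(3) integrable_completion[OF m] unfolding set_integrable_def by simp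
  have "(LINT x:S|lborel. f x) = (LINT x:S|lebesgue. f x)"
    unfolding set_lebesgue_integral_def using integral_completion[OF m] by simp
  also have "\<dots> = integral S f" by (rule set_lebesgue_integral_eq_integral(2)[OF assms(3)])
  finally show "(LINT x:S|lborel. f x) = integral S f" .
qed

text \<open>The integral over the half line that defines \<open>bessel_K\<close>, unfolded by symmetry to the
  whole line, which is the image of the times \<open>t > 0\<close> under the logarithmic substitution of
  the next lemma.\<close>

lemma bessel_symmetric_integrable:
  assumes a: "a > (0::real)"
  shows "integrable lborel (\<lambda>u. exp (- \<nu> * u) * exp (- a * cosh u))"
    and "(LINT u|lborel. exp (- \<nu> * u) * exp (- a * cosh u)) = 2 * bessel_K \<nu> a"
    and "bessel_K \<nu> a > 0"
proof -
  define f where "f u = exp (- \<nu> * u) * exp (- a * cosh u)" for u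
  have fc: "continuous_on UNIV f" unfolding f_def by (intro continuous_intros)
  have fm[measurable]: "f \<in> borel_measurable borel" by (rule borel_measurable_continuous_onI[OF fc])
  \<comment> \<open>\<open>cosh u\<close> grows at least quadratically and so outweighs the linear term \<open>\<nu> * u\<close>\<close>
  obtain M where M: "\<And>u. \<bar>f u\<bar> \<le> M * exp (- \<bar>u\<bar>)"
  proof -
    define k where "k = \<bar>\<nu>\<bar> + 1"
    have k: "k \<ge> 1" by (simp add: k_def)
    have "exp (- \<nu> * u) * exp (- a * cosh u) \<le> exp (2 * k\<^sup>2 / a) * exp (- \<bar>u\<bar>)" for u
    proof -
      have e: "cosh u \<ge> exp \<bar>u\<bar> / 2" unfolding cosh_def by (cases "u \<ge> 0") auto
      have "exp \<bar>u\<bar> \<ge> 1 + \<bar>u\<bar> + \<bar>u\<bar>\<^sup>2 / 2" by (rule exp_lower_Taylor_quadratic) simp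
      hence "cosh u \<ge> \<bar>u\<bar>\<^sup>2 / 4" using e by simp
      hence "a * cosh u \<ge> a * (\<bar>u\<bar>\<^sup>2 / 4)" using a by (intro mult_left_mono) auto
      moreover have "k * \<bar>u\<bar> \<le> a * (\<bar>u\<bar>\<^sup>2 / 4) + 2 * k\<^sup>2 / a"
      proof -
        have "0 \<le> (a * \<bar>u\<bar> - 2 * k)\<^sup>2" by simp
        hence "4 * a * k * \<bar>u\<bar> \<le> a\<^sup>2 * \<bar>u\<bar>\<^sup>2 + 4 * k\<^sup>2" by (simp add: power2_eq_square algebra_simps)
        also have "\<dots> \<le> a\<^sup>2 * \<bar>u\<bar>\<^sup>2 + 8 * k\<^sup>2" by simp
        also have "\<dots> = 4 * a * (a * (\<bar>u\<bar>\<^sup>2 / 4) + 2 * k\<^sup>2 / a)"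
          using a by (simp add: distrib_left power2_eq_square)
        finally have "4 * a * (k * \<bar>u\<bar>) \<le> 4 * a * (a * (\<bar>u\<bar>\<^sup>2 / 4) + 2 * k\<^sup>2 / a)"
          by (simp only: mult.assoc)
        thus ?thesis by (rule mult_left_le_imp_le) (use a in simp)
      qed
      moreover have "- \<nu> * u \<le> \<bar>\<nu>\<bar> * \<bar>u\<bar>" by (metis abs_ge_self abs_minus_cancel abs_mult)
      ultimately have "- \<nu> * u + - a * cosh u \<le> 2 * k\<^sup>2 / a + - \<bar>u\<bar>"
        by (simp add: k_def algebra_simps)
      thus ?thesis unfolding exp_add[symmetric] by simp
    qed
    thus thesis using that[of "exp (2 * k\<^sup>2 / a)"] by (simp add: f_def)
  qed
  have ie: "set_integrable lborel {0..} (\<lambda>u. M * exp (- u))"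
    using power_exp_integral(1)[of 1 0] by simp
  have half: "set_integrable lborel {0..} (\<lambda>u. f u)" "set_integrable lborel {0..} (\<lambda>u. f (- u))"
  proof -
    have *: "set_integrable lborel {0..} g" if g: "g \<in> borel_measurable borel" "\<And>u. u \<ge> 0 \<Longrightarrow> \<bar>g u\<bar> \<le> M * exp (- u)"
      for g :: "real \<Rightarrow> real"
    proof (rule set_integrable_bound[OF ie])
      show "set_borel_measurable lborel {0..} g" using g(1) unfolding set_borel_measurable_def by measurable
      show "AE u in lborel. u \<in> {0..} \<longrightarrow> norm (g u) \<le> norm (M * exp (- u))"
        using g(2) by (intro AE_I2) (auto intro: order.trans[OF _ abs_ge_self])
    qed
    show "set_integrable lborel {0..} (\<lambda>u. f u)"
    proof (rule *)
      fix u :: real assume "u \<ge> 0"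
      thus "\<bar>f u\<bar> \<le> M * exp (- u)" using M[of u] by simp
    qed measurable
    show "set_integrable lborel {0..} (\<lambda>u. f (- u))"
    proof (rule *)
      fix u :: real assume "u \<ge> 0"
      thus "\<bar>f (- u)\<bar> \<le> M * exp (- u)" using M[of "- u"] by simp
    qed measurable
  qed
  have neg: "integrable lborel (\<lambda>u. indicator {..<0} u *\<^sub>R f u)"
    "(LINT u|lborel. indicator {..<0} u *\<^sub>R f u) = (LINT u|lborel. indicator {0..} u *\<^sub>R f (- u))"
  proof -
    have e1: "AE u in lborel. indicator {0..} u *\<^sub>R f (- u) = indicator {..<0} (0 + - 1 * u) *\<^sub>R f (0 + - 1 * u)"
      using AE_lborel_singleton[of 0] by eventually_elim (auto simp: indicator_def)
    have i1: "integrable lborel (\<lambda>u. indicator {..<0} (0 + - 1 * u) *\<^sub>R f (0 + - 1 * u))"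
      using half(2) unfolding set_integrable_def
      by (rule integrable_cong_AE_imp) (use e1 in \<open>auto elim!: eventually_mono\<close>)
    show "integrable lborel (\<lambda>u. indicator {..<0} u *\<^sub>R f u)"
      using lborel_integrable_real_affine_iff[of "- 1" "\<lambda>u. indicator {..<0} u *\<^sub>R f u" 0] i1 by simp
    have "(LINT u|lborel. indicator {..<0} u *\<^sub>R f u) = \<bar>- 1\<bar> *\<^sub>R (LINT u|lborel. indicator {..<0} (0 + - 1 * u) *\<^sub>R f (0 + - 1 * u))"
      by (rule lborel_integral_real_affine) simp
    also have "\<dots> = (LINT u|lborel. indicator {0..} u *\<^sub>R f (- u))"
      using integral_cong_AE[OF _ _ e1] by simp
    finally show "(LINT u|lborel. indicator {..<0} u *\<^sub>R f u) = (LINT u|lborel. indicator {0..} u *\<^sub>R f (- u))" .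
  qed
  have split: "f = (\<lambda>u. indicator {..<0} u *\<^sub>R f u + indicator {0..} u *\<^sub>R f u)"
    by (auto simp: fun_eq_iff indicator_def)
  show fi: "integrable lborel (\<lambda>u. exp (- \<nu> * u) * exp (- a * cosh u))"
  proof -
    have "integrable lborel (\<lambda>u. indicator {..<0} u *\<^sub>R f u + indicator {0..} u *\<^sub>R f u)"
      using neg(1) half(1) unfolding set_integrable_def by (rule Bochner_Integration.integrable_add)
    hence "integrable lborel f" unfolding split[symmetric] .
    thus ?thesis by (simp only: f_def[abs_def])
  qed
  have K: "2 * bessel_K \<nu> a = (LINT u|lborel. indicator {0..} u *\<^sub>R f u) + (LINT u|lborel. indicator {0..} u *\<^sub>R f (- u))"
  proof -
    have "2 * bessel_K \<nu> a = (LINT u|lborel. 2 * (indicator {0..} u *\<^sub>R (exp (- a * cosh u) * cosh (\<nu> * u))))"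
      unfolding bessel_K_def set_lebesgue_integral_def by simp
    also have "(\<lambda>u. 2 * (indicator {0..} u *\<^sub>R (exp (- a * cosh u) * cosh (\<nu> * u)))) =
        (\<lambda>u. indicator {0..} u *\<^sub>R f u + indicator {0..} u *\<^sub>R f (- u))"
      by (auto simp: fun_eq_iff f_def cosh_def indicator_def algebra_simps)
    finally show ?thesis using half unfolding set_integrable_def by simp
  qed
  have "(LINT u|lborel. f u) = (LINT u|lborel. indicator {..<0} u *\<^sub>R f u + indicator {0..} u *\<^sub>R f u)"
    using arg_cong[OF split, of "integral\<^sup>L lborel"] .
  also have "\<dots> = 2 * bessel_K \<nu> a"
    unfolding K using neg half(1) unfolding set_integrable_def by simp
  finally show v: "(LINT u|lborel. exp (- \<nu> * u) * exp (- a * cosh u)) = 2 * bessel_K \<nu> a" by (simp add: f_def)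
  have "(LINT u|lborel. f u) \<noteq> 0"
  proof
    assume "(LINT u|lborel. f u) = 0"
    hence "AE u in lborel. f u = 0"
      using integral_nonneg_eq_0_iff_AE[of lborel f] fi by (simp add: f_def[abs_def])
    hence "AE u in (lborel :: real measure). False" by (rule eventually_mono) (simp add: f_def)
    thus False by (simp add: eventually_False ae_filter_eq_bot_iff)
  qed
  moreover have "(LINT u|lborel. f u) \<ge> 0" by (intro integral_nonneg_AE AE_I2) (simp add: f_def)
  ultimately have "(LINT u|lborel. f u) > 0" by simp
  thus "bessel_K \<nu> a > 0" using v unfolding f_def by linarith
qed

text \<open>The substitution \<open>t = r / (2 * c) * exp u\<close> turns the exponent into \<open>- c * r * cosh u\<close>.\<close>

lemma heat_integral_bessel:
  assumes c: "c > 0" and r: "r > 0"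
  shows "set_integrable lborel {0<..} (heat_integrand L \<mu> c r)"
    and "fact L / 2 * (LINT t:{0<..}|lborel. heat_integrand L \<mu> c r t) =
      fact L * 2 ^ L * sqrt (2 * pi) powr \<mu> * r powr (- real (2 * L) - \<mu>) * bessel_K_tilde ((\<mu> + real (2 * L)) / 2) (c * r)"
proof -
  define \<nu> where "\<nu> = (\<mu> + real (2 * L)) / 2"
  \<comment> \<open>the time at which \<open>c\<^sup>2 * t\<close> and \<open>r\<^sup>2 / (4 * t)\<close> are equal\<close>
  define a where "a = r / (2 * c)"
  have a: "a > 0" using c r by (simp add: a_def)
  define g where "g u = a * exp u" for u
  have gpos: "g u > 0" for u using a by (simp add: g_def)
  have gd: "(g has_field_derivative g u) (at u within UNIV)" for u
    unfolding g_def by (auto intro!: derivative_eq_intros)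
  have inj: "inj_on g UNIV" using a by (auto simp: inj_on_def g_def)
  have img: "g ` UNIV = {0<..}"
  proof -
    have "t \<in> range g" if "t > 0" for t
      using that a by (intro image_eqI[of _ _ "ln (t / a)"]) (auto simp: g_def)
    thus ?thesis using gpos by auto
  qed
  define A where "A = sqrt pi powr \<mu> * a powr (- \<nu>)"
  have cr: "c * r > 0" using c r by simp
  have sub: "\<bar>g u\<bar> * heat_integrand L \<mu> c r (g u) = A * (exp (- \<nu> * u) * exp (- (c * r) * cosh u))" for u
  proof -
    have c1: "c\<^sup>2 * g u = c * r / 2 * exp u" using c by (simp add: g_def a_def power2_eq_square)
    have "r\<^sup>2 / (4 * (r / (2 * c) * E)) = c * r / 2 * (1 / E)" if "E > 0" for E
      using c r that by (simp add: divide_simps) (simp add: power2_eq_square)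
    from this[of "exp u"] have c2: "r\<^sup>2 / (4 * g u) = c * r / 2 * exp (- u)"
      unfolding g_def a_def by (simp add: exp_minus inverse_eq_divide)
    have 1: "- c\<^sup>2 * g u - r\<^sup>2 / (4 * g u) = - (c * r) * cosh u"
      unfolding c2 mult_minus_left c1 by (simp add: cosh_def algebra_simps)
    have 2: "g u / g u ^ Suc L * sqrt (pi / g u) powr \<mu> = A * exp (- \<nu> * u)"
    proof -
      have "sqrt (pi / g u) powr \<mu> = sqrt pi powr \<mu> / sqrt (g u) powr \<mu>"
        using gpos[of u] by (simp add: real_sqrt_divide powr_divide)
      also have "sqrt (g u) powr \<mu> = g u powr (\<mu> / 2)"
        using gpos[of u] by (simp add: powr_half_sqrt[symmetric] powr_powr)
      finally have s1: "sqrt (pi / g u) powr \<mu> = sqrt pi powr \<mu> / g u powr (\<mu> / 2)" .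
      have s2: "g u / g u ^ Suc L = 1 / g u powr (real L)"
        using gpos[of u] by (simp add: powr_realpow)
      have "\<nu> = real L + \<mu> / 2" by (simp add: \<nu>_def field_simps)
      hence s3: "g u powr (real L) * g u powr (\<mu> / 2) = g u powr \<nu>" by (simp only: powr_add)
      have s4: "g u powr \<nu> = a powr \<nu> * exp (\<nu> * u)"
        using a by (simp add: g_def powr_mult powr_def[of "exp u"])
      have "g u / g u ^ Suc L * sqrt (pi / g u) powr \<mu> = sqrt pi powr \<mu> / (g u powr (real L) * g u powr (\<mu> / 2))"
        unfolding s1 s2 by simp
      also have "\<dots> = A * exp (- \<nu> * u)"
        unfolding s3 s4 A_def by (simp add: powr_minus exp_minus divide_inverse)
      finally show ?thesis .
    qed
    have "\<bar>g u\<bar> * heat_integrand L \<mu> c r (g u) = exp (- c\<^sup>2 * g u - r\<^sup>2 / (4 * g u)) * (g u / g u ^ Suc L * sqrt (pi / g u) powr \<mu>)"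
      unfolding heat_integrand_def using gpos[of u] by simp
    thus ?thesis unfolding 1 2 by simp
  qed
  define F where "F u = A * (exp (- \<nu> * u) * exp (- (c * r) * cosh u))" for u
  have Fi: "integrable lborel F" unfolding F_def by (intro integrable_mult_right bessel_symmetric_integrable(1)[OF cr])
  have Fa: "F absolutely_integrable_on UNIV"
    using Fi integrable_completion[of F lborel] by (simp add: set_integrable_def borel_measurable_integrable)
  have Fm: "F \<in> borel_measurable borel" unfolding F_def
    by (intro borel_measurable_continuous_onI continuous_intros)
  have "integral UNIV F = (LINT x:UNIV|lborel. F x)"
    using lborel_set_integral_eq_integral(2)[OF Fm _ Fa] by simp
  also have "\<dots> = (LINT x|lborel. F x)" by (simp add: set_lebesgue_integral_def)
  also have "\<dots> = A * (2 * bessel_K \<nu> (c * r))"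
    unfolding F_def Bochner_Integration.integral_mult_right_zero bessel_symmetric_integrable(2)[OF cr] by (rule refl)
  finally have FI: "integral UNIV F = A * (2 * bessel_K \<nu> (c * r))" .
  have cov: "heat_integrand L \<mu> c r absolutely_integrable_on {0<..} \<and>
     integral {0<..} (heat_integrand L \<mu> c r) = A * (2 * bessel_K \<nu> (c * r))"
    using has_absolute_integral_change_of_variables_1'[of UNIV g g "heat_integrand L \<mu> c r" "A * (2 * bessel_K \<nu> (c * r))"]
      gd inj img Fa FI unfolding sub F_def[symmetric] by simp
  have hm: "heat_integrand L \<mu> c r \<in> borel_measurable borel" unfolding heat_integrand_def[abs_def] by measurable
  show "set_integrable lborel {0<..} (heat_integrand L \<mu> c r)"
    by (rule lborel_set_integral_eq_integral(1)[OF hm]) (use cov in auto)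
  have "(LINT t:{0<..}|lborel. heat_integrand L \<mu> c r t) = A * (2 * bessel_K \<nu> (c * r))"
    using lborel_set_integral_eq_integral(2)[OF hm, of "{0<..}"] cov by simp
  hence "fact L / 2 * (LINT t:{0<..}|lborel. heat_integrand L \<mu> c r t) = fact L * (A * bessel_K \<nu> (c * r))" by simp
  also have "A = 2 ^ L * sqrt (2 * pi) powr \<mu> * r powr (- real (2 * L) - \<mu>) * (c * r) powr \<nu>"
  proof -
    have \<nu>: "\<nu> = real L + \<mu> / 2" by (simp add: \<nu>_def field_simps)
    have s1: "a powr (- \<nu>) = 2 powr \<nu> * c powr \<nu> / r powr \<nu>"
      using c r by (simp add: a_def powr_minus powr_divide powr_mult)
    have "2 powr (\<mu> / 2) = sqrt 2 powr \<mu>" by (simp add: powr_half_sqrt[symmetric] powr_powr)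
    hence s2: "2 powr \<nu> = 2 ^ L * sqrt 2 powr \<mu>" unfolding \<nu> powr_add by (simp add: powr_realpow)
    have e: "- real (2 * L) - \<mu> = - \<nu> + - \<nu>" unfolding \<nu> by simp
    have s3: "r powr (- real (2 * L) - \<mu>) = 1 / (r powr \<nu> * r powr \<nu>)"
      unfolding e powr_add by (simp add: powr_minus divide_inverse)
    show ?thesis unfolding A_def s1 s2 s3 using c r by (simp add: real_sqrt_mult powr_mult)
  qed
  finally show "fact L / 2 * (LINT t:{0<..}|lborel. heat_integrand L \<mu> c r t) =
      fact L * 2 ^ L * sqrt (2 * pi) powr \<mu> * r powr (- real (2 * L) - \<mu>) * bessel_K_tilde ((\<mu> + real (2 * L)) / 2) (c * r)"
    unfolding bessel_K_tilde_def \<nu>_def by (simp only: mult_ac)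
qed

section \<open>Fourier transforms of functions that vanish near the origin\<close>

lemma norm_integral_le:
  fixes f :: "'a \<Rightarrow> 'b::{banach, second_countable_topology}"
  assumes "integrable M f" "integrable M g" "\<And>x. norm (f x) \<le> g x"
  shows "norm (integral\<^sup>L M f) \<le> integral\<^sup>L M g"
  by (rule order.trans[OF integral_norm_bound Bochner_Integration.integral_mono]) (use assms in auto)

text \<open>The integral of the Fourier transform with a Gaussian convergence factor; its Taylor
  coefficients at \<open>t = 0\<close> are the even moments of the transform.\<close>

definition damped_integral :: "(real^'n::finite \<Rightarrow> complex) \<Rightarrow> real \<Rightarrow> complex" where
  "damped_integral \<psi> t = (LINT x|lborel. of_real (exp (- t * (norm x)\<^sup>2)) * fourier \<psi> x)"

lemma fourier_integrable:
  fixes \<psi> :: "real^'n::finite \<Rightarrow> complex"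
  shows "\<psi> \<in> test_functions \<Longrightarrow> integrable lborel (fourier \<psi>)"
  using fourier_moment_integrable[of \<psi> 0] by simp

lemma damped_integral_eq:
  fixes \<psi> :: "real^'n::finite \<Rightarrow> complex"
  assumes \<psi>: "\<psi> \<in> test_functions" and t: "t > 0"
  shows "damped_integral \<psi> t = (LINT \<theta>|lborel. of_real (sqrt (pi / t) ^ CARD('n) * exp (- (norm \<theta>)\<^sup>2 / (4 * t))) * \<psi> \<theta>)"
proof -
  have [measurable]: "\<psi> \<in> borel_measurable borel"
    using test_function_continuous[OF \<psi>] by (rule borel_measurable_continuous_onI)
  define f where "f x \<theta> = of_real (exp (- t * (norm x)\<^sup>2)) * (exp (- \<i> * of_real (\<theta> \<bullet> x)) * \<psi> \<theta>)" for x \<theta> :: "real^'n"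
  have fm: "(\<lambda>(x, \<theta>). f x \<theta>) \<in> borel_measurable (lborel \<Otimes>\<^sub>M lborel)" unfolding f_def by measurable
  have fb: "cmod (f x \<theta>) \<le> exp (- t * (norm x)\<^sup>2) * cmod (\<psi> \<theta>)" for x \<theta>
    by (simp add: f_def norm_mult)
  have "damped_integral \<psi> t = (LINT x|lborel. LINT \<theta>|lborel. f x \<theta>)"
    unfolding damped_integral_def fourier_def f_def Bochner_Integration.integral_mult_right_zero by (rule refl)
  also have "\<dots> = (LINT \<theta>|lborel. LINT x|lborel. f x \<theta>)"
    by (rule fubini_dominated(1)[OF fm fb gaussian_integral(1)[OF t]])
       (use test_function_integrable[OF \<psi>] in auto)
  also have "\<dots> = (LINT \<theta>|lborel. of_real (sqrt (pi / t) ^ CARD('n) * exp (- (norm \<theta>)\<^sup>2 / (4 * t))) * \<psi> \<theta>)"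
  proof (rule arg_cong[where f="integral\<^sup>L lborel"], rule ext)
    fix \<theta> :: "real^'n"
    have "(LINT x|lborel. f x \<theta>) = (LINT x|lborel. (of_real (exp (- t * (norm x)\<^sup>2)) * iexp ((- \<theta>) \<bullet> x)) * \<psi> \<theta>)"
      by (simp add: f_def mult.assoc)
    also have "\<dots> = (LINT x|lborel. of_real (exp (- t * (norm x)\<^sup>2)) * iexp ((- \<theta>) \<bullet> x)) * \<psi> \<theta>"
      by (rule Bochner_Integration.integral_mult_left_zero)
    also have "\<dots> = of_real (sqrt (pi / t) ^ CARD('n) * exp (- (norm \<theta>)\<^sup>2 / (4 * t))) * \<psi> \<theta>"
      unfolding gaussian_fourier(2)[OF t] by simp
    finally show "(LINT x|lborel. f x \<theta>) = of_real (sqrt (pi / t) ^ CARD('n) * exp (- (norm \<theta>)\<^sup>2 / (4 * t))) * \<psi> \<theta>" .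
  qed
  finally show ?thesis .
qed

lemma heat_weight_bound:
  assumes r0: "r0 > 0"
  obtains B where "B \<ge> 0" "\<And>t r. t > 0 \<Longrightarrow> r \<ge> r0 \<Longrightarrow> exp (- r\<^sup>2 / (4 * t)) / t ^ Suc j * sqrt (pi / t) ^ n \<le> B"
proof -
  define a where "a = r0\<^sup>2 / 4"
  have a: "a > 0" using r0 by (simp add: a_def)
  define k where "k = Suc j + n"
  define B where "B = sqrt pi ^ n * (fact k * exp a / a ^ k)"
  show thesis
  proof (rule that[of B])
    show "B \<ge> 0" using a by (simp add: B_def)
    fix t r :: real assume t: "t > 0" and r: "r \<ge> r0"
    define y where "y = 1 / t"
    have y: "y > 0" using t by (simp add: y_def)
    have e: "exp (- r\<^sup>2 / (4 * t)) \<le> exp (- (a * y))"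
    proof -
      have "r0\<^sup>2 \<le> r\<^sup>2" using r r0 by (intro power_mono) auto
      hence "r0\<^sup>2 / (4 * t) \<le> r\<^sup>2 / (4 * t)" using t by (intro divide_right_mono) auto
      thus ?thesis by (simp add: a_def y_def)
    qed
    have sy: "sqrt y \<le> 1 + y"
    proof (rule real_le_lsqrt)
      have "y \<le> 1 + 2 * y + y\<^sup>2" using y by (simp add: add_nonneg_pos)
      thus "y \<le> (1 + y)\<^sup>2" by (simp add: power2_eq_square algebra_simps)
    qed (use y in auto)
    have "y ^ Suc j * sqrt y ^ n \<le> (1 + y) ^ Suc j * (1 + y) ^ n"
      using y sy by (intro mult_mono power_mono) auto
    also have "\<dots> = (1 + y) ^ k" by (simp add: k_def power_add)
    also have "\<dots> \<le> fact k * exp (a * (1 + y)) / a ^ k"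
    proof -
      have "(a * (1 + y)) ^ k / fact k \<le> exp (a * (1 + y))" using a y by (intro power_over_fact_le_exp) auto
      hence "(1 + y) ^ k * a ^ k \<le> fact k * exp (a * (1 + y))"
        by (simp add: pos_divide_le_eq power_mult_distrib mult.commute)
      thus ?thesis using a by (simp add: pos_le_divide_eq)
    qed
    finally have m: "y ^ Suc j * sqrt y ^ n \<le> fact k * exp (a * (1 + y)) / a ^ k" .
    have i: "inverse (t ^ Suc j) = y ^ Suc j" by (simp only: y_def inverse_eq_divide power_one_over)
    have sq: "sqrt (pi / t) = sqrt pi * sqrt y" by (simp add: y_def real_sqrt_divide)
    have "exp (- r\<^sup>2 / (4 * t)) / t ^ Suc j * sqrt (pi / t) ^ n =
       exp (- r\<^sup>2 / (4 * t)) * (sqrt pi ^ n * (y ^ Suc j * sqrt y ^ n))"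
      unfolding divide_inverse[of _ "t ^ Suc j"] i sq power_mult_distrib by (simp only: mult_ac)
    also have "\<dots> \<le> exp (- (a * y)) * (sqrt pi ^ n * (fact k * exp (a * (1 + y)) / a ^ k))"
    proof (rule mult_mono[OF e mult_left_mono[OF m]])
      have "0 \<le> y ^ Suc j * sqrt y ^ n" using y by (intro mult_nonneg_nonneg zero_le_power) auto
      thus "0 \<le> sqrt pi ^ n * (y ^ Suc j * sqrt y ^ n)" by (rule mult_nonneg_nonneg[rotated]) simp
    qed auto
    also have "\<dots> = B * (exp (- (a * y)) * exp (a * y))"
      by (simp add: B_def distrib_left exp_add)
    also have "\<dots> = B" by (simp add: exp_minus)
    finally show "exp (- r\<^sup>2 / (4 * t)) / t ^ Suc j * sqrt (pi / t) ^ n \<le> B" .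
  qed
qed

lemma supp_away_from_origin:
  assumes "0 \<notin> supp \<psi>"
  obtains r0 where "r0 > 0" "\<And>\<theta>. \<psi> \<theta> \<noteq> 0 \<Longrightarrow> norm \<theta> \<ge> r0"
proof -
  have "open (- supp \<psi>)" by (simp add: supp_def open_Compl)
  then obtain e where e: "e > 0" "ball 0 e \<subseteq> - supp \<psi>"
    using assms by (meson ComplI openE)
  have "\<psi> \<theta> = 0" if "norm \<theta> < e" for \<theta>
    using e(2) that closure_subset[of "{x. \<psi> x \<noteq> 0}"] by (auto simp: supp_def)
  thus thesis using that[of e] e by (meson not_le)
qed

text \<open>The factor moves to \<open>\<psi>\<close> as a Gaussian of width \<open>sqrt t\<close>, which is small to every order
  on the support of \<open>\<psi>\<close>.\<close>

lemma damped_integral_flat: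
  fixes \<psi> :: "real^'n::finite \<Rightarrow> complex"
  assumes \<psi>: "\<psi> \<in> test_functions" and s: "0 \<notin> supp \<psi>"
  obtains B where "B \<ge> 0" "\<And>t. t > 0 \<Longrightarrow> cmod (damped_integral \<psi> t) \<le> B * t ^ Suc j"
proof -
  obtain r0 where r0: "r0 > 0" "\<And>\<theta>. \<psi> \<theta> \<noteq> 0 \<Longrightarrow> norm \<theta> \<ge> r0" using supp_away_from_origin[OF s] by blast
  obtain B where B: "B \<ge> 0" "\<And>t r. t > 0 \<Longrightarrow> r \<ge> r0 \<Longrightarrow> exp (- r\<^sup>2 / (4 * t)) / t ^ Suc j * sqrt (pi / t) ^ CARD('n) \<le> B"
    using heat_weight_bound[OF r0(1)] by blast
  have i: "integrable lborel (\<lambda>\<theta>. cmod (\<psi> \<theta>))" using test_function_integrable[OF \<psi>] by simp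
  show thesis
  proof (rule that[of "B * (LINT \<theta>|lborel. cmod (\<psi> \<theta>))"])
    show "0 \<le> B * (LINT \<theta>|lborel. cmod (\<psi> \<theta>))" using B(1) by (intro mult_nonneg_nonneg) auto
    fix t :: real assume t: "t > 0"
    have "cmod (damped_integral \<psi> t) \<le> (LINT \<theta>|lborel. B * t ^ Suc j * cmod (\<psi> \<theta>))"
      unfolding damped_integral_eq[OF \<psi> t]
    proof (rule norm_integral_le)
      show "integrable lborel (\<lambda>\<theta>. of_real (sqrt (pi / t) ^ CARD('n) * exp (- (norm \<theta>)\<^sup>2 / (4 * t))) * \<psi> \<theta>)"
        by (intro test_function_mult_integrable \<psi> continuous_intros) (use t in auto)
      show "integrable lborel (\<lambda>\<theta>. B * t ^ Suc j * cmod (\<psi> \<theta>))" using i by simp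
      fix \<theta> :: "real^'n"
      show "norm (of_real (sqrt (pi / t) ^ CARD('n) * exp (- (norm \<theta>)\<^sup>2 / (4 * t))) * \<psi> \<theta>) \<le> B * t ^ Suc j * cmod (\<psi> \<theta>)"
      proof (cases "\<psi> \<theta> = 0")
        case False
        have "exp (- (norm \<theta>)\<^sup>2 / (4 * t)) / t ^ Suc j * sqrt (pi / t) ^ CARD('n) \<le> B" by (rule B(2)[OF t r0(2)[OF False]])
        hence "sqrt (pi / t) ^ CARD('n) * exp (- (norm \<theta>)\<^sup>2 / (4 * t)) / t ^ Suc j \<le> B" by (simp add: mult.commute)
        hence "sqrt (pi / t) ^ CARD('n) * exp (- (norm \<theta>)\<^sup>2 / (4 * t)) \<le> B * t ^ Suc j"
          using t by (simp only: pos_divide_le_eq zero_less_power)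
        hence "\<bar>sqrt (pi / t) ^ CARD('n) * exp (- (norm \<theta>)\<^sup>2 / (4 * t))\<bar> \<le> B * t ^ Suc j"
          using t by (subst abs_of_nonneg) auto
        thus ?thesis unfolding norm_mult norm_of_real by (intro mult_right_mono) auto
      qed simp
    qed
    also have "\<dots> = B * (LINT \<theta>|lborel. cmod (\<psi> \<theta>)) * t ^ Suc j" by simp
    finally show "cmod (damped_integral \<psi> t) \<le> B * (LINT \<theta>|lborel. cmod (\<psi> \<theta>)) * t ^ Suc j" .
  qed
qed

text \<open>These moments are, up to constants, values at the origin of powers of the Laplacian
  applied to \<open>\<psi>\<close>. The proof avoids Fourier inversion: by \<open>damped_integral_flat\<close> the function
  \<open>damped_integral \<psi>\<close> vanishes to every order at \<open>0\<close>, so its Taylor coefficients are zero one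
  after the other.\<close>

lemma fourier_moments_vanish:
  fixes \<psi> :: "real^'n::finite \<Rightarrow> complex"
  assumes \<psi>: "\<psi> \<in> test_functions" and s: "0 \<notin> supp \<psi>"
  shows "(LINT x|lborel. of_real (norm x ^ (2 * j)) * fourier \<psi> x) = 0"
proof (induction j rule: less_induct)
  case (less j)
  define M where "M i = (LINT x|lborel. of_real (norm x ^ (2 * i)) * fourier \<psi> x)" for i
  have Mi: "integrable lborel (\<lambda>x. of_real (norm x ^ (2 * i)) * fourier \<psi> x)" for i
    by (rule fourier_moment_integrable[OF \<psi>])
  obtain B where B: "B \<ge> 0" "\<And>t. t > 0 \<Longrightarrow> cmod (damped_integral \<psi> t) \<le> B * t ^ Suc j"
    using damped_integral_flat[OF \<psi> s] by blast
  define C where "C = (LINT x|lborel. cmod (of_real (norm x ^ (2 * Suc j)) * fourier \<psi> x))"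
  have C0: "C \<ge> 0" by (simp add: C_def)
  have "cmod (M j) \<le> 0"
  proof (rule limit_of_linear_bound)
    show "fact j * (B + C) \<ge> 0" using B C0 by simp
    fix t :: real assume t: "t > 0"
    define P where "P x = (\<Sum>i\<le>j. of_real ((- t) ^ i / fact i) * (of_real (norm x ^ (2 * i)) * fourier \<psi> x))" for x
    have Pi: "integrable lborel P" unfolding P_def by (intro Bochner_Integration.integrable_sum integrable_mult_right Mi)
    have "integral\<^sup>L lborel P = (\<Sum>i\<le>j. of_real ((- t) ^ i / fact i) * M i)"
      unfolding P_def M_def
      by (subst Bochner_Integration.integral_sum, intro integrable_mult_right Mi, intro sum.cong refl, rule Bochner_Integration.integral_mult_right_zero)
    also have "{..j} = insert j {..<j}" by auto
    also have "(\<Sum>i\<in>insert j {..<j}. of_real ((- t) ^ i / fact i) * M i) = of_real ((- t) ^ j / fact j) * M j"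
      using less.IH by (simp add: M_def)
    finally have PM: "integral\<^sup>L lborel P = of_real ((- t) ^ j / fact j) * M j" .
    have Di: "integrable lborel (\<lambda>x. of_real (exp (- t * (norm x)\<^sup>2)) * fourier \<psi> x)"
    proof (rule Bochner_Integration.integrable_bound[OF fourier_integrable[OF \<psi>]])
      show "(\<lambda>x. of_real (exp (- t * (norm x)\<^sup>2)) * fourier \<psi> x) \<in> borel_measurable lborel"
        using fourier_measurable[OF \<psi>] by measurable
      show "AE x in lborel. norm (of_real (exp (- t * (norm x)\<^sup>2)) * fourier \<psi> x) \<le> norm (fourier \<psi> x)"
        using t by (intro AE_I2) (simp add: norm_mult mult_left_le_one_le)
    qed
    have "damped_integral \<psi> t - integral\<^sup>L lborel P = (LINT x|lborel. of_real (exp (- t * (norm x)\<^sup>2)) * fourier \<psi> x - P x)"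
      unfolding damped_integral_def by (rule Bochner_Integration.integral_diff[OF Di Pi, symmetric])
    also have "cmod \<dots> \<le> (LINT x|lborel. t ^ Suc j * cmod (of_real (norm x ^ (2 * Suc j)) * fourier \<psi> x))"
    proof (rule norm_integral_le)
      show "integrable lborel (\<lambda>x. of_real (exp (- t * (norm x)\<^sup>2)) * fourier \<psi> x - P x)"
        by (rule Bochner_Integration.integrable_diff[OF Di Pi])
      show "integrable lborel (\<lambda>x. t ^ Suc j * cmod (of_real (norm x ^ (2 * Suc j)) * fourier \<psi> x))"
        by (intro integrable_mult_right integrable_norm Mi)
      fix x :: "real^'n"
      define u where "u = t * (norm x)\<^sup>2"
      have u0: "u \<ge> 0" using t by (simp add: u_def)
      have tb: "\<bar>exp (- u) - (\<Sum>i\<le>j. (- u) ^ i / fact i)\<bar> \<le> u ^ Suc j"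
      proof (cases "u = 0")
        case True
        have "(\<Sum>i\<le>j. (0::real) ^ i / fact i) = 1" by (induction j) simp_all
        thus ?thesis using True by simp
      next
        case False
        thus ?thesis using exp_minus_taylor_bound[of u j] u0 by simp
      qed
      have "P x = of_real (\<Sum>i\<le>j. (- u) ^ i / fact i) * fourier \<psi> x"
        unfolding P_def of_real_sum sum_distrib_right
      proof (rule sum.cong)
        fix i
        have "(- u) ^ i = (- t) ^ i * norm x ^ (2 * i)"
          by (simp add: u_def power_mult flip: power_mult_distrib)
        thus "complex_of_real ((- t) ^ i / fact i) * (of_real (norm x ^ (2 * i)) * fourier \<psi> x) = of_real ((- u) ^ i / fact i) * fourier \<psi> x"
          by simp
      qed simp
      moreover have "- t * (norm x)\<^sup>2 = - u" by (simp add: u_def)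
      ultimately have "of_real (exp (- t * (norm x)\<^sup>2)) * fourier \<psi> x - P x = of_real (exp (- u) - (\<Sum>i\<le>j. (- u) ^ i / fact i)) * fourier \<psi> x"
        by (simp only: of_real_diff left_diff_distrib)
      hence "norm (of_real (exp (- t * (norm x)\<^sup>2)) * fourier \<psi> x - P x) = \<bar>exp (- u) - (\<Sum>i\<le>j. (- u) ^ i / fact i)\<bar> * cmod (fourier \<psi> x)"
        by (simp only: norm_mult norm_of_real)
      also have "\<dots> \<le> u ^ Suc j * cmod (fourier \<psi> x)" by (rule mult_right_mono[OF tb]) simp
      also have "u ^ Suc j = t ^ Suc j * norm x ^ (2 * Suc j)"
        unfolding u_def power_mult_distrib by (simp only: power_mult)
      finally show "norm (of_real (exp (- t * (norm x)\<^sup>2)) * fourier \<psi> x - P x) \<le> t ^ Suc j * cmod (of_real (norm x ^ (2 * Suc j)) * fourier \<psi> x)"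
        by (simp only: norm_mult norm_of_real abs_power2 power_abs abs_norm_cancel mult.assoc)
    qed
    also have "\<dots> = t ^ Suc j * C" by (simp add: C_def)
    finally have "cmod (damped_integral \<psi> t - integral\<^sup>L lborel P) \<le> t ^ Suc j * C" .
    hence "cmod (integral\<^sup>L lborel P) \<le> B * t ^ Suc j + t ^ Suc j * C"
      using B(2)[OF t] norm_triangle_sub[of "integral\<^sup>L lborel P" "damped_integral \<psi> t"]
      by (simp add: norm_minus_commute)
    hence "t ^ j / fact j * cmod (M j) \<le> t ^ j / fact j * (t * (fact j * (B + C)))"
      unfolding PM norm_mult norm_of_real using t
      by (simp add: power_abs algebra_simps)
    hence "cmod (M j) \<le> t * (fact j * (B + C))"
      by (rule mult_left_le_imp_le) (use t in simp)
    thus "cmod (M j) \<le> 0 + t * (fact j * (B + C))" by simp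
  qed
  thus ?case by (simp add: M_def)
qed

lemma fourier_shifted_moments:
  fixes \<psi> :: "real^'n::finite \<Rightarrow> complex"
  assumes \<psi>: "\<psi> \<in> test_functions"
  shows "integrable lborel (\<lambda>x. of_real (((norm x)\<^sup>2 + d) ^ j) * fourier \<psi> x)"
    and "0 \<notin> supp \<psi> \<Longrightarrow> (LINT x|lborel. of_real (((norm x)\<^sup>2 + d) ^ j) * fourier \<psi> x) = 0"
proof -
  have eq: "complex_of_real (((norm x)\<^sup>2 + d) ^ j) * fourier \<psi> x =
     (\<Sum>i\<le>j. of_real (real (j choose i) * d ^ (j - i)) * (of_real (norm x ^ (2 * i)) * fourier \<psi> x))" for x
    unfolding binomial_ring of_real_sum sum_distrib_right power_mult[of _ 2]
    by (intro sum.cong refl) (simp only: of_real_mult mult_ac)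
  note Mi = fourier_moment_integrable[OF \<psi>]
  show "integrable lborel (\<lambda>x. of_real (((norm x)\<^sup>2 + d) ^ j) * fourier \<psi> x)"
    unfolding eq by (intro Bochner_Integration.integrable_sum integrable_mult_right Mi)
  assume s: "0 \<notin> supp \<psi>"
  have "(LINT x|lborel. of_real (((norm x)\<^sup>2 + d) ^ j) * fourier \<psi> x) =
    (\<Sum>i\<le>j. of_real (real (j choose i) * d ^ (j - i)) * (LINT x|lborel. of_real (norm x ^ (2 * i)) * fourier \<psi> x))"
    unfolding eq
    by (subst Bochner_Integration.integral_sum, intro integrable_mult_right Mi, intro sum.cong refl, rule Bochner_Integration.integral_mult_right_zero)
  also have "\<dots> = 0" unfolding fourier_moments_vanish[OF \<psi> s] by simp
  finally show "(LINT x|lborel. of_real (((norm x)\<^sup>2 + d) ^ j) * fourier \<psi> x) = 0" .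
qed

section \<open>The Fourier transform of the shifted surface spline\<close>

lemma shifted_spline_continuous:
  assumes c: "c > 0"
  shows "continuous_on A (shifted_spline (Suc L) (2 * L) c :: real^'n::finite \<Rightarrow> real)"
proof -
  have "(norm (x :: real^'n))\<^sup>2 + c\<^sup>2 \<noteq> 0" for x using c by (simp add: add_nonneg_eq_0_iff)
  thus ?thesis unfolding shifted_spline_eq[OF c, abs_def] by (intro continuous_intros) auto
qed

lemma shifted_spline_bound:
  fixes x :: "real^'n::finite"
  assumes c: "c > 0"
  shows "\<bar>shifted_spline (Suc L) (2 * L) c x\<bar> \<le> ((norm x)\<^sup>2 + c\<^sup>2) ^ Suc L + 1 / c\<^sup>2 * ((norm x)\<^sup>2 + c\<^sup>2) ^ L"
proof -
  define s where "s = (norm x)\<^sup>2 + c\<^sup>2"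
  have s: "s > 0" "s \<ge> c\<^sup>2" using c by (simp_all add: s_def add_nonneg_pos)
  have "ln s \<le> s" using ln_le_minus_one[OF s(1)] by simp
  moreover have "- ln s \<le> 1 / c\<^sup>2"
  proof -
    have "- ln s = ln (1 / s)" using s by (simp add: ln_div)
    also have "\<dots> \<le> 1 / s" using ln_le_minus_one[of "1 / s"] s by simp
    also have "\<dots> \<le> 1 / c\<^sup>2" using s c by (intro divide_left_mono) auto
    finally show ?thesis .
  qed
  ultimately have "\<bar>ln s\<bar> \<le> s + 1 / c\<^sup>2" using s c by (simp add: abs_le_iff add_increasing add_increasing2)
  hence "s ^ L * (\<bar>ln s\<bar> / 2) \<le> s ^ L * (s + 1 / c\<^sup>2)" using s by (intro mult_left_mono) auto
  also have "\<dots> = s ^ Suc L + 1 / c\<^sup>2 * s ^ L" by (simp add: algebra_simps)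
  finally show ?thesis unfolding shifted_spline_eq[OF c] s_def[symmetric] using s by (simp add: abs_mult power_abs)
qed

text \<open>The mixture truncated to \<open>t \<ge> e\<close> is transformed under the integral sign. The polynomial
  part contributes nothing, because the moments of \<open>fourier \<psi>\<close> vanish, and the part of the
  mixture with \<open>t < e\<close> contributes \<open>O(e)\<close>, because \<open>damped_integral \<psi> t\<close> cancels the
  singularity of the weight.\<close>

lemma shifted_spline_fourier:
  fixes \<psi> :: "real^'n::finite \<Rightarrow> complex" and L :: nat
  assumes c: "c > 0" and \<psi>: "\<psi> \<in> test_functions" and supp: "0 \<notin> supp \<psi>"
  defines "\<Phi> \<equiv> \<lambda>\<theta> :: real^'n. LINT t:{0<..}|lborel. heat_integrand L (real CARD('n)) c (norm \<theta>) t"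
  shows "integrable lborel (\<lambda>\<theta>. of_real (\<Phi> \<theta>) * \<psi> \<theta>)"
    and "(LINT x|lborel. of_real (shifted_spline (Suc L) (2 * L) c x) * fourier \<psi> x) =
      (LINT \<theta>|lborel. of_real (fact L / 2 * \<Phi> \<theta>) * \<psi> \<theta>)"
proof -
  let ?n = "CARD('n)"
  define s where "s x = (norm x)\<^sup>2 + c\<^sup>2" for x :: "real^'n"
  have s: "s x \<ge> c\<^sup>2" "s x > 0" for x using c by (simp_all add: s_def add_nonneg_pos)
  have c2: "c\<^sup>2 > 0" using c by simp
  have [measurable]: "\<psi> \<in> borel_measurable borel"
    using test_function_continuous[OF \<psi>] by (rule borel_measurable_continuous_onI)
  have [measurable]: "fourier \<psi> \<in> borel_measurable borel" by (rule fourier_measurable[OF \<psi>])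
  have [measurable]: "s \<in> borel_measurable borel" unfolding s_def by measurable
  have si: "integrable lborel (\<lambda>x. of_real (s x ^ j) * fourier \<psi> x)" and
    s0: "(LINT x|lborel. of_real (s x ^ j) * fourier \<psi> x) = 0" for j
    using fourier_shifted_moments[OF \<psi>, of "c\<^sup>2" j] supp by (simp_all add: s_def)
  obtain r0 where r0: "r0 > 0" "\<And>\<theta>. \<psi> \<theta> \<noteq> 0 \<Longrightarrow> norm \<theta> \<ge> r0" using supp_away_from_origin[OF supp] by blast
  obtain B where B: "B \<ge> 0" "\<And>t r. t > 0 \<Longrightarrow> r \<ge> r0 \<Longrightarrow> exp (- r\<^sup>2 / (4 * t)) / t ^ Suc L * sqrt (pi / t) ^ ?n \<le> B"
    using heat_weight_bound[OF r0(1)] by blast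
  obtain B' where B': "B' \<ge> 0" "\<And>t. t > 0 \<Longrightarrow> cmod (damped_integral \<psi> t) \<le> B' * t ^ Suc L"
    using damped_integral_flat[OF \<psi> supp] by blast
  \<comment> \<open>the mixture without truncation: on the support of \<open>\<psi>\<close> its transform is integrable in \<open>t\<close>
    down to \<open>0\<close>\<close>
  define f where "f t \<theta> = of_real (indicator {0<..} t * heat_integrand L (real ?n) c (norm \<theta>) t) * \<psi> \<theta>" for t and \<theta> :: "real^'n"
  have fm: "(\<lambda>(t, \<theta>). f t \<theta>) \<in> borel_measurable (lborel \<Otimes>\<^sub>M lborel)"
    unfolding f_def heat_integrand_def by measurable
  have hi: "heat_integrand L (real ?n) c r t = exp (- c\<^sup>2 * t) / t ^ Suc L * (sqrt (pi / t) ^ ?n * exp (- r\<^sup>2 / (4 * t)))"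
    if "t > 0" for t r
  proof -
    have "exp (- c\<^sup>2 * t - r\<^sup>2 / (4 * t)) = exp (- c\<^sup>2 * t) * exp (- r\<^sup>2 / (4 * t))"
      unfolding exp_add[symmetric] by simp
    moreover have "sqrt (pi / t) powr real ?n = sqrt (pi / t) ^ ?n" using that by (simp add: powr_realpow)
    ultimately show ?thesis unfolding heat_integrand_def
      by (simp only: times_divide_eq_left times_divide_eq_right mult_ac)
  qed
  have fb: "cmod (f t \<theta>) \<le> (indicator {0..} t *\<^sub>R (t ^ 0 * exp (- c\<^sup>2 * t))) * (B * cmod (\<psi> \<theta>))" for t \<theta>
  proof (cases "t > 0 \<and> \<psi> \<theta> \<noteq> 0")
    case True
    hence t: "t > 0" and z: "\<psi> \<theta> \<noteq> 0" by auto
    have "heat_integrand L (real ?n) c (norm \<theta>) t = exp (- c\<^sup>2 * t) * (exp (- (norm \<theta>)\<^sup>2 / (4 * t)) / t ^ Suc L * sqrt (pi / t) ^ ?n)"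
      unfolding hi[OF t] by (simp only: times_divide_eq_left times_divide_eq_right mult_ac)
    also have "\<dots> \<le> exp (- c\<^sup>2 * t) * B"
      by (rule mult_left_mono[OF B(2)[OF t r0(2)[OF z]]]) simp
    finally have h: "heat_integrand L (real ?n) c (norm \<theta>) t \<le> exp (- c\<^sup>2 * t) * B" .
    have h0: "heat_integrand L (real ?n) c (norm \<theta>) t \<ge> 0" using t by (simp add: heat_integrand_def)
    have "cmod (f t \<theta>) = heat_integrand L (real ?n) c (norm \<theta>) t * cmod (\<psi> \<theta>)"
      unfolding f_def norm_mult norm_of_real using t h0 by simp
    also have "\<dots> \<le> exp (- c\<^sup>2 * t) * B * cmod (\<psi> \<theta>)" by (rule mult_right_mono[OF h]) simp
    finally show ?thesis using t by simp
  next
    case False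
    hence "f t \<theta> = 0" by (auto simp: f_def)
    thus ?thesis using B(1) by simp
  qed
  have ia: "integrable lborel (\<lambda>t. indicator {0..} t *\<^sub>R (t ^ 0 * exp (- c\<^sup>2 * t)))"
    using power_exp_integral(1)[OF c2, of 0] unfolding set_integrable_def .
  have ib: "integrable lborel (\<lambda>\<theta>. B * cmod (\<psi> \<theta>))" using test_function_integrable[OF \<psi>] by simp
  have na: "0 \<le> indicator {0..} t *\<^sub>R (t ^ 0 * exp (- c\<^sup>2 * t))" for t :: real by simp
  have nb: "0 \<le> B * cmod (\<psi> \<theta>)" for \<theta> using B(1) by simp
  note fub = fubini_dominated[OF fm fb ia ib na nb]
  have ft: "(LINT t|lborel. f t \<theta>) = of_real (\<Phi> \<theta>) * \<psi> \<theta>" for \<theta>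
    unfolding f_def Bochner_Integration.integral_mult_left_zero integral_complex_of_real \<Phi>_def set_lebesgue_integral_def real_scaleR_def
    by (rule refl)
  show "integrable lborel (\<lambda>\<theta>. of_real (\<Phi> \<theta>) * \<psi> \<theta>)" using fub(3) unfolding ft .
  define w where "w t = exp (- c\<^sup>2 * t) / t ^ Suc L" for t :: real
  have f\<theta>: "(LINT \<theta>|lborel. f t \<theta>) = of_real (indicator {0<..} t * w t) * damped_integral \<psi> t" for t
  proof (cases "t > 0")
    case True
    have "f t \<theta> = of_real (indicator {0<..} t * w t) * (of_real (sqrt (pi / t) ^ ?n * exp (- (norm \<theta>)\<^sup>2 / (4 * t))) * \<psi> \<theta>)" for \<theta>
      unfolding f_def w_def hi[OF True] by (simp only: of_real_mult mult.assoc)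
    thus ?thesis unfolding damped_integral_eq[OF \<psi> True] by simp
  qed (simp add: f_def)
  have total: "(LINT t|lborel. of_real (indicator {0<..} t * w t) * damped_integral \<psi> t) = (LINT \<theta>|lborel. of_real (\<Phi> \<theta>) * \<psi> \<theta>)"
    using fub(1) unfolding f\<theta> ft .
  have ti: "integrable lborel (\<lambda>t. of_real (indicator {0<..} t * w t) * damped_integral \<psi> t)"
    using fub(2) unfolding f\<theta> .
  \<comment> \<open>for \<open>t \<ge> e\<close> the mixture is jointly integrable already before the Fourier transform\<close>
  have gt: "(LINT x|lborel. of_real (gamma_tail L e (s x)) * fourier \<psi> x) =
       (LINT t|lborel. of_real (indicator {e..} t * w t) * damped_integral \<psi> t)"
    and gi: "integrable lborel (\<lambda>x. of_real (gamma_tail L e (s x)) * fourier \<psi> x)"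
    and ei: "integrable lborel (\<lambda>t. of_real (indicator {e..} t * w t) * damped_integral \<psi> t)" if e: "e > 0" for e
  proof -
    define g where "g t x = of_real (indicator {e..} t * (exp (- s x * t) / t ^ Suc L)) * fourier \<psi> x" for t x
    have gm: "(\<lambda>(t, x). g t x) \<in> borel_measurable (lborel \<Otimes>\<^sub>M lborel)" unfolding g_def by measurable
    have gb: "cmod (g t x) \<le> (indicator {e..} t *\<^sub>R (exp (- c\<^sup>2 * t) / t ^ Suc L)) * cmod (fourier \<psi> x)" for t x
    proof (cases "t \<ge> e")
      case True
      hence t: "t > 0" using e by linarith
      have "exp (- s x * t) \<le> exp (- c\<^sup>2 * t)" using s(1)[of x] t by simp
      hence "exp (- s x * t) / t ^ Suc L \<le> exp (- c\<^sup>2 * t) / t ^ Suc L" using t by (intro divide_right_mono) auto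
      hence "exp (- s x * t) / t ^ Suc L * cmod (fourier \<psi> x) \<le> exp (- c\<^sup>2 * t) / t ^ Suc L * cmod (fourier \<psi> x)"
        by (rule mult_right_mono) simp
      moreover have "0 \<le> exp (- s x * t) / t ^ Suc L" using t by simp
      hence "\<bar>indicat_real {e..} t * (exp (- s x * t) / t ^ Suc L)\<bar> = exp (- s x * t) / t ^ Suc L"
        using True by (simp del: power_Suc abs_divide)
      ultimately show ?thesis using True unfolding g_def norm_mult norm_of_real by (simp del: power_Suc)
    qed (simp add: g_def)
    have i1: "integrable lborel (\<lambda>t. indicator {e..} t *\<^sub>R (exp (- c\<^sup>2 * t) / t ^ Suc L))"
      using set_integrable_exp_over_power[OF e c2] unfolding set_integrable_def .
    have i2: "integrable lborel (\<lambda>x. cmod (fourier \<psi> x))" using fourier_integrable[OF \<psi>] by simp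
    have n1: "0 \<le> indicator {e..} t *\<^sub>R (exp (- c\<^sup>2 * t) / t ^ Suc L)" for t :: real using e by (simp add: indicator_def)
    note fg = fubini_dominated[OF gm gb i1 i2 n1 norm_ge_zero]
    have g1: "(LINT t|lborel. g t x) = of_real (gamma_tail L e (s x)) * fourier \<psi> x" for x
      unfolding g_def Bochner_Integration.integral_mult_left_zero integral_complex_of_real gamma_tail_def set_lebesgue_integral_def real_scaleR_def
      by (rule refl)
    have g2: "(LINT x|lborel. g t x) = of_real (indicator {e..} t * w t) * damped_integral \<psi> t" for t
    proof -
      have "g t x = of_real (indicator {e..} t * w t) * (of_real (exp (- t * (norm x)\<^sup>2)) * fourier \<psi> x)" for x
      proof -
        have "exp (- s x * t) = exp (- c\<^sup>2 * t) * exp (- t * (norm x)\<^sup>2)"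
          by (simp add: s_def exp_add[symmetric] algebra_simps)
        thus ?thesis unfolding g_def w_def by simp
      qed
      thus ?thesis unfolding damped_integral_def by simp
    qed
    show "(LINT x|lborel. of_real (gamma_tail L e (s x)) * fourier \<psi> x) =
       (LINT t|lborel. of_real (indicator {e..} t * w t) * damped_integral \<psi> t)"
      using fg(1) unfolding g1 g2 by simp
    show "integrable lborel (\<lambda>x. of_real (gamma_tail L e (s x)) * fourier \<psi> x)" using fg(3) unfolding g1 .
    show "integrable lborel (\<lambda>t. of_real (indicator {e..} t * w t) * damped_integral \<psi> t)" using fg(2) unfolding g2 .
  qed
  have tail: "cmod ((LINT t|lborel. of_real (indicator {0<..} t * w t) * damped_integral \<psi> t) -
      (LINT t|lborel. of_real (indicator {e..} t * w t) * damped_integral \<psi> t)) \<le> e * B'" if e: "e > 0" for e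
  proof -
    have "(LINT t|lborel. of_real (indicator {0<..} t * w t) * damped_integral \<psi> t) -
      (LINT t|lborel. of_real (indicator {e..} t * w t) * damped_integral \<psi> t) =
      (LINT t|lborel. of_real (indicator {0<..} t * w t) * damped_integral \<psi> t - of_real (indicator {e..} t * w t) * damped_integral \<psi> t)"
      by (rule Bochner_Integration.integral_diff[OF ti ei[OF e], symmetric])
    also have "cmod \<dots> \<le> (LINT t|lborel. B' * indicator {0..e} t)"
    proof (rule norm_integral_le)
      show "integrable lborel (\<lambda>t. of_real (indicator {0<..} t * w t) * damped_integral \<psi> t - of_real (indicator {e..} t * w t) * damped_integral \<psi> t)"
        by (rule Bochner_Integration.integrable_diff[OF ti ei[OF e]])
      show "integrable lborel (\<lambda>t. B' * indicator {0..e} t)"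
        by (intro integrable_mult_right integrable_real_indicator) (auto simp: emeasure_lborel_Icc_eq)
      fix t
      show "cmod (of_real (indicator {0<..} t * w t) * damped_integral \<psi> t - of_real (indicator {e..} t * w t) * damped_integral \<psi> t) \<le> B' * indicator {0..e} t"
      proof (cases "0 < t \<and> t < e")
        case True
        have w: "0 \<le> w t" "w t \<le> 1 / t ^ Suc L" using True c2 by (auto simp: w_def intro!: divide_right_mono)
        have "cmod (of_real (w t) * damped_integral \<psi> t) \<le> 1 / t ^ Suc L * (B' * t ^ Suc L)"
          unfolding norm_mult norm_of_real using w B'(2)[of t] True by (intro mult_mono) auto
        also have "\<dots> = B'" using True by simp
        finally show ?thesis using True by simp
      next
        case False
        thus ?thesis using e B'(1) by (auto simp: indicator_def)
      qed
    qed
    also have "\<dots> = e * B'" using e by simp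
    finally show ?thesis .
  qed
  let ?h = "shifted_spline (Suc L) (2 * L) c :: real^'n \<Rightarrow> real"
  have hm: "?h \<in> borel_measurable borel"
    by (rule borel_measurable_continuous_onI[OF shifted_spline_continuous[OF c]])
  have bi: "integrable lborel (\<lambda>x. cmod (of_real (s x ^ Suc L) * fourier \<psi> x) + d * cmod (of_real (s x ^ L) * fourier \<psi> x))" for d
    by (intro Bochner_Integration.integrable_add integrable_mult_right integrable_norm si)
  have hint: "integrable lborel (\<lambda>x. of_real (?h x) * fourier \<psi> x)"
  proof (rule Bochner_Integration.integrable_bound[OF bi[of "1 / c\<^sup>2"]])
    show "(\<lambda>x. of_real (?h x) * fourier \<psi> x) \<in> borel_measurable lborel" using hm by measurable
    show "AE x in lborel. norm (of_real (?h x) * fourier \<psi> x) \<le>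
        norm (cmod (of_real (s x ^ Suc L) * fourier \<psi> x) + 1 / c\<^sup>2 * cmod (of_real (s x ^ L) * fourier \<psi> x))"
    proof (rule AE_I2)
      fix x :: "real^'n"
      have "\<bar>?h x\<bar> * cmod (fourier \<psi> x) \<le> (s x ^ Suc L + 1 / c\<^sup>2 * s x ^ L) * cmod (fourier \<psi> x)"
        using shifted_spline_bound[OF c, of L x] unfolding s_def by (intro mult_right_mono) auto
      also have "\<dots> = cmod (of_real (s x ^ Suc L) * fourier \<psi> x) + 1 / c\<^sup>2 * cmod (of_real (s x ^ L) * fourier \<psi> x)"
        using s(2)[of x] unfolding norm_mult norm_of_real by (simp add: algebra_simps abs_mult power_abs)
      also have "\<dots> \<le> norm \<dots>" unfolding real_norm_def by (rule abs_ge_self)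
      finally show "norm (of_real (?h x) * fourier \<psi> x) \<le>
        norm (cmod (of_real (s x ^ Suc L) * fourier \<psi> x) + 1 / c\<^sup>2 * cmod (of_real (s x ^ L) * fourier \<psi> x))"
        unfolding norm_mult[of "of_real (?h x)"] norm_of_real .
    qed
  qed
  define E where "E = (LINT x|lborel. fact L / 2 * (cmod (of_real (s x ^ Suc L) * fourier \<psi> x) + 1 * cmod (of_real (s x ^ L) * fourier \<psi> x)))"
  have E0: "E \<ge> 0" unfolding E_def by (intro integral_nonneg_AE AE_I2) simp
  have comp: "cmod ((LINT x|lborel. of_real (?h x) * fourier \<psi> x) - of_real (fact L / 2) * (LINT x|lborel. of_real (gamma_tail L e (s x)) * fourier \<psi> x)) \<le> e * E"
    if e: "e > 0" for e
  proof -
    obtain \<kappa> where \<kappa>: "\<And>x :: real^'n. \<bar>?h x - fact L / 2 * (gamma_tail L e (s x) - (\<Sum>j\<le>L. \<kappa> j * s x ^ j))\<bar>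
     \<le> e * (fact L / 2 * (s x ^ L * (s x + 1)))"
      using shifted_spline_gaussian_mixture[OF e c] unfolding s_def by blast
    define P where "P x = (\<Sum>j\<le>L. of_real (\<kappa> j) * (of_real (s x ^ j) * fourier \<psi> x))" for x
    have Pi: "integrable lborel P" unfolding P_def by (intro Bochner_Integration.integrable_sum integrable_mult_right si)
    have P0: "integral\<^sup>L lborel P = 0" unfolding P_def
      by (subst Bochner_Integration.integral_sum, intro integrable_mult_right si)
         (simp only: Bochner_Integration.integral_mult_right_zero s0 mult_zero_right sum.neutral_const)
    define G where "G x = of_real (gamma_tail L e (s x)) * fourier \<psi> x" for x
    have Gi: "integrable lborel G" unfolding G_def by (rule gi[OF e])
    have "(LINT x|lborel. of_real (?h x) * fourier \<psi> x - of_real (fact L / 2) * (G x - P x)) =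
       (LINT x|lborel. of_real (?h x) * fourier \<psi> x) - of_real (fact L / 2) * (integral\<^sup>L lborel G - integral\<^sup>L lborel P)"
      using hint Gi Pi by simp
    hence "(LINT x|lborel. of_real (?h x) * fourier \<psi> x) - of_real (fact L / 2) * integral\<^sup>L lborel G =
       (LINT x|lborel. of_real (?h x) * fourier \<psi> x - of_real (fact L / 2) * (G x - P x))"
      unfolding P0 by simp
    also have "cmod \<dots> \<le> (LINT x|lborel. e * (fact L / 2 * (cmod (of_real (s x ^ Suc L) * fourier \<psi> x) + 1 * cmod (of_real (s x ^ L) * fourier \<psi> x))))"
    proof (rule norm_integral_le)
      show "integrable lborel (\<lambda>x. of_real (?h x) * fourier \<psi> x - of_real (fact L / 2) * (G x - P x))"
        by (intro Bochner_Integration.integrable_diff hint integrable_mult_right Gi Pi)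
      show "integrable lborel (\<lambda>x. e * (fact L / 2 * (cmod (of_real (s x ^ Suc L) * fourier \<psi> x) + 1 * cmod (of_real (s x ^ L) * fourier \<psi> x))))"
        by (intro integrable_mult_right bi)
      fix x
      have "P x = of_real (\<Sum>j\<le>L. \<kappa> j * s x ^ j) * fourier \<psi> x"
        unfolding P_def of_real_sum sum_distrib_right of_real_mult by (simp only: mult.assoc)
      hence "of_real (?h x) * fourier \<psi> x - of_real (fact L / 2) * (G x - P x) =
         of_real (?h x - fact L / 2 * (gamma_tail L e (s x) - (\<Sum>j\<le>L. \<kappa> j * s x ^ j))) * fourier \<psi> x"
        unfolding G_def of_real_diff of_real_mult by (simp only: left_diff_distrib right_diff_distrib mult.assoc)
      hence "cmod (of_real (?h x) * fourier \<psi> x - of_real (fact L / 2) * (G x - P x)) =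
         \<bar>?h x - fact L / 2 * (gamma_tail L e (s x) - (\<Sum>j\<le>L. \<kappa> j * s x ^ j))\<bar> * cmod (fourier \<psi> x)"
        by (simp only: norm_mult norm_of_real)
      also have "\<dots> \<le> e * (fact L / 2 * (s x ^ L * (s x + 1))) * cmod (fourier \<psi> x)"
        by (rule mult_right_mono[OF \<kappa>]) simp
      also have "\<dots> = e * (fact L / 2 * (cmod (of_real (s x ^ Suc L) * fourier \<psi> x) + 1 * cmod (of_real (s x ^ L) * fourier \<psi> x)))"
        using s(2)[of x] unfolding norm_mult norm_of_real by (simp add: algebra_simps abs_mult power_abs)
      finally show "cmod (of_real (?h x) * fourier \<psi> x - of_real (fact L / 2) * (G x - P x)) \<le>
         e * (fact L / 2 * (cmod (of_real (s x ^ Suc L) * fourier \<psi> x) + 1 * cmod (of_real (s x ^ L) * fourier \<psi> x)))" .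
    qed
    also have "\<dots> = e * E" unfolding E_def by (rule Bochner_Integration.integral_mult_right_zero)
    finally show ?thesis unfolding G_def .
  qed
  have "cmod ((LINT x|lborel. of_real (?h x) * fourier \<psi> x) - of_real (fact L / 2) * (LINT \<theta>|lborel. of_real (\<Phi> \<theta>) * \<psi> \<theta>)) \<le> 0"
  proof (rule limit_of_linear_bound)
    show "E + fact L / 2 * B' \<ge> 0" using E0 B' by simp
    fix e :: real assume e: "e > 0"
    have tri: "cmod (H - F * T) \<le> e1 + r * e2" if "cmod (H - F * T') \<le> e1" "cmod (T - T') \<le> e2" "cmod F = r" for H F T T' :: complex and e1 e2 r
    proof -
      have "H - F * T = (H - F * T') - F * (T - T')" by (simp add: algebra_simps)
      hence "cmod (H - F * T) \<le> cmod (H - F * T') + cmod (F * (T - T'))" by (metis norm_triangle_ineq4)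
      also have "cmod (F * (T - T')) \<le> r * e2" unfolding norm_mult using that by (intro mult_mono) auto
      finally show ?thesis using that by simp
    qed
    have "cmod (complex_of_real (fact L / 2)) = fact L / 2" unfolding norm_of_real by simp
    from tri[OF comp[OF e, unfolded gt[OF e]] tail[OF e, unfolded total] this]
    show "cmod ((LINT x|lborel. of_real (?h x) * fourier \<psi> x) - of_real (fact L / 2) * (LINT \<theta>|lborel. of_real (\<Phi> \<theta>) * \<psi> \<theta>)) \<le> 0 + e * (E + fact L / 2 * B')"
      by (simp add: algebra_simps)
  qed
  hence "(LINT x|lborel. of_real (?h x) * fourier \<psi> x) = of_real (fact L / 2) * (LINT \<theta>|lborel. of_real (\<Phi> \<theta>) * \<psi> \<theta>)" by simp
  also have "\<dots> = (LINT \<theta>|lborel. of_real (fact L / 2 * \<Phi> \<theta>) * \<psi> \<theta>)"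
    unfolding of_real_mult[of "fact L / 2"] mult.assoc by (rule Bochner_Integration.integral_mult_right_zero[symmetric])
  finally show "(LINT x|lborel. of_real (?h x) * fourier \<psi> x) = (LINT \<theta>|lborel. of_real (fact L / 2 * \<Phi> \<theta>) * \<psi> \<theta>)" .
qed

text \<open>By \<open>shifted_spline_fourier\<close> and \<open>heat_integral_bessel\<close> the right-hand side has the
  defining property. For uniqueness the property is tested on a bump around a unit vector, on
  which the positive weight has a positive integral.\<close>

lemma l_const_eq:
  "l_const TYPE('n::finite) (2 * L) = fact L * 2 ^ L * sqrt (2 * pi) ^ CARD('n)"
proof -
  define l0 :: real where "l0 = fact L * 2 ^ L * sqrt (2 * pi) ^ CARD('n)"
  have l0: "l0 > 0" by (simp add: l0_def)
  define w where "w c \<theta> = norm \<theta> powr (- real (2 * L) - real CARD('n)) *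
      bessel_K_tilde ((real CARD('n) + real (2 * L)) / 2) (c * norm \<theta>)" for c and \<theta> :: "real^'n"
  define \<Phi> where "\<Phi> c \<theta> = (LINT t:{0<..}|lborel. heat_integrand L (real CARD('n)) c (norm \<theta>) t)" for c and \<theta> :: "real^'n"
  have \<Phi>: "fact L / 2 * \<Phi> c \<theta> = l0 * w c \<theta>" if "c > 0" "\<theta> \<noteq> 0" for c \<theta>
    using heat_integral_bessel(2)[OF that(1), of "norm \<theta>" L "real CARD('n)"] that(2)
    unfolding \<Phi>_def w_def l0_def by (simp add: powr_realpow mult_ac)
  define u where "u c x = complex_of_real (shifted_spline (1 + (2 * L) div 2) (2 * L) c x)" for c and x :: "real^'n"
  have u: "u c = (\<lambda>x. of_real (shifted_spline (Suc L) (2 * L) c x))" for c by (simp add: u_def fun_eq_iff)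
  have key: "(LINT x|lborel. u c x * fourier \<psi> x) = of_real l0 * (LINT \<theta>|lborel. of_real (w c \<theta>) * \<psi> \<theta>)"
    "integrable lborel (\<lambda>\<theta>. of_real (w c \<theta>) * \<psi> \<theta>)"
    if c: "c > 0" and \<psi>: "\<psi> \<in> test_functions" and s: "0 \<notin> supp \<psi>" for c \<psi>
  proof -
    have z: "\<psi> 0 = 0" using s closure_subset[of "{x. \<psi> x \<noteq> 0}"] by (auto simp: supp_def)
    have eq: "of_real (fact L / 2 * \<Phi> c \<theta>) * \<psi> \<theta> = of_real l0 * (of_real (w c \<theta>) * \<psi> \<theta>)" for \<theta>
    proof (cases "\<theta> = 0")
      case False
      show ?thesis unfolding \<Phi>[OF c False] of_real_mult[of l0] mult.assoc by (rule refl)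
    qed (simp add: z)
    show "(LINT x|lborel. u c x * fourier \<psi> x) = of_real l0 * (LINT \<theta>|lborel. of_real (w c \<theta>) * \<psi> \<theta>)"
      unfolding u shifted_spline_fourier(2)[OF c \<psi> s] \<Phi>_def[symmetric] eq by (rule Bochner_Integration.integral_mult_right_zero)
    have "integrable lborel (\<lambda>\<theta>. of_real (fact L / 2 * \<Phi> c \<theta>) * \<psi> \<theta>)"
      using shifted_spline_fourier(1)[OF c \<psi> s, of L] unfolding \<Phi>_def[symmetric] of_real_mult mult.assoc
      by (intro integrable_mult_right)
    hence A: "integrable lborel (\<lambda>\<theta>. of_real l0 * (of_real (w c \<theta>) * \<psi> \<theta>))" unfolding eq .
    have e: "of_real (1 / l0) * (of_real l0 * z) = z" for z :: complex using l0 by simp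
    have "integrable lborel (\<lambda>\<theta>. of_real (1 / l0) * (of_real l0 * (of_real (w c \<theta>) * \<psi> \<theta>)))"
      by (rule integrable_mult_right[OF A])
    thus "integrable lborel (\<lambda>\<theta>. of_real (w c \<theta>) * \<psi> \<theta>)" unfolding e .
  qed
  have ff: "fourier_off_origin (u c) (\<lambda>\<theta>. of_real (l * norm \<theta> powr (- real (2 * L) - real CARD('n)) *
          bessel_K_tilde ((real CARD('n) + real (2 * L)) / 2) (c * norm \<theta>))) \<longleftrightarrow>
      (\<forall>\<psi>\<in>test_functions. 0 \<notin> supp \<psi> \<longrightarrow> (LINT x|lborel. u c x * fourier \<psi> x) = of_real l * (LINT \<theta>|lborel. of_real (w c \<theta>) * \<psi> \<theta>))" for c l
    unfolding fourier_off_origin_def w_def mult.assoc of_real_mult[of l] Bochner_Integration.integral_mult_right_zero by (rule refl)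
  have "l_const TYPE('n) (2 * L) = l0"
    unfolding l_const_def u_def[symmetric, abs_def]
  proof (rule the_equality)
    show "0 < l0 \<and> (\<forall>c>0. fourier_off_origin (u c) (\<lambda>\<theta>. of_real (l0 * norm \<theta> powr (- real (2 * L) - real CARD('n)) *
          bessel_K_tilde ((real CARD('n) + real (2 * L)) / 2) (c * norm \<theta>))))"
      unfolding ff using l0 key(1) by blast
    fix l assume l: "0 < l \<and> (\<forall>c>0. fourier_off_origin (u c) (\<lambda>\<theta>. of_real (l * norm \<theta> powr (- real (2 * L) - real CARD('n)) *
          bessel_K_tilde ((real CARD('n) + real (2 * L)) / 2) (c * norm \<theta>))))"
    obtain y :: "real^'n" where y: "norm y = 1" using vector_choose_size[of 1] by auto
    define \<psi> where "\<psi> x = complex_of_real (bump y (1 / 2) x)" for x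
    have \<psi>: "\<psi> \<in> test_functions" unfolding \<psi>_def by (rule bump_test_function) simp
    have nz: "\<theta> \<noteq> 0" if "dist y \<theta> \<le> 1 / 2" for \<theta> using that y by (auto simp: dist_norm)
    have "supp \<psi> \<subseteq> cball y (1 / 2)" unfolding supp_def
      by (rule closure_minimal) (auto simp: \<psi>_def bump_eq_0_iff dist_commute)
    hence s: "0 \<notin> supp \<psi>" using nz[of 0] by auto
    define I where "I = (LINT \<theta>|lborel. of_real (w 1 \<theta>) * \<psi> \<theta>)"
    have "of_real l * I = of_real l0 * I"
      using l \<psi> s key(1)[OF _ \<psi> s, of 1] unfolding ff I_def by fastforce
    moreover have "I \<noteq> 0"
    proof -
      have wi: "integrable lborel (\<lambda>\<theta>. w 1 \<theta> * bump y (1 / 2) \<theta>)"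
        using integrable_Re[OF key(2)[OF _ \<psi> s, of 1]] by (simp add: \<psi>_def)
      have wp: "w 1 \<theta> > 0" if "\<theta> \<noteq> 0" for \<theta>
        using bessel_symmetric_integrable(3)[of "norm \<theta>"] that by (simp add: w_def bessel_K_tilde_def)
      have "(LINT \<theta>|lborel. w 1 \<theta> * bump y (1 / 2) \<theta>) > 0"
      proof (rule integral_positive[OF wi])
        show "(1/2 :: real) > 0" by simp
        fix x
        show "0 \<le> w 1 x * bump y (1 / 2) x"
        proof (cases "dist y x \<le> 1 / 2")
          case True thus ?thesis using wp[OF nz[OF True]] bump_nonneg[of y "1/2" x] by simp
        next
          case False
          hence "bump y (1 / 2) x = 0" by (simp add: bump_eq_0_iff dist_commute)
          thus ?thesis by simp
        qed
        assume d: "dist y x < 1 / 2"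
        hence "bump y (1 / 2) x > 0" by (simp add: bump_pos_iff dist_commute)
        thus "0 < w 1 x * bump y (1 / 2) x" using wp[OF nz] d by simp
      qed
      moreover have "I = of_real (LINT \<theta>|lborel. w 1 \<theta> * bump y (1 / 2) \<theta>)"
        unfolding I_def \<psi>_def of_real_mult[symmetric] by (rule integral_complex_of_real)
      ultimately show ?thesis by simp
    qed
    ultimately show "l = l0" by simp
  qed
  thus ?thesis by (simp add: l0_def)
qed

section \<open>Data points in a cube and the local error estimate\<close>

lemma norm_le_sqrt_card:
  fixes u :: "real^'n::finite"
  assumes "\<And>i. \<bar>u $ i\<bar> \<le> a" "a \<ge> 0"
  shows "norm u \<le> sqrt (real CARD('n)) * a"
proof -
  have "(norm u)\<^sup>2 = (\<Sum>i\<in>UNIV. (u $ i)\<^sup>2)" by (rule norm_sq_vec)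
  also have "\<dots> \<le> (\<Sum>i\<in>(UNIV :: 'n set). a\<^sup>2)"
    by (intro sum_mono) (metis abs_ge_zero assms(1) power2_abs power_mono)
  also have "\<dots> = (sqrt (real CARD('n)) * a)\<^sup>2" by (simp add: power_mult_distrib)
  finally show ?thesis by (rule power2_le_imp_le) (use assms in simp)
qed

lemma orthogonal_matrix_norm:
  fixes R :: "real^'n^'n::finite"
  assumes "orthogonal_matrix R" shows "norm (R *v x) = norm x"
  using assms by (simp add: orthogonal_transformation_matrix orthogonal_transformation_norm)

text \<open>The point \<open>x\<close> may lie on the boundary of the cube, so a ball around it need not be
  filled with data points. Instead \<open>z\<close> is the centre of a subcube of side \<open>q * \<delta>\<close> that
  contains \<open>x\<close>, and the ball inscribed in it is used; the distance from \<open>z\<close> to \<open>x\<close> exceeds its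
  radius by at most the factor \<open>sqrt n\<close>.\<close>

lemma dense_points_in_subcube:
  fixes R :: "real^'n^'n::finite" and X :: "(real^'n) set"
  assumes R: "rotation_matrix R" and d: "\<delta> > 0" and q: "q \<ge> 1" and qb: "real q * \<delta> \<le> b"
    and hit: "\<And>w. cube R w \<delta> \<subseteq> cube R v b \<Longrightarrow> cube R w \<delta> \<inter> X \<noteq> {}"
    and x: "x \<in> cube R v b"
  obtains z where "dist z x \<le> sqrt (real CARD('n)) * (real q * \<delta> / 2)"
    "\<And>p. dist z p \<le> real q * \<delta> / 2 \<Longrightarrow> \<exists>y\<in>X. dist p y \<le> sqrt (real CARD('n)) * \<delta> \<and> dist y x \<le> sqrt (real CARD('n)) * (real q * \<delta>)"
proof -
  define l where "l = real q * \<delta>"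
  have l: "l \<ge> \<delta>" "l \<le> b" "l > 0" using q d qb by (auto simp: l_def)
  have orth: "orthogonal_matrix R" using R by (simp add: rotation_matrix_def)
  obtain \<xi> :: "real^'n" where \<xi>: "x = v + R *v \<xi>" "\<And>i. 0 \<le> \<xi> $ i" "\<And>i. \<xi> $ i \<le> b"
    using x by (auto simp: cube_def mem_box_cart)
  \<comment> \<open>the lower corner of a subcube of side \<open>l\<close> that contains \<open>x\<close>: start at \<open>x\<close> and move back
    into the cube where necessary\<close>
  define a :: "real^'n" where "a = (\<chi> i. min (\<xi> $ i) (b - l))"
  have a: "0 \<le> a $ i" "a $ i + l \<le> b" "a $ i \<le> \<xi> $ i" "\<xi> $ i \<le> a $ i + l" for i
    using \<xi>(2,3)[of i] l by (auto simp: a_def min_def)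
  define h :: "real^'n" where "h = (\<chi> i. l / 2)"
  define z where "z = v + R *v (a + h)"
  show thesis
  proof (rule that[of z])
    have "dist z x = norm (R *v (a + h - \<xi>))"
      unfolding z_def \<xi>(1) dist_norm by (simp add: matrix_vector_mult_diff_distrib)
    also have "\<dots> = norm (a + h - \<xi>)" by (rule orthogonal_matrix_norm[OF orth])
    also have "\<dots> \<le> sqrt (real CARD('n)) * (l / 2)"
    proof (rule norm_le_sqrt_card)
      fix i show "\<bar>(a + h - \<xi>) $ i\<bar> \<le> l / 2" using a(3,4)[of i] unfolding abs_le_iff by (auto simp: h_def)
    qed (use l in simp)
    finally show "dist z x \<le> sqrt (real CARD('n)) * (real q * \<delta> / 2)" by (simp add: l_def)
    fix p assume p: "dist z p \<le> real q * \<delta> / 2"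
    define \<zeta> where "\<zeta> = transpose R *v (p - z)"
    have R\<zeta>: "R *v \<zeta> = p - z"
    proof -
      have "R *v \<zeta> = (R ** transpose R) *v (p - z)" unfolding \<zeta>_def by (rule matrix_vector_mul_assoc)
      also have "R ** transpose R = mat 1" using orth by (simp add: orthogonal_matrix_def)
      finally show ?thesis by simp
    qed
    have n\<zeta>: "norm \<zeta> \<le> l / 2"
    proof -
      have "norm \<zeta> = norm (R *v \<zeta>)" by (rule orthogonal_matrix_norm[OF orth, symmetric])
      thus ?thesis using p unfolding R\<zeta> by (simp add: dist_norm norm_minus_commute l_def)
    qed
    define \<eta> where "\<eta> = a + h + \<zeta>"
    have p_eq: "p = v + R *v \<eta>"
      unfolding \<eta>_def matrix_vector_mult_add_rdistrib[symmetric] using R\<zeta>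
      by (simp add: z_def matrix_vector_right_distrib)
    have \<eta>: "a $ i \<le> \<eta> $ i" "\<eta> $ i \<le> a $ i + l" for i
    proof -
      have "\<bar>\<zeta> $ i\<bar> \<le> l / 2" using component_le_norm_cart[of \<zeta> i] n\<zeta> by linarith
      thus "a $ i \<le> \<eta> $ i" "\<eta> $ i \<le> a $ i + l" by (auto simp: \<eta>_def h_def)
    qed
    \<comment> \<open>in the same way, the corner of a cube of side \<open>\<delta>\<close> inside this subcube that contains
      \<open>p\<close>\<close>
    define w :: "real^'n" where "w = (\<chi> i. min (\<eta> $ i) (a $ i + l - \<delta>))"
    have w: "a $ i \<le> w $ i" "w $ i + \<delta> \<le> a $ i + l" "w $ i \<le> \<eta> $ i" "\<eta> $ i \<le> w $ i + \<delta>" for i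
      using \<eta>[of i] l d by (auto simp: w_def min_def)
    have cub: "cube R (v + R *v w) \<delta> = (\<lambda>u. v + R *v (w + u)) ` cbox 0 (\<chi> i. \<delta>)"
      unfolding cube_def by (simp add: matrix_vector_right_distrib add.assoc)
    have "cube R (v + R *v w) \<delta> \<subseteq> cube R v b"
    proof
      fix y assume "y \<in> cube R (v + R *v w) \<delta>"
      then obtain u :: "real^'n" where u: "y = v + R *v (w + u)" "\<And>i. 0 \<le> u $ i" "\<And>i. u $ i \<le> \<delta>"
        unfolding cub by (auto simp: mem_box_cart)
      have "w + u \<in> cbox 0 (\<chi> i. b)"
        unfolding mem_box_cart
      proof
        fix i show "(0 :: real^'n) $ i \<le> (w + u) $ i \<and> (w + u) $ i \<le> (\<chi> i. b) $ i"
          using w[of i] a(1,2)[of i] u(2,3)[of i] by simp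
      qed
      thus "y \<in> cube R v b" unfolding cube_def u(1) by blast
    qed
    hence "cube R (v + R *v w) \<delta> \<inter> X \<noteq> {}" by (rule hit)
    then obtain u where u': "u \<in> cbox 0 (\<chi> i. \<delta>)" and u1: "v + R *v (w + u) \<in> X" unfolding cub by blast
    have u: "0 \<le> u $ i" "u $ i \<le> \<delta>" for i using u' by (simp_all add: mem_box_cart)
    show "\<exists>y\<in>X. dist p y \<le> sqrt (real CARD('n)) * \<delta> \<and> dist y x \<le> sqrt (real CARD('n)) * (real q * \<delta>)"
    proof (intro bexI[OF _ u1] conjI)
      have "dist p (v + R *v (w + u)) = norm (R *v (\<eta> - (w + u)))"
        unfolding p_eq dist_norm by (simp add: matrix_vector_mult_diff_distrib)
      also have "\<dots> = norm (\<eta> - (w + u))" by (rule orthogonal_matrix_norm[OF orth])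
      also have "\<dots> \<le> sqrt (real CARD('n)) * \<delta>"
      proof (rule norm_le_sqrt_card)
        fix i show "\<bar>(\<eta> - (w + u)) $ i\<bar> \<le> \<delta>" using w(3,4)[of i] u[of i] by (simp add: abs_le_iff)
      qed (use d in simp)
      finally show "dist p (v + R *v (w + u)) \<le> sqrt (real CARD('n)) * \<delta>" .
      have "dist (v + R *v (w + u)) x = norm (R *v ((w + u) - \<xi>))"
        unfolding \<xi>(1) dist_norm by (simp add: matrix_vector_mult_diff_distrib)
      also have "\<dots> = norm ((w + u) - \<xi>)" by (rule orthogonal_matrix_norm[OF orth])
      also have "\<dots> \<le> sqrt (real CARD('n)) * l"
      proof (rule norm_le_sqrt_card)
        fix i show "\<bar>((w + u) - \<xi>) $ i\<bar> \<le> l"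
          using w(1,2)[of i] u[of i] a(3,4)[of i] by (simp add: abs_le_iff)
      qed (use l in simp)
      finally show "dist (v + R *v (w + u)) x \<le> sqrt (real CARD('n)) * (real q * \<delta>)" by (simp add: l_def)
    qed
  qed
qed

text \<open>Here \<open>x\<close> lies within \<open>sqrt n\<close> radii of the centre of the ball in which the points are
  dense. The requirement \<open>q \<ge> 6 * n * k\<close> makes them dense enough for polynomials of degree
  \<open>k - 1\<close>.\<close>

lemma reproducing_weights:
  fixes Y :: "(real^'n::finite) set"
  assumes k: "k \<ge> 2" and n: "CARD('n) \<ge> 2" and q: "real q \<ge> 6 * real CARD('n) * real k" and d: "\<delta> > 0"
    and fin: "finite Y"
    and zx: "dist z x \<le> sqrt (real CARD('n)) * (real q * \<delta> / 2)"
    and dense: "\<And>p. dist z p \<le> real q * \<delta> / 2 \<Longrightarrow> \<exists>y\<in>Y. dist p y \<le> sqrt (real CARD('n)) * \<delta>"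
  obtains \<sigma> where "(\<Sum>y\<in>Y. \<bar>\<sigma> y\<bar>) \<le> 8 * (1 + 9 * real CARD('n) / 4) ^ (2 * (k - 1))"
    "\<And>p. p \<in> real_polys (k - 1) \<Longrightarrow> p x = (\<Sum>y\<in>Y. \<sigma> y * p y)"
proof (rule weights_from_norming_set[OF fin, of "real_polys (k - 1)" "8 * (1 + 9 * real CARD('n) / 4) ^ (2 * (k - 1))" x])
  define r where "r = real q * \<delta> / 2"
  have q0: "real q > 0"
  proof -
    have "0 < 6 * real CARD('n) * real k" using k by simp
    thus ?thesis using q by linarith
  qed
  have r: "r > 0" using q0 d by (simp add: r_def)
  have dens: "6 * real (k - 1) * (sqrt (real CARD('n)) * \<delta>) \<le> sqrt 2 * r"
  proof -
    have s: "sqrt (real CARD('n)) * sqrt 2 \<le> real CARD('n)"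
    proof -
      have "sqrt (real CARD('n)) * sqrt 2 \<le> sqrt (real CARD('n)) * sqrt (real CARD('n))"
        using n by (intro mult_left_mono) auto
      thus ?thesis by simp
    qed
    have "12 * real (k - 1) * sqrt (real CARD('n)) * sqrt 2 \<le> 12 * real (k - 1) * real CARD('n)"
      using mult_left_mono[OF s, of "12 * real (k - 1)"] by (simp add: mult_ac)
    also have "\<dots> \<le> 12 * real k * real CARD('n)" by (intro mult_right_mono) auto
    also have "\<dots> \<le> 2 * real q" using q by (simp add: mult_ac)
    also have "\<dots> = sqrt 2 * real q * sqrt 2" by simp
    finally have "12 * real (k - 1) * sqrt (real CARD('n)) * sqrt 2 \<le> sqrt 2 * real q * sqrt 2" .
    hence "12 * real (k - 1) * sqrt (real CARD('n)) \<le> sqrt 2 * real q" by (rule mult_right_le_imp_le) simp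
    hence "12 * real (k - 1) * sqrt (real CARD('n)) * (\<delta> / 2) \<le> sqrt 2 * real q * (\<delta> / 2)"
      using d by (intro mult_right_mono) auto
    thus ?thesis by (simp add: r_def mult_ac)
  qed
  fix p B assume p: "p \<in> real_polys (k - 1)" and B: "\<And>y. y \<in> Y \<Longrightarrow> \<bar>p y\<bar> \<le> B"
  have "\<bar>p x\<bar> \<le> 8 * (1 + (3 * dist z x / (2 * r))\<^sup>2) ^ (2 * (k - 1)) * B"
    by (rule norming_set_ball[OF _ poly_on_lines_real_polys[OF p] continuous_on_real_polys[OF p] r _ dens B])
       (use k dense in \<open>auto simp: r_def\<close>)
  also have "\<dots> \<le> 8 * (1 + 9 * real CARD('n) / 4) ^ (2 * (k - 1)) * B"
  proof (intro mult_right_mono mult_left_mono power_mono add_left_mono)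
    have "dist z z \<le> real q * \<delta> / 2" using r by (simp add: r_def)
    then obtain y where "y \<in> Y" using dense by blast
    thus "0 \<le> B" using B[of y] by linarith
    have "3 * dist z x / (2 * r) \<le> 3 * (sqrt (real CARD('n)) * r) / (2 * r)"
      using zx r by (intro divide_right_mono mult_left_mono) (auto simp: r_def)
    also have "\<dots> = 3 * sqrt (real CARD('n)) / 2" using r by simp
    finally have "(3 * dist z x / (2 * r))\<^sup>2 \<le> (3 * sqrt (real CARD('n)) / 2)\<^sup>2"
      using r by (intro power_mono) auto
    thus "(3 * dist z x / (2 * r))\<^sup>2 \<le> 9 * real CARD('n) / 4" by (simp add: power_divide power_mult_distrib)
  qed auto
  finally show "\<bar>p x\<bar> \<le> 8 * (1 + 9 * real CARD('n) / 4) ^ (2 * (k - 1)) * B" .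
qed (auto intro: real_polys_lincomb real_polys_zero)

text \<open>The functional \<open>\<tau>\<close> is the evaluation at \<open>x\<close> minus the weighted evaluations on \<open>Y\<close>. It
  may happen that \<open>x\<close> belongs to \<open>Y\<close>; then both contributions are added at this point, whose
  distance from \<open>x\<close> is \<open>0\<close>.\<close>

lemma spline_error_from_weights:
  fixes f s :: "real^'n::finite \<Rightarrow> complex"
  assumes c: "c > 0" and k: "k \<ge> Suc L"
    and hb: "h_bound (shifted_spline (Suc L) (2 * L) c) (Suc L) f K" and f: "continuous_on UNIV f"
    and sp: "h_spline_interpolant (shifted_spline (Suc L) (2 * L) c) (Suc L) X f s"
    and YX: "Y \<subseteq> X" and far: "\<And>y. y \<in> Y \<Longrightarrow> dist y x \<le> D"
    and \<sigma>: "(\<Sum>y\<in>Y. \<bar>\<sigma> y\<bar>) \<le> \<Lambda>" "\<And>p. p \<in> real_polys (k - 1) \<Longrightarrow> p x = (\<Sum>y\<in>Y. \<sigma> y * p y)"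
  shows "cmod (f x - s x) \<le> K * sqrt (fact L / 2 * ((\<Lambda> * D ^ k)\<^sup>2 / fact k * 8 ^ k * sqrt 2 ^ CARD('n) *
     (fact (k - Suc L) / (c\<^sup>2) ^ (k - L))))"
proof -
  let ?h = "shifted_spline (Suc L) (2 * L) c :: real^'n \<Rightarrow> real"
  have K: "K \<ge> 0" using hb by (simp add: h_bound_def)
  obtain p a where pa: "finite X" "p \<in> poly_space L" "\<And>q. q \<in> poly_space L \<Longrightarrow> (\<Sum>y\<in>X. a y * q y) = 0"
    "\<And>x. s x = p x + (\<Sum>y\<in>X. a y * of_real (?h (x - y)))" "\<And>y. y \<in> X \<Longrightarrow> s y = f y"
    using sp unfolding h_spline_interpolant_def diff_Suc_1 by blast
  define V where "V = insert x X"
  have fV: "finite V" "X \<subseteq> V" "Y \<subseteq> V" "x \<in> V" using pa(1) YX by (auto simp: V_def)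
  define \<tau> where "\<tau> v = complex_of_real ((if v = x then 1 else 0) - (if v \<in> Y then \<sigma> v else 0))" for v
  have \<tau>sum: "(\<Sum>v\<in>V. \<tau> v * g v) = g x - (\<Sum>y\<in>Y. of_real (\<sigma> y) * g y)" for g :: "real^'n \<Rightarrow> complex"
  proof -
    have "(\<Sum>v\<in>V. \<tau> v * g v) = (\<Sum>v\<in>V. if v = x then g v else 0) - (\<Sum>v\<in>V. if v \<in> Y then of_real (\<sigma> v) * g v else 0)"
      unfolding \<tau>_def sum_subtractf[symmetric] by (intro sum.cong) (auto simp: left_diff_distrib)
    also have "(\<Sum>v\<in>V. if v = x then g v else 0) = g x" using fV by simp
    also have "(\<Sum>v\<in>V. if v \<in> Y then of_real (\<sigma> v) * g v else 0) = (\<Sum>y\<in>Y. of_real (\<sigma> y) * g y)"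
      using sum.inter_restrict[OF fV(1), of "\<lambda>v. of_real (\<sigma> v) * g v" Y] fV(3) by (simp add: Int_absorb1)
    finally show ?thesis .
  qed
  have annk: "annihilates k V \<tau>" unfolding annihilates_def \<tau>sum
  proof (intro allI impI)
    fix \<alpha> :: "'n \<Rightarrow> nat" assume "sum \<alpha> UNIV < k"
    hence "monomial_fun \<alpha> x = (\<Sum>y\<in>Y. \<sigma> y * monomial_fun \<alpha> y)"
      by (intro \<sigma>(2) monomial_in_real_polys) simp
    thus "complex_of_real (monomial_fun \<alpha> x) - (\<Sum>y\<in>Y. of_real (\<sigma> y) * of_real (monomial_fun \<alpha> y)) = 0"
      by simp
  qed
  have ann: "annihilates (Suc L) V \<tau>" by (rule annihilates_mono[OF annk k])
  have W: "(\<Sum>v\<in>V. cmod (\<tau> v) * norm (v - x) ^ k) \<le> \<Lambda> * D ^ k"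
  proof -
    have k0: "k > 0" using k by simp
    have "(\<Sum>v\<in>V. cmod (\<tau> v) * norm (v - x) ^ k) \<le> (\<Sum>v\<in>V. if v \<in> Y then \<bar>\<sigma> v\<bar> * D ^ k else 0)"
    proof (rule sum_mono)
      fix v
      show "cmod (\<tau> v) * norm (v - x) ^ k \<le> (if v \<in> Y then \<bar>\<sigma> v\<bar> * D ^ k else 0)"
      proof (cases "v = x")
        case True
        have "D \<ge> 0" if "v \<in> Y" using far[OF that] zero_le_dist order.trans by blast
        thus ?thesis using True k0 by (auto simp: zero_power)
      next
        case False
        thus ?thesis using far[of v] by (auto simp: \<tau>_def dist_norm intro!: mult_left_mono power_mono)
      qed
    qed
    also have "\<dots> = (\<Sum>y\<in>Y. \<bar>\<sigma> y\<bar>) * D ^ k"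
      using sum.inter_restrict[OF fV(1), of "\<lambda>v. \<bar>\<sigma> v\<bar> * D ^ k" Y] fV(3)
      by (simp add: Int_absorb1 sum_distrib_right)
    also have "\<dots> \<le> \<Lambda> * D ^ k"
    proof (cases "Y = {}")
      case True
      have "(1 :: real) = 0" using \<sigma>(2)[OF real_polys_const[of 1]] True by simp
      thus ?thesis by simp
    next
      case False
      then obtain y where "y \<in> Y" by blast
      hence "D \<ge> 0" using far zero_le_dist order.trans by blast
      thus ?thesis using \<sigma>(1) by (intro mult_right_mono) auto
    qed
    finally show ?thesis .
  qed
  have "cmod (\<Sum>v\<in>V. \<tau> v * (f v - s v)) \<le> K * sqrt (Re (kernel_form ?h V \<tau> \<tau>))"
  proof (rule native_interpolation_error[where X=X and m="Suc L" and p=p and a=a])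
    show "?h (- x) = ?h x" for x by (simp add: shifted_spline_def)
    show "kernel_form ?h V \<sigma>' \<sigma>' = of_real (Re (kernel_form ?h V \<sigma>' \<sigma>'))" "Re (kernel_form ?h V \<sigma>' \<sigma>') \<ge> 0"
      if "annihilates (Suc L) V \<sigma>'" for \<sigma>'
    proof -
      interpret spline_form L c V \<sigma>' by unfold_locales (use c fV that in auto)
      show "kernel_form ?h V \<sigma>' \<sigma>' = of_real (Re (kernel_form ?h V \<sigma>' \<sigma>'))" "Re (kernel_form ?h V \<sigma>' \<sigma>') \<ge> 0"
        using form_nonneg by auto
    qed
    show "cmod (\<Sum>v\<in>V. \<sigma>' v * f v) \<le> K * sqrt (Re (kernel_form ?h V \<sigma>' \<sigma>'))" if "annihilates (Suc L) V \<sigma>'" for \<sigma>'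
      by (rule native_point_functional_bound[OF f hb shifted_spline_continuous[OF c] fV(1) that])
  qed (use fV K pa ann in auto)
  also have "(\<Sum>v\<in>V. \<tau> v * (f v - s v)) = f x - s x"
  proof -
    have "(\<Sum>y\<in>Y. of_real (\<sigma> y) * (f y - s y)) = 0" using pa(5) YX by (intro sum.neutral) auto
    thus ?thesis unfolding \<tau>sum by simp
  qed
  finally have 1: "cmod (f x - s x) \<le> K * sqrt (Re (kernel_form ?h V \<tau> \<tau>))" .
  interpret spline_form L c V \<tau> by unfold_locales (use c fV ann in auto)
  have "Re (kernel_form ?h V \<tau> \<tau>) \<le> fact L / 2 * ((\<Lambda> * D ^ k)\<^sup>2 / fact k * 8 ^ k * sqrt 2 ^ CARD('n) *
     (fact (k - Suc L) / (c\<^sup>2) ^ (k - L)))"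
    by (rule form_upper_bound[OF annk k W])
  hence "K * sqrt (Re (kernel_form ?h V \<tau> \<tau>)) \<le> K * sqrt (fact L / 2 * ((\<Lambda> * D ^ k)\<^sup>2 / fact k * 8 ^ k * sqrt 2 ^ CARD('n) *
     (fact (k - Suc L) / (c\<^sup>2) ^ (k - L))))"
    using K by (intro mult_left_mono real_sqrt_le_mono)
  thus ?thesis using 1 by linarith
qed

section \<open>Comparison of the constants\<close>

lemma gamma_seq_lower_bounds:
  assumes "n \<ge> 2"
  shows "6 * real n \<le> real (gamma_seq n)" and "fact n \<le> real (gamma_seq n)"
proof -
  have g: "6 * n \<le> gamma_seq n \<and> fact n \<le> gamma_seq n" using assms
  proof (induction n rule: nat_induct_at_least)
    case base
    show ?case by (simp add: numeral_2_eq_2)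
  next
    case (Suc n)
    obtain j where j: "n = Suc j" using Suc.hyps by (cases n) auto
    have g: "gamma_seq (Suc n) = 2 * Suc n * (1 + gamma_seq n)" unfolding j by simp
    have "6 * Suc n \<le> 2 * Suc n * (1 + gamma_seq n)" using Suc by (simp add: algebra_simps)
    moreover have "Suc n * fact n \<le> Suc n * (1 + gamma_seq n)" using Suc by (intro mult_left_mono) auto
    hence "fact (Suc n) \<le> 2 * Suc n * (1 + gamma_seq n)" by simp
    ultimately show ?case unfolding g by simp
  qed
  have "real (6 * n) \<le> real (gamma_seq n)" "real (fact n) \<le> real (gamma_seq n)"
    unfolding of_nat_le_iff using g by auto
  thus "6 * real n \<le> real (gamma_seq n)" "fact n \<le> real (gamma_seq n)" by simp_all
qed

lemma rho_const_ge_1: "rho_const n lam m \<ge> 1"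
proof -
  have "0 \<le> \<lceil>(real n - real lam - 3) / 2\<rceil>" if "int n - int lam > 3"
  proof -
    have "real n - real lam - 3 > 0" using that by linarith
    thus ?thesis by (simp add: less_ceiling_iff order_less_imp_le)
  qed
  thus ?thesis by (auto simp: rho_const_def)
qed

lemma fact_ratio_le_one: "i \<le> k \<Longrightarrow> fact i / fact k \<le> (1 :: real)"
  by (simp add: fact_mono)

text \<open>For \<open>n - lam > 1\<close> the product \<open>\<Delta>\<^sub>0 * \<rho> ^ (2 * k)\<close> is at least \<open>1\<close>, since
  \<open>2 * k \<ge> 2 * m + 2\<close>. Otherwise \<open>\<rho> = 1\<close>, and the product in the denominator of \<open>\<Delta>\<^sub>0\<close> has at
  most \<open>L\<close> factors, each at most \<open>2 * L + 4\<close>; it is compared with \<open>fact L * exp (2 * k)\<close>.\<close>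

lemma Delta0_lower_bound:
  assumes n: "even n" "n \<ge> 2" and k: "k \<ge> Suc (Suc L)"
  shows "Delta0_const n (2 * L) (Suc L) > 0"
    and "fact (k - Suc L) / fact k \<le> exp (2 * real k) * (Delta0_const n (2 * L) (Suc L) * rho_const n (2 * L) (Suc L) ^ (2 * k))"
proof -
  let ?D = "Delta0_const n (2 * L) (Suc L)" and ?r = "rho_const n (2 * L) (Suc L)"
  obtain N where N: "n = 2 * N" using n(1) by (elim evenE)
  have N1: "N \<ge> 1" using n(2) N by simp
  have r1: "?r \<ge> 1" by (rule rho_const_ge_1)
  have e1: "exp (2 * real k) \<ge> 1" by simp
  have f1: "fact (k - Suc L) / fact k \<le> (1 :: real)" by (rule fact_ratio_le_one) simp
  have goal: "?D > 0 \<and> fact (k - Suc L) / fact k \<le> exp (2 * real k) * (?D * ?r ^ (2 * k))"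
  proof (cases "int n - int (2 * L) \<le> 1")
    case False
    have D: "?D > 0 \<and> ?D * ?r ^ (2 * k) \<ge> 1"
    proof (cases "int n - int (2 * L) > 3")
      case True
      define P where "P = (\<Prod>j = 2 * int (Suc L) + 3..2 * int (Suc L) + 2 + \<lceil>(real n - real (2 * L) - 3) / 2\<rceil>. of_int j :: real)"
      have P1: "P \<ge> 1" unfolding P_def by (rule prod_ge_1) auto
      have D: "?D = P / ?r ^ (2 * Suc L + 2)" using True by (simp add: Delta0_const_def P_def Let_def)
      have "?r ^ (2 * k) = ?r ^ (2 * k - (2 * Suc L + 2)) * ?r ^ (2 * Suc L + 2)"
      proof -
        have "(2 * k - (2 * Suc L + 2)) + (2 * Suc L + 2) = 2 * k" using k by simp
        thus ?thesis by (metis power_add)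
      qed
      hence "?D * ?r ^ (2 * k) = P * ?r ^ (2 * k - (2 * Suc L + 2))" using D r1 by simp
      moreover have "P * ?r ^ (2 * k - (2 * Suc L + 2)) \<ge> 1 * 1"
        using P1 r1 by (intro mult_mono one_le_power) auto
      moreover have "?D > 0" unfolding D using P1 r1 by (intro divide_pos_pos zero_less_power) auto
      ultimately show ?thesis by simp
    next
      case F: False
      have "?D = 1" using F False by (simp add: Delta0_const_def)
      thus ?thesis using one_le_power[OF r1] by simp
    qed
    have "1 * 1 \<le> exp (2 * real k) * (?D * ?r ^ (2 * k))" using e1 D by (intro mult_mono) auto
    thus ?thesis using f1 D by linarith
  next
    case True
    hence NL: "N \<le> L" using N by simp
    have ceil: "\<lceil>(real n - real (2 * L) - 3) / 2\<rceil> = int N - int L - 1"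
      by (rule ceiling_unique) (simp_all add: N field_simps)
    \<comment> \<open>an interval of \<open>L - N + 1\<close> integers, the last of which is \<open>2 * L + 4\<close>\<close>
    define S where "S = {2 * int (Suc L) - - (int N - int L - 1) + 3..2 * int (Suc L) + 2}"
    have D: "?D = 1 / (\<Prod>j\<in>S. of_int j)"
      unfolding Delta0_const_def Let_def ceil S_def using True by simp
    have rr: "?r = 1" using True by (simp add: rho_const_def)
    have Spos: "j > 0" if "j \<in> S" for j using that N1 by (auto simp: S_def)
    have P0: "(\<Prod>j\<in>S. of_int j :: real) > 0" using Spos by (intro prod_pos) auto
    have "(\<Prod>j\<in>S. of_int j :: real) \<le> (\<Prod>j\<in>S. 2 * real L + 4)"
    proof (rule prod_mono, safe)
      fix j assume "j \<in> S"
      hence "0 < j" "j \<le> 2 * int L + 4" using Spos by (auto simp: S_def)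
      thus "0 \<le> (of_int j :: real)" "of_int j \<le> 2 * real L + 4" by linarith+
    qed
    also have "\<dots> = (2 * real L + 4) ^ card S" by simp
    also have "\<dots> \<le> (2 * real L + 4) ^ L"
      by (intro power_increasing) (use N1 NL in \<open>auto simp: S_def\<close>)
    also have "\<dots> \<le> fact L * exp (2 * real L + 4)"
      using power_over_fact_le_exp[of "2 * real L + 4" L] by (simp add: pos_divide_le_eq mult.commute)
    also have "\<dots> \<le> fact L * exp (2 * real k)" using k by (intro mult_left_mono) auto
    finally have P: "(\<Prod>j\<in>S. of_int j :: real) \<le> fact L * exp (2 * real k)" .
    have "fact L * fact (k - L) \<le> (fact k :: nat)"
      using fact_fact_dvd_fact[of L "k - L", where 'a = nat] k by (intro dvd_imp_le) (simp_all add: add.commute)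
    hence "fact L * fact (k - L) \<le> (fact k :: real)" by (metis of_nat_fact of_nat_le_iff of_nat_mult)
    moreover have "fact (k - Suc L) \<le> (fact (k - L) :: real)" by (intro fact_mono) simp
    hence "fact L * fact (k - Suc L) \<le> fact L * (fact (k - L) :: real)" by (intro mult_left_mono) auto
    ultimately have q: "fact L * fact (k - Suc L) \<le> (fact k :: real)" by linarith
    have "fact (k - Suc L) / fact k * (\<Prod>j\<in>S. of_int j :: real) \<le> fact (k - Suc L) / fact k * (fact L * exp (2 * real k))"
      using P by (intro mult_left_mono) auto
    also have "\<dots> = (fact L * fact (k - Suc L)) / fact k * exp (2 * real k)" by simp
    also have "\<dots> \<le> 1 * exp (2 * real k)" using q by (intro mult_right_mono) auto
    finally have "fact (k - Suc L) / fact k \<le> exp (2 * real k) / (\<Prod>j\<in>S. of_int j)"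
      using P0 by (simp add: pos_le_divide_eq)
    thus ?thesis using P0 by (simp add: D rr)
  qed
  show "?D > 0" "fact (k - Suc L) / fact k \<le> exp (2 * real k) * (?D * ?r ^ (2 * k))" using goal by auto
qed

text \<open>The left side collects the factors that are exponential in \<open>k\<close> and the factor \<open>fact n\<close>
  that comes from the volume of the ball. The exponent on the right is \<open>4 * n * k * g\<close> with
  \<open>g \<ge> 12\<close>, and \<open>g * n * k\<close> alone dominates each contribution on the left.\<close>

lemma exponential_budget:
  assumes n: "n \<ge> 2" and k: "k \<ge> 1" and g: "g = real (gamma_seq n)"
  shows "2 ^ k * (8 * (1 + 9 * real n / 4) ^ (2 * (k - 1)))\<^sup>2 * exp (2 * real k) * fact n \<le> exp (2 * real n * g) ^ (2 * k)"
proof -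
  have g6: "g \<ge> 6 * real n" "fact n \<le> g"
    using gamma_seq_lower_bounds[OF n] by (simp_all add: g)
  have g12: "g \<ge> 12" using g6(1) n by linarith
  have e2: "(2 :: real) \<le> exp 1" using exp_ge_add_one_self[of 1] by simp
  have a1: "(2 :: real) ^ k \<le> exp (real k)"
    using power_mono[OF e2, of k] by (simp add: exp_of_nat_mult[symmetric])
  have a2: "(8 :: real)\<^sup>2 \<le> exp 6"
    using power_mono[OF e2, of 6] by (simp add: exp_of_nat_mult[symmetric])
  have a3: "((1 + 9 * real n / 4) ^ (2 * (k - 1)))\<^sup>2 \<le> exp (9 * real n * real k)"
  proof -
    have "(1 + 9 * real n / 4) \<le> exp (9 * real n / 4)" by (rule exp_ge_add_one_self)
    hence "(1 + 9 * real n / 4) ^ (4 * (k - 1)) \<le> exp (9 * real n / 4) ^ (4 * (k - 1))" by (intro power_mono) auto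
    also have "\<dots> = exp (9 * real n * real (k - 1))" by (simp add: exp_of_nat_mult[symmetric])
    also have "\<dots> \<le> exp (9 * real n * real k)" by (simp add: mult_left_mono)
    finally show ?thesis by (simp flip: power_mult)
  qed
  have a4: "fact n \<le> exp g" using g6(2) exp_ge_add_one_self[of g] by linarith
  have "2 ^ k * (8 * (1 + 9 * real n / 4) ^ (2 * (k - 1)))\<^sup>2 * exp (2 * real k) * fact n
      = 2 ^ k * (8\<^sup>2 * ((1 + 9 * real n / 4) ^ (2 * (k - 1)))\<^sup>2) * exp (2 * real k) * fact n"
    by (simp only: power_mult_distrib)
  also have "\<dots> \<le> exp (real k) * (exp 6 * exp (9 * real n * real k)) * exp (2 * real k) * exp g"
    using a1 a2 a3 a4 by (intro mult_mono) auto
  also have "\<dots> = exp (real k + (6 + 9 * real n * real k) + 2 * real k + g)" by (simp only: exp_add)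
  also have "\<dots> \<le> exp (real (2 * k) * (2 * real n * g))"
  proof -
    have k1: "real k \<ge> 1" using k by simp
    have n2: "real n \<ge> 2" using n by simp
    have nk: "real n * real k \<ge> 2 * 1" using n2 k1 by (intro mult_mono) auto
    have b1: "9 * (real n * real k) \<le> g * (real n * real k)" using g12 nk by (intro mult_right_mono) auto
    have b2: "g \<le> g * (real n * real k)" using mult_left_mono[of 1 "real n * real k" g] nk g12 by simp
    have b3: "3 * real k + 6 \<le> g * (real n * real k)"
    proof -
      have "3 * real k + 6 \<le> 9 * real k" using k1 by simp
      also have "\<dots> \<le> 9 * (real n * real k)" using n2 k1 by (simp add: mult_right_mono)
      finally show ?thesis using b1 by linarith
    qed
    have b4: "0 \<le> g * (real n * real k)" using g12 nk by simp
    have "real k + (6 + 9 * real n * real k) + 2 * real k + g = (3 * real k + 6) + 9 * (real n * real k) + g" by simp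
    also have "\<dots> \<le> 4 * (g * (real n * real k))" using b1 b2 b3 b4 by linarith
    also have "\<dots> = real (2 * k) * (2 * real n * g)" by simp
    finally show ?thesis by (subst exp_le_cancel_iff)
  qed
  also have "\<dots> = exp (2 * real n * g) ^ (2 * k)" by (rule exp_of_nat_mult)
  finally show ?thesis .
qed

text \<open>By the choice of \<open>C\<close>, \<open>D / c\<close> is at most \<open>1 / (3 * \<rho> * exp (2 * n * g))\<close>. In its power
  with exponent \<open>2 * k\<close> the factor \<open>\<rho>\<close> serves \<open>Delta0_lower_bound\<close>, the exponential serves
  \<open>exponential_budget\<close>, and \<open>9 ^ k\<close> against \<open>8 ^ k\<close> leaves \<open>(4 / 9) ^ k\<close> once the factor
  \<open>2 ^ k\<close> is charged to the exponential.\<close>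

lemma squared_error_numeric_bound:
  fixes c D C :: real
  assumes n: "even n" "n \<ge> 2" and k: "k \<ge> Suc (Suc L)" and g: "g = real (gamma_seq n)" and c: "c > 0"
    and C: "C \<ge> 2 * (rho_const n (2 * L) (Suc L) / c) * sqrt (real n) * exp (2 * real n * g)"
    and D: "0 \<le> D" "D \<le> sqrt (real n) * (2 / (3 * C))"
    and nv: "nv \<ge> 1 / fact n"
  defines "\<Lambda> \<equiv> 8 * (1 + 9 * real n / 4) ^ (2 * (k - 1))"
  shows "fact L / 2 * ((\<Lambda> * D ^ k)\<^sup>2 / fact k * 8 ^ k * sqrt 2 ^ n * (fact (k - Suc L) / (c\<^sup>2) ^ (k - L))) \<le>
     (fact L * 2 ^ L * sqrt (2 * pi) ^ n) * sqrt (pi / 2) * nv * c ^ (2 * L) * Delta0_const n (2 * L) (Suc L) * (4 / 9) ^ k"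
proof -
  define r where "r = rho_const n (2 * L) (Suc L)"
  define \<Delta> where "\<Delta> = Delta0_const n (2 * L) (Suc L)"
  define E where "E = exp (2 * real n * g)"
  have r: "r \<ge> 1" unfolding r_def by (rule rho_const_ge_1)
  have \<Delta>: "\<Delta> > 0" "fact (k - Suc L) / fact k \<le> exp (2 * real k) * (\<Delta> * r ^ (2 * k))"
    using Delta0_lower_bound[OF n k] by (auto simp: \<Delta>_def r_def)
  have E: "E > 0" by (simp add: E_def)
  have sn: "sqrt (real n) > 0" using n by simp
  have Cpos: "C > 0"
  proof -
    have "0 < 2 * (r / c) * sqrt (real n) * E" using r c sn E by simp
    thus ?thesis using C unfolding r_def E_def by linarith
  qed
  have Dc: "D / c \<le> 1 / (3 * r * E)"
  proof -
    have C': "2 * (r / c) * sqrt (real n) * E \<le> C" using C by (simp add: r_def E_def)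
    have "sqrt (real n) * (2 / (3 * C)) \<le> sqrt (real n) * (2 / (3 * (2 * (r / c) * sqrt (real n) * E)))"
      using C' Cpos r c sn E by (intro mult_left_mono divide_left_mono) auto
    also have "\<dots> = c / (3 * r * E)" using sn r c E by (simp add: field_simps)
    finally have "D \<le> c / (3 * r * E)" using D(2) by linarith
    hence "D / c \<le> c / (3 * r * E) / c" using c by (intro divide_right_mono) auto
    thus ?thesis using c by simp
  qed
  have L0: "\<Lambda> > 0" by (simp add: \<Lambda>_def add_pos_nonneg)
  have pw: "(D / c) ^ (2 * k) \<le> 1 / (9 ^ k * r ^ (2 * k) * E ^ (2 * k))"
  proof -
    have "(D / c) ^ (2 * k) \<le> (1 / (3 * r * E)) ^ (2 * k)" using Dc D(1) c by (intro power_mono) auto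
    also have "\<dots> = 1 / (3 ^ (2 * k) * r ^ (2 * k) * E ^ (2 * k))" by (simp only: power_one_over power_mult_distrib)
    also have "(3 :: real) ^ (2 * k) = 9 ^ k" by (simp add: power_mult)
    finally show ?thesis .
  qed
  have cc: "(\<Lambda> * D ^ k)\<^sup>2 / (c\<^sup>2) ^ (k - L) = \<Lambda>\<^sup>2 * (D / c) ^ (2 * k) * c ^ (2 * L)"
  proof -
    have "2 * k = 2 * (k - L) + 2 * L" using k by simp
    hence "c ^ (2 * k) = (c\<^sup>2) ^ (k - L) * c ^ (2 * L)" by (simp add: power_add power_mult)
    moreover have "(D ^ k)\<^sup>2 = D ^ (2 * k)" by (simp flip: power_mult) (simp add: mult.commute)
    ultimately show ?thesis using c by (simp add: power_mult_distrib power_divide)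
  qed
  define F where "F = fact L / 2 * sqrt 2 ^ n * c ^ (2 * L)"
  have F: "F > 0" using c by (simp add: F_def)
  have "fact L / 2 * ((\<Lambda> * D ^ k)\<^sup>2 / fact k * 8 ^ k * sqrt 2 ^ n * (fact (k - Suc L) / (c\<^sup>2) ^ (k - L))) =
     fact L / 2 * sqrt 2 ^ n * 8 ^ k * (fact (k - Suc L) / fact k) * ((\<Lambda> * D ^ k)\<^sup>2 / (c\<^sup>2) ^ (k - L))"
    by (simp only: times_divide_eq_left times_divide_eq_right divide_divide_eq_left mult_ac)
  also have "\<dots> = F * (8 ^ k * \<Lambda>\<^sup>2 * ((fact (k - Suc L) / fact k) * (D / c) ^ (2 * k)))"
    unfolding cc F_def by (simp only: mult_ac)
  also have "\<dots> \<le> F * (8 ^ k * \<Lambda>\<^sup>2 * ((exp (2 * real k) * (\<Delta> * r ^ (2 * k))) * (1 / (9 ^ k * r ^ (2 * k) * E ^ (2 * k)))))"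
    using F \<Delta> pw D(1) c by (intro mult_left_mono mult_mono) auto
  also have "\<dots> = F * \<Delta> * (8 ^ k / 9 ^ k) * (\<Lambda>\<^sup>2 * exp (2 * real k) / E ^ (2 * k))"
    using r by simp
  also have "(8 :: real) ^ k / 9 ^ k = (4 / 9) ^ k * 2 ^ k"
    by (simp add: power_divide[symmetric] power_mult_distrib[symmetric])
  also have "F * \<Delta> * ((4 / 9) ^ k * 2 ^ k) * (\<Lambda>\<^sup>2 * exp (2 * real k) / E ^ (2 * k)) =
     F * \<Delta> * (4 / 9) ^ k * ((2 ^ k * \<Lambda>\<^sup>2 * exp (2 * real k)) / E ^ (2 * k))"
    by (simp only: times_divide_eq_right mult_ac)
  also have "\<dots> \<le> F * \<Delta> * (4 / 9) ^ k * (1 / fact n)"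
  proof (intro mult_left_mono)
    have "2 ^ k * \<Lambda>\<^sup>2 * exp (2 * real k) * fact n \<le> E ^ (2 * k)"
      unfolding \<Lambda>_def E_def by (rule exponential_budget[OF n(2) _ g]) (use k in simp)
    thus "2 ^ k * \<Lambda>\<^sup>2 * exp (2 * real k) / E ^ (2 * k) \<le> 1 / fact n"
      using E by (simp add: pos_divide_le_eq pos_le_divide_eq)
    show "0 \<le> F * \<Delta> * (4 / 9) ^ k" using F \<Delta> by simp
  qed
  also have "\<dots> \<le> F * \<Delta> * (4 / 9) ^ k * nv"
    using nv F \<Delta> by (intro mult_left_mono) auto
  also have "\<dots> \<le> (fact L * 2 ^ L * sqrt (2 * pi) ^ n * sqrt (pi / 2) * c ^ (2 * L)) * (\<Delta> * (4 / 9) ^ k * nv)"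
  proof -
    have "F \<le> fact L * 2 ^ L * sqrt (2 * pi) ^ n * sqrt (pi / 2) * c ^ (2 * L)"
    proof -
      have s: "sqrt 2 ^ n \<le> sqrt (2 * pi) ^ n" using pi_gt3 by (intro power_mono) auto
      have p: "1 \<le> sqrt (pi / 2)" using pi_gt3 by simp
      have "F = fact L * (1 / 2) * sqrt 2 ^ n * 1 * c ^ (2 * L)" by (simp add: F_def)
      also have "\<dots> \<le> fact L * 2 ^ L * sqrt (2 * pi) ^ n * sqrt (pi / 2) * c ^ (2 * L)"
      proof (intro mult_mono s p)
        have "(1/2 :: real) \<le> 1" by simp
        also have "1 \<le> (2 :: real) ^ L" by simp
        finally show "1 / 2 \<le> (2 :: real) ^ L" .
      qed (use c in auto)
      finally show ?thesis .
    qed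
    moreover have "0 \<le> \<Delta> * (4 / 9) ^ k * nv"
    proof -
      have "0 \<le> (1 :: real) / fact n" by simp
      hence "0 \<le> nv" using nv by linarith
      thus ?thesis using \<Delta> by simp
    qed
    ultimately have "F * (\<Delta> * (4 / 9) ^ k * nv) \<le> (fact L * 2 ^ L * sqrt (2 * pi) ^ n * sqrt (pi / 2) * c ^ (2 * L)) * (\<Delta> * (4 / 9) ^ k * nv)"
      by (rule mult_right_mono)
    thus ?thesis by (simp only: mult_ac)
  qed
  finally show ?thesis unfolding \<Delta>_def by (simp only: mult_ac)
qed

section \<open>The error bound\<close>

text \<open>A crude bound suffices, since the factor \<open>fact n\<close> is charged to \<open>exponential_budget\<close>.\<close>

lemma unit_ball_measure_lower_bound:
  assumes n: "CARD('n::finite) \<ge> 1" "even CARD('n)"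
  shows "real CARD('n) * measure lborel (ball (0 :: real^'n) 1) \<ge> 1 / fact CARD('n)"
proof -
  obtain N where N: "CARD('n) = 2 * N" using n(2) by (elim evenE)
  have "measure lborel (ball (0 :: real^'n) 1) = unit_ball_vol (real CARD('n))"
    using content_ball[of 1 "0 :: real^'n"] by simp
  also have "\<dots> = pi ^ N / fact N" unfolding N by (rule unit_ball_vol_even)
  also have "\<dots> \<ge> 1 / fact CARD('n)"
  proof (rule frac_le)
    show "1 \<le> pi ^ N" using pi_gt3 by (intro one_le_power) simp
    show "fact N \<le> (fact CARD('n) :: real)" unfolding N by (intro fact_mono) simp
  qed auto
  finally have m: "1 / fact CARD('n) \<le> measure lborel (ball (0 :: real^'n) 1)" .
  have "1 * (1 / fact CARD('n)) \<le> real CARD('n) * measure lborel (ball (0 :: real^'n) 1)"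
    using n(1) m by (intro mult_mono) auto
  thus ?thesis by simp
qed

text \<open>Put \<open>t = 6 * C * gam * d\<close>. The order \<open>k\<close> has to be at least \<open>1 / t\<close> for the decay and at
  most \<open>2 / t\<close> for the subcube to fit into a cube of side \<open>2 / (3 * C)\<close>; the restriction on
  \<open>d\<close> makes \<open>k\<close> larger than \<open>m\<close>.\<close>

lemma spline_error_in_cube:
  fixes f s :: "real^'n::finite \<Rightarrow> complex" and c C d b gam K :: real and L :: nat
  defines "h \<equiv> (shifted_spline (Suc L) (2 * L) c :: real^'n \<Rightarrow> real)"
  assumes n: "CARD('n) \<ge> 2" "even CARD('n)" and c: "c > 0"
    and gam: "gam = real (gamma_seq CARD('n))"
    and C: "C \<ge> 2 * (rho_const CARD('n) (2 * L) (Suc L) / c) * sqrt (real CARD('n)) * exp (2 * real CARD('n) * gam)" "C > 0"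
    and hb: "h_bound h (Suc L) f K" and f: "continuous_on UNIV f"
    and sp: "h_spline_interpolant h (Suc L) X f s"
    and R: "rotation_matrix R" and b: "2 / (3 * C) \<le> b"
    and d: "0 < d" "d \<le> 1 / (3 * C * gam * (real (Suc L) + 1)) / 2"
    and hit: "\<And>w. cube R w (2 * d) \<subseteq> cube R v b \<Longrightarrow> cube R w (2 * d) \<inter> X \<noteq> {}"
    and x: "x \<in> cube R v b"
  shows "cmod (f x - s x) \<le> sqrt ((fact L * 2 ^ L * sqrt (2 * pi) ^ CARD('n)) * sqrt (pi / 2) *
       (real CARD('n) * measure lborel (ball (0 :: real^'n) 1)) * c ^ (2 * L) *
       Delta0_const CARD('n) (2 * L) (Suc L) * ((2 / 3) powr (1 / (3 * C * gam * d)))) * K"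
proof -
  let ?n = "real CARD('n)"
  have K: "K \<ge> 0" using hb by (simp add: h_bound_def)
  have g6: "gam \<ge> 6 * ?n" unfolding gam by (rule gamma_seq_lower_bounds(1)[OF n(1)])
  have gpos: "gam > 0" using g6 n(1) by linarith
  define t where "t = 6 * C * gam * d"
  have t: "t > 0" "t \<le> 1 / (real (Suc L) + 1)"
  proof -
    show "t > 0" using C gpos d by (simp add: t_def)
    have "6 * C * gam * d \<le> 6 * C * gam * (1 / (3 * C * gam * (real (Suc L) + 1)) / 2)"
      using d C gpos by (intro mult_left_mono) auto
    also have "\<dots> = 1 / (real (Suc L) + 1)" using C(2) gpos by simp
    finally show "t \<le> 1 / (real (Suc L) + 1)" by (simp add: t_def)
  qed
  define k where "k = nat \<lceil>1 / t\<rceil>"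
  have k1: "1 / t \<le> real k" unfolding k_def by linarith
  have k2: "real k < 1 / t + 1"
  proof -
    have "0 < 1 / t" using t by simp
    thus ?thesis unfolding k_def by linarith
  qed
  have kL: "k \<ge> Suc (Suc L)"
  proof -
    have "real (Suc L) + 1 \<le> 1 / t" using t by (simp add: field_simps)
    hence "real (Suc (Suc L)) \<le> real k" using k1 by simp
    thus ?thesis by simp
  qed
  have kt: "real k * t \<le> 2"
  proof -
    have "real k * t \<le> (1 / t + 1) * t" using k2 t by (intro mult_right_mono) auto
    also have "\<dots> = 1 + t" using t by (simp add: algebra_simps)
    also have "t \<le> 1"
      by (rule order.trans[OF t(2)]) simp
    finally show ?thesis by simp
  qed
  \<comment> \<open>the number of cubes of side \<open>2 * d\<close> along an edge of the subcube\<close>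
  define q where "q = gamma_seq CARD('n) * k"
  have q: "real q = gam * real k" by (simp add: q_def gam)
  have side: "real q * (2 * d) = real k * t / (3 * C)" using C(2) by (simp add: q t_def)
  have side2: "real q * (2 * d) \<le> 2 / (3 * C)" unfolding side using kt C(2) by (intro divide_right_mono) auto
  have q1: "q \<ge> 1"
  proof -
    have "real q > 0" unfolding q using gpos kL by (intro mult_pos_pos) auto
    thus ?thesis by simp
  qed
  obtain z where z: "dist z x \<le> sqrt ?n * (real q * (2 * d) / 2)"
    "\<And>p. dist z p \<le> real q * (2 * d) / 2 \<Longrightarrow> \<exists>y\<in>X. dist p y \<le> sqrt ?n * (2 * d) \<and> dist y x \<le> sqrt ?n * (real q * (2 * d))"
    using dense_points_in_subcube[OF R _ q1 order.trans[OF side2 b] hit x] d(1) by auto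
  define D where "D = sqrt ?n * (real q * (2 * d))"
  define Y where "Y = {y \<in> X. dist y x \<le> D}"
  have finX: "finite X" using sp by (simp add: h_spline_interpolant_def)
  have finY: "finite Y" using finX by (simp add: Y_def)
  define \<Lambda> where "\<Lambda> = 8 * (1 + 9 * ?n / 4) ^ (2 * (k - 1))"
  obtain \<sigma> where \<sigma>: "(\<Sum>y\<in>Y. \<bar>\<sigma> y\<bar>) \<le> \<Lambda>" "\<And>p. p \<in> real_polys (k - 1) \<Longrightarrow> p x = (\<Sum>y\<in>Y. \<sigma> y * p y)"
  proof (rule reproducing_weights[of k q "2 * d" Y z x, folded \<Lambda>_def])
    show "6 * ?n * real k \<le> real q" unfolding q using g6 by (intro mult_right_mono) auto
    show "\<exists>y\<in>Y. dist p y \<le> sqrt ?n * (2 * d)" if "dist z p \<le> real q * (2 * d) / 2" for p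
      using z(2)[OF that] by (auto simp: Y_def D_def)
  qed (use kL n d finY z(1) in auto)
  have "cmod (f x - s x) \<le> K * sqrt (fact L / 2 * ((\<Lambda> * D ^ k)\<^sup>2 / fact k * 8 ^ k * sqrt 2 ^ CARD('n) *
     (fact (k - Suc L) / (c\<^sup>2) ^ (k - L))))"
    by (rule spline_error_from_weights[OF c _ hb[unfolded h_def] f sp[unfolded h_def] _ _ \<sigma>])
       (use kL in \<open>auto simp: Y_def\<close>)
  also have "\<dots> \<le> K * sqrt ((fact L * 2 ^ L * sqrt (2 * pi) ^ CARD('n)) * sqrt (pi / 2) *
       (?n * measure lborel (ball (0 :: real^'n) 1)) * c ^ (2 * L) *
       Delta0_const CARD('n) (2 * L) (Suc L) * ((2 / 3) powr (1 / (3 * C * gam * d))))"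
  proof (intro mult_left_mono real_sqrt_le_mono K)
    have D0: "0 \<le> D" using d by (simp add: D_def)
    have D1: "D \<le> sqrt ?n * (2 / (3 * C))" unfolding D_def using side2 by (intro mult_left_mono) auto
    have nv: "1 / fact CARD('n) \<le> ?n * measure lborel (ball (0 :: real^'n) 1)"
      using unit_ball_measure_lower_bound n by auto
    have "fact L / 2 * ((\<Lambda> * D ^ k)\<^sup>2 / fact k * 8 ^ k * sqrt 2 ^ CARD('n) * (fact (k - Suc L) / (c\<^sup>2) ^ (k - L))) \<le>
      (fact L * 2 ^ L * sqrt (2 * pi) ^ CARD('n)) * sqrt (pi / 2) * (?n * measure lborel (ball (0 :: real^'n) 1)) * c ^ (2 * L) *
       Delta0_const CARD('n) (2 * L) (Suc L) * (4 / 9) ^ k"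
      unfolding \<Lambda>_def by (rule squared_error_numeric_bound[OF n(2,1) kL gam c C(1) D0 D1 nv])
    also have "\<dots> \<le> (fact L * 2 ^ L * sqrt (2 * pi) ^ CARD('n)) * sqrt (pi / 2) * (?n * measure lborel (ball (0 :: real^'n) 1)) * c ^ (2 * L) *
       Delta0_const CARD('n) (2 * L) (Suc L) * ((2 / 3) powr (1 / (3 * C * gam * d)))"
    proof (rule mult_left_mono)
      have "(4 / 9 :: real) ^ k = (2 / 3) powr (2 * real k)"
        using powr_realpow[of "2 / 3 :: real" "2 * k"] by (simp add: power_mult power_divide)
      also have "\<dots> \<le> (2 / 3) powr (1 / (3 * C * gam * d))"
      proof (rule powr_mono')
        have "1 / (3 * C * gam * d) = 2 * (1 / t)" using C gpos d by (simp add: t_def)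
        thus "1 / (3 * C * gam * d) \<le> 2 * real k" using k1 by simp
      qed auto
      finally show "(4 / 9 :: real) ^ k \<le> (2 / 3) powr (1 / (3 * C * gam * d))" .
      have "0 < Delta0_const CARD('n) (2 * L) (Suc L)" by (rule Delta0_lower_bound(1)[OF n(2,1) kL])
      thus "0 \<le> (fact L * 2 ^ L * sqrt (2 * pi) ^ CARD('n)) * sqrt (pi / 2) * (?n * measure lborel (ball (0 :: real^'n) 1)) * c ^ (2 * L) *
       Delta0_const CARD('n) (2 * L) (Suc L)" using c by simp
    qed
    finally show "fact L / 2 * ((\<Lambda> * D ^ k)\<^sup>2 / fact k * 8 ^ k * sqrt 2 ^ CARD('n) * (fact (k - Suc L) / (c\<^sup>2) ^ (k - L))) \<le>
      (fact L * 2 ^ L * sqrt (2 * pi) ^ CARD('n)) * sqrt (pi / 2) * (?n * measure lborel (ball (0 :: real^'n) 1)) * c ^ (2 * L) *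
       Delta0_const CARD('n) (2 * L) (Suc L) * ((2 / 3) powr (1 / (3 * C * gam * d)))" .
  qed
  finally show ?thesis by (simp only: mult.commute)
qed

theorem corollary2p5:
  fixes n lam m :: nat
    and c b0 rho' C delta0 omega d0 omega' gam alpha :: real
    and h :: "real^'n::finite \<Rightarrow> real"
  assumes "n = CARD('n)" and "n \<ge> 2" and "even n"
    and "lam > 0" and "even lam"
    and "c > 0" and "b0 > 0"
    and "m = 1 + lam div 2"
    and "h = shifted_spline m lam c"
    and "gam = real (gamma_seq n)"
    and "alpha = measure lborel (ball (0 :: real^'n) 1)"
    and "rho' = rho_const n lam m / c"
    and "C = max (2 * rho' * sqrt (real n) * exp (2 * real n * gam)) (2 / (3 * b0))"
    and "delta0 = 1 / (3 * C * gam * (real m + 1))"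
    and "omega = (2 / 3) powr (1 / (3 * C * gam))"
    and "d0 = delta0 / 2"
    and "omega' = sqrt omega"
  shows "0 < d0 \<and> 0 < omega' \<and> omega' < 1 \<and>
    (\<forall>(f :: real^'n \<Rightarrow> complex) s X \<Omega> E R v b d.
       f \<in> native_space h m \<longrightarrow>
       h_spline_interpolant h m X f s \<longrightarrow>
       union_of_cubes b0 \<Omega> \<longrightarrow>
       rotation_matrix R \<longrightarrow> E = cube R v b \<longrightarrow> E \<subseteq> \<Omega> \<longrightarrow> b \<ge> b0 \<longrightarrow>
       0 < d \<longrightarrow> d \<le> d0 \<longrightarrow>
       (\<forall>w. cube R w (2 * d) \<subseteq> E \<longrightarrow> cube R w (2 * d) \<inter> X \<noteq> {}) \<longrightarrow>
       (\<forall>x\<in>E. cmod (f x - s x) \<le>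
          sqrt (l_const TYPE('n) lam) * (pi / 2) powr (1 / 4) * sqrt (real n * alpha) *
          c powr (real lam / 2) * sqrt (Delta0_const n lam m) *
          omega' powr (1 / d) * h_seminorm h m f))"
proof -
  define L where "L = lam div 2"
  have lam: "lam = 2 * L" using \<open>even lam\<close> by (simp add: L_def)
  have m: "m = Suc L" using \<open>m = 1 + lam div 2\<close> by (simp add: L_def)
  note n = \<open>n = CARD('n)\<close>
  have n2: "CARD('n) \<ge> 2" "even CARD('n)" using assms by auto
  have c: "c > 0" by fact
  have gam: "gam = real (gamma_seq CARD('n))" using assms by simp
  have g6: "gam \<ge> 6 * real CARD('n)" unfolding gam by (rule gamma_seq_lower_bounds(1)[OF n2(1)])
  have gpos: "gam > 0" using g6 n2(1) by linarith
  have C_def: "C = max (2 * (rho_const CARD('n) (2 * L) (Suc L) / c) * sqrt (real CARD('n)) * exp (2 * real CARD('n) * gam)) (2 / (3 * b0))"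
    unfolding \<open>C = max (2 * rho' * sqrt (real n) * exp (2 * real n * gam)) (2 / (3 * b0))\<close>
      \<open>rho' = rho_const n lam m / c\<close> n lam m ..
  have C1: "C \<ge> 2 * (rho_const CARD('n) (2 * L) (Suc L) / c) * sqrt (real CARD('n)) * exp (2 * real CARD('n) * gam)"
    and C2: "C \<ge> 2 / (3 * b0)" unfolding C_def by auto
  have b0: "b0 > 0" by fact
  have C0: "C > 0"
  proof -
    have "2 / (3 * b0) > 0" using b0 by simp
    thus ?thesis using C2 by linarith
  qed
  have Cb: "2 / (3 * C) \<le> b0" using C2 C0 b0 by (simp add: field_simps)
  have omega: "omega = (2 / 3) powr (1 / (3 * C * gam))" by fact
  have omega': "omega' = sqrt omega" by fact
  have d0: "d0 = 1 / (3 * C * gam * (real (Suc L) + 1)) / 2"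
    unfolding \<open>d0 = delta0 / 2\<close> \<open>delta0 = 1 / (3 * C * gam * (real m + 1))\<close> m ..
  have d0pos: "d0 > 0" unfolding d0 using C0 gpos by simp
  have om: "0 < omega" "omega < 1"
  proof -
    show "0 < omega" by (simp add: omega)
    have "(2 / 3 :: real) powr (1 / (3 * C * gam)) < (2 / 3) powr 0"
      using C0 gpos by (intro powr_less_mono') auto
    thus "omega < 1" by (simp add: omega)
  qed
  define A where "A = sqrt (l_const TYPE('n) lam) * (pi / 2) powr (1 / 4) * sqrt (real n * alpha) *
          c powr (real lam / 2) * sqrt (Delta0_const n lam m)"
  have main: "cmod (f x - s x) \<le> A * omega' powr (1 / d) * h_seminorm h m f"
    if f: "f \<in> native_space h m" and sp: "h_spline_interpolant h m X f s" and R: "rotation_matrix R"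
      and b: "b \<ge> b0" and d: "0 < d" "d \<le> d0"
      and hit: "\<forall>w. cube R w (2 * d) \<subseteq> cube R v b \<longrightarrow> cube R w (2 * d) \<inter> X \<noteq> {}" and x: "x \<in> cube R v b"
    for f s :: "real^'n \<Rightarrow> complex" and X R v b d x
  proof -
    define B where "B = sqrt ((fact L * 2 ^ L * sqrt (2 * pi) ^ CARD('n)) * sqrt (pi / 2) *
       (real CARD('n) * measure lborel (ball (0 :: real^'n) 1)) * c ^ (2 * L) *
       Delta0_const CARD('n) (2 * L) (Suc L) * ((2 / 3) powr (1 / (3 * C * gam * d))))"
    have h: "h = shifted_spline (Suc L) (2 * L) c"
      using \<open>h = shifted_spline m lam c\<close> unfolding m lam .
    have fc: "continuous_on UNIV f" and ex: "\<exists>K. h_bound h m f K" using f by (auto simp: native_space_def)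
    have bd: "cmod (f x - s x) \<le> B * K" if "h_bound h m f K" for K
      unfolding B_def
      by (rule spline_error_in_cube[where X=X and R=R and v=v and b=b, OF n2 c gam C1 C0 _ fc _ R order.trans[OF Cb b] d(1) d(2)[unfolded d0] _ x])
         (use that sp hit in \<open>auto simp: h m\<close>)
    have B0: "B \<ge> 0" unfolding B_def
    proof (rule real_sqrt_ge_zero)
      have "0 < Delta0_const CARD('n) (2 * L) (Suc L)" by (rule Delta0_lower_bound(1)[OF n2(2,1) order_refl])
      thus "0 \<le> (fact L * 2 ^ L * sqrt (2 * pi) ^ CARD('n)) * sqrt (pi / 2) *
       (real CARD('n) * measure lborel (ball (0 :: real^'n) 1)) * c ^ (2 * L) *
       Delta0_const CARD('n) (2 * L) (Suc L) * ((2 / 3) powr (1 / (3 * C * gam * d)))" using c by simp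
    qed
    have "cmod (f x - s x) \<le> B * h_seminorm h m f"
    proof (cases "B = 0")
      case True
      thus ?thesis using bd ex by auto
    next
      case False
      hence Bp: "B > 0" using B0 by simp
      \<comment> \<open>the estimate holds for every admissible constant, hence for their infimum\<close>
      have "cmod (f x - s x) / B \<le> h_seminorm h m f" unfolding h_seminorm_def
      proof (rule cInf_greatest)
        show "{K. h_bound h m f K} \<noteq> {}" using ex by blast
        fix K assume "K \<in> {K. h_bound h m f K}"
        hence "cmod (f x - s x) \<le> B * K" using bd by blast
        thus "cmod (f x - s x) / B \<le> K" using Bp by (simp add: pos_divide_le_eq mult.commute)
      qed
      thus ?thesis using Bp by (simp add: pos_divide_le_eq mult.commute)
    qed
    also have "B = A * omega' powr (1 / d)"
    proof -
      have 1: "l_const TYPE('n) lam = fact L * 2 ^ L * sqrt (2 * pi) ^ CARD('n)" unfolding lam by (rule l_const_eq)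
      have "(pi / 2) powr (1 / 2 * (1 / 2)) = sqrt (sqrt (pi / 2))"
        unfolding powr_powr[symmetric] by (simp add: powr_half_sqrt)
      hence 2: "(pi / 2) powr (1 / 4) = sqrt (sqrt (pi / 2))" by simp
      have "c powr (real lam / 2) = c ^ L" using c by (simp add: lam powr_realpow)
      also have "\<dots> = sqrt (c ^ (2 * L))" using c by (simp add: power_mult[of c 2 L] real_sqrt_power)
      finally have 3: "c powr (real lam / 2) = sqrt (c ^ (2 * L))" .
      have "omega' powr (1 / d) = sqrt (omega powr (1 / d))"
        using om by (simp add: omega' powr_half_sqrt[symmetric] powr_powr mult.commute)
      also have "omega powr (1 / d) = (2 / 3) powr (1 / (3 * C * gam * d))"
        by (simp add: omega powr_powr)
      finally have 4: "omega' powr (1 / d) = sqrt ((2 / 3) powr (1 / (3 * C * gam * d)))" .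
      have 5: "alpha = measure lborel (ball (0 :: real^'n) 1)" by fact
      show ?thesis unfolding A_def B_def 2 4 5 n m lam 1[unfolded lam] 3[unfolded lam]
        by (simp only: real_sqrt_mult)
    qed
    finally show ?thesis .
  qed
  show ?thesis using d0pos om main unfolding A_def omega' by auto
qed

end
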